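(* Let $G_n$ be one of the split groups $\mathrm{SO}_{2n+1}(F)$, $\mathrm{Sp}_{2n}(F)$ or $\mathrm{SO}_{2n}(F)$ and let $\lambda\in\Lambda(G_n)$ be an infinitesimal parameter. Suppose that the unique open $L$-parameter $\phi^0$ of $\Phi(G_n)_\lambda$ is tempered, and let $\mathcal{O}'=d_{BV}(\mathcal{O}_{\phi^0})$. Then any $L$-parameter in $$(d_{BV})^{-1}_{\Phi(G_n)_\lambda}(\mathcal{O}'):=\{\phi\in\Phi(G_n)_\lambda\ |\ d_{BV}(\mathcal{O}_\phi)=\mathcal{O}'\}$$ is of Arthur type.
   Context: $F$ is a non-Archimedean local field of characteristic zero with Weil group $W_F$; $|\cdot|$ is the norm character of $W_F$. For $G_n=\mathrm{SO}_{2n+1}(F),\mathrm{Sp}_{2n}(F),\mathrm{SO}_{2n}(F)$ (split) the dual group $\widehat G_n(\mathbb{C})$ is $\mathrm{Sp}_{2n}(\mathbb{C}),\mathrm{SO}_{2n+1}(\mathbb{C}),\mathrm{SO}_{2n}(\mathbb{C})$ respectively, with Lie algebra $\widehat{\mathfrak g}_n(\mathbb{C})$; $\mathfrak g_n(\mathbb{C})$ is the complex Lie algebra of $G_n$. All parameters are taken up to $\widehat G_n(\mathbb{C})$-conjugacy. An $L$-parameter is a continuous homomorphism $\phi:W_F\times \mathrm{SL}_2(\mathbb{C})\to\widehat G_n(\mathbb{C})$, semisimple on $W_F$ and algebraic on $\mathrm{SL}_2(\mathbb{C})$; it is tempered if $\phi(W_F)$ is bounded. A local Arthur parameter is a homomorphism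 $\psi:W_F\times \mathrm{SL}_2^D(\mathbb{C})\times \mathrm{SL}_2^A(\mathbb{C})\to\widehat G_n(\mathbb{C})$ (two copies of $\mathrm{SL}_2(\mathbb{C})$) such that $\psi|_{W_F\times \mathrm{SL}_2^D}$ is an $L$-parameter, $\psi|_{\mathrm{SL}_2^A}$ is algebraic and $\psi(W_F)$ is bounded. An infinitesimal parameter is a continuous homomorphism $\lambda:W_F\to\widehat G_n(\mathbb{C})$ with semisimple image; $\Lambda(G_n)$ is the set of these. With $d_w=\mathrm{diag}(|w|^{1/2},|w|^{-1/2})$, put $\phi_\psi(w,x)=\psi(w,x,d_w)$ and $\lambda_\phi(w)=\phi(w,d_w)$. $\Phi(G_n)_\lambda$ is the set of $L$-parameters $\phi$ with $\lambda_\phi=\lambda$. An $L$-parameter is of Arthur type if it equals $\phi_\psi$ for some local Arthur parameter $\psi$ of $G_n$. $\mathcal{O}_\phi$ is the nilpotent orbit of $\widehat{\mathfrak g}_n(\mathbb{C})$ containing $d(\phi|_{\mathrm{SL}_2})\begin{pmatrix}0&1\\0&0\end{pmatrix}$, and $\underline p(\phi)$ is the corresponding partition. The open $L$-parameter of $\Phi(G_n)_\lambda$ is the unique $\phi^0\in\Phi(G_n)_\lambda$ such that $\underline p(\phi^0)\ge\underline p(\phi)$ (dominance order) for all $\phi\in\Phi(G_n)_\lambda$. Barbasch–Vogan duality $d_{BV}$, from nilpotent orbits of $\widehat{\mathfrak g}_n(\mathbb{C})$ to those of $\mathfrak g_n(\mathbb{C})$. A partition of $n$ is of type $B$ (resp.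 $D$) if $n$ is odd (resp. even) and every even part has even multiplicity, of type $C$ if $n$ is even and every odd part has even multiplicity. Nilpotent orbits of $\mathfrak{so}_{2n+1},\mathfrak{sp}_{2n},\mathfrak{so}_{2n}$ correspond to partitions of type $B,C,D$ (of $2n+1,2n,2n$), bijectively except that a very even partition of type $D$ (all parts even) corresponds to two orbits $\mathcal{O}^I,\mathcal{O}^{II}$. For a partition $\underline p=[p_1\ge\dots\ge p_N]$ with $p_N>0$ let $\underline p^+=[p_1+1,p_2,\dots,p_N]$, $\underline p^-=[p_1,\dots,p_{N-1},p_N-1]$, $\underline p^*$ the transpose, and $\underline p_X$ the $X$-collapse (the largest partition of type $X$ that is $\le\underline p$ in dominance order). Then $d_{BV}(\underline p)=((\underline p^-)_C)^*$ for type $B$, $((\underline p^+)_B)^*$ for type $C$, $(\underline p^* )_D$ for type $D$. On orbits, $d_{BV}(\mathcal{O}_{\underline p})=\mathcal{O}_{d_{BV}(\underline p)}$, except that for $\underline p$ a very even partition of $2n$, $d_{BV}(\mathcal{O}_{\underline p}^I)$ is $\mathcal{O}_{\underline p}^I$ if $n$ is even and $\mathcal{O}_{\underline p}^{II}$ if $n$ is odd (and correspondingly with $I,II$ exchanged). *)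

theory Defs
  imports
    "HOL-Analysis.Analysis"
    "HOL-Algebra.Algebraic_Closure_Type"
    "Jordan_Normal_Form.Jordan_Normal_Form"
begin

section \<open>Local fields and Weil groups\<close>

text \<open>Completeness is spelled out with the absolute value, because the type \<open>'f\<close> carries no
  topology. Assumption \<open>v_uniformizer\<close> says that the value group is discrete and nontrivial.\<close>

locale nonarch_local_field =
  fixes v :: "'f::field_char_0 \<Rightarrow> real"
  assumes v_zero_iff: "v x = 0 \<longleftrightarrow> x = 0"
    and v_mult: "v (x * y) = v x * v y"
    and v_ultrametric: "v (x + y) \<le> max (v x) (v y)"
    and v_nonneg: "0 \<le> v x"
    and v_uniformizer: "\<exists>\<pi>. 0 < v \<pi> \<and> v \<pi> < 1 \<and> (\<forall>x. v x < 1 \<longrightarrow> v x \<le> v \<pi>)"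
    and v_complete: "\<And>s :: nat \<Rightarrow> 'f. (\<forall>e>0. \<exists>M. \<forall>m\<ge>M. \<forall>k\<ge>M. v (s m - s k) < e)
          \<Longrightarrow> \<exists>L. \<forall>e>0. \<exists>M. \<forall>m\<ge>M. v (s m - L) < e"
    and finite_residue_field:
      "finite ({x. v x \<le> 1} // {(x, y). v x \<le> 1 \<and> v y \<le> 1 \<and> v (x - y) < 1})"

definition residue_card :: "('f::field_char_0 \<Rightarrow> real) \<Rightarrow> nat" where
  "residue_card v = card ({x. v x \<le> 1} // {(x, y). v x \<le> 1 \<and> v y \<le> 1 \<and> v (x - y) < 1})"

text \<open>The ring of integers of the algebraic closure is the integral closure of the ring of
  integers of the base field; it is a local ring, and its maximal ideal is the set of nonunits.\<close>

definition ac_integers :: "('f::field_char_0 \<Rightarrow> real) \<Rightarrow> 'f alg_closure set" where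
  "ac_integers v = {x. \<exists>p. Polynomial.lead_coeff p = 1 \<and>
     (\<forall>i. v (Polynomial.coeff p i) \<le> 1) \<and> Polynomial.poly (map_poly to_ac p) x = 0}"

definition ac_maximal_ideal :: "('f::field_char_0 \<Rightarrow> real) \<Rightarrow> 'f alg_closure set" where
  "ac_maximal_ideal v = {x \<in> ac_integers v. x = 0 \<or> inverse x \<notin> ac_integers v}"

definition galois_automorphisms :: "('f::field_char_0 alg_closure \<Rightarrow> 'f alg_closure) set" where
  "galois_automorphisms = {\<sigma>. bij \<sigma> \<and> (\<forall>x y. \<sigma> (x + y) = \<sigma> x + \<sigma> y) \<and>
     (\<forall>x y. \<sigma> (x * y) = \<sigma> x * \<sigma> y) \<and> (\<forall>a. \<sigma> (to_ac a) = to_ac a)}"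

text \<open>\<open>frobenius_degree v \<sigma> k\<close>: on the residue field of the algebraic closure \<open>\<sigma>\<close> acts as the
  \<open>k\<close>-th power of the arithmetic Frobenius. One of the two exponents is \<open>q^0\<close>: the congruence is
  \<open>\<sigma> x = x^(q^k)\<close> if \<open>k \<ge> 0\<close> and \<open>(\<sigma> x)^(q^(-k)) = x\<close> if \<open>k \<le> 0\<close>.\<close>

definition frobenius_degree ::
  "('f::field_char_0 \<Rightarrow> real) \<Rightarrow> ('f alg_closure \<Rightarrow> 'f alg_closure) \<Rightarrow> int \<Rightarrow> bool" where
  "frobenius_degree v \<sigma> k \<longleftrightarrow> (\<forall>x \<in> ac_integers v.
     \<sigma> x ^ (residue_card v ^ nat (- k)) - x ^ (residue_card v ^ nat k) \<in> ac_maximal_ideal v)"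

definition weil_group ::
  "('f::field_char_0 \<Rightarrow> real) \<Rightarrow> ('f alg_closure \<Rightarrow> 'f alg_closure) monoid" where
  "weil_group v =
     \<lparr>carrier = {\<sigma> \<in> galois_automorphisms. \<exists>k. frobenius_degree v \<sigma> k}, mult = (\<circ>), one = id\<rparr>"

definition inertia_group ::
  "('f::field_char_0 \<Rightarrow> real) \<Rightarrow> ('f alg_closure \<Rightarrow> 'f alg_closure) set" where
  "inertia_group v = {\<sigma> \<in> galois_automorphisms. frobenius_degree v \<sigma> 0}"

text \<open>The topology in which the inertia group is open and carries the Krull topology: the basic
  open sets are the left cosets of the pointwise stabilizers, in the inertia group, of finite
  sets \<open>E\<close>.\<close>

definition weil_topology ::
  "('f::field_char_0 \<Rightarrow> real) \<Rightarrow> ('f alg_closure \<Rightarrow> 'f alg_closure) topology" where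
  "weil_topology v = topology_generated_by
     {(\<lambda>\<tau>. \<sigma> \<circ> \<tau>) ` {\<tau> \<in> inertia_group v. \<forall>x\<in>E. \<tau> x = x} |\<sigma> E.
        \<sigma> \<in> carrier (weil_group v) \<and> finite E}"

text \<open>Normalized so that a geometric Frobenius element has norm \<open>1/q\<close>.\<close>

definition weil_norm ::
  "('f::field_char_0 \<Rightarrow> real) \<Rightarrow> ('f alg_closure \<Rightarrow> 'f alg_closure) \<Rightarrow> real" where
  "weil_norm v w = real (residue_card v) powi (THE k. frobenius_degree v w k)"


section \<open>Complex classical groups and their Lie algebras\<close>

definition matrix_topology :: "nat \<Rightarrow> complex mat topology" where
  "matrix_topology N = pullback_topology (carrier_mat N N)
     (\<lambda>A. restrict (\<lambda>ij. A $$ ij) ({..<N} \<times> {..<N}))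
     (product_topology (\<lambda>_. euclidean) ({..<N} \<times> {..<N}))"

text \<open>Type \<open>B\<close>, \<open>C\<close>, \<open>D\<close> of rank \<open>n\<close> stands for \<open>SO(2n+1)\<close>, \<open>Sp(2n)\<close>, \<open>SO(2n)\<close> (split).\<close>

datatype classical_type = TypeB | TypeC | TypeD

fun dual_type :: "classical_type \<Rightarrow> classical_type" where
  "dual_type TypeB = TypeC"
| "dual_type TypeC = TypeB"
| "dual_type TypeD = TypeD"

fun std_dim :: "classical_type \<Rightarrow> nat \<Rightarrow> nat" where
  "std_dim TypeB n = 2 * n + 1"
| "std_dim TypeC n = 2 * n"
| "std_dim TypeD n = 2 * n"

definition form_matrix :: "classical_type \<Rightarrow> nat \<Rightarrow> complex mat" where
  "form_matrix T n = mat (std_dim T n) (std_dim T n) (\<lambda>(i, j).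
     if i + j + 1 = std_dim T n then (if T = TypeC \<and> n \<le> i then -1 else 1) else 0)"

definition matrix_group :: "nat \<Rightarrow> complex mat set \<Rightarrow> complex mat monoid" where
  "matrix_group N S = \<lparr>carrier = S, mult = (*), one = 1\<^sub>m N\<rparr>"

text \<open>For type \<open>C\<close> the determinant condition is automatic.\<close>

definition classical_group :: "classical_type \<Rightarrow> nat \<Rightarrow> complex mat monoid" where
  "classical_group T n = matrix_group (std_dim T n)
     {g \<in> carrier_mat (std_dim T n) (std_dim T n).
        transpose_mat g * form_matrix T n * g = form_matrix T n \<and> Determinant.det g = 1}"

definition classical_lie_algebra :: "classical_type \<Rightarrow> nat \<Rightarrow> complex mat set" where
  "classical_lie_algebra T n = {A \<in> carrier_mat (std_dim T n) (std_dim T n).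
     transpose_mat A * form_matrix T n + form_matrix T n * A = 0\<^sub>m (std_dim T n) (std_dim T n)}"

definition SL2 :: "complex mat monoid" where
  "SL2 = matrix_group 2 {x \<in> carrier_mat 2 2. Determinant.det x = 1}"


section \<open>Partitions\<close>

text \<open>Partitions are nonincreasing lists of positive numbers.\<close>

definition is_partition :: "nat list \<Rightarrow> bool" where
  "is_partition p \<longleftrightarrow> sorted_wrt (\<ge>) p \<and> 0 \<notin> set p"

definition dominated :: "nat list \<Rightarrow> nat list \<Rightarrow> bool" where
  "dominated p q \<longleftrightarrow> sum_list p = sum_list q \<and> (\<forall>k. sum_list (take k p) \<le> sum_list (take k q))"

fun partition_of_type :: "classical_type \<Rightarrow> nat list \<Rightarrow> bool" where
  "partition_of_type TypeB p \<longleftrightarrow>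
     is_partition p \<and> odd (sum_list p) \<and> (\<forall>k. even k \<longrightarrow> even (count_list p k))"
| "partition_of_type TypeC p \<longleftrightarrow>
     is_partition p \<and> even (sum_list p) \<and> (\<forall>k. odd k \<longrightarrow> even (count_list p k))"
| "partition_of_type TypeD p \<longleftrightarrow>
     is_partition p \<and> even (sum_list p) \<and> (\<forall>k. even k \<longrightarrow> even (count_list p k))"

definition very_even :: "nat list \<Rightarrow> bool" where
  "very_even p \<longleftrightarrow> partition_of_type TypeD p \<and> (\<forall>k\<in>set p. even k)"

definition conjugate_partition :: "nat list \<Rightarrow> nat list" where
  "conjugate_partition p = map (\<lambda>i. length (filter (\<lambda>k. i < k) p)) [0..<fold max p 0]"

text \<open>The empty partition, which occurs only in rank \<open>0\<close>, is read as \<open>[0]\<close> here.\<close>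

fun partition_plus :: "nat list \<Rightarrow> nat list" where
  "partition_plus [] = [1]"
| "partition_plus (k # p) = (k + 1) # p"

text \<open>A last part that drops to \<open>0\<close> is deleted.\<close>

definition partition_minus :: "nat list \<Rightarrow> nat list" where
  "partition_minus p = filter (\<lambda>k. k \<noteq> 0) (butlast p @ [last p - 1])"

definition collapse :: "classical_type \<Rightarrow> nat list \<Rightarrow> nat list" where
  "collapse T p = (THE q. partition_of_type T q \<and> dominated q p \<and>
     (\<forall>r. partition_of_type T r \<and> dominated r p \<longrightarrow> dominated r q))"

text \<open>The argument \<open>T\<close> is the type of the partition \<open>p\<close>, so the value has type \<open>dual_type T\<close>.\<close>

fun dBV_partition :: "classical_type \<Rightarrow> nat list \<Rightarrow> nat list" where
  "dBV_partition TypeB p = conjugate_partition (collapse TypeC (partition_minus p))"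
| "dBV_partition TypeC p = conjugate_partition (collapse TypeB (partition_plus p))"
| "dBV_partition TypeD p = collapse TypeD (conjugate_partition p)"


section \<open>Nilpotent orbits and Barbasch--Vogan duality\<close>

definition adjoint_orbit :: "classical_type \<Rightarrow> nat \<Rightarrow> complex mat \<Rightarrow> complex mat set" where
  "adjoint_orbit T n A =
     {g * A * m_inv (classical_group T n) g |g. g \<in> carrier (classical_group T n)}"

definition nilpotent_orbits :: "classical_type \<Rightarrow> nat \<Rightarrow> complex mat set set" where
  "nilpotent_orbits T n = {adjoint_orbit T n A |A. A \<in> classical_lie_algebra T n \<and>
     (\<exists>k. A ^\<^sub>m k = 0\<^sub>m (std_dim T n) (std_dim T n))}"

text \<open>The partition of a nilpotent orbit lists the Jordan block sizes of its elements.\<close>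

definition orbit_partition :: "complex mat set \<Rightarrow> nat list" where
  "orbit_partition Orb =
     (THE p. is_partition p \<and> (\<exists>A\<in>Orb. jordan_nf A (map (\<lambda>k. (k, 0)) p)))"

definition orbit_of_partition :: "classical_type \<Rightarrow> nat \<Rightarrow> nat list \<Rightarrow> complex mat set" where
  "orbit_of_partition T n p = (THE Orb. Orb \<in> nilpotent_orbits T n \<and> orbit_partition Orb = p)"

text \<open>A naming of the two orbits of a very even partition: \<open>OI p\<close> is the one called \<open>I\<close>, and the
  other one is called \<open>II\<close>. No rule for choosing the name is fixed, so the naming is a
  parameter; the same naming is used on both sides of the duality of type \<open>D\<close>.\<close>

definition very_even_labelling :: "nat \<Rightarrow> (nat list \<Rightarrow> complex mat set) \<Rightarrow> bool" where
  "very_even_labelling n OI \<longleftrightarrow> (\<forall>p. very_even p \<and> sum_list p = 2 * n \<longrightarrow>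
     OI p \<in> nilpotent_orbits TypeD n \<and> orbit_partition (OI p) = p)"

definition orbit_II :: "nat \<Rightarrow> (nat list \<Rightarrow> complex mat set) \<Rightarrow> nat list \<Rightarrow> complex mat set" where
  "orbit_II n OI p = (THE Orb. Orb \<in> nilpotent_orbits TypeD n \<and> orbit_partition Orb = p \<and> Orb \<noteq> OI p)"

text \<open>\<open>dBV T n OI\<close> sends the nilpotent orbits of type \<open>T\<close> to those of type \<open>dual_type T\<close>. If \<open>p\<close> is
  very even then so is \<open>dBV_partition TypeD p\<close>; the name \<open>I\<close> or \<open>II\<close> is kept for even \<open>n\<close> and
  switched for odd \<open>n\<close>.\<close>

definition dBV ::
  "classical_type \<Rightarrow> nat \<Rightarrow> (nat list \<Rightarrow> complex mat set) \<Rightarrow> complex mat set \<Rightarrow> complex mat set" where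
  "dBV T n OI Orb = (let p = orbit_partition Orb; p' = dBV_partition T p in
     if T = TypeD \<and> very_even p
     then (if (Orb = OI p) = even n then OI p' else orbit_II n OI p')
     else orbit_of_partition (dual_type T) n p')"


section \<open>Parameters\<close>

text \<open>A parameter is a function on (a product of) carriers with values in the dual group, and only
  its values there matter. Throughout, \<open>T\<close> is the type of the group \<open>G\<close> itself.\<close>

abbreviation dual_group :: "classical_type \<Rightarrow> nat \<Rightarrow> complex mat monoid" where
  "dual_group T n \<equiv> classical_group (dual_type T) n"

abbreviation dual_dim :: "classical_type \<Rightarrow> nat \<Rightarrow> nat" where
  "dual_dim T n \<equiv> std_dim (dual_type T) n"

definition conjugate_on ::
  "classical_type \<Rightarrow> nat \<Rightarrow> 'a set \<Rightarrow> ('a \<Rightarrow> complex mat) \<Rightarrow> ('a \<Rightarrow> complex mat) \<Rightarrow> bool" where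
  "conjugate_on T n S f f' \<longleftrightarrow> (\<exists>g \<in> carrier (dual_group T n).
     \<forall>s\<in>S. f' s = g * f s * m_inv (dual_group T n) g)"

definition semisimple_mat :: "complex mat \<Rightarrow> bool" where
  "semisimple_mat A \<longleftrightarrow> (\<exists>D. diagonal_mat D \<and> similar_mat A D)"

text \<open>Regular functions on \<open>SL\<^sub>2\<close> are the restrictions of polynomials in the four entries.\<close>

definition regular_on_SL2 :: "(complex mat \<Rightarrow> complex) \<Rightarrow> bool" where
  "regular_on_SL2 f \<longleftrightarrow> (\<exists>(c :: nat \<Rightarrow> nat \<Rightarrow> nat \<Rightarrow> nat \<Rightarrow> complex) d. \<forall>x \<in> carrier SL2.
     f x = (\<Sum>i\<le>d. \<Sum>j\<le>d. \<Sum>k\<le>d. \<Sum>l\<le>d.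
       c i j k l * x $$ (0,0) ^ i * x $$ (0,1) ^ j * x $$ (1,0) ^ k * x $$ (1,1) ^ l))"

definition algebraic_on_SL2 :: "nat \<Rightarrow> (complex mat \<Rightarrow> complex mat) \<Rightarrow> bool" where
  "algebraic_on_SL2 N f \<longleftrightarrow> (\<forall>i<N. \<forall>j<N. regular_on_SL2 (\<lambda>x. f x $$ (i, j)))"

definition entries_bounded :: "nat \<Rightarrow> complex mat set \<Rightarrow> bool" where
  "entries_bounded N S \<longleftrightarrow> (\<exists>c. \<forall>A\<in>S. \<forall>i<N. \<forall>j<N. cmod (A $$ (i, j)) \<le> c)"

type_synonym 'f weil = "'f alg_closure \<Rightarrow> 'f alg_closure"

definition infinitesimal_parameter ::
  "('f::field_char_0 \<Rightarrow> real) \<Rightarrow> classical_type \<Rightarrow> nat \<Rightarrow> ('f weil \<Rightarrow> complex mat) \<Rightarrow> bool" where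
  "infinitesimal_parameter v T n lam \<longleftrightarrow>
     lam \<in> hom (weil_group v) (dual_group T n) \<and>
     continuous_map (weil_topology v) (matrix_topology (dual_dim T n)) lam \<and>
     (\<forall>w \<in> carrier (weil_group v). semisimple_mat (lam w))"

definition L_parameter ::
  "('f::field_char_0 \<Rightarrow> real) \<Rightarrow> classical_type \<Rightarrow> nat \<Rightarrow> ('f weil \<times> complex mat \<Rightarrow> complex mat) \<Rightarrow> bool" where
  "L_parameter v T n \<phi> \<longleftrightarrow>
     \<phi> \<in> hom (weil_group v \<times>\<times> SL2) (dual_group T n) \<and>
     continuous_map (prod_topology (weil_topology v) (subtopology (matrix_topology 2) (carrier SL2)))
       (matrix_topology (dual_dim T n)) \<phi> \<and>
     (\<forall>w \<in> carrier (weil_group v). semisimple_mat (\<phi> (w, 1\<^sub>m 2))) \<and>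
     algebraic_on_SL2 (dual_dim T n) (\<lambda>x. \<phi> (id, x))"

definition tempered ::
  "('f::field_char_0 \<Rightarrow> real) \<Rightarrow> classical_type \<Rightarrow> nat \<Rightarrow> ('f weil \<times> complex mat \<Rightarrow> complex mat) \<Rightarrow> bool" where
  "tempered v T n \<phi> \<longleftrightarrow>
     entries_bounded (dual_dim T n) ((\<lambda>w. \<phi> (w, 1\<^sub>m 2)) ` carrier (weil_group v))"

definition arthur_parameter ::
  "('f::field_char_0 \<Rightarrow> real) \<Rightarrow> classical_type \<Rightarrow> nat
     \<Rightarrow> ('f weil \<times> complex mat \<times> complex mat \<Rightarrow> complex mat) \<Rightarrow> bool" where
  "arthur_parameter v T n \<psi> \<longleftrightarrow>
     \<psi> \<in> hom (weil_group v \<times>\<times> SL2 \<times>\<times> SL2) (dual_group T n) \<and>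
     L_parameter v T n (\<lambda>(w, x). \<psi> (w, x, 1\<^sub>m 2)) \<and>
     algebraic_on_SL2 (dual_dim T n) (\<lambda>y. \<psi> (id, 1\<^sub>m 2, y)) \<and>
     entries_bounded (dual_dim T n) ((\<lambda>w. \<psi> (w, 1\<^sub>m 2, 1\<^sub>m 2)) ` carrier (weil_group v))"

definition d_mat :: "('f::field_char_0 \<Rightarrow> real) \<Rightarrow> 'f weil \<Rightarrow> complex mat" where
  "d_mat v w = mat_of_rows_list 2
     [[complex_of_real (weil_norm v w powr (1/2)), 0],
      [0, complex_of_real (weil_norm v w powr (-1/2))]]"

definition phi_of_psi ::
  "('f::field_char_0 \<Rightarrow> real) \<Rightarrow> ('f weil \<times> complex mat \<times> complex mat \<Rightarrow> complex mat)
     \<Rightarrow> 'f weil \<times> complex mat \<Rightarrow> complex mat" where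
  "phi_of_psi v \<psi> = (\<lambda>(w, x). \<psi> (w, x, d_mat v w))"

definition lambda_of_phi ::
  "('f::field_char_0 \<Rightarrow> real) \<Rightarrow> ('f weil \<times> complex mat \<Rightarrow> complex mat) \<Rightarrow> 'f weil \<Rightarrow> complex mat" where
  "lambda_of_phi v \<phi> = (\<lambda>w. \<phi> (w, d_mat v w))"

definition L_parameters_over ::
  "('f::field_char_0 \<Rightarrow> real) \<Rightarrow> classical_type \<Rightarrow> nat \<Rightarrow> ('f weil \<Rightarrow> complex mat)
     \<Rightarrow> ('f weil \<times> complex mat \<Rightarrow> complex mat) set" where
  "L_parameters_over v T n lam = {\<phi>. L_parameter v T n \<phi> \<and>
     conjugate_on T n (carrier (weil_group v)) (lambda_of_phi v \<phi>) lam}"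

definition arthur_type ::
  "('f::field_char_0 \<Rightarrow> real) \<Rightarrow> classical_type \<Rightarrow> nat \<Rightarrow> ('f weil \<times> complex mat \<Rightarrow> complex mat) \<Rightarrow> bool" where
  "arthur_type v T n \<phi> \<longleftrightarrow> (\<exists>\<psi>. arthur_parameter v T n \<psi> \<and>
     conjugate_on T n (carrier (weil_group v \<times>\<times> SL2)) (phi_of_psi v \<psi>) \<phi>)"

text \<open>The differential of the restriction of \<open>\<phi>\<close> to \<open>SL\<^sub>2\<close>, applied to the matrix unit \<open>E\<^sub>1\<^sub>2\<close>,
  is the derivative at \<open>0\<close> along the one-parameter group \<open>exp (t E\<^sub>1\<^sub>2)\<close>.\<close>

definition nilpotent_of_phi :: "nat \<Rightarrow> ('f::field_char_0 weil \<times> complex mat \<Rightarrow> complex mat) \<Rightarrow> complex mat" where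
  "nilpotent_of_phi N \<phi> =
     mat N N (\<lambda>(i, j). deriv (\<lambda>t. \<phi> (id, mat_of_rows_list 2 [[1, t], [0, 1]]) $$ (i, j)) 0)"

definition orbit_of_phi ::
  "classical_type \<Rightarrow> nat \<Rightarrow> ('f::field_char_0 weil \<times> complex mat \<Rightarrow> complex mat) \<Rightarrow> complex mat set" where
  "orbit_of_phi T n \<phi> = adjoint_orbit (dual_type T) n (nilpotent_of_phi (dual_dim T n) \<phi>)"

text \<open>Uniqueness up to conjugacy is a consequence of maximality and is not part of the definition.\<close>

definition open_parameter ::
  "('f::field_char_0 \<Rightarrow> real) \<Rightarrow> classical_type \<Rightarrow> nat \<Rightarrow> ('f weil \<Rightarrow> complex mat)
     \<Rightarrow> ('f weil \<times> complex mat \<Rightarrow> complex mat) \<Rightarrow> bool" where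
  "open_parameter v T n lam \<phi>0 \<longleftrightarrow> \<phi>0 \<in> L_parameters_over v T n lam \<and>
     (\<forall>\<phi> \<in> L_parameters_over v T n lam.
        dominated (orbit_partition (orbit_of_phi T n \<phi>)) (orbit_partition (orbit_of_phi T n \<phi>0)))"

definition dBV_fibre ::
  "('f::field_char_0 \<Rightarrow> real) \<Rightarrow> classical_type \<Rightarrow> nat \<Rightarrow> (nat list \<Rightarrow> complex mat set)
     \<Rightarrow> ('f weil \<Rightarrow> complex mat) \<Rightarrow> complex mat set \<Rightarrow> ('f weil \<times> complex mat \<Rightarrow> complex mat) set" where
  "dBV_fibre v T n OI lam Orb =
     {\<phi> \<in> L_parameters_over v T n lam. dBV (dual_type T) n OI (orbit_of_phi T n \<phi>) = Orb}"

end

theory Submission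
 imports
  Defs
  "Jordan_Normal_Form.Jordan_Normal_Form_Existence"
begin

text \<open>Equality of the Barbasch--Vogan duals forces \<open>rk (N0 ^ k) \<le> rk (N ^ k) + 1\<close> for \<open>k > 0\<close>, where
 \<open>N0\<close> and \<open>N\<close> are the nilpotent elements of \<open>\<phi>0\<close> and \<open>\<phi>\<close>. Conjugate so that the infinitesimal
 parameters agree. As \<open>\<phi>0\<close> is tempered, the weights of \<open>\<phi>0\<close> on \<open>SL\<^sub>2\<close> are read off from the absolute
 values of Frobenius eigenvalues, hence from the infinitesimal parameter. (Temperedness is applied to
 the powers of an element of the Weil group; that these belong to the Weil group rests on the locality
 of the integral closure.) The inequality of ranks implies that the weights of \<open>\<phi>0\<close> and \<open>\<phi>\<close> differ by at
 most \<open>1\<close>, which splits the space into subrepresentations \<open>Q (-1)\<close>, \<open>Q 0\<close>, \<open>Q 1\<close> of \<open>\<phi>\<close> on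
 \<open>SL\<^sub>2\<close>, and that \<open>Q (-1)\<close> is multiplicity free. Its lowest weight vectors assemble into an isomorphism
 \<open>f\<close> from \<open>Q 1\<close> to \<open>Q (-1)\<close>, skew for the form, which commutes with \<open>\<phi>\<close> on \<open>SL\<^sub>2\<close> and, by a comparison
 of traces, with \<open>\<phi>0\<close> on the Weil group. So \<open>f\<close> and its inverse define a second action \<open>\<theta>\<close> of \<open>SL\<^sub>2\<close>,
 and \<open>\<phi>0 (w, 1) * \<phi> (1, x) * \<theta> y\<close> is the required Arthur parameter.\<close>

text \<open>The obstacle is to control the multiplicities, and parity does it. The rank of
  \<open>N ^ k\<close> is even whenever the form makes this power skew, that is, for
  \<open>(-1) ^ k = - \<epsilon>\<close>; so ranks can differ only for the other parity. Sorted by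
  the weights of \<open>\<phi>0\<close>, the weights below \<open>- k\<close> contribute twice to
  the rank (a weight and its adjoint) and the weight \<open>- k\<close> once. A difference of one
  therefore leaves no kernel below \<open>- k\<close> and at most a line at \<open>- k\<close>.
  These lines are the lowest weight vectors of \<open>Q (-1)\<close>, and the parity left over is
  exactly the one in which a rank one operator \<open>u * tp u * J\<close> spreads to a skew
  intertwiner. As each line is acted on by scalars, one trace suffices to see that the intertwiner
  is invariant. Linear algebra is done with products: subspaces are images of idempotents, and an
  arbitrary matrix \<open>Y\<close> plays the role of a vector. Square roots that are polynomials in
  a matrix replace spectral theory, because they inherit commutation and self-adjointness.\<close>

no_notation Polynomials.var (\<open>X\<index>\<close>)
hide_const (open) up_ring.monom up_ring.coeff Polynomials.degree Polynomials.lead_coeff module.smult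

lemmas assoc = mult.assoc
lemmas sum_distrib = sum_distrib_left sum_distrib_right

section \<open>Partitions and Barbasch--Vogan duality\<close>

definition part :: "nat list => nat => nat" where
 "part p i = (if i < length p then p ! i else 0)"

definition psum :: "nat list => nat => nat" where
 "psum p k = sum_list (take k p)"

lemma part_Nil [simp]: "part [] i = 0" by (simp add: part_def)

lemma part_Cons_0 [simp]: "part (x # p) 0 = x" by (simp add: part_def)

lemma part_Cons_Suc [simp]: "part (x # p) (Suc i) = part p i" by (simp add: part_def)

lemma psum_0 [simp]: "psum p 0 = 0" by (simp add: psum_def)

lemma psum_Nil [simp]: "psum [] k = 0" by (simp add: psum_def)

lemma psum_Suc: "psum p (Suc k) = psum p k + part p k" by (simp add: psum_def part_def take_Suc_conv_app_nth)

lemma psum_Cons_Suc [simp]: "psum (x # p) (Suc k) = x + psum p k" by (simp add: psum_def)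

lemma psum_ge: "length p \<le> k ==> psum p k = sum_list p" by (simp add: psum_def)

lemma part_antimono: "is_partition p ==> i \<le> j ==> part p j \<le> part p i"
 unfolding is_partition_def part_def by (cases "i = j") (auto simp: sorted_wrt_iff_nth_less)

lemma part_eq_0_iff: "is_partition p ==> part p i = 0 \<longleftrightarrow> length p \<le> i"
 unfolding is_partition_def part_def by (auto simp: in_set_conv_nth)

lemma partition_eqI:
 assumes "is_partition p" "is_partition q" "\<And>i. part p i = part q i"
 shows "p = q"
proof -
 have "length p \<le> i \<longleftrightarrow> length q \<le> i" for i using assms part_eq_0_iff by metis
 then have "length p = length q" by (meson antisym order_refl)
 moreover from this have "p ! i = q ! i" if "i < length p" for i using that assms(3)[of i] by (simp add: part_def)
 ultimately show ?thesis by (rule nth_equalityI)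
qed

lemma partition_of_function:
 fixes a :: "nat => nat"
 assumes "\<And>i. a (Suc i) \<le> a i" "a L = 0"
 obtains p where "is_partition p" "\<And>i. part p i = a i"
proof -
 have anti: "a j \<le> a i" if "i \<le> j" for i j using lift_Suc_antimono_le[of a, OF assms(1) that] .
 define c where "c = (LEAST i. a i = 0)"
 have c: "a c = 0" unfolding c_def using assms(2) by (rule LeastI)
 have nz: "a i ~= 0" if "i < c" for i using that not_less_Least c_def by blast
 define p where "p = map a [0..<c]"
 have "0 \<notin> set p" using nz by (force simp: p_def)
 then have "is_partition p" using anti by (auto simp: is_partition_def p_def sorted_wrt_iff_nth_less)
 moreover have "part p i = a i" for i using c anti[of c i] by (auto simp: part_def p_def)
 ultimately show thesis using that by blast
qed

text \<open>Parts with the parity of \<open>e\<close> stand alone, all others come in adjacent equal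
  pairs; \<open>e = 0\<close> is the symplectic and \<open>e = 1\<close> the orthogonal condition.
  The inductive form lets \<open>adapted_form_exists\<close> build a form block by block.\<close>

inductive good_parts :: "nat => nat list => bool" for e where
 Nil: "good_parts e []"
| single: "even (x + e) ==> good_parts e p ==> good_parts e (x # p)"
| pair: "odd (x + e) ==> good_parts e p ==> good_parts e (x # x # p)"

lemma good_parts_count: "good_parts e p ==> odd (v + e) ==> even (count_list p v)"
 by (induction rule: good_parts.induct) auto

text \<open>In a sorted list equal parts are adjacent, so an even multiplicity can be peeled off two
  copies at a time.\<close>

lemma good_partsI:
 assumes "sorted_wrt (\<ge>) p" "\<And>v. odd (v + e) ==> even (count_list p v)"
 shows "good_parts e p" using assms
proof (induction "length p" arbitrary: p rule: less_induct)
 case less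
 show ?case
 proof (cases p)
  case Nil
  then show ?thesis by (simp add: good_parts.Nil)
 next
  case (Cons x q)
  show ?thesis
  proof (cases "even (x + e)")
   case True
   have "good_parts e q"
   proof (rule less.hyps)
    fix v assume "odd (v + e)"
    then show "even (count_list q v)" using less.prems(2)[of v] True Cons by (auto split: if_splits)
   qed (use less.prems Cons in auto)
   then show ?thesis using True Cons by (simp add: good_parts.single)
  next
   case False
   then have "even (count_list p x)" using less.prems(2) by blast
   then have "odd (count_list q x)" using Cons by simp
   then have "count_list q x ~= 0" by (metis even_zero)
   then have "x \<in> set q" by (metis count_notin)
   then obtain y r where q: "q = y # r" by (cases q) auto
   have "y = x" using less.prems(1) \<open>x \<in> set q\<close> Cons q by auto
   have "good_parts e r"
   proof (rule less.hyps)
    fix v assume "odd (v + e)"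
    then show "even (count_list r v)" using less.prems(2)[of v] Cons q \<open>y = x\<close> by (auto split: if_splits)
   qed (use less.prems Cons q in auto)
   then show ?thesis using False Cons q \<open>y = x\<close> by (simp add: good_parts.pair)
  qed
 qed
qed

section \<open>Partition types through parities of partial sums, and the collapse\<close>

definition type_eps :: "classical_type => nat" where
 "type_eps T = (if T = TypeC then 0 else 1)"

lemma partition_of_type_iff:
 "partition_of_type T p \<longleftrightarrow>
   is_partition p \<and> (even (sum_list p) \<longleftrightarrow> T ~= TypeB) \<and> good_parts (type_eps T) p"
proof -
 have "good_parts e p \<longleftrightarrow> (\<forall>v. odd (v + e) --> even (count_list p v))" if "is_partition p" for e
  using that good_parts_count[of e p] good_partsI[of p e] unfolding is_partition_def by blast
 from this[of 0] this[of 1] show ?thesis by (cases T) (simp_all add: type_eps_def conj_commute cong: conj_cong)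
qed

text \<open>Modulo 2, \<open>psum p k + e * k\<close> counts the paired parts among the first
  \<open>k\<close>. If the count is odd, the cut after these parts separates the two members of a
  pair.\<close>

definition psum_cond :: "nat => nat list => bool" where
 "psum_cond e p \<longleftrightarrow> (\<forall>k. odd (psum p (Suc k) + e * Suc k) --> part p k = part p (Suc k) \<and> odd (part p k + e))"

lemma psum_condD:
 assumes "psum_cond e p" "odd (psum p (Suc k) + e * Suc k)"
 shows "part p k = part p (Suc k)" "odd (part p k + e)" using assms unfolding psum_cond_def by blast+

lemma even_pos_cases: "even m ==> m ~= 0 ==> \<exists>j. m = Suc (Suc j) \<and> even j" by (rule exI[of _ "m - 2"]) presburger

lemma odd_cases: "odd m ==> \<exists>j. m = Suc j \<and> even j" by (rule exI[of _ "m - 1"]) presburger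

lemma good_parts_psum_cond: "good_parts e p ==> psum_cond e p"
proof (induction rule: good_parts.induct)
 case Nil
 then show ?case by (auto simp: psum_cond_def)
next
 case (single x p)
 show ?case unfolding psum_cond_def
 proof
  fix k
  show "odd (psum (x # p) (Suc k) + e * Suc k) -->
    part (x # p) k = part (x # p) (Suc k) \<and> odd (part (x # p) k + e)"
   using single by (cases k) (auto simp: psum_cond_def)
 qed
next
 case (pair x p)
 show ?case unfolding psum_cond_def
 proof
  fix k
  consider "k = 0" | "k = 1" | j where "k = Suc (Suc j)" by (metis One_nat_def not0_implies_Suc)
  then show "odd (psum (x # x # p) (Suc k) + e * Suc k) -->
    part (x # x # p) k = part (x # x # p) (Suc k) \<and> odd (part (x # x # p) k + e)"
   using pair by cases (auto simp: psum_cond_def)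
 qed
qed

lemma psum_cond_good_parts: "psum_cond e p ==> 0 \<notin> set p ==> good_parts e p"
proof (induction "length p" arbitrary: p rule: less_induct)
 case less
 show ?case
 proof (cases p)
  case Nil
  then show ?thesis by (simp add: good_parts.Nil)
 next
  case (Cons x q)
  show ?thesis
  proof (cases "even (x + e)")
   case True
   have "psum_cond e q" unfolding psum_cond_def
   proof (intro allI impI)
    fix k assume "odd (psum q (Suc k) + e * Suc k)"
    then have "odd (psum p (Suc (Suc k)) + e * Suc (Suc k))" using True Cons by auto
    then show "part q k = part q (Suc k) \<and> odd (part q k + e)"
     using less.prems(1) Cons unfolding psum_cond_def by (metis part_Cons_Suc)
   qed
   then show ?thesis using less True Cons by (simp add: good_parts.single)
  next
   case False
   then have x: "part p 0 = part p 1" using less.prems(1)[unfolded psum_cond_def, rule_format, of 0] Cons by simp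
   \<comment> \<open>Positivity guarantees that the part equal to \<open>x\<close> at position 1 is
     a genuine entry and not the default \<open>0\<close> of \<open>part\<close>.\<close>
   moreover have "x ~= 0" using less.prems(2) Cons by auto
   ultimately obtain r where q: "q = x # r" using Cons by (cases q) auto
   have "psum_cond e r" unfolding psum_cond_def
   proof (intro allI impI)
    fix k assume "odd (psum r (Suc k) + e * Suc k)"
    then have "odd (psum p (Suc (Suc (Suc k))) + e * Suc (Suc (Suc k)))" using Cons q by auto
    then show "part r k = part r (Suc k) \<and> odd (part r k + e)"
     using less.prems(1) Cons q unfolding psum_cond_def by (metis part_Cons_Suc)
   qed
   then show ?thesis using less False Cons q by (simp add: good_parts.pair)
  qed
 qed
qed

lemma dominated_iff: "dominated p q \<longleftrightarrow> sum_list p = sum_list q \<and> (\<forall>k. psum p k \<le> psum q k)"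
 by (simp add: dominated_def psum_def)

lemma partition_eq_psumI:
 assumes "is_partition p" "is_partition q" "\<And>k. psum p k = psum q k" shows "p = q"
proof (rule partition_eqI[OF assms(1,2)])
 fix i show "part p i = part q i" using assms(3)[of "Suc i"] assms(3)[of i] by (simp add: psum_Suc)
qed

text \<open>The positions at which the collapse lowers the partial sum, always by one.\<close>

definition drops :: "nat => nat list => nat => bool" where
 "drops e p k \<longleftrightarrow> odd (psum p k + e * k) \<and>
   \<not> (k > 0 \<and> part p (k - 1) = part p k \<and> odd (part p k + e))"

lemma drops_Suc: "drops e p (Suc k) \<longleftrightarrow>
  odd (psum p (Suc k) + e * Suc k) \<and> \<not> (part p k = part p (Suc k) \<and> odd (part p (Suc k) + e))"
 by (simp add: drops_def)

text \<open>The partial sums are lowered at the drops and differences are taken. What remains odd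
  afterwards are cuts inside a pair, which is the criterion \<open>psum_cond\<close>.\<close>

lemma collapse_exists:
 assumes p: "is_partition p" and e: "e = 1 \<or> e = 0 \<and> even (sum_list p)"
 obtains q where "is_partition q" "good_parts e q" "\<And>k. psum q k = psum p k - of_bool (drops e p k)"
  "sum_list q = sum_list p"
proof -
 define r where "r k = (of_bool (drops e p k) :: nat)" for k
 have r01: "r k = 0 \<or> r k = 1" for k by (simp add: r_def)
 have r1: "r k = 1 \<longleftrightarrow> drops e p k" for k by (simp add: r_def)
 have odd_h: "odd (psum p k + e * k)" if "r k = 1" for k using that unfolding r1 drops_def by blast
 have even_r: "r k = 1" if "odd (psum p k + e * k)" "even (part p k + e)" for k
  using that unfolding r1 drops_def by blast
 have even_r': "r (Suc k) = 1" if "odd (psum p (Suc k) + e * Suc k)" "even (part p k + e)" for k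
  using that unfolding r1 drops_def by (metis diff_Suc_1)
 have r0: "r 0 = 0" by (simp add: r_def drops_def)
 \<comment> \<open>Past the end the partial sum is the total: for \<open>e = 0\<close> it is even,
   and for \<open>e = 1\<close> the zeros count as paired parts, so there is no drop.\<close>
 have rz: "r (Suc k) = 0" if z: "part p k = 0" for k
 proof -
  have l: "length p \<le> k" using z part_eq_0_iff[OF p] by blast
  then have "part p (Suc k) = 0" "psum p (Suc k) = sum_list p" by (auto simp: part_def psum_ge)
  then show ?thesis using e z by (auto simp: r_def drops_def)
 qed
 define a where "a k = part p k + r k - r (Suc k)" for k
 have pos: "r (Suc k) \<le> part p k + r k" for k using rz[of k] r01[of "Suc k"] by (cases "part p k = 0") auto
 \<comment> \<open>Monotonicity of \<open>a\<close>, written without subtraction. It is in doubt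
   only if the two parts differ by at most \<open>1\<close>; then a part with the parity of
   \<open>e\<close> forces a drop on its other side as well.\<close>
 have step: "part p (Suc k) + 2 * r (Suc k) \<le> part p k + r k + r (Suc (Suc k))" for k
 proof (cases "r (Suc k) = 1")
  case True
  define x y where "x = part p k" and "y = part p (Suc k)"
  have xy: "y \<le> x" using part_antimono[OF p, of k "Suc k"] by (simp add: x_def y_def)
  have h: "odd (psum p (Suc k) + e * Suc k)" using odd_h[OF True] .
  have up: "r (Suc (Suc k)) = 1" if "even (y + e)" using that h by (intro even_r') (auto simp: psum_Suc y_def)
  have down: "r k = 1" if "even (x + e)" using that h by (intro even_r) (auto simp: psum_Suc x_def)
  consider "x \<ge> y + 2" | "x = y + 1" | "x = y" using xy by linarith
  then show ?thesis
  proof cases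
   case 1
   then show ?thesis using True by (simp add: x_def y_def)
  next
   case 2
   then have "even (x + e) \<or> even (y + e)" by auto
   then have "r k = 1 \<or> r (Suc (Suc k)) = 1" using up down by blast
   then show ?thesis using True 2 by (auto simp: x_def y_def)
  next
   case 3
   moreover have "\<not> (part p k = part p (Suc k) \<and> odd (part p (Suc k) + e))"
    using True unfolding r1 drops_def by simp
   ultimately have "even (x + e)" by (simp add: x_def y_def)
   then have "r k = 1" "r (Suc (Suc k)) = 1" using up down 3 by auto
   then show ?thesis using True 3 by (auto simp: x_def y_def)
  qed
 next
  case False
  then have "r (Suc k) = 0" using r01 by blast
  then show ?thesis using part_antimono[OF p, of k "Suc k"] by simp
 qed
 have anti: "a (Suc k) \<le> a k" for k using step[of k] pos[of k] pos[of "Suc k"] by (simp add: a_def)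
 have big: "r k = 0" if "k > length p" for k using that rz[of "k - 1"] by (auto simp: part_def)
 have aL: "a (Suc (length p)) = 0" using big by (simp add: a_def part_def)
 obtain q where q: "is_partition q" "\<And>i. part q i = a i" using partition_of_function[of a, OF anti aL] by blast
 have S: "psum q k + r k = psum p k" for k
 proof (induction k)
  case 0
  then show ?case by (simp add: r0)
 next
  case (Suc k)
  then show ?case using pos[of k] by (simp add: psum_Suc q(2) a_def)
 qed
 show thesis
 proof (rule that[OF q(1)])
  show "psum q k = psum p k - of_bool (drops e p k)" for k using S[of k] by (simp add: r_def)
  have "psum q (length p + length q + 1) = psum p (length p + length q + 1)"
   using S[of "length p + length q + 1"] big by simp
  then show "sum_list q = sum_list p" by (simp add: psum_ge)
  have "psum_cond e q" unfolding psum_cond_def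
  proof (intro allI impI)
   fix k assume *: "odd (psum q (Suc k) + e * Suc k)"
   have rk: "r (Suc k) = 0"
   proof (rule ccontr)
    assume "r (Suc k) ~= 0"
    then have 1: "r (Suc k) = 1" using r01[of "Suc k"] by simp
    then have "psum p (Suc k) = Suc (psum q (Suc k))" using S[of "Suc k"] by simp
    then show False using odd_h[OF 1] * by (simp only: add_Suc even_Suc) blast
   qed
   then have h: "odd (psum p (Suc k) + e * Suc k)" using * S[of "Suc k"] by simp
   then have x: "part p k = part p (Suc k)" "odd (part p (Suc k) + e)"
   proof -
    have "\<not> drops e p (Suc k)" using rk by (simp add: r_def)
    then show "part p k = part p (Suc k)" "odd (part p (Suc k) + e)" using h unfolding drops_Suc by blast+
   qed
   have "r k = 0" using odd_h[of k] h x r01[of k] by (auto simp: psum_Suc)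
   moreover have "r (Suc (Suc k)) = 0"
    using odd_h[of "Suc (Suc k)"] h x r01[of "Suc (Suc k)"] by (auto simp: psum_Suc)
   ultimately show "part q k = part q (Suc k) \<and> odd (part q k + e)" using rk x by (simp add: q(2) a_def)
  qed
  then show "good_parts e q" using q(1) by (intro psum_cond_good_parts) (auto simp: is_partition_def)
 qed
qed

text \<open>If \<open>r\<close> met \<open>p\<close> at a drop, the cut would split a pair of
  \<open>r\<close>. The part of \<open>p\<close> before the cut is then at most the paired value and
  the part after it at least that value, so \<open>p\<close> has equal parts of the paired parity
  there, which a drop excludes.\<close>

lemma good_parts_below_collapse:
 assumes p: "is_partition p" and r: "is_partition r" "good_parts e r" and dom: "\<And>k. psum r k \<le> psum p k"
 shows "psum r k \<le> psum p k - of_bool (drops e p k)"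
proof (rule ccontr)
 assume *: "\<not> ?thesis"
 have d: "drops e p k" by (rule ccontr) (use * dom[of k] in simp)
 have eq: "psum r k = psum p k" using * d dom[of k] by simp
 from d obtain j where k: "k = Suc j" by (cases k) (auto simp: drops_def)
 have "odd (psum r (Suc j) + e * Suc j)" using d eq k by (simp add: drops_def)
 then have rr: "part r j = part r (Suc j)" "odd (part r j + e)"
  using good_parts_psum_cond[OF r(2)] unfolding psum_cond_def by blast+
 have "part p j \<le> part r j" "part r (Suc j) \<le> part p (Suc j)"
  using dom[of j] dom[of "Suc (Suc j)"] eq k by (simp_all add: psum_Suc)
 moreover have "part p (Suc j) \<le> part p j" using part_antimono[OF p] by simp
 ultimately have "part p j = part p (Suc j)" "part r j = part p j" using rr by linarith+
 then show False using d k rr by (simp add: drops_def)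
qed

text \<open>Evaluates the definite description: \<open>collapse_exists\<close> gives the candidate,
  \<open>good_parts_below_collapse\<close> its maximality, antisymmetry of dominance the
  uniqueness.\<close>

lemma collapse:
 assumes p: "is_partition p" and T: "even (sum_list p) \<longleftrightarrow> T ~= TypeB"
 shows "partition_of_type T (collapse T p)" "sum_list (collapse T p) = sum_list p"
  "psum (collapse T p) k = psum p k - of_bool (drops (type_eps T) p k)"
proof -
 define e where "e = type_eps T"
 have "e = 1 \<or> e = 0 \<and> even (sum_list p)" using T by (auto simp: e_def type_eps_def)
 from collapse_exists[OF p this] obtain q where q: "is_partition q" "good_parts e q"
  "\<And>k. psum q k = psum p k - of_bool (drops e p k)" "sum_list q = sum_list p" by metis
 have "collapse T p = q" unfolding collapse_def
 proof (rule the_equality)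
  show 1: "partition_of_type T q \<and> dominated q p \<and> (\<forall>r. partition_of_type T r \<and> dominated r p --> dominated r q)"
   using q T good_parts_below_collapse[OF p] by (auto simp: partition_of_type_iff dominated_iff e_def)
  fix q' assume 2: "partition_of_type T q' \<and> dominated q' p \<and>
   (\<forall>r. partition_of_type T r \<and> dominated r p --> dominated r q')"
  have "dominated q q'" "dominated q' q" using 1 2 by blast+
  then have "psum q' k = psum q k" for k by (meson antisym dominated_iff)
  moreover have "is_partition q'" using 2 partition_of_type_iff by blast
  ultimately show "q' = q" using q(1) by (intro partition_eq_psumI)
 qed
 then show "partition_of_type T (collapse T p)" "sum_list (collapse T p) = sum_list p"
  "psum (collapse T p) k = psum p k - of_bool (drops (type_eps T) p k)"
  using q T by (auto simp: partition_of_type_iff e_def)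
qed

lemma psum_collapse_le:
 assumes "is_partition p" "even (sum_list p) \<longleftrightarrow> T ~= TypeB"
 shows "psum (collapse T p) k \<le> psum p k" "psum p k \<le> psum (collapse T p) k + 1"
 unfolding collapse(3)[OF assms] by (cases "drops (type_eps T) p k"; simp)+

lemma collapse_id:
 assumes p: "partition_of_type T p" shows "collapse T p = p"
proof -
 have 1: "is_partition p" "even (sum_list p) \<longleftrightarrow> T ~= TypeB" "psum_cond (type_eps T) p"
  using p by (auto simp: partition_of_type_iff good_parts_psum_cond)
 have "\<not> drops (type_eps T) p k" for k
 proof
  assume d: "drops (type_eps T) p k"
  then obtain j where k: "k = Suc j" by (cases k) (auto simp: drops_def)
  have "odd (psum p (Suc j) + type_eps T * Suc j)" using d by (simp add: drops_def k)
  then show False using 1(3) d unfolding psum_cond_def drops_def k by (metis diff_Suc_1 zero_less_Suc)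
 qed
 then have "psum (collapse T p) k = psum p k" for k by (simp add: collapse(3)[OF 1(1,2)])
 then show ?thesis using collapse(1)[OF 1(1,2)] 1(1) by (intro partition_eq_psumI) (auto simp: partition_of_type_iff)
qed

subsection \<open>Conjugate partitions\<close>

definition exceeding :: "nat list => nat => nat" where
 "exceeding p m = length (filter (\<lambda>k. m < k) p)"

lemma less_fold_max: "i < fold max p a \<longleftrightarrow> i < a \<or> (\<exists>k\<in>set p. i < (k::nat))"
 by (induction p arbitrary: a) (auto simp: less_max_iff_disj)

lemma exceeding_pos: "0 < exceeding p i \<longleftrightarrow> (\<exists>k\<in>set p. i < k)" by (auto simp: exceeding_def filter_empty_conv)

lemma part_conjugate: "part (conjugate_partition p) i = exceeding p i"
 using exceeding_pos[of p i] less_fold_max[of i p 0] by (auto simp: part_def conjugate_partition_def exceeding_def)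

lemma exceeding_antimono: "i \<le> j ==> exceeding p j \<le> exceeding p i" by (induction p) (auto simp: exceeding_def)

lemma conjugate_is_partition: "is_partition (conjugate_partition p)"
proof -
 have "exceeding p i ~= 0" if "i < fold max p 0" for i
  using that exceeding_pos[of p i] less_fold_max[of i p 0] by auto
 moreover have "conjugate_partition p = map (exceeding p) [0..<fold max p 0]"
  by (simp add: conjugate_partition_def exceeding_def)
 moreover from calculation have "0 \<notin> set (conjugate_partition p)" by force
 ultimately show ?thesis by (auto simp: is_partition_def sorted_wrt_iff_nth_less exceeding_antimono)
qed

lemma psum_conjugate: "psum (conjugate_partition p) k = sum_list (map (\<lambda>j. min j k) p)"
proof (induction k)
 case (Suc k)
 have "sum_list (map (\<lambda>j. min j (Suc k)) p) = sum_list (map (\<lambda>j. min j k) p) + exceeding p k"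
  by (induction p) (auto simp: exceeding_def)
 with Suc show ?case by (simp add: psum_Suc part_conjugate)
qed (simp add: sum_list_0)

lemma sum_list_conjugate: "sum_list (conjugate_partition p) = sum_list p"
proof -
 define k where "k = length (conjugate_partition p) + fold max p 0"
 have "j \<le> k" if "j \<in> set p" for j using that less_fold_max[of "fold max p 0" p 0] by (fastforce simp: k_def)
 then have "map (\<lambda>j. min j k) p = p" by (intro map_idI) (simp add: min_absorb1)
 moreover have "sum_list (conjugate_partition p) = psum (conjugate_partition p) k" by (simp add: psum_ge k_def)
 ultimately show ?thesis by (simp add: psum_conjugate)
qed

lemma less_exceeding_iff: "is_partition p ==> i < exceeding p m \<longleftrightarrow> m < part p i"
proof (induction p arbitrary: i)
 case (Cons x p)
 have p: "is_partition p" using Cons.prems by (simp add: is_partition_def)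
 show ?case
 proof (cases "m < x")
  case True
  then show ?thesis using Cons.IH[OF p] by (cases i) (auto simp: exceeding_def)
 next
  case False
  then have "filter ((<) m) p = []" using Cons.prems by (auto simp: is_partition_def filter_empty_conv)
  moreover have "part (x # p) i \<le> m" using part_antimono[OF Cons.prems, of 0 i] False by simp
  ultimately show ?thesis using False by (simp add: exceeding_def)
 qed
qed (simp add: exceeding_def)

lemma conjugate_inject:
 assumes "is_partition p" "is_partition q" "conjugate_partition p = conjugate_partition q" shows "p = q"
proof (rule partition_eqI[OF assms(1,2)])
 fix i
 have "m < part p i \<longleftrightarrow> m < part q i" for m using assms part_conjugate less_exceeding_iff by metis
 then show "part p i = part q i" by (meson linorder_neqE_nat order_less_irrefl)
qed

lemma count_conjugate:
 assumes q: "is_partition q" and m: "m > 0"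
 shows "count_list (conjugate_partition q) m = part q (m - 1) - part q m"
proof -
 define c where "c = conjugate_partition q"
 have ci: "part c i = m \<longleftrightarrow> part q m \<le> i \<and> i < part q (m - 1)" for i
  using less_exceeding_iff[OF q, of "m - 1" i] less_exceeding_iff[OF q, of m i] m
  unfolding c_def part_conjugate by linarith
 have "{i. i < length c \<and> c ! i = m} = {i. part c i = m}" using m by (auto simp: part_def split: if_splits)
 also have "\<dots> = {part q m..<part q (m - 1)}" unfolding ci by auto
 finally have "card {i. i < length c \<and> c ! i = m} = part q (m - 1) - part q m" by simp
 moreover have "count_list c m = length (filter (\<lambda>x. x = m) c)" by (induction c) auto
 ultimately show ?thesis unfolding c_def by (simp add: length_filter_conv_card)
qed

lemma count_list_exceeding: "m > 0 ==> count_list p m + exceeding p m = exceeding p (m - 1)"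
 by (induction p) (auto simp: exceeding_def)

lemma count_list_0: "is_partition p ==> count_list p 0 = 0" by (simp add: is_partition_def count_list_0_iff)

subsection \<open>The excess over a column\<close>

text \<open>The number of boxes to the right of column \<open>k\<close>; for a nilpotent matrix with
  Jordan blocks \<open>p\<close> this is the rank of the \<open>k\<close>-th power.\<close>

definition excess :: "nat list => nat => nat" where
 "excess p k = sum_list (map (\<lambda>j. j - k) p)"

lemma excess_plus_psum_conjugate: "excess p k + psum (conjugate_partition p) k = sum_list p"
 by (induction p) (auto simp: excess_def psum_conjugate)

text \<open>With \<open>psum_eq_excess\<close>, this makes \<open>excess p k\<close> the maximum
  over \<open>j\<close> of \<open>psum p j - j * k\<close>, a Legendre transform. Bounds on partial
  sums therefore pass to ranks of powers.\<close>

lemma psum_le_excess: "psum p j \<le> excess p k + j * k"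
proof (induction p arbitrary: j)
 case (Cons x p)
 show ?case
 proof (cases j)
  case (Suc i)
  then show ?thesis using Cons.IH[of i] by (simp add: excess_def)
 qed simp
qed (simp add: excess_def)

lemma psum_eq_excess: "is_partition p ==> psum p (exceeding p k) = excess p k + exceeding p k * k"
proof (induction p)
 case (Cons x p)
 have p: "is_partition p" using Cons.prems by (simp add: is_partition_def)
 show ?case
 proof (cases "k < x")
  case True
  then show ?thesis using Cons.IH[OF p] by (simp add: excess_def exceeding_def)
 next
  case False
  then have *: "\<forall>y\<in>set (x # p). y \<le> k" using Cons.prems by (auto simp: is_partition_def)
  then have "filter ((<) k) (x # p) = []" by (auto simp: filter_empty_conv)
  then have "exceeding (x # p) k = 0" by (simp add: exceeding_def)
  moreover have "excess (x # p) k = 0" using * by (auto simp: excess_def)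
  ultimately show ?thesis by simp
 qed
qed (simp add: excess_def exceeding_def)

lemma excess_leI:
 assumes "is_partition q" "\<And>j. psum q j \<le> psum p j + 1" shows "excess q k \<le> excess p k + 1"
 using psum_eq_excess[OF assms(1), of k] assms(2)[of "exceeding q k"] psum_le_excess[of p "exceeding q k" k] by linarith

section \<open>The dual partition: its type, and the fibres of the duality\<close>

lemma is_partition_plus: "is_partition p ==> is_partition (partition_plus p)"
 by (cases p) (auto simp: is_partition_def intro: le_trans)

lemma part_plus: "part (partition_plus p) i = part p i + of_bool (i = 0)" by (cases p; cases i) auto

lemma psum_plus: "psum (partition_plus p) k = psum p k + of_bool (k > 0)" by (cases p; cases k) auto

lemma sum_list_plus: "sum_list (partition_plus p) = sum_list p + 1" by (cases p) auto

lemma partition_minus: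
 assumes p: "is_partition p" "p ~= []"
 shows "is_partition (partition_minus p)" "sum_list (partition_minus p) + 1 = sum_list p"
  "psum (partition_minus p) k = (if k < length p then psum p k else sum_list p - 1)"
  "k + 1 < length p ==> part (partition_minus p) k = part p k"
proof -
 obtain q l where ql: "p = q @ [l]" using p(2) by (metis rev_exhaust)
 have l: "l > 0" "\<forall>x\<in>set q. x \<ge> l" "is_partition q" using p(1) by (auto simp: ql is_partition_def sorted_wrt_append)
 have m: "partition_minus p = q @ (if l = 1 then [] else [l - 1])"
  using l by (auto simp: partition_minus_def ql is_partition_def filter_id_conv intro!: filter_True)
 show "is_partition (partition_minus p)" "sum_list (partition_minus p) + 1 = sum_list p"
  using l unfolding m by (fastforce simp: ql is_partition_def sorted_wrt_append)+
 show "psum (partition_minus p) k = (if k < length p then psum p k else sum_list p - 1)"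
  using l unfolding m psum_def by (auto simp: ql)
 show "part (partition_minus p) k = part p k" if "k + 1 < length p"
  using that unfolding m part_def by (auto simp: ql nth_append)
qed

lemma type_B_nonempty: "partition_of_type TypeB p ==> p ~= []" by (cases p) simp_all

text \<open>By \<open>count_conjugate\<close> a multiplicity in the transpose is a difference of
  consecutive parts. Those of even numbers are even once all partial sums of the collapse over an
  odd number of parts are odd, which is \<open>odd_q\<close>.\<close>

lemma dBV_partition_type_C:
 assumes p: "partition_of_type TypeC p"
 shows "partition_of_type TypeB (dBV_partition TypeC p)" "sum_list (dBV_partition TypeC p) = sum_list p + 1"
proof -
 have p1: "is_partition p" "even (sum_list p)" "psum_cond 0 p"
  using p by (auto simp: partition_of_type_iff good_parts_psum_cond type_eps_def)
 define P where "P = partition_plus p"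
 have P: "is_partition P" "even (sum_list P) \<longleftrightarrow> TypeB ~= TypeB"
  using p1 by (auto simp: P_def is_partition_plus sum_list_plus)
 define q where "q = collapse TypeB P"
 note q = collapse[OF P, folded q_def]
 have e: "type_eps TypeB = 1" by (simp add: type_eps_def)
 have odd_q: "odd (psum q (Suc k))" if k: "even k" for k
 proof (cases "even (psum p (Suc k))")
  case True
  then have "\<not> drops 1 P (Suc k)" using k by (simp add: drops_def P_def psum_plus)
  then show ?thesis using True by (simp add: q(3) e P_def psum_plus)
 next
  case False
  then have x: "part p k = part p (Suc k)" "odd (part p k)" using psum_condD[OF p1(3), of k] by simp_all
  then have "drops 1 P (Suc k)" using k False by (auto simp: drops_def P_def psum_plus part_plus)
  then show ?thesis using False by (simp add: q(3) e P_def psum_plus)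
 qed
 have d: "dBV_partition TypeC p = conjugate_partition q" by (simp add: q_def P_def)
 show s: "sum_list (dBV_partition TypeC p) = sum_list p + 1"
  unfolding d sum_list_conjugate q(2) by (simp add: P_def sum_list_plus)
 have qp: "is_partition q" using q(1) by simp
 have "even (count_list (conjugate_partition q) m)" if "even m" for m
 proof (cases "m = 0")
  case True
  then show ?thesis by (simp add: count_list_0 conjugate_is_partition)
 next
  case False
  then obtain j where m: "m = Suc (Suc j)" "even j" using even_pos_cases[of m] False \<open>even m\<close> by blast
  have "part q m \<le> part q (m - 1)" using part_antimono[OF qp] by simp
  moreover have "psum q (Suc (Suc (Suc j))) = psum q (Suc j) + part q (Suc j) + part q m" by (simp add: psum_Suc m)
  then have "even (part q (Suc j) + part q m)" using odd_q[of j] odd_q[of "Suc (Suc j)"] m by auto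
  ultimately show ?thesis using count_conjugate[OF qp, of m] False by (simp add: m)
 qed
 then show "partition_of_type TypeB (dBV_partition TypeC p)"
  using s p1 unfolding d by (simp add: conjugate_is_partition)
qed

text \<open>As for type C, but now the partial sums over an even number of parts have to be even;
  this controls the multiplicities of odd numbers in the transpose.\<close>

lemma dBV_partition_type_B:
 assumes p: "partition_of_type TypeB p"
 shows "partition_of_type TypeC (dBV_partition TypeB p)" "sum_list (dBV_partition TypeB p) + 1 = sum_list p"
proof -
 have p1: "is_partition p" "odd (sum_list p)" "psum_cond 1 p"
  using p by (auto simp: partition_of_type_iff good_parts_psum_cond type_eps_def)
 have ne: "p ~= []" using type_B_nonempty[OF p] .
 define P where "P = partition_minus p"
 note PP = partition_minus[OF p1(1) ne, folded P_def]
 have P: "is_partition P" "even (sum_list P) \<longleftrightarrow> TypeC ~= TypeB" using PP(1) PP(2) p1(2) by (auto, presburger)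
 define q where "q = collapse TypeC P"
 note q = collapse[OF P, folded q_def]
 have e: "type_eps TypeC = 0" by (simp add: type_eps_def)
 have even_q: "even (psum q k)" if k: "even k" for k
 proof (cases "k < length p \<and> odd (psum p k)")
  case False
  then have "even (psum P k)" using p1(2) by (auto simp: PP(3))
  then have "\<not> drops 0 P k" by (simp add: drops_def)
  then show ?thesis using \<open>even (psum P k)\<close> by (simp add: q(3) e)
 next
  case True
  then obtain j where j: "k = Suc j" by (cases k) auto
  have "odd (psum p (Suc j) + 1 * Suc j)" using True k j by auto
  then have x: "part p j = part p (Suc j)" "even (part p j)" using psum_condD[OF p1(3), of j] by simp_all
  have "part P j = part p j" using True j by (intro PP(4)) simp
  then have "drops 0 P k" using True x j by (auto simp: drops_def PP(3))
  then show ?thesis using True by (simp add: q(3) e PP(3))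
 qed
 have d: "dBV_partition TypeB p = conjugate_partition q" by (simp add: q_def P_def)
 show s: "sum_list (dBV_partition TypeB p) + 1 = sum_list p" unfolding d sum_list_conjugate q(2) by (rule PP(2))
 have qp: "is_partition q" using q(1) by simp
 have "even (count_list (conjugate_partition q) m)" if "odd m" for m
 proof -
  obtain j where m: "m = Suc j" "even j" using odd_cases[of m] \<open>odd m\<close> by blast
  have "part q m \<le> part q (m - 1)" using part_antimono[OF qp] by simp
  moreover have "psum q (Suc (Suc j)) = psum q j + part q j + part q m" by (simp add: psum_Suc m)
  then have "even (part q j + part q m)" using even_q[of j] even_q[of "Suc (Suc j)"] m by auto
  ultimately show ?thesis using count_conjugate[OF qp, of m] by (simp add: m)
 qed
 then show "partition_of_type TypeC (dBV_partition TypeB p)"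
  using s p1 unfolding d by (auto simp: conjugate_is_partition) presburger
qed

lemma dBV_partition_type_D:
 assumes p: "partition_of_type TypeD p"
 shows "partition_of_type TypeD (dBV_partition TypeD p)" "sum_list (dBV_partition TypeD p) = sum_list p"
proof -
 have "even (sum_list (conjugate_partition p)) \<longleftrightarrow> TypeD ~= TypeB" using p by (simp add: sum_list_conjugate)
 from collapse[OF conjugate_is_partition this]
 show "partition_of_type TypeD (dBV_partition TypeD p)" "sum_list (dBV_partition TypeD p) = sum_list p"
  by (simp_all only: dBV_partition.simps sum_list_conjugate)
qed

text \<open>A collapse lowers each partial sum by at most \<open>1\<close> and transposition is
  injective, so equal duals force partial sums (of the partitions, or in type D of their transposes)
  to differ by at most \<open>1\<close>. The bound then passes to excesses.\<close>

lemma dBV_partition_fibre: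
 assumes p: "partition_of_type T p" and q: "partition_of_type T q" and sum: "sum_list p = sum_list q"
  and eq: "dBV_partition T p = dBV_partition T q"
 shows "excess q k \<le> excess p k + 1"
proof (cases T)
 case TypeC
 have P: "is_partition (partition_plus r)" "even (sum_list (partition_plus r)) \<longleftrightarrow> TypeB ~= TypeB"
  if "partition_of_type T r" for r using that TypeC by (auto simp: is_partition_plus sum_list_plus)
 have ip: "is_partition (collapse TypeB (partition_plus r))" if "partition_of_type T r" for r
  using collapse(1)[OF P[OF that]] by simp
 have c: "collapse TypeB (partition_plus p) = collapse TypeB (partition_plus q)"
  by (rule conjugate_inject[OF ip[OF p] ip[OF q]]) (use eq TypeC in simp)
 show ?thesis
 proof (rule excess_leI)
  show "is_partition q" using q TypeC by simp
  fix j
  show "psum q j \<le> psum p j + 1"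
   using psum_collapse_le(2)[OF P[OF q], of j] psum_collapse_le(1)[OF P[OF p], of j] c by (simp add: psum_plus)
 qed
next
 case TypeD
 have P: "is_partition (conjugate_partition r)" "even (sum_list (conjugate_partition r)) \<longleftrightarrow> TypeD ~= TypeB"
  if "partition_of_type T r" for r using that TypeD by (auto simp: conjugate_is_partition sum_list_conjugate)
 have "psum (conjugate_partition p) k \<le> psum (conjugate_partition q) k + 1"
  using psum_collapse_le(2)[OF P[OF p], of k] psum_collapse_le(1)[OF P[OF q], of k] eq TypeD by simp
 then show ?thesis using excess_plus_psum_conjugate[of p k] excess_plus_psum_conjugate[of q k] sum by linarith
next
 case TypeB
 have ne: "r ~= []" "is_partition r" "odd (sum_list r)" if "partition_of_type T r" for r
  using that type_B_nonempty[of r] unfolding TypeB by (blast, simp_all)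
 have P: "is_partition (partition_minus r)" "even (sum_list (partition_minus r)) \<longleftrightarrow> TypeC ~= TypeB"
  if "partition_of_type T r" for r
  using partition_minus(1,2)[OF ne(2)[OF that] ne(1)[OF that]] ne(3)[OF that] by (auto, presburger)
 have ip: "is_partition (collapse TypeC (partition_minus r))" if "partition_of_type T r" for r
  using collapse(1)[OF P[OF that]] by simp
 have c: "collapse TypeC (partition_minus p) = collapse TypeC (partition_minus q)"
  by (rule conjugate_inject[OF ip[OF p] ip[OF q]]) (use eq TypeB in simp)
 show ?thesis
 proof (rule excess_leI)
  show "is_partition q" using q TypeB by simp
  fix j
  have tot: "psum q j \<le> sum_list q" by (simp add: psum_def) (metis append_take_drop_id le_add1 sum_list_append)
  note mp = partition_minus(3)[OF ne(2)[OF p] ne(1)[OF p], of j] and mq = partition_minus(3)[OF ne(2)[OF q] ne(1)[OF q], of j]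
  have le: "psum (partition_minus q) j \<le> psum (partition_minus p) j + 1"
   using psum_collapse_le(2)[OF P[OF q], of j] psum_collapse_le(1)[OF P[OF p], of j] c by simp
  show "psum q j \<le> psum p j + 1"
  proof (cases "j < length p")
   case False
   then show ?thesis using tot sum by (simp add: psum_ge)
  next
   case True
   show ?thesis
   proof (cases "j < length q")
    case True
    then show ?thesis using le mp mq \<open>j < length p\<close> by simp
   next
    \<comment> \<open>Here \<open>q\<close> is exhausted and its last part has already lost
      \<open>1\<close>. The remaining sum is even, so the symplectic collapse does not lower it
      again; otherwise two losses would have to be reckoned with.\<close>
    case False
    then have "even (psum (partition_minus q) j)" using mq ne(3)[OF q] by simp
    then have "\<not> drops (type_eps TypeC) (partition_minus q) j" by (simp add: drops_def type_eps_def)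
    then have "psum (collapse TypeC (partition_minus q)) j = sum_list q - 1"
     using collapse(3)[OF P[OF q], of j] mq False by simp
    then have "sum_list q - 1 \<le> psum p j" using psum_collapse_le(1)[OF P[OF p], of j] c mp \<open>j < length p\<close> by simp
    then show ?thesis using tot by linarith
   qed
  qed
 qed
qed

lemma very_even_conjugate:
 assumes "very_even p" shows "very_even (conjugate_partition p)"
proof -
 have p: "partition_of_type TypeD p" "\<forall>k\<in>set p. even k" using assms by (auto simp: very_even_def)
 have "good_parts 1 p" using p(1) unfolding partition_of_type_iff by (simp add: type_eps_def)
 then have "even (exceeding p i)" for i using p(2) by (induction rule: good_parts.induct) (auto simp: exceeding_def)
 then have even: "\<forall>k\<in>set (conjugate_partition p). even k" by (auto simp: conjugate_partition_def exceeding_def)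
 have ip: "is_partition p" using p by simp
 have ep: "even (part p i)" for i using p(2) by (auto simp: part_def)
 have "even (count_list (conjugate_partition p) m)" for m
  using ep count_conjugate[OF ip, of m] by (cases "m = 0") (auto simp: count_list_0 conjugate_is_partition)
 then show ?thesis using even p(1) by (simp add: very_even_def conjugate_is_partition sum_list_conjugate)
qed

lemma very_even_dBV: "very_even p ==> very_even (dBV_partition TypeD p)"
 using very_even_conjugate[of p] collapse_id[of TypeD "conjugate_partition p"] by (simp add: very_even_def)

text \<open>Ensures that the dual of a partition that is not very even determines its orbit. Even
  parts make all partial sums of the collapse even, and type D then pairs consecutive parts; this
  leaves no room for a drop, so the transpose of \<open>p\<close> is its own collapse.\<close>

lemma very_even_if_dBV:
 assumes p: "partition_of_type TypeD p" and ve: "very_even (dBV_partition TypeD p)"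
 shows "very_even p"
proof -
 define c where "c = conjugate_partition p"
 define q where "q = collapse TypeD c"
 have ce: "is_partition c" "even (sum_list c) \<longleftrightarrow> TypeD ~= TypeB"
  using p by (simp_all add: c_def conjugate_is_partition sum_list_conjugate)
 have e: "type_eps TypeD = 1" by (simp add: type_eps_def)
 note q = collapse[OF ce, folded q_def, unfolded e]
 have qe: "even (part q i)" for i using ve by (auto simp: very_even_def q_def c_def part_def)
 have Se: "even (psum q k)" for k by (induction k) (auto simp: psum_Suc qe)
 have cond: "psum_cond 1 q" using q(1) unfolding partition_of_type_iff e by (simp add: good_parts_psum_cond)
 have pairs: "part q k = part q (Suc k)" if "even k" for k
  using psum_condD(1)[OF cond, of k] that Se[of "Suc k"] by simp
 have odd_nodrop: "\<not> drops 1 c k" if "odd k" for k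
 proof
  assume d: "drops 1 c k"
  obtain j where k: "k = Suc j" using odd_cases[of k] \<open>odd k\<close> by blast
  \<comment> \<open>Excludes that truncated subtraction hides the drop.\<close>
  have "psum c k ~= 0"
  proof
   assume "psum c k = 0"
   then have "part c j = 0" by (simp add: k psum_Suc)
   moreover from this have "part c k = 0" using part_antimono[OF ce(1), of j k] k by simp
   ultimately show False using d k by (simp add: drops_def)
  qed
  moreover have "even (psum c k)" using d that by (simp add: drops_def)
  ultimately have "odd (psum q k)" using q(3)[of k] d by simp
  then show False using Se by blast
 qed
 \<comment> \<open>At an even position a drop would leave \<open>c\<close> with a part larger than
   its predecessor, because the two corresponding parts of \<open>q\<close> are equal.\<close>
 have nodrop: "\<not> drops 1 c k" for k
 proof
  assume d: "drops 1 c k"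
  then have "even k" using odd_nodrop by blast
  moreover have "k ~= 0" using d by (cases k) (simp_all add: drops_def)
  ultimately obtain j where k: "k = Suc (Suc j)" "even j" using even_pos_cases[of k] by blast
  have "psum c k > 0" using d k by (auto simp: drops_def intro: odd_pos)
  then have 1: "psum c k = psum q k + 1" using q(3)[of k] d by simp
  have 2: "psum c (Suc j) = psum q (Suc j)" using q(3)[of "Suc j"] odd_nodrop[of "Suc j"] k by simp
  have 3: "psum q j \<le> psum c j" using q(3)[of j] by simp
  have "part c (Suc j) = part q (Suc j) + 1" using 1 2 by (simp add: k psum_Suc)
  moreover have "part c j \<le> part q j" using 2 3 by (simp add: psum_Suc)
  ultimately have "part c j < part c (Suc j)" using pairs[OF k(2)] by simp
  then show False using part_antimono[OF ce(1), of j "Suc j"] by simp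
 qed
 then have "psum q k = psum c k" for k using q(3) by simp
 then have "q = c" using q(1) ce(1) by (intro partition_eq_psumI) auto
 have "even m" if "m \<in> set p" for m
 proof (rule ccontr)
  assume "odd m"
  then obtain j where m: "m = Suc j" "even j" using odd_cases by blast
  have "exceeding p m = exceeding p (m - 1)" using pairs[OF m(2)] \<open>q = c\<close> by (simp add: m c_def part_conjugate)
  then have "count_list p m = 0" using count_list_exceeding[of m p] m by simp
  with that show False by (simp add: count_list_0_iff)
 qed
 then show ?thesis using p by (simp add: very_even_def)
qed

section \<open>Integers of the algebraic closure and powers of Weil group elements\<close>

interpretation to_ac_hom: field_hom to_ac by unfold_locales simp_all

definition acpoly :: "'f::field poly => 'f alg_closure => 'f alg_closure" where
 "acpoly p x = poly (map_poly to_ac p) x"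

lemma acpoly_simps [simp]:
 "acpoly 0 x = 0" "acpoly 1 x = 1" "acpoly (pCons a p) x = to_ac a + x * acpoly p x"
 "acpoly (p + q) x = acpoly p x + acpoly q x" "acpoly (smult c p) x = to_ac c * acpoly p x"
 by (simp_all add: acpoly_def hom_distribs)

lemma acpoly_minus [simp]: "acpoly (- p) x = - acpoly p x" using acpoly_simps(5)[of "-1" p x] by simp

lemma acpoly_diff [simp]: "acpoly (p - q) x = acpoly p x - acpoly q x" using acpoly_simps(4)[of p "- q" x] by simp

lemma acpoly_mult [simp]: "acpoly (p * q) x = acpoly p x * acpoly q x" by (induction p) (simp_all add: algebra_simps)

lemma acpoly_power [simp]: "acpoly (p ^ k) x = acpoly p x ^ k" by (induction k) simp_all

lemma acpoly_sum: "acpoly (\<Sum>i\<in>I. f i) x = (\<Sum>i\<in>I. acpoly (f i) x)" by (induction I rule: infinite_finite_induct) auto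

lemma acpoly_altdef: "acpoly p x = (\<Sum>i\<le>degree p. to_ac (coeff p i) * x ^ i)"
 unfolding acpoly_def poly_altdef by (simp add: to_ac_hom.hom_zero degree_map_poly coeff_map_poly)

context nonarch_local_field
begin

lemma v_0 [simp]: "v 0 = 0" by (simp add: v_zero_iff)

lemma v_1 [simp]: "v 1 = 1" using v_mult[of 1 1] v_zero_iff[of 1] by simp

lemma v_minus [simp]: "v (- x) = v x"
proof -
 have "(v (- 1))\<^sup>2 = 1" using v_mult[of "-1" "-1"] by (simp add: power2_eq_square)
 then have "v (- 1) = 1" using v_nonneg[of "-1"] by (simp add: power2_eq_1_iff)
 then show ?thesis using v_mult[of "-1" x] by simp
qed

lemma v_add_le: "v x \<le> c ==> v y \<le> c ==> v (x + y) \<le> c" using v_ultrametric[of x y] by linarith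

lemma v_diff_le: "v x \<le> c ==> v y \<le> c ==> v (x - y) \<le> c" using v_add_le[of x c "- y"] by simp

lemma v_sum_le: "(\<And>i. i \<in> I ==> v (f i) \<le> c) ==> 0 \<le> c ==> v (\<Sum>i\<in>I. f i) \<le> c"
 by (induction I rule: infinite_finite_induct) (auto intro: v_add_le)

lemma v_power: "v (x ^ n) = v x ^ n" by (induction n) (simp_all add: v_mult)

lemma v_mult_le: "v x \<le> c ==> v y \<le> d ==> v (x * y) \<le> c * d"
 unfolding v_mult by (intro mult_mono v_nonneg) (auto intro: order_trans[OF v_nonneg])

section \<open>Gauss norm bounds for polynomials over the local field\<close>

definition coeffs_le :: "real => 'f poly => bool" where
 "coeffs_le c p \<longleftrightarrow> (\<forall>i. v (coeff p i) \<le> c)"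

lemma coeffs_le_add: "coeffs_le c p ==> coeffs_le c q ==> coeffs_le c (p + q)" by (simp add: coeffs_le_def v_add_le)

lemma coeffs_le_minus: "coeffs_le c p ==> coeffs_le c (- p)" by (simp add: coeffs_le_def)

lemma coeffs_le_diff: "coeffs_le c p ==> coeffs_le c q ==> coeffs_le c (p - q)" by (simp add: coeffs_le_def v_diff_le)

lemma coeffs_le_nonneg: "coeffs_le c p ==> 0 \<le> c" unfolding coeffs_le_def using v_nonneg order_trans by blast

lemma coeffs_le_mult:
 assumes "coeffs_le c p" "coeffs_le d q" shows "coeffs_le (c * d) (p * q)" unfolding coeffs_le_def
proof
 fix i
 have "v (coeff p k * coeff q (i - k)) \<le> c * d" for k using assms by (intro v_mult_le) (auto simp: coeffs_le_def)
 then show "v (coeff (p * q) i) \<le> c * d" unfolding coeff_mult using assms coeffs_le_nonneg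
  by (intro v_sum_le) (auto intro: mult_nonneg_nonneg)
qed

lemma coeffs_le_mult1: "coeffs_le c p ==> coeffs_le 1 q ==> coeffs_le c (p * q)" using coeffs_le_mult[of c p 1 q] by simp

lemma coeffs_le_mono: "coeffs_le c p ==> c \<le> d ==> coeffs_le d p" unfolding coeffs_le_def using order_trans by blast

lemma coeffs_le_monom: "v a \<le> c ==> coeffs_le c (monom a k)"
 unfolding coeffs_le_def using order_trans[OF v_nonneg] by (auto simp: coeff_monom)

lemma coeffs_le_const: "v a \<le> c ==> coeffs_le c [:a:]" using coeffs_le_monom[of a c 0] by (simp add: monom_0)

lemma coeffs_le_0: "0 \<le> c ==> coeffs_le c 0" by (simp add: coeffs_le_def)

lemma coeffs_le_pCons: "v a \<le> c ==> coeffs_le c p ==> coeffs_le c (pCons a p)"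
 by (auto simp: coeffs_le_def coeff_pCons split: nat.split)

lemma coeffs_le_1: "coeffs_le 1 1" using coeffs_le_const[of 1 1] by (simp add: one_pCons)

lemma coeffs_le_numeral: "coeffs_le 1 (numeral k)"
proof -
 have "coeffs_le 1 (of_nat m)" for m by (induction m) (auto intro: coeffs_le_add coeffs_le_1 coeffs_le_0)
 from this[of "numeral k"] show ?thesis by simp
qed

lemma coeffs_le_sum: "(\<And>i. i \<in> I ==> coeffs_le c (f i)) ==> 0 \<le> c ==> coeffs_le c (\<Sum>i\<in>I. f i)"
 by (induction I rule: infinite_finite_induct) (auto intro: coeffs_le_add coeffs_le_0)

lemma coeffs_le_prod: "(\<And>i. i \<in> I ==> coeffs_le 1 (f i)) ==> coeffs_le 1 (\<Prod>i\<in>I. f i)"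
 by (induction I rule: infinite_finite_induct) (auto intro: coeffs_le_mult1 coeffs_le_1)

lemma coeffs_le_power: "coeffs_le 1 p ==> coeffs_le 1 (p ^ k)" using coeffs_le_prod[of "{..<k}" "\<lambda>_. p"] by simp

text \<open>Reduction by a monic polynomial never divides: each Horner step subtracts a coefficient
  already bounded by \<open>c\<close> times the integral polynomial \<open>f\<close>.\<close>

lemma coeffs_le_mod:
 assumes f: "lead_coeff f = 1" "coeffs_le 1 f" and p: "coeffs_le c p"
 shows "coeffs_le c (p mod f)" using p
proof (induction p)
 case (pCons a p)
 have "f ~= 0" using f by auto
 have a: "v a \<le> c" "coeffs_le c p" using pCons.prems unfolding coeffs_le_def
  by (metis coeff_pCons_0, metis coeff_pCons_Suc)
 then have "coeffs_le c (pCons a (p mod f))" using pCons.IH by (intro coeffs_le_pCons)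
 moreover from this have "coeffs_le c (smult b f)" if "b = coeff (pCons a (p mod f)) (degree f)" for b
  using coeffs_le_mult1[OF coeffs_le_const[of b c] f(2)] that by (simp add: coeffs_le_def)
 ultimately show ?case unfolding mod_pCons[OF \<open>f ~= 0\<close>] f(1) by (auto intro!: coeffs_le_diff)
qed simp

lemma coeff_mod_eq_0: "f ~= 0 ==> degree f \<le> i ==> coeff (p mod f) i = 0"
 using degree_mod_less[of f p] by (auto intro: coeff_eq_0)

section \<open>Integral elements form a ring\<close>

lemma ac_integers_iff: "x \<in> ac_integers v \<longleftrightarrow>
  (\<exists>p. lead_coeff p = 1 \<and> coeffs_le 1 p \<and> acpoly p x = 0)"
 by (simp add: ac_integers_def coeffs_le_def acpoly_def)

lemma ac_integersI: "lead_coeff p = 1 ==> coeffs_le 1 p ==> acpoly p x = 0 ==> x \<in> ac_integers v"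
 using ac_integers_iff by blast

text \<open>The determinant trick: \<open>z\<close> is an eigenvalue of the integral matrix
  \<open>A\<close>, hence a root of its characteristic polynomial, which is monic with integral
  coefficients.\<close>

lemma ac_integers_of_module:
 fixes b :: "'i => 'f alg_closure"
 assumes I: "finite I" "i0 \<in> I" "b i0 ~= 0"
  and A: "\<And>i j. i \<in> I ==> j \<in> I ==> v (A i j) \<le> 1"
  and z: "\<And>i. i \<in> I ==> z * b i = (\<Sum>j\<in>I. to_ac (A i j) * b j)"
 shows "z \<in> ac_integers v"
proof -
 define m where "m = card I"
 obtain h where h: "bij_betw h {0..<m} I" using ex_bij_betw_nat_finite[OF I(1)] m_def by blast
 have hI: "h i \<in> I" if "i < m" for i using h that by (auto simp: bij_betw_def)
 define M where "M = mat m m (\<lambda>(i, j). A (h i) (h j))"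
 have M: "M \<in> carrier_mat m m" by (simp add: M_def)
 define w where "w = vec m (\<lambda>i. b (h i))"
 obtain k where k: "k < m" "h k = i0" using h I(2) by (auto simp: bij_betw_def)
 have "w $ k ~= 0" using k I(3) by (simp add: w_def)
 then have w0: "w ~= 0\<^sub>v m" using k by auto
 have "map_mat to_ac M *\<^sub>v w = z \<cdot>\<^sub>v w"
 proof (rule eq_vecI)
  fix i assume "i < dim_vec (z \<cdot>\<^sub>v w)"
  then have i: "i < m" by (simp add: w_def)
  have "(map_mat to_ac M *\<^sub>v w) $ i = (\<Sum>j\<in>{0..<m}. to_ac (A (h i) (h j)) * b (h j))"
   using i by (auto simp: M_def w_def scalar_prod_def intro!: sum.cong)
  also have "\<dots> = (\<Sum>j\<in>I. to_ac (A (h i) j) * b j)" by (rule sum.reindex_bij_betw[OF h])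
  also have "\<dots> = z * b (h i)" using z[OF hI[OF i]] by simp
  finally show "(map_mat to_ac M *\<^sub>v w) $ i = (z \<cdot>\<^sub>v w) $ i" using i by (simp add: w_def)
 qed (simp add: w_def M_def)
 then have "eigenvector (map_mat to_ac M) w z" using w0 M by (auto simp: eigenvector_def w_def)
 then have "eigenvalue (map_mat to_ac M) z" unfolding eigenvalue_def by blast
 then have "poly (char_poly (map_mat to_ac M)) z = 0"
  using eigenvalue_root_char_poly[of "map_mat to_ac M" m z] M by simp
 then have "acpoly (char_poly M) z = 0" by (simp add: acpoly_def to_ac_hom.char_poly_hom[OF M])
 moreover have "lead_coeff (char_poly M) = 1" using degree_monic_char_poly[OF M] by simp
 moreover have "coeffs_le 1 (char_poly M)"
 proof -
  define C where "C = char_poly_matrix M"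
  have C: "C \<in> carrier_mat m m" using M by (simp add: C_def)
  have "coeffs_le 1 [:0, 1:]" using coeffs_le_monom[of 1 1 1] by (simp add: monom_Suc monom_0)
  then have ent: "coeffs_le 1 (C $$ (i, j))" if "i < m" "j < m" for i j using that M A[OF hI hI, of i j]
   by (auto simp: C_def char_poly_matrix_def M_def intro!: coeffs_le_pCons coeffs_le_0 coeffs_le_1)
  have "coeffs_le 1 (signof p * (\<Prod>i = 0..<m. C $$ (i, p i)))" if "p permutes {0..<m}" for p
  proof (rule coeffs_le_mult1)
   show "coeffs_le 1 (\<Prod>i = 0..<m. C $$ (i, p i))"
    using that permutes_in_image[OF that] by (intro coeffs_le_prod ent) auto
   show "coeffs_le 1 (signof p)" by (cases p rule: sign_cases) (auto simp: coeffs_le_1 coeffs_le_minus)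
  qed
  then have "coeffs_le 1 (Determinant.det C)" unfolding det_def'[OF C] by (intro coeffs_le_sum) auto
  then show ?thesis by (simp add: char_poly_def C_def)
 qed
 ultimately show ?thesis by (intro ac_integersI)
qed

definition int_span :: "('i => 'f alg_closure) => 'i set => 'f alg_closure set" where
 "int_span b I = {\<Sum>i\<in>I. to_ac (c i) * b i |c. \<forall>i. v (c i) \<le> 1}"

lemma int_span_add: "x \<in> int_span b I ==> y \<in> int_span b I ==> x + y \<in> int_span b I"
proof -
 assume "x \<in> int_span b I" "y \<in> int_span b I"
 then obtain c d where *: "x = (\<Sum>i\<in>I. to_ac (c i) * b i)" "\<forall>i. v (c i) \<le> 1"
  "y = (\<Sum>i\<in>I. to_ac (d i) * b i)" "\<forall>i. v (d i) \<le> 1" unfolding int_span_def by blast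
 have "x + y = (\<Sum>i\<in>I. to_ac (c i + d i) * b i)" by (simp add: * distrib_right sum.distrib)
 then show ?thesis using * unfolding int_span_def by (intro CollectI exI[of _ "\<lambda>i. c i + d i"]) (simp add: v_add_le)
qed

lemma int_span_scale: "v a \<le> 1 ==> x \<in> int_span b I ==> to_ac a * x \<in> int_span b I"
proof -
 assume a: "v a \<le> 1" and "x \<in> int_span b I"
 then obtain c where *: "x = (\<Sum>i\<in>I. to_ac (c i) * b i)" "\<forall>i. v (c i) \<le> 1" unfolding int_span_def by blast
 have "to_ac a * x = (\<Sum>i\<in>I. to_ac (a * c i) * b i)" by (simp add: * sum_distrib_left assoc)
 moreover have "\<forall>i. v (a * c i) \<le> 1" using a * v_mult_le[of a 1 _ 1] by simp
 ultimately show ?thesis unfolding int_span_def by (intro CollectI exI[of _ "\<lambda>i. a * c i"]) simp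
qed

lemma int_span_0: "0 \<in> int_span b I" unfolding int_span_def by (rule CollectI, rule exI[of _ "\<lambda>_. 0"]) simp

lemma int_span_sum: "(\<And>k. k \<in> K ==> f k \<in> int_span b I) ==> (\<Sum>k\<in>K. f k) \<in> int_span b I"
 by (induction K rule: infinite_finite_induct) (auto intro: int_span_add int_span_0)

lemma int_span_base: "finite I ==> i \<in> I ==> b i \<in> int_span b I"
proof -
 assume I: "finite I" "i \<in> I"
 have "b i = (\<Sum>j\<in>I. to_ac (if j = i then 1 else 0) * b j)"
  using I by (simp add: if_distrib[of to_ac] if_distrib[of "\<lambda>c. c * _"] cong: if_cong)
 then show ?thesis unfolding int_span_def by (intro CollectI exI[of _ "\<lambda>j. if j = i then 1 else 0"]) simp
qed

lemma int_span_mult: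
 assumes "\<And>i. i \<in> I ==> x * b i \<in> int_span b I" "y \<in> int_span b I"
 shows "x * y \<in> int_span b I"
proof -
 obtain c where *: "y = (\<Sum>i\<in>I. to_ac (c i) * b i)" "\<forall>i. v (c i) \<le> 1" using assms(2) unfolding int_span_def by blast
 have "x * y = (\<Sum>i\<in>I. to_ac (c i) * (x * b i))" by (simp add: * sum_distrib_left mult_ac)
 also have "\<dots> \<in> int_span b I" using assms(1) * by (intro int_span_sum int_span_scale) auto
 finally show ?thesis .
qed

lemma ac_integers_of_span:
 assumes I: "finite I" "i0 \<in> I" "b i0 ~= 0" and z: "\<And>i. i \<in> I ==> z * b i \<in> int_span b I"
 shows "z \<in> ac_integers v"
proof -
 have "\<forall>i\<in>I. \<exists>c. z * b i = (\<Sum>j\<in>I. to_ac (c j) * b j) \<and> (\<forall>j. v (c j) \<le> 1)" using z unfolding int_span_def by blast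
 then obtain A where "\<forall>i\<in>I. z * b i = (\<Sum>j\<in>I. to_ac (A i j) * b j) \<and> (\<forall>j. v (A i j) \<le> 1)" by metis
 then show ?thesis using ac_integers_of_module[of I i0 b A z] I by blast
qed

lemma ac_integers_degree: 
 assumes "lead_coeff f = 1" "acpoly f x = 0" shows "degree f > 0"
proof (rule ccontr)
 assume "\<not> ?thesis"
 then have "f = [:lead_coeff f:]" by (metis degree_eq_zeroE coeff_pCons_0 not_gr_zero)
 then show False using assms by (metis acpoly_simps(2) one_pCons zero_neq_one)
qed

lemma monic_root_power:
 assumes f: "lead_coeff f = 1" "acpoly f x = 0"
 shows "x ^ degree f = (\<Sum>k<degree f. to_ac (- coeff f k) * x ^ k)"
proof -
 have "0 = (\<Sum>k\<le>degree f. to_ac (coeff f k) * x ^ k)" using f(2) by (simp add: acpoly_altdef)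
 also have "\<dots> = (\<Sum>k<degree f. to_ac (coeff f k) * x ^ k) + x ^ degree f"
  using f(1) by (simp add: lessThan_Suc_atMost[symmetric])
 finally show ?thesis by (simp add: sum_negf eq_neg_iff_add_eq_0 add.commute)
qed

lemma int_span_root_mult:
 assumes f: "lead_coeff f = 1" "coeffs_le 1 f" "acpoly f x = 0"
  and c: "\<And>i. i < degree f ==> x ^ i * c \<in> int_span b I" and i: "i < degree f"
 shows "x * (x ^ i * c) \<in> int_span b I"
proof (cases "Suc i < degree f")
 case True
 then show ?thesis using c[of "Suc i"] by (simp add: assoc)
next
 case False
 then have "degree f = Suc i" using i by simp
 then have "x * (x ^ i * c) = (\<Sum>k<degree f. to_ac (- coeff f k) * x ^ k) * c"
  unfolding monic_root_power[OF f(1,3), symmetric] by (simp add: assoc)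
 also have "\<dots> = (\<Sum>k<degree f. to_ac (- coeff f k) * (x ^ k * c))" by (simp add: sum_distrib_right assoc)
 also have "\<dots> \<in> int_span b I" using f(2) c by (intro int_span_sum int_span_scale) (auto simp: coeffs_le_def)
 finally show ?thesis .
qed

text \<open>Multiplication by \<open>x\<close> and by \<open>y\<close> preserves the module spanned
  by the products \<open>x ^ i * y ^ j\<close> with exponents below the degrees of the two
  equations, so the determinant trick applies to sum, product and difference.\<close>

lemma ac_integers_ring:
 assumes "x \<in> ac_integers v" "y \<in> ac_integers v"
 shows "x + y \<in> ac_integers v" "x * y \<in> ac_integers v" "x - y \<in> ac_integers v"
proof -
 obtain f where f: "lead_coeff f = 1" "coeffs_le 1 f" "acpoly f x = 0" using assms(1) ac_integers_iff by blast
 obtain g where g: "lead_coeff g = 1" "coeffs_le 1 g" "acpoly g y = 0" using assms(2) ac_integers_iff by blast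
 define m n where "m = degree f" and "n = degree g"
 have mn: "m > 0" "n > 0" using ac_integers_degree f g by (auto simp: m_def n_def)
 define I where "I = {..<m} \<times> {..<n}"
 define b where "b = (\<lambda>(i, j). x ^ i * y ^ j)"
 have I: "finite I" "(0, 0) \<in> I" "b (0, 0) ~= 0" using mn by (auto simp: I_def b_def)
 have base: "x ^ i * y ^ j \<in> int_span b I" if "i < m" "j < n" for i j
  using int_span_base[OF I(1), of "(i, j)" b] that by (simp add: I_def b_def)
 have x: "x * b p \<in> int_span b I" if "p \<in> I" for p
  using that base int_span_root_mult[OF f, of "y ^ snd p" b I "fst p"] by (cases p) (auto simp: I_def b_def m_def)
 have y: "y * b p \<in> int_span b I" if "p \<in> I" for p
  using that base int_span_root_mult[OF g, of "x ^ fst p" b I "snd p"]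
  by (cases p) (auto simp: I_def b_def n_def mult.commute)
 show "x + y \<in> ac_integers v"
  using x y by (intro ac_integers_of_span[of I "(0, 0)" b, OF I]) (simp add: distrib_right int_span_add)
 show "x * y \<in> ac_integers v"
  using int_span_mult[of I x b, OF x] y by (intro ac_integers_of_span[of I "(0, 0)" b, OF I]) (simp add: assoc)
 have "to_ac (- 1) * (y * b p) \<in> int_span b I" if "p \<in> I" for p using y[OF that] by (intro int_span_scale) auto
 then show "x - y \<in> ac_integers v"
  using int_span_add[OF x] by (intro ac_integers_of_span[of I "(0, 0)" b, OF I]) (simp add: left_diff_distrib, metis add_uminus_conv_diff)
qed

lemma to_ac_integer: "v a \<le> 1 ==> to_ac a \<in> ac_integers v"
proof (rule ac_integersI[of "[:- a, 1:]"])
 assume "v a \<le> 1"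
 then have "coeffs_le 1 (monom 1 1 + [:- a:])" by (intro coeffs_le_add coeffs_le_monom coeffs_le_const) auto
 then show "coeffs_le 1 [:- a, 1:]" by (simp add: monom_Suc monom_0)
qed simp_all

lemma ac_integers_0: "0 \<in> ac_integers v" and ac_integers_1: "1 \<in> ac_integers v"
 using to_ac_integer[of 0] to_ac_integer[of 1] by simp_all

lemma ac_integers_power: "x \<in> ac_integers v ==> x ^ n \<in> ac_integers v"
 by (induction n) (auto intro: ac_integers_ring ac_integers_1)

lemma ac_integers_sum: "(\<And>i. i \<in> I ==> f i \<in> ac_integers v) ==> (\<Sum>i\<in>I. f i) \<in> ac_integers v"
 by (induction I rule: infinite_finite_induct) (auto intro: ac_integers_ring ac_integers_0)

lemma ac_integers_acpoly: "x \<in> ac_integers v ==> coeffs_le 1 p ==> acpoly p x \<in> ac_integers v"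
 unfolding acpoly_altdef coeffs_le_def
 by (intro ac_integers_sum ac_integers_ring(2) to_ac_integer ac_integers_power) auto

section \<open>The integral closure is a local ring\<close>

definition uniformizer :: 'f where
 "uniformizer = (SOME \<pi>. 0 < v \<pi> \<and> v \<pi> < 1 \<and> (\<forall>x. v x < 1 --> v x \<le> v \<pi>))"

lemma uniformizer: "0 < v uniformizer" "v uniformizer < 1" "v x < 1 ==> v x \<le> v uniformizer"
 using someI_ex[OF v_uniformizer] unfolding uniformizer_def by blast+

text \<open>Substituting \<open>z = (u - 1) / (\<pi> u)\<close> into a monic equation \<open>g\<close> for \<open>z\<close> and clearing denominators gives
 an equation \<open>h\<close> for \<open>u = 1 / (1 - \<pi> z)\<close> whose leading coefficient is congruent to \<open>1\<close> modulo \<open>\<pi>\<close>.\<close>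

lemma one_minus_uniformizer_unit:
 assumes z: "z \<in> ac_integers v"
 shows "1 - to_ac uniformizer * z ~= 0" "inverse (1 - to_ac uniformizer * z) \<in> ac_integers v"
proof -
 define \<pi> where "\<pi> = uniformizer"
 have pi: "\<pi> ~= 0" "v \<pi> < 1" using uniformizer v_zero_iff by (auto simp: \<pi>_def)
 obtain g where g: "lead_coeff g = 1" "coeffs_le 1 g" "acpoly g z = 0" using z ac_integers_iff by blast
 define n where "n = degree g"
 \<comment> \<open>The coefficients of the monic polynomial with root \<open>\<pi> z\<close>
   obtained by scaling \<open>g\<close>; below the top degree all of them are divisible by
   \<open>\<pi>\<close>.\<close>
 define b where "b i = coeff g i * \<pi> ^ (n - i)" for i
 define c where "c = (\<Sum>i\<le>n. b i)"
 have b1: "v (b i) \<le> 1" for i using g(2) v_mult_le[of "coeff g i" 1 "\<pi> ^ (n - i)" 1] pi v_nonneg[of \<pi>]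
  by (simp add: b_def coeffs_le_def v_power power_le_one)
 have "v (b i) \<le> v \<pi>" if "i < n" for i
 proof -
  have "v (\<pi> ^ (n - i)) \<le> v \<pi> ^ 1" using that pi v_nonneg[of \<pi>] unfolding v_power by (intro power_decreasing) auto
  then show ?thesis using g(2) v_mult_le[of "coeff g i" 1 "\<pi> ^ (n - i)"] by (simp add: b_def coeffs_le_def)
 qed
 then have "v (\<Sum>i<n. b i) \<le> v \<pi>" using v_nonneg by (intro v_sum_le) auto
 moreover have "c = (\<Sum>i<n. b i) + 1" using g(1) by (simp add: c_def b_def n_def flip: lessThan_Suc_atMost)
 ultimately have c: "v c = 1" using v_ultrametric[of c "- (\<Sum>i<n. b i)"] v_add_le[of "\<Sum>i<n. b i" 1 1] pi by force
 have sum: "(\<Sum>i\<le>n. to_ac (b i) * (to_ac \<pi> * z) ^ i) = 0"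
 proof -
  have "to_ac (b i) * (to_ac \<pi> * z) ^ i = to_ac (\<pi> ^ n) * (to_ac (coeff g i) * z ^ i)" if "i \<le> n" for i
  proof -
   have "to_ac \<pi> ^ (n - i) * to_ac \<pi> ^ i = to_ac \<pi> ^ n" using that by (simp flip: power_add)
   then show ?thesis by (simp add: b_def power_mult_distrib mult_ac)
  qed
  then have "(\<Sum>i\<le>n. to_ac (b i) * (to_ac \<pi> * z) ^ i) = to_ac (\<pi> ^ n) * acpoly g z"
   by (simp add: acpoly_altdef sum_distrib_left n_def)
  then show ?thesis using g(3) by simp
 qed
 have nz: "1 - to_ac \<pi> * z ~= 0"
 proof
  assume "1 - to_ac \<pi> * z = 0"
  then have "to_ac c = 0" using sum by (simp add: c_def to_ac_hom.hom_sum)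
  then show False using c by simp
 qed
 define u where "u = inverse (1 - to_ac \<pi> * z)"
 have u: "u - 1 = u * (to_ac \<pi> * z)" using nz by (simp add: u_def field_simps)
 \<comment> \<open>Homogenizing in \<open>u - 1\<close> and \<open>u\<close> makes every
   \<open>m i\<close> monic of degree \<open>n\<close>, so the leading coefficient of
   \<open>h\<close> is \<open>c\<close>, the sum of the \<open>b i\<close>.\<close>
 define m where "m i = [:- 1, 1 :: 'f:] ^ i * [:0, 1:] ^ (n - i)" for i
 define h where "h = (\<Sum>i\<le>n. smult (b i) (m i))"
 have m: "degree (m i) = n" "coeff (m i) n = 1" "coeffs_le 1 (m i)" if "i \<le> n" for i
 proof -
  show d: "degree (m i) = n" using that by (simp add: m_def degree_mult_eq degree_power_eq)
  have "lead_coeff (m i) = 1" by (simp add: m_def lead_coeff_mult lead_coeff_power)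
  then show "coeff (m i) n = 1" by (simp only: d)
  show "coeffs_le 1 (m i)" unfolding m_def
   by (intro coeffs_le_mult1 coeffs_le_power coeffs_le_pCons coeffs_le_0) auto
 qed
 have hc: "coeff h n = c" using m(2) by (simp add: h_def coeff_sum c_def)
 have "degree h \<le> n" unfolding h_def using m(1) by (intro degree_sum_le) auto
 then have dh: "degree h = n" using c hc by (intro antisym le_degree) auto
 have "coeffs_le 1 h" unfolding h_def
  using m(3) b1 coeffs_le_mult1[OF coeffs_le_const] by (intro coeffs_le_sum) fastforce+
 moreover have "acpoly h u = 0"
 proof -
  have "acpoly h u = (\<Sum>i\<le>n. u ^ n * (to_ac (b i) * (to_ac \<pi> * z) ^ i))" unfolding h_def acpoly_sum
  proof (intro sum.cong refl)
   fix i assume "i \<in> {..n}"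
   then have "u ^ n = u ^ i * u ^ (n - i)" by (simp flip: power_add)
   moreover have "acpoly (m i) u = (u - 1) ^ i * u ^ (n - i)" by (simp add: m_def)
   ultimately show "acpoly (smult (b i) (m i)) u = u ^ n * (to_ac (b i) * (to_ac \<pi> * z) ^ i)"
    by (simp add: u power_mult_distrib mult_ac)
  qed
  then show ?thesis by (simp add: sum flip: sum_distrib_left)
 qed
 moreover have "v (inverse c) = 1" using c v_mult[of c "inverse c"] v_zero_iff[of c] by auto
 ultimately have "u \<in> ac_integers v"
  using c dh hc by (intro ac_integersI[of "smult (inverse c) h"]) (auto simp: coeffs_le_def v_mult)
 then show "1 - to_ac uniformizer * z ~= 0" "inverse (1 - to_ac uniformizer * z) \<in> ac_integers v"
  using nz by (simp_all add: \<pi>_def u_def)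
qed

text \<open>One Newton step squares the defect \<open>e * e - e\<close> up to an integral
  factor.\<close>

lemma newton_identity:
 fixes e :: "'b::comm_ring_1"
 shows "(3 * e * e - 2 * e * e * e) * (3 * e * e - 2 * e * e * e) - (3 * e * e - 2 * e * e * e)
  = (e * e - e) * (e * e - e) * (4 * (e * e - e) - 3)"
 by (simp add: left_diff_distrib right_diff_distrib distrib_left distrib_right mult_ac)

lemma acpoly_mod: "acpoly f x = 0 ==> acpoly (p mod f) x = acpoly p x"
 using acpoly_simps(4)[of "f * (p div f)" "p mod f" x] by (simp add: mult.commute)

text \<open>Pigeonhole: a remainder modulo \<open>f\<close> has \<open>degree f\<close>
  coefficients, and each has finitely many residue classes. As the value group is discrete, a
  difference of size below \<open>1\<close> has at most the size of the uniformizer.\<close>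

lemma power_congruence_mod_uniformizer:
 assumes f: "lead_coeff f = 1" "coeffs_le 1 f" "degree f > 0"
 obtains a b where "a < b"
  "coeffs_le (v uniformizer) ((monom 1 a - monom 1 b) mod f)"
proof -
 define n where "n = degree f"
 define r where "r = {(x, y). v x \<le> 1 \<and> v y \<le> 1 \<and> v (x - y) < 1}"
 define p where "p a = monom 1 a mod f" for a
 define c where "c a = restrict (\<lambda>i. r `` {coeff (p a) i}) {..<n}" for a
 have p1: "coeffs_le 1 (p a)" for a unfolding p_def by (intro coeffs_le_mod f coeffs_le_monom) simp
 have "range c \<subseteq> PiE {..<n} (\<lambda>_. {x. v x \<le> 1} // r)" using p1 by (auto simp: c_def coeffs_le_def intro!: quotientI)
 moreover have "finite (PiE {..<n} (\<lambda>_. {x. v x \<le> 1} // r))"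
  using finite_residue_field by (intro finite_PiE) (auto simp: r_def)
 ultimately have "finite (range c)" by (rule finite_subset)
 then have "\<not> inj c" by (metis finite_imageD infinite_UNIV_nat)
 then obtain a b where ab: "a < b" "c a = c b" unfolding inj_def by (metis nat_neq_iff)
 have lt: "v (coeff (p a) i - coeff (p b) i) < 1" if "i < n" for i
 proof -
  have "r `` {coeff (p a) i} = r `` {coeff (p b) i}" using fun_cong[OF ab(2), of i] that by (simp add: c_def)
  moreover have "coeff (p b) i \<in> r `` {coeff (p b) i}" using p1[of b] by (simp add: r_def coeffs_le_def)
  ultimately have "coeff (p b) i \<in> r `` {coeff (p a) i}" by (simp only:)
  then show ?thesis by (simp add: r_def)
 qed
 have "f ~= 0" using f(1) by auto
 then have deg: "coeff (p a) i = 0" if "n \<le> i" for a i using that coeff_mod_eq_0 by (simp add: p_def n_def)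
 have "coeffs_le (v uniformizer) (p a - p b)" unfolding coeffs_le_def
 proof
  fix i
  show "v (coeff (p a - p b) i) \<le> v uniformizer"
   using uniformizer(3)[OF lt[of i]] deg[of i] v_nonneg by (cases "i < n") auto
 qed
 moreover have "p a - p b = (monom 1 a - monom 1 b) mod f" by (simp add: p_def poly_mod_diff_left)
 ultimately show thesis using that ab(1) by simp
qed

text \<open>Idempotents lift from the reduction modulo the uniformizer by Newton's iteration
 \<open>e \<mapsto> 3 e\<^sup>2 - 2 e\<^sup>3\<close>.\<close>

lemma lift_idempotent:
 assumes f: "lead_coeff f = 1" "coeffs_le 1 f" "degree f > 0"
  and y: "coeffs_le 1 y" "coeffs_le (v uniformizer) ((y * y - y) mod f)"
 obtains e where "coeffs_le 1 e" "f dvd e * e - e" "coeffs_le (v uniformizer) (e - y mod f)"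
proof -
 define q where "q = v uniformizer"
 have q: "0 < q" "q < 1" using uniformizer by (auto simp: q_def)
 define n where "n = degree f"
 have "f ~= 0" using f(1) by auto
 then have deg: "coeff (p mod f) i = 0" if "n \<le> i" for p i using that coeff_mod_eq_0 by (simp add: n_def)
 define E where "E j = ((\<lambda>e. (3 * e * e - 2 * e * e * e) mod f) ^^ j) (y mod f)" for j
 have E0: "E 0 = y mod f" and ES: "E (Suc j) = (3 * E j * E j - 2 * E j * E j * E j) mod f" for j
  by (simp_all add: E_def)
 have Emod: "E j mod f = E j" for j by (cases j) (simp_all add: E0 ES)
 have E1: "coeffs_le 1 (E j)" for j
 proof (induction j)
  case (Suc j)
  then show ?case unfolding ES by (intro coeffs_le_mod f coeffs_le_diff coeffs_le_mult1 coeffs_le_numeral)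
 qed (use y f in \<open>auto simp: E0 intro!: coeffs_le_mod\<close>)
 define D where "D j = (E j * E j - E j) mod f" for j
 \<comment> \<open>The defect in fact decreases quadratically; the geometric rate recorded here is
   enough for convergence.\<close>
 have Dq: "coeffs_le (q ^ Suc j) (D j)" for j
 proof (induction j)
  case 0
  have "D 0 = (y * y - y) mod f" unfolding D_def E0 by (rule mod_diff_cong) (simp_all add: mod_mult_eq)
  then show ?case using y by (simp add: q_def)
 next
  case (Suc j)
  define e where "e = E j"
  define w where "w = 3 * e * e - 2 * e * e * e"
  have id: "w * w - w = (e * e - e) * (e * e - e) * (4 * (e * e - e) - 3)" unfolding w_def by (rule newton_identity)
  have "D (Suc j) = (w * w - w) mod f"
   unfolding D_def ES w_def e_def by (rule mod_diff_cong) (simp_all add: mod_mult_eq)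
  also have "\<dots> = (D j * (D j * (4 * (e * e - e) - 3))) mod f"
   unfolding id D_def e_def assoc by (rule mod_mult_cong) (simp_all add: mod_mult_left_eq)
  finally have DS: "D (Suc j) = (D j * (D j * (4 * (e * e - e) - 3))) mod f" .
  have "coeffs_le 1 (4 * (e * e - e) - 3)"
   using E1[of j] by (intro coeffs_le_diff coeffs_le_mult1 coeffs_le_numeral) (auto simp: e_def)
  then have "coeffs_le (q ^ Suc j * q ^ Suc j) (D j * (D j * (4 * (e * e - e) - 3)))"
   using Suc.IH by (intro coeffs_le_mult coeffs_le_mult1) auto
  then have "coeffs_le (q ^ Suc j * q ^ Suc j) (D (Suc j))" unfolding DS by (intro coeffs_le_mod f)
  moreover have "q ^ Suc j * q ^ Suc j \<le> q ^ Suc (Suc j)"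
   using q unfolding power_add[symmetric] by (intro power_decreasing) auto
  ultimately show ?case by (rule coeffs_le_mono)
 qed
 have step: "coeffs_le (q ^ Suc j) (E (Suc j) - E j)" for j
 proof -
  have "E (Suc j) - E j = ((3 * E j * E j - 2 * E j * E j * E j) - E j) mod f"
   unfolding ES by (metis Emod mod_diff_left_eq poly_mod_diff_left)
  also have "(3 * E j * E j - 2 * E j * E j * E j) - E j = (E j * E j - E j) * (1 - 2 * E j)"
   by (simp add: algebra_simps)
  also have "\<dots> mod f = (D j * (1 - 2 * E j)) mod f" unfolding D_def by (metis mod_mult_left_eq)
  finally have eq: "E (Suc j) - E j = (D j * (1 - 2 * E j)) mod f" .
  have "coeffs_le 1 (1 - (E j + E j))" using E1 by (intro coeffs_le_diff coeffs_le_add coeffs_le_1)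
  then have "coeffs_le 1 (1 - 2 * E j)" by simp
  then show ?thesis unfolding eq using Dq by (intro coeffs_le_mod f coeffs_le_mult1)
 qed
 have cauchy: "coeffs_le (q ^ Suc j) (E (j + k) - E j)" for j k
 proof (induction k)
  case (Suc k)
  have "coeffs_le (q ^ Suc j) (E (Suc (j + k)) - E (j + k))"
   by (rule coeffs_le_mono[OF step]) (use q in \<open>intro power_decreasing, auto\<close>)
  from coeffs_le_add[OF this Suc.IH] show ?case by simp
 qed (use q in \<open>simp add: coeffs_le_0\<close>)
 have small: "\<exists>M. q ^ Suc M < c" if c: "c > 0" for c :: real
 proof -
  obtain M where "q ^ M < c" using real_arch_pow_inv[of c q] c q by auto
  moreover have "q ^ Suc M \<le> q ^ M" using q by (intro power_decreasing) auto
  ultimately show ?thesis by (intro exI[of _ M]) linarith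
 qed
 have "\<exists>L. \<forall>c>0. \<exists>M. \<forall>m\<ge>M. v (coeff (E m) i - L) < c" for i
 proof (rule v_complete, intro allI impI)
  fix c :: real assume "c > 0"
  then obtain M where M: "q ^ Suc M < c" using small by blast
  have le: "v (coeff (E m) i - coeff (E M) i) \<le> q ^ Suc M" if "m \<ge> M" for m
   using cauchy[of M "m - M"] that by (simp add: coeffs_le_def)
  have "v (coeff (E m) i - coeff (E k) i) < c" if "m \<ge> M" "k \<ge> M" for m k
   using v_diff_le[OF le[OF that(1)] le[OF that(2)]] M by simp
  then show "\<exists>M. \<forall>m\<ge>M. \<forall>k\<ge>M. v (coeff (E m) i - coeff (E k) i) < c" by blast
 qed
 then obtain L where L: "\<And>i c. c > 0 ==> \<exists>M. \<forall>m\<ge>M. v (coeff (E m) i - L i) < c" by metis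
 define e where "e = (\<Sum>i<n. monom (L i) i)"
 have ce: "coeff e i = (if i < n then L i else 0)" for i by (simp add: e_def coeff_sum coeff_monom)
 have lim: "coeffs_le (q ^ Suc j) (e - E j)" for j unfolding coeffs_le_def
 proof
  fix i
  show "v (coeff (e - E j) i) \<le> q ^ Suc j"
  proof (cases "i < n")
   case False
   then have "coeff (E j) i = 0" using deg[of i "E j"] Emod by simp
   then show ?thesis using False q by (simp add: ce)
  next
   case True
   obtain M where M: "\<forall>m\<ge>M. v (coeff (E m) i - L i) < q ^ Suc j" using L[of "q ^ Suc j" i] q by auto
   have "v (coeff (E (j + M)) i - L i) \<le> q ^ Suc j" using M by (simp add: less_imp_le)
   moreover have "v (coeff (E (j + M)) i - coeff (E j) i) \<le> q ^ Suc j"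
    using cauchy[of j M] by (simp add: coeffs_le_def)
   ultimately show ?thesis using v_diff_le[of _ "q ^ Suc j"] True by (fastforce simp: ce)
  qed
 qed
 have e1: "coeffs_le 1 e" using coeffs_le_add[OF coeffs_le_mono[OF lim[of 0], of 1] E1[of 0]] q by simp
 show thesis
 proof (rule that[OF e1])
  show "coeffs_le (v uniformizer) (e - y mod f)" using lim[of 0] by (simp add: E0 q_def)
  have "coeffs_le (q ^ Suc j) ((e * e - e) mod f)" for j
  proof -
   have "e * e - e = (E j * E j - E j) + (e - E j) * (e + E j - 1)" by (simp add: algebra_simps)
   then have "(e * e - e) mod f = D j + ((e - E j) * (e + E j - 1)) mod f" by (simp add: D_def poly_mod_add_left)
   moreover have "coeffs_le (q ^ Suc j) (((e - E j) * (e + E j - 1)) mod f)"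
    by (intro coeffs_le_mod f coeffs_le_mult1 lim coeffs_le_diff coeffs_le_add e1 E1 coeffs_le_1)
   ultimately show ?thesis using coeffs_le_add[OF Dq] by simp
  qed
  then have le: "v (coeff ((e * e - e) mod f) i) \<le> q ^ Suc j" for i j by (simp add: coeffs_le_def)
  have "coeff ((e * e - e) mod f) i = 0" for i
  proof (rule ccontr)
   assume "coeff ((e * e - e) mod f) i ~= 0"
   then have "v (coeff ((e * e - e) mod f) i) > 0" using v_nonneg v_zero_iff by (metis less_eq_real_def)
   then show False using small le by (meson not_less)
  qed
  then have "(e * e - e) mod f = 0" by (intro poly_eqI) simp
  then show "f dvd e * e - e" by (simp add: mod_eq_0_iff_dvd)
 qed
qed

lemma uniformizer_dvd:
 assumes "coeffs_le (v uniformizer) p" "x \<in> ac_integers v"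
 obtains z where "z \<in> ac_integers v" "acpoly p x = to_ac uniformizer * z"
proof -
 have u: "uniformizer ~= 0" using uniformizer v_zero_iff by force
 define p' where "p' = smult (inverse uniformizer) p"
 have "v (inverse uniformizer) * v uniformizer = 1" using u by (simp flip: v_mult)
 then have "coeffs_le 1 p'" using assms(1) v_nonneg unfolding coeffs_le_def p'_def coeff_smult v_mult
  by (metis mult_left_mono)
 moreover have "p = smult uniformizer p'" using u by (simp add: p'_def)
 then have "acpoly p x = to_ac uniformizer * acpoly p' x" by (metis acpoly_simps(5))
 ultimately show thesis using that ac_integers_acpoly[OF assms(2)] by blast
qed

text \<open>Some power \<open>x ^ M\<close> is idempotent modulo the uniformizer, as the residue algebra of \<open>f\<close> is finite.
 Its lift is \<open>0\<close> or \<open>1\<close>, so \<open>x ^ M\<close> or \<open>1 - x ^ M\<close> is congruent to \<open>1\<close>.\<close>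

lemma ac_integers_local:
 assumes x: "x \<in> ac_integers v"
 shows "(x ~= 0 \<and> inverse x \<in> ac_integers v) \<or> (1 - x ~= 0 \<and> inverse (1 - x) \<in> ac_integers v)"
proof -
 obtain f where f: "lead_coeff f = 1" "coeffs_le 1 f" "acpoly f x = 0" using x ac_integers_iff by blast
 have df: "degree f > 0" using ac_integers_degree f by blast
 obtain a b where ab: "a < b" "coeffs_le (v uniformizer) ((monom 1 a - monom 1 b) mod f)"
  using power_congruence_mod_uniformizer[OF f(1,2) df] .
 define d where "d = b - a"
 \<comment> \<open>A multiple of the period \<open>d\<close> that is at least the preperiod
   \<open>a\<close>: then \<open>t ^ M\<close> and its square agree modulo \<open>f\<close> and the
   uniformizer.\<close>
 define M where "M = d * (a + 1)"
 have "d > 0" using ab by (simp add: d_def)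
 moreover from this have "1 * (a + 1) \<le> d * (a + 1)" by (intro mult_le_mono1) simp
 ultimately have d: "d > 0" "M > 0" "a \<le> M" by (simp_all add: M_def)
 define t :: "'f poly" where "t = [:0, 1:]"
 have t1: "coeffs_le 1 t" by (auto simp: t_def intro!: coeffs_le_pCons coeffs_le_0)
 have monom: "monom 1 k = t ^ k" for k by (simp add: t_def monom_altdef)
 have "t ^ M * t ^ M - t ^ M = (t ^ a - t ^ b) * (- (t ^ (M - a) * (\<Sum>i<a+1. (t ^ d) ^ i)))"
 proof -
  define w where "w = (\<Sum>i<a+1. (t ^ d) ^ i)"
  have 1: "1 - t ^ M = (1 - t ^ d) * w" unfolding M_def power_mult w_def by (rule one_diff_power_eq)
  have 2: "t ^ M = t ^ a * t ^ (M - a)" using d by (simp flip: power_add)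
  have "t ^ M * t ^ M - t ^ M = - (t ^ M * (1 - t ^ M))" by (simp add: right_diff_distrib)
  also have "t ^ M * (1 - t ^ M) = (t ^ a * t ^ (M - a)) * ((1 - t ^ d) * w)" by (rule arg_cong2[OF 2 1])
  also have "- \<dots> = (t ^ a - t ^ a * t ^ d) * (- (t ^ (M - a) * w))" by (simp add: algebra_simps)
  also have "t ^ a * t ^ d = t ^ b" using ab by (simp add: d_def flip: power_add)
  finally show ?thesis by (simp only: w_def)
 qed
 then have "(t ^ M * t ^ M - t ^ M) mod f
   = (((t ^ a - t ^ b) mod f) * (- (t ^ (M - a) * (\<Sum>i<a+1. (t ^ d) ^ i)))) mod f"
  by (simp only: mod_mult_left_eq)
 moreover have "coeffs_le (v uniformizer) \<dots>"
 proof (rule coeffs_le_mod[OF f(1,2)], rule coeffs_le_mult1)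
  show "coeffs_le (v uniformizer) ((t ^ a - t ^ b) mod f)" using ab(2) by (simp add: monom)
  show "coeffs_le 1 (- (t ^ (M - a) * (\<Sum>i<a+1. (t ^ d) ^ i)))"
   using t1 by (intro coeffs_le_mult1 coeffs_le_minus coeffs_le_power coeffs_le_sum) auto
 qed
 ultimately have "coeffs_le (v uniformizer) ((t ^ M * t ^ M - t ^ M) mod f)" by simp
 from lift_idempotent[OF f(1,2) df coeffs_le_power[OF t1] this]
 obtain e where e: "coeffs_le 1 e" "f dvd e * e - e" "coeffs_le (v uniformizer) (e - t ^ M mod f)" .
 define y where "y = acpoly e x"
 obtain k where k: "e * e - e = f * k" using e(2) by (rule dvdE)
 have "acpoly (e * e - e) x = 0" unfolding k using f(3) by simp
 then have "y * (y - 1) = 0" by (simp add: y_def algebra_simps)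
 then have y01: "y = 0 \<or> y = 1" by simp
 obtain z where z: "z \<in> ac_integers v" "acpoly (e - t ^ M mod f) x = to_ac uniformizer * z"
  using uniformizer_dvd[OF e(3) x] .
 have "acpoly t x = x" by (simp add: t_def)
 then have yz: "y - x ^ M = to_ac uniformizer * z" using z(2) f(3) by (simp add: acpoly_mod y_def)
 from y01 show ?thesis
 proof
  assume "y = 1"
  then have xM: "x ^ M = 1 - to_ac uniformizer * z" using yz by (simp add: algebra_simps)
  then have nz: "x ^ M ~= 0" "inverse (x ^ M) \<in> ac_integers v" using one_minus_uniformizer_unit[OF z(1)] by auto
  then have "x ~= 0" using d by auto
  moreover have "inverse x = x ^ (M - 1) * inverse (x ^ M)" using d \<open>x ~= 0\<close> by (cases M) (simp_all add: field_simps)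
  ultimately show ?thesis using ac_integers_ring(2) ac_integers_power x nz by metis
 next
  assume "y = 0"
  define s where "s = (\<Sum>i<M. x ^ i)"
  have s: "s \<in> ac_integers v" unfolding s_def by (intro ac_integers_sum ac_integers_power x)
  have "- z \<in> ac_integers v" using ac_integers_ring(3)[OF ac_integers_0 z(1)] by simp
  note u = one_minus_uniformizer_unit[OF this]
  have "(1 - x) * s = 1 - x ^ M" unfolding s_def by (rule one_diff_power_eq[symmetric])
  also have "x ^ M = to_ac uniformizer * (- z)" using yz \<open>y = 0\<close> by (simp flip: yz)
  finally have xs: "(1 - x) * s = 1 - to_ac uniformizer * (- z)" .
  then have "(1 - x) ~= 0" "s ~= 0" using u(1) by auto
  then have "inverse (1 - x) = s * inverse (1 - to_ac uniformizer * (- z))" unfolding xs[symmetric] by simp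
  then show ?thesis using ac_integers_ring(2)[OF s u(2)] \<open>1 - x ~= 0\<close> by simp
 qed
qed

section \<open>Residue congruences and Frobenius exponents\<close>

lemma ac_maximal_ideal_iff: "x \<in> ac_maximal_ideal v \<longleftrightarrow> x \<in> ac_integers v \<and> (x = 0 \<or> inverse x \<notin> ac_integers v)"
 by (simp add: ac_maximal_ideal_def)

lemma ac_maximal_ideal_mult:
 assumes "x \<in> ac_maximal_ideal v" "y \<in> ac_integers v" shows "x * y \<in> ac_maximal_ideal v"
proof -
 have x: "x \<in> ac_integers v" "x = 0 \<or> inverse x \<notin> ac_integers v" using assms by (auto simp: ac_maximal_ideal_iff)
 have "inverse (x * y) \<notin> ac_integers v" if "x * y ~= 0"
 proof
  assume *: "inverse (x * y) \<in> ac_integers v"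
  have eq: "inverse x = inverse (x * y) * y" using that by simp
  have "inverse x \<in> ac_integers v" unfolding eq by (rule ac_integers_ring(2)[OF * assms(2)])
  then show False using x that by auto
 qed
 then show ?thesis using x ac_integers_ring(2)[OF x(1) assms(2)] by (auto simp: ac_maximal_ideal_iff)
qed

text \<open>If \<open>x + y\<close> were a unit, dividing by it would write \<open>1\<close> as a
  sum of two nonunits, which locality forbids.\<close>

lemma ac_maximal_ideal_add:
 assumes "x \<in> ac_maximal_ideal v" "y \<in> ac_maximal_ideal v" shows "x + y \<in> ac_maximal_ideal v"
proof (rule ccontr)
 assume *: "x + y \<notin> ac_maximal_ideal v"
 have xy: "x \<in> ac_integers v" "y \<in> ac_integers v" using assms by (auto simp: ac_maximal_ideal_iff)
 then have u: "x + y ~= 0" "inverse (x + y) \<in> ac_integers v"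
  using * ac_integers_ring(1) by (auto simp: ac_maximal_ideal_iff)
 have a: "x * inverse (x + y) \<in> ac_maximal_ideal v" "y * inverse (x + y) \<in> ac_maximal_ideal v"
  using assms u ac_maximal_ideal_mult by blast+
 have "1 - x * inverse (x + y) = y * inverse (x + y)" using u(1) by (simp add: field_simps)
 then show False using a ac_integers_local[of "x * inverse (x + y)"] by (simp only: ac_maximal_ideal_iff) metis
qed

definition ac_cong :: "'f alg_closure => 'f alg_closure => bool" where
 "ac_cong x y \<longleftrightarrow> x \<in> ac_integers v \<and> y \<in> ac_integers v \<and> x - y \<in> ac_maximal_ideal v"

lemma ac_cong_trans: "ac_cong x y ==> ac_cong y z ==> ac_cong x z"
 unfolding ac_cong_def using ac_maximal_ideal_add[of "x - y" "y - z"] by simp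

lemma ac_cong_power: assumes "ac_cong x y" shows "ac_cong (x ^ n) (y ^ n)"
proof -
 have xy: "x \<in> ac_integers v" "y \<in> ac_integers v" "x - y \<in> ac_maximal_ideal v"
  using assms by (auto simp: ac_cong_def)
 have "(\<Sum>i<n. y ^ (n - Suc i) * x ^ i) \<in> ac_integers v"
  using xy by (intro ac_integers_sum ac_integers_ring(2) ac_integers_power)
 then have "x ^ n - y ^ n \<in> ac_maximal_ideal v" unfolding power_diff_sumr2 using xy ac_maximal_ideal_mult by blast
 then show ?thesis using xy by (simp add: ac_cong_def ac_integers_power)
qed

lemma galois_map_poly:
 assumes "\<sigma> \<in> galois_automorphisms" shows "acpoly p (\<sigma> x) = \<sigma> (acpoly p x)"
proof -
 have s: "\<sigma> (x + y) = \<sigma> x + \<sigma> y" "\<sigma> (x * y) = \<sigma> x * \<sigma> y" "\<sigma> (to_ac a) = to_ac a" for x y a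
  using assms by (auto simp: galois_automorphisms_def)
 have "\<sigma> 0 = 0" using s(3)[of 0] by simp
 then show ?thesis by (induction p) (simp_all add: s)
qed

lemma galois_integer:
 assumes s: "\<sigma> \<in> galois_automorphisms" and x: "x \<in> ac_integers v" shows "\<sigma> x \<in> ac_integers v"
proof -
 obtain f where f: "lead_coeff f = 1" "coeffs_le 1 f" "acpoly f x = 0" using x ac_integers_iff by blast
 have "\<sigma> (to_ac 0) = to_ac 0" using s unfolding galois_automorphisms_def by blast
 then have "acpoly f (\<sigma> x) = 0" using galois_map_poly[OF s, of f x] f(3) by simp
 then show ?thesis using f ac_integersI by blast
qed

lemma id_weil_group: "id \<in> carrier (weil_group v)"
proof -
 have "frobenius_degree v id 0" using ac_integers_0 by (simp add: frobenius_degree_def ac_maximal_ideal_iff)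
 then show ?thesis by (auto simp: weil_group_def galois_automorphisms_def)
qed

text \<open>Congruences can be raised to powers and chained, so \<open>w ^^ m\<close> has Frobenius
  exponent \<open>m * k\<close>. Chaining needs nonunits to be closed under addition, which is where
  locality enters.\<close>

lemma weil_group_power:
 assumes w: "w \<in> carrier (weil_group v)" shows "w ^^ m \<in> carrier (weil_group v)"
proof -
 obtain k where wg: "w \<in> galois_automorphisms" and k: "frobenius_degree v w k" using w by (auto simp: weil_group_def)
 have "bij (w ^^ m)" for m
  using wg by (induction m) (auto simp: galois_automorphisms_def simp del: o_apply intro: bij_comp)
 moreover have "(w ^^ m) (x + y) = (w ^^ m) x + (w ^^ m) y" "(w ^^ m) (x * y) = (w ^^ m) x * (w ^^ m) y"
  "(w ^^ m) (to_ac a) = to_ac a" for m x y a using wg by (induction m) (auto simp: galois_automorphisms_def)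
 ultimately have gm: "w ^^ m \<in> galois_automorphisms" for m by (simp add: galois_automorphisms_def)
 \<comment> \<open>At least one of these is \<open>1\<close>; keeping both treats positive and
   negative \<open>k\<close> at once.\<close>
 define a b where "a = residue_card v ^ nat (- k)" and "b = residue_card v ^ nat k"
 have "ac_cong ((w ^^ m) x ^ (a ^ m)) (x ^ (b ^ m))" if "x \<in> ac_integers v" for x using that
 proof (induction m arbitrary: x)
  case 0
  then show ?case using ac_integers_0 by (simp add: ac_cong_def ac_maximal_ideal_iff)
 next
  case (Suc m)
  have wx: "w x \<in> ac_integers v" using galois_integer[OF wg Suc.prems] .
  then have "ac_cong ((w x) ^ a) (x ^ b)"
   using k Suc.prems ac_integers_power by (auto simp: frobenius_degree_def ac_cong_def a_def b_def)
  then have "ac_cong (((w x) ^ a) ^ (b ^ m)) ((x ^ b) ^ (b ^ m))" by (rule ac_cong_power)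
  moreover have "ac_cong ((((w ^^ m) (w x)) ^ (a ^ m)) ^ a) (((w x) ^ (b ^ m)) ^ a)"
   using Suc.IH[OF wx] by (rule ac_cong_power)
  ultimately show ?case using ac_cong_trans by (simp add: funpow_swap1 mult.commute flip: power_mult)
 qed
 moreover have "a ^ m = residue_card v ^ nat (- (int m * k))" "b ^ m = residue_card v ^ nat (int m * k)"
  using nat_mult_distrib[of "int m" "- k"] nat_mult_distrib[of "int m" k]
  by (simp_all add: a_def b_def mult.commute flip: power_mult)
 ultimately have "frobenius_degree v (w ^^ m) (int m * k)" by (simp add: frobenius_degree_def ac_cong_def)
 then show ?thesis using gm by (auto simp: weil_group_def)
qed

lemma residue_card_pos: "residue_card v > 0"
proof -
 define r where "r = {(x, y). v x \<le> 1 \<and> v y \<le> 1 \<and> v (x - y) < 1}"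
 have "r `` {0} \<in> {x. v x \<le> 1} // r" by (intro quotientI) simp
 then have "{x. v x \<le> 1} // r ~= {}" by (metis empty_iff)
 moreover have "finite ({x. v x \<le> 1} // r)" unfolding r_def by (rule finite_residue_field)
 ultimately show ?thesis unfolding residue_card_def r_def[symmetric] card_gt_0_iff by blast
qed

lemma weil_norm_pos: "weil_norm v w > 0" using residue_card_pos by (simp add: weil_norm_def)

end


section \<open>A ring of infinite matrices\<close>

text \<open>Matrices of all sizes are embedded in one ring of row- and column-finite infinite matrices,
 so that the simplifier's ring theory and finite sums apply without dimension side conditions.
 Square matrices of size \<open>n\<close> form the corner with unit \<open>idm n\<close>.\<close>

typedef imat = "{A :: nat => nat => complex.
  (\<forall>i. finite {j. A i j ~= 0}) \<and> (\<forall>j. finite {i. A i j ~= 0})}"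
 morphisms ent Imat by (rule exI[of _ "\<lambda>_ _. 0"]) simp

setup_lifting type_definition_imat

lemma imat_eqI: "(\<And>i j. ent A i j = ent B i j) ==> A = B" by (metis ent_inject ext)

lemma finite_row: "finite {j. ent A i j ~= 0}" using ent[of A] by simp

lemma finite_col: "finite {i. ent A i j ~= 0}" using ent[of A] by simp

lemma sum_mult_nonzero:
 fixes f g :: "'a => complex"
 assumes "(\<Sum>k\<in>S. f k * g k) ~= 0"
 shows "\<exists>k\<in>S. f k ~= 0 \<and> g k ~= 0" using sum.not_neutral_contains_not_neutral[OF assms] by auto

instantiation imat :: "{zero, one, plus, minus, uminus, times}"
begin

lift_definition zero_imat :: imat is "\<lambda>_ _. 0" by simp

lift_definition one_imat :: imat is "\<lambda>i j. if i = j then 1 else 0" by simp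

lift_definition plus_imat :: "imat => imat => imat" is "\<lambda>A B i j. A i j + B i j"
proof -
 fix A B :: "nat => nat => complex"
 assume A: "(\<forall>i. finite {j. A i j ~= 0}) \<and> (\<forall>j. finite {i. A i j ~= 0})"
  and B: "(\<forall>i. finite {j. B i j ~= 0}) \<and> (\<forall>j. finite {i. B i j ~= 0})"
 have "{j. A i j + B i j ~= 0} \<subseteq> {j. A i j ~= 0} \<union> {j. B i j ~= 0}" for i by auto
 moreover have "{i. A i j + B i j ~= 0} \<subseteq> {i. A i j ~= 0} \<union> {i. B i j ~= 0}" for j by auto
 ultimately show "(\<forall>i. finite {j. A i j + B i j ~= 0}) \<and> (\<forall>j. finite {i. A i j + B i j ~= 0})"
  using A B by (meson finite_UnI finite_subset)
qed

lift_definition uminus_imat :: "imat => imat" is "\<lambda>A i j. - A i j" by simp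

definition minus_imat :: "imat => imat => imat" where "minus_imat A B = A + - B"

lift_definition times_imat :: "imat => imat => imat"
 is "\<lambda>A B i j. \<Sum>k | A i k ~= 0. A i k * B k j"
proof -
 fix A B :: "nat => nat => complex"
 assume A: "(\<forall>i. finite {j. A i j ~= 0}) \<and> (\<forall>j. finite {i. A i j ~= 0})"
  and B: "(\<forall>i. finite {j. B i j ~= 0}) \<and> (\<forall>j. finite {i. B i j ~= 0})"
 have "{j. (\<Sum>k | A i k ~= 0. A i k * B k j) ~= 0} \<subseteq> (\<Union>k\<in>{k. A i k ~= 0}. {j. B k j ~= 0})" for i
  by (fastforce dest: sum_mult_nonzero)
 moreover have "{i. (\<Sum>k | A i k ~= 0. A i k * B k j) ~= 0} \<subseteq> (\<Union>k\<in>{k. B k j ~= 0}. {i. A i k ~= 0})" for j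
  by (fastforce dest: sum_mult_nonzero)
 ultimately show "(\<forall>i. finite {j. (\<Sum>k | A i k ~= 0. A i k * B k j) ~= 0}) \<and>
   (\<forall>j. finite {i. (\<Sum>k | A i k ~= 0. A i k * B k j) ~= 0})"
  using A B by (meson finite_UN_I finite_subset)
qed

instance ..

end

lemma ent_simps [simp]:
 "ent 0 i j = 0" "ent (A + B) i j = ent A i j + ent B i j" "ent (- A) i j = - ent A i j"
 "ent (A - B) i j = ent A i j - ent B i j" unfolding minus_imat_def by (transfer; simp)+

lemma ent_one: "ent 1 i j = (if i = j then 1 else 0)" by transfer simp

lemma ent_mult:
 assumes "finite K" and "\<And>k. ent A i k ~= 0 ==> ent B k j ~= 0 ==> k \<in> K"
 shows "ent (A * B) i j = (\<Sum>k\<in>K. ent A i k * ent B k j)"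
proof -
 have "ent (A * B) i j = (\<Sum>k | ent A i k ~= 0. ent A i k * ent B k j)" by transfer simp
 also have "\<dots> = (\<Sum>k\<in>K \<union> {k. ent A i k ~= 0}. ent A i k * ent B k j)"
  using assms(1) finite_row by (intro sum.mono_neutral_left) auto
 also have "\<dots> = (\<Sum>k\<in>K. ent A i k * ent B k j)" using assms finite_row by (intro sum.mono_neutral_right) auto
 finally show ?thesis .
qed

instance imat :: ring_1
proof
 fix A B C :: imat
 show "A * B * C = A * (B * C)"
 proof (rule imat_eqI)
  fix i j
  define K where "K = {k. ent A i k ~= 0}"
  define L where "L = {l. ent C l j ~= 0}"
  have fin: "finite K" "finite L" by (auto simp: K_def L_def finite_row finite_col)
  have "ent (A * B * C) i j = (\<Sum>l\<in>L. ent (A * B) i l * ent C l j)" using fin by (intro ent_mult) (auto simp: L_def)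
  also have "\<dots> = (\<Sum>l\<in>L. \<Sum>k\<in>K. ent A i k * ent B k l * ent C l j)"
   using fin by (simp add: ent_mult[of K] K_def sum_distrib_right)
  also have "\<dots> = (\<Sum>k\<in>K. \<Sum>l\<in>L. ent A i k * ent B k l * ent C l j)" by (rule sum.swap)
  also have "\<dots> = (\<Sum>k\<in>K. ent A i k * ent (B * C) k j)"
   using fin by (simp add: ent_mult[of L] L_def sum_distrib_left assoc)
  also have "\<dots> = ent (A * (B * C)) i j" using fin by (intro ent_mult[symmetric]) (auto simp: K_def)
  finally show "ent (A * B * C) i j = ent (A * (B * C)) i j" .
 qed
 show "1 * A = A" by (rule imat_eqI) (subst ent_mult[of "{_}"], auto simp: ent_one split: if_splits)
 show "A * 1 = A" by (rule imat_eqI) (subst ent_mult[of "{_}"], auto simp: ent_one split: if_splits)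
 show "(A + B) * C = A * C + B * C"
 proof (rule imat_eqI)
  fix i j
  show "ent ((A + B) * C) i j = ent (A * C + B * C) i j" using finite_col[of C j]
   by (simp add: ent_mult[of "{k. ent C k j ~= 0}"] sum.distrib distrib_right)
 qed
 show "C * (A + B) = C * A + C * B"
 proof (rule imat_eqI)
  fix i j
  show "ent (C * (A + B)) i j = ent (C * A + C * B) i j" using finite_row[of C i]
   by (simp add: ent_mult[of "{k. ent C i k ~= 0}"] sum.distrib distrib_left)
 qed
 have "ent 0 0 0 ~= ent 1 0 0" by (simp add: ent_one)
 then show "(0::imat) ~= 1" by metis
qed (rule imat_eqI; simp)+

lemma ent_sum [simp]: "ent (\<Sum>x\<in>S. f x) i j = (\<Sum>x\<in>S. ent (f x) i j)" by (induction S rule: infinite_finite_induct) auto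

lift_definition tp :: "imat => imat" is "\<lambda>A i j. A j i" by simp

lemma ent_tp [simp]: "ent (tp A) i j = ent A j i" by transfer simp

lemma tp_simps [simp]:
 "tp (tp A) = A" "tp 0 = 0" "tp 1 = 1" "tp (A + B) = tp A + tp B" "tp (A - B) = tp A - tp B" "tp (- A) = - tp A"
 by (rule imat_eqI; simp add: ent_one)+

lemma tp_mult: "tp (A * B) = tp B * tp A"
proof (rule imat_eqI)
 fix i j
 have "ent (tp (A * B)) i j = (\<Sum>k | ent A j k ~= 0. ent A j k * ent B k i)"
  using finite_row[of A j] by (simp add: ent_mult)
 also have "\<dots> = (\<Sum>k | ent A j k ~= 0. ent (tp B) i k * ent (tp A) k j)" by (simp add: mult.commute)
 also have "\<dots> = ent (tp B * tp A) i j" using finite_row[of A j] by (intro ent_mult[symmetric]) auto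
 finally show "ent (tp (A * B)) i j = ent (tp B * tp A) i j" .
qed

lemma tp_sum: "tp (\<Sum>x\<in>S. f x) = (\<Sum>x\<in>S. tp (f x))" by (rule imat_eqI) simp

lift_definition scl :: "complex => imat => imat" is "\<lambda>c A i j. c * A i j"
proof -
 fix c and A :: "nat => nat => complex"
 assume A: "(\<forall>i. finite {j. A i j ~= 0}) \<and> (\<forall>j. finite {i. A i j ~= 0})"
 show "(\<forall>i. finite {j. c * A i j ~= 0}) \<and> (\<forall>j. finite {i. c * A i j ~= 0})" by (cases "c = 0") (use A in auto)
qed

lemma ent_scl [simp]: "ent (scl c A) i j = c * ent A i j" by transfer simp

interpretation imat: vector_space scl by unfold_locales (rule imat_eqI; simp add: algebra_simps)+

lemma scl_mult_left: "scl c A * B = scl c (A * B)"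
proof (rule imat_eqI)
 fix i j
 have "ent (scl c (A * B)) i j = (\<Sum>k | ent A i k ~= 0. ent (scl c A) i k * ent B k j)"
  using finite_row[of A i] by (simp add: ent_mult sum_distrib_left assoc)
 also have "\<dots> = ent (scl c A * B) i j" using finite_row[of A i] by (intro ent_mult[symmetric]) auto
 finally show "ent (scl c A * B) i j = ent (scl c (A * B)) i j" by simp
qed

lemma scl_mult_right: "A * scl c B = scl c (A * B)"
proof (rule imat_eqI)
 fix i j
 have "ent (scl c (A * B)) i j = (\<Sum>k | ent A i k ~= 0. ent A i k * ent (scl c B) k j)"
  using finite_row[of A i] by (simp add: ent_mult sum_distrib_left mult_ac)
 also have "\<dots> = ent (A * scl c B) i j" using finite_row[of A i] by (intro ent_mult[symmetric]) auto
 finally show "ent (A * scl c B) i j = ent (scl c (A * B)) i j" by simp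
qed

lemmas scl_mult = scl_mult_left scl_mult_right

lemma tp_scl [simp]: "tp (scl c A) = scl c (tp A)" by (rule imat_eqI) simp

lemmas scl_simps [simp] = imat.scale_one imat.scale_zero_left imat.scale_zero_right imat.scale_scale
 imat.scale_minus_left imat.scale_minus_right scl_mult

lemma scl_eq_0_iff [simp]: "scl c A = 0 \<longleftrightarrow> c = 0 \<or> A = 0" by (rule imat.scale_eq_0_iff)

lift_definition cj :: "imat => imat" is "\<lambda>A i j. cnj (A i j)" by simp

lemma ent_cj [simp]: "ent (cj A) i j = cnj (ent A i j)" by transfer simp

lemma cj_mult: "cj (A * B) = cj A * cj B"
proof (rule imat_eqI)
 fix i j
 have "ent (cj (A * B)) i j = (\<Sum>k | ent A i k ~= 0. ent (cj A) i k * ent (cj B) k j)"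
  using finite_row[of A i] by (simp add: ent_mult)
 also have "\<dots> = ent (cj A * cj B) i j" using finite_row[of A i] by (intro ent_mult[symmetric]) auto
 finally show "ent (cj (A * B)) i j = ent (cj A * cj B) i j" .
qed

subsection \<open>Corners\<close>

lift_definition idm :: "nat => imat" is "\<lambda>n i j. if i = j \<and> i < n then 1 else 0" by simp

lemma ent_idm: "ent (idm n) i j = (if i = j \<and> i < n then 1 else 0)" by transfer simp

lemma ent_idm_mult [simp]: "ent (idm n * A) i j = (if i < n then ent A i j else 0)"
 by (subst ent_mult[of "{i}"]) (auto simp: ent_idm split: if_splits)

lemma ent_mult_idm [simp]: "ent (A * idm n) i j = (if j < n then ent A i j else 0)"
 by (subst ent_mult[of "{j}"]) (auto simp: ent_idm split: if_splits)

lemma idm_mult_idm [simp]: "idm m * idm n = idm (min m n)" by (rule imat_eqI) (auto simp: ent_idm)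

lemma tp_idm [simp]: "tp (idm n) = idm n" by (rule imat_eqI) (auto simp: ent_idm)

lemma cj_idm [simp]: "cj (idm n) = idm n" by (rule imat_eqI) (auto simp: ent_idm)

lemma idm_0 [simp]: "idm 0 = 0" by (rule imat_eqI) (auto simp: ent_idm)

definition rect :: "nat => nat => imat set" where
 "rect m n = {A. idm m * A = A \<and> A * idm n = A}"

abbreviation cor :: "nat => imat set" where "cor n \<equiv> rect n n"

lemma rectD: "A \<in> rect m n ==> idm m * A = A" "A \<in> rect m n ==> A * idm n = A" by (auto simp: rect_def)

lemma rect_iff: "A \<in> rect m n \<longleftrightarrow> (\<forall>i j. ent A i j ~= 0 --> i < m \<and> j < n)"
proof
 assume "A \<in> rect m n"
 then have A: "idm m * A = A" "A * idm n = A" by (auto simp: rect_def)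
 show "\<forall>i j. ent A i j ~= 0 --> i < m \<and> j < n" using ent_idm_mult[of m A] ent_mult_idm[of A n] unfolding A by metis
next
 assume *: "\<forall>i j. ent A i j ~= 0 --> i < m \<and> j < n"
 then have "ent A i j = 0" if "\<not> i < m \<or> \<not> j < n" for i j using that by blast
 then show "A \<in> rect m n" by (auto simp: rect_def intro!: imat_eqI)
qed

lemma rect_zero [simp]: "0 \<in> rect m n" by (simp add: rect_def)

lemma rect_add: "A \<in> rect m n ==> B \<in> rect m n ==> A + B \<in> rect m n" by (simp add: rect_def algebra_simps)

lemma rect_diff: "A \<in> rect m n ==> B \<in> rect m n ==> A - B \<in> rect m n" by (simp add: rect_def algebra_simps)

lemma rect_minus: "A \<in> rect m n ==> - A \<in> rect m n" by (simp add: rect_def)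

lemma rect_scl: "A \<in> rect m n ==> scl c A \<in> rect m n" by (simp add: rect_def)

lemma rect_sum: "(\<And>x. x \<in> S ==> f x \<in> rect m n) ==> (\<Sum>x\<in>S. f x) \<in> rect m n"
 by (induction S rule: infinite_finite_induct) (auto intro: rect_add)

lemma rect_mult: "A \<in> rect m n ==> B \<in> rect k l ==> A * B \<in> rect m l" unfolding rect_def by (simp, metis assoc)

lemma rect_tp: "A \<in> rect m n ==> tp A \<in> rect n m" unfolding rect_def by (simp, metis tp_mult tp_idm)

lemma rect_idm: "n \<le> m ==> n \<le> l ==> idm n \<in> rect m l" by (simp add: rect_def min_absorb1 min_absorb2)

lemma idm_cor [simp]: "idm n \<in> cor n" by (simp add: rect_idm)

lemma rect_mono: "A \<in> rect m n ==> m \<le> m' ==> n \<le> n' ==> A \<in> rect m' n'" unfolding rect_iff by (meson order_less_le_trans)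

lemma rect_power: "A \<in> cor n ==> k > 0 ==> A ^ k \<in> cor n"
proof (induction k)
 case (Suc k)
 then show ?case by (cases "k = 0") (auto intro: rect_mult)
qed simp

lemma idm_rect: "idm m * A * idm n \<in> rect m n" by (auto simp: rect_iff assoc split: if_splits)

text \<open>Multiplied from the left, it deletes the first \<open>n\<close> coordinates. Conjugation
  as in \<open>dirsum\<close> moves a corner along the diagonal, which gives block sums inside the
  single ring.\<close>

definition shift :: "nat => imat" where
 "shift n = Imat (\<lambda>i j. if j = i + n then 1 else 0)"

lemma ent_shift: "ent (shift n) i j = (if j = i + n then 1 else 0)"
proof -
 have "finite {j. (if j = i + n then 1 else 0 :: complex) ~= 0}" for i by (rule finite_subset[of _ "{i + n}"]) auto
 moreover have "finite {i. (if j = i + n then 1 else 0 :: complex) ~= 0}" for j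
  by (rule finite_subset[of _ "{..j}"]) (auto split: if_splits)
 ultimately show ?thesis unfolding shift_def by (subst Imat_inverse) auto
qed

lemma ent_shift_mult: "ent (shift n * A) i j = ent A (i + n) j"
 by (subst ent_mult[of "{i + n}"]) (auto simp: ent_shift split: if_splits)

lemma ent_mult_shift: "ent (A * shift n) i j = (if n \<le> j then ent A i (j - n) else 0)"
proof (cases "n \<le> j")
 case True
 then show ?thesis by (subst ent_mult[of "{j - n}"]) (auto simp: ent_shift split: if_splits)
next
 case False
 then show ?thesis by (subst ent_mult[of "{}"]) (auto simp: ent_shift split: if_splits)
qed

lemma shift_tp_shift [simp]: "shift n * tp (shift n) = 1"
 by (rule imat_eqI) (auto simp: ent_shift_mult ent_shift ent_one)

lemma tp_shift_shift: "tp (shift n) * shift n = 1 - idm n"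
proof (rule imat_eqI)
 fix i j
 show "ent (tp (shift n) * shift n) i j = ent (1 - idm n) i j"
  by (auto simp: ent_mult_shift ent_shift ent_one ent_idm)
qed

lemma shift_idm [simp]: "shift n * idm n = 0" by (rule imat_eqI) (simp add: ent_shift)

lemma idm_tp_shift [simp]: "idm n * tp (shift n) = 0" by (rule imat_eqI) (simp add: ent_shift)

lemma idm_shift: "idm m * shift n = shift n * (idm (m + n) - idm n)"
 by (rule imat_eqI) (auto simp: ent_shift right_diff_distrib)

subsection \<open>Passage from matrices\<close>

lift_definition of_m :: "complex mat => imat" is
 "\<lambda>A i j. if i < dim_row A \<and> j < dim_col A then A $$ (i, j) else 0"
proof -
 fix A :: "complex mat"
 have "finite {j. (if i < dim_row A \<and> j < dim_col A then A $$ (i, j) else 0) ~= 0}" for i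
  by (rule finite_subset[of _ "{..<dim_col A}"]) (auto split: if_splits)
 moreover have "finite {i. (if i < dim_row A \<and> j < dim_col A then A $$ (i, j) else 0) ~= 0}" for j
  by (rule finite_subset[of _ "{..<dim_row A}"]) (auto split: if_splits)
 ultimately show "(\<forall>i. finite {j. (if i < dim_row A \<and> j < dim_col A then A $$ (i, j) else 0) ~= 0}) \<and>
   (\<forall>j. finite {i. (if i < dim_row A \<and> j < dim_col A then A $$ (i, j) else 0) ~= 0})" by blast
qed

lemma ent_of_m: "ent (of_m A) i j = (if i < dim_row A \<and> j < dim_col A then A $$ (i, j) else 0)"
 by (simp add: of_m.rep_eq)

lemma of_m_rect: "A \<in> carrier_mat m n ==> of_m A \<in> rect m n" unfolding rect_iff by (simp add: ent_of_m)

definition to_m :: "nat => nat => imat => complex mat" where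
 "to_m m n A = mat m n (\<lambda>(i, j). ent A i j)"

lemma to_m_carrier [simp]: "to_m m n A \<in> carrier_mat m n" by (simp add: to_m_def)

lemma to_m_dims [simp]: "dim_row (to_m m n A) = m" "dim_col (to_m m n A) = n" by (simp_all add: to_m_def)

lemma to_m_of_m: "A \<in> carrier_mat m n ==> to_m m n (of_m A) = A" by (intro eq_matI) (auto simp: to_m_def ent_of_m)

lemma of_m_to_m: "A \<in> rect m n ==> of_m (to_m m n A) = A" by (rule imat_eqI) (auto simp: to_m_def ent_of_m rect_iff)

lemma of_m_inj: "A \<in> carrier_mat m n ==> B \<in> carrier_mat m n ==> of_m A = of_m B ==> A = B" by (metis to_m_of_m)

lemma of_m_mult: "A \<in> carrier_mat m n ==> B \<in> carrier_mat n k ==> of_m (A * B) = of_m A * of_m B"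
proof (rule imat_eqI)
 fix i j
 assume AB: "A \<in> carrier_mat m n" "B \<in> carrier_mat n k"
 have "ent (of_m A * of_m B) i j = (\<Sum>l<n. ent (of_m A) i l * ent (of_m B) l j)"
  using AB by (intro ent_mult) (auto simp: ent_of_m split: if_splits)
 then show "ent (of_m (A * B)) i j = ent (of_m A * of_m B) i j"
  using AB by (auto simp: ent_of_m scalar_prod_def lessThan_atLeast0 intro!: sum.neutral)
qed

lemma of_m_add: "A \<in> carrier_mat m n ==> B \<in> carrier_mat m n ==> of_m (A + B) = of_m A + of_m B"
 by (rule imat_eqI) (auto simp: ent_of_m)

lemma of_m_one: "of_m (1\<^sub>m n) = idm n" by (rule imat_eqI) (auto simp: ent_of_m ent_idm)

lemma of_m_zero: "of_m (0\<^sub>m m n) = 0" by (rule imat_eqI) (auto simp: ent_of_m)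

lemma of_m_tp: "of_m (transpose_mat A) = tp (of_m A)" by (rule imat_eqI) (auto simp: ent_of_m)

lemma of_m_pow: "A \<in> carrier_mat n n ==> of_m (A ^\<^sub>m k) = idm n * of_m A ^ k"
proof (induction k)
 case 0
 then show ?case by (simp add: of_m_one)
next
 case (Suc k)
 then have "of_m (A ^\<^sub>m Suc k) = of_m (A ^\<^sub>m k) * of_m A" by (simp add: of_m_mult[of _ n n])
 then show ?case using Suc by (simp add: assoc power_commutes)
qed

definition dt :: "nat => imat => complex" where
 "dt n A = Determinant.det (to_m n n A)"

lemma to_m_mult: "A \<in> rect m n ==> B \<in> rect n k ==> to_m m k (A * B) = to_m m n A * to_m n k B"
 by (rule of_m_inj[of _ m k])
  (auto simp: of_m_to_m of_m_to_m[OF rect_mult[of A m n B n k]] of_m_mult[OF to_m_carrier to_m_carrier]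
    intro: mult_carrier_mat)

lemma to_m_idm: "to_m n n (idm n) = 1\<^sub>m n" by (metis of_m_one one_carrier_mat to_m_of_m)

lemma to_m_tp: "to_m m n (tp A) = transpose_mat (to_m n m A)" by (intro eq_matI) (auto simp: to_m_def)

lemma dt_mult: "A \<in> cor n ==> B \<in> cor n ==> dt n (A * B) = dt n A * dt n B"
 unfolding dt_def by (simp add: to_m_mult det_mult[of _ n])

lemma dt_idm: "dt n (idm n) = 1" by (simp add: dt_def to_m_idm)

lemma dt_tp: "dt n (tp A) = dt n A" by (simp add: dt_def to_m_tp Determinant.det_transpose[of _ n])

lemma dt_minus: "dt n (- A) = (-1) ^ n * dt n A"
proof -
 have "to_m n n (- A) = (-1) \<cdot>\<^sub>m to_m n n A" by (intro eq_matI) (auto simp: to_m_def)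
 then show ?thesis by (simp add: dt_def to_m_def)
qed

lemma cor_inverse_commutes:
 assumes "A \<in> cor n" "B \<in> cor n" "A * B = idm n"
 shows "B * A = idm n"
proof -
 have "to_m n n A * to_m n n B = 1\<^sub>m n" using assms by (simp flip: to_m_mult add: to_m_idm)
 then have "to_m n n B * to_m n n A = 1\<^sub>m n" by (rule mat_mult_left_right_inverse[of _ n, rotated 2]) auto
 then have "of_m (to_m n n B * to_m n n A) = idm n" by (simp add: of_m_one)
 then show ?thesis using assms by (simp add: of_m_mult[OF to_m_carrier[of n n] to_m_carrier[of n n]] of_m_to_m)
qed

text \<open>Injectivity is tested on arbitrary matrices \<open>Y\<close> in place of vectors, the
  form in which later kernel arguments supply it. A singular matrix would kill a nonzero
  column.\<close>

lemma cor_invertible: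
 assumes A: "A \<in> cor n" and inj: "\<And>Y. A * Y = 0 ==> idm n * Y = 0"
 obtains B where "B \<in> cor n" "A * B = idm n" "B * A = idm n"
proof -
 have "Determinant.det (to_m n n A) ~= 0"
 proof
  assume "Determinant.det (to_m n n A) = 0"
  then obtain x where x: "x \<in> carrier_vec n" "x ~= 0\<^sub>v n" "to_m n n A *\<^sub>v x = 0\<^sub>v n"
   using det_0_iff_vec_prod_zero_field[of "to_m n n A" n] by auto
  define M where "M = mat_of_cols n [x]"
  have M: "M \<in> carrier_mat n 1" by (simp add: M_def mat_of_cols_def)
  have "to_m n n A * M = 0\<^sub>m n 1"
  proof (rule eq_matI)
   fix i j
   assume "i < dim_row (0\<^sub>m n 1 :: complex mat)" "j < dim_col (0\<^sub>m n 1 :: complex mat)"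
   then have ij: "i < n" "j = 0" by auto
   have "(to_m n n A *\<^sub>v x) $ i = 0" using x ij by simp
   moreover have "col M 0 = x" using x by (auto simp: M_def mat_of_cols_def)
   ultimately show "(to_m n n A * M) $$ (i, j) = (0\<^sub>m n 1 :: complex mat) $$ (i, j)"
    using ij M by (simp add: to_m_def)
  qed (use M in auto)
  then have "of_m (to_m n n A * M) = 0" by (simp add: of_m_zero)
  then have "A * of_m M = 0" using M A by (simp add: of_m_mult[of _ n n _ 1] of_m_to_m)
  then have "idm n * of_m M = 0" by (rule inj)
  then have "of_m M = 0" using of_m_rect[OF M] by (simp add: rectD)
   moreover have "x $ i = ent (of_m M) i 0" if "i < n" for i
   using that by (simp add: ent_of_m M_def mat_of_cols_def)
  ultimately have "x $ i = 0" if "i < n" for i using that by simp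
  with x show False by (auto intro: eq_vecI)
 qed
 then obtain B where "B \<in> carrier_mat n n" "to_m n n A * B = 1\<^sub>m n"
  using det_non_zero_imp_unit[OF to_m_carrier[of n n A]] by (auto simp: Units_def ring_mat_def)
 have "A * of_m B = of_m (to_m n n A * B)"
  using A \<open>B \<in> _\<close> by (simp add: of_m_mult[of "to_m n n A" n n B n] of_m_to_m)
 then have "A * of_m B = idm n" using \<open>to_m n n A * B = 1\<^sub>m n\<close> by (simp add: of_m_one)
 with cor_inverse_commutes[of A n "of_m B"] A of_m_rect[OF \<open>B \<in> carrier_mat n n\<close>] that
 show thesis by blast
qed

lemma cor_invertible_dt: assumes "A \<in> cor n" "B \<in> cor n" "A * B = idm n" shows "dt n A ~= 0"
 using dt_mult[of A n B] assms by (auto simp: dt_idm)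

section \<open>Rank\<close>

lemma assoc_rule: "(A :: 'a :: semigroup_mult) * B = C ==> A * (B * D) = C * D" by (simp flip: assoc)

lemma idm_mult_idm_assoc [simp]: "idm m * (idm n * A) = idm (min m n) * A" by (simp flip: assoc)

section \<open>Finite support, traces and rank factorizations\<close>

definition fin :: "imat => bool" where "fin A \<longleftrightarrow> (\<exists>n. A \<in> cor n)"

lemma finI: "A \<in> rect m n ==> fin A" unfolding fin_def by (meson rect_mono max.cobounded1 max.cobounded2)

lemma fin_simps [simp]: "fin 0" "fin (idm n)" by (auto intro: finI[OF rect_zero] finI[OF idm_cor])

lemma fin_common: assumes "fin A" "fin B" obtains n where "A \<in> cor n" "B \<in> cor n"
 using assms unfolding fin_def by (meson rect_mono max.cobounded1 max.cobounded2)

lemma fin_add: "fin A ==> fin B ==> fin (A + B)" by (metis fin_common fin_def rect_add)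

lemma fin_diff: "fin A ==> fin B ==> fin (A - B)" by (metis fin_common fin_def rect_diff)

lemma fin_scl: "fin A ==> fin (scl c A)" by (metis fin_def rect_scl)

lemma fin_tp: "fin A ==> fin (tp A)" by (metis fin_def rect_tp)

lemma fin_mult_left: assumes "fin A" shows "fin (X * A)"
proof -
 obtain n where n: "A \<in> cor n" using assms fin_def by blast
 define R where "R = (\<Union>j<n. {i. ent X i j ~= 0})"
 have "finite R" by (auto simp: R_def finite_col)
 then obtain m where m: "R \<subseteq> {..<m}" using finite_nat_iff_bounded by blast
 have "X * A \<in> rect m n" unfolding rect_iff
 proof (intro allI impI)
  fix i j assume nz: "ent (X * A) i j ~= 0"
  have "ent (X * A) i j = (\<Sum>k<n. ent X i k * ent A k j)" using n by (intro ent_mult) (auto simp: rect_iff)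
  then obtain k where "k < n" "ent X i k ~= 0" "ent A k j ~= 0"
   using nz sum_mult_nonzero[of "ent X i" "\<lambda>k. ent A k j" "{..<n}"] by auto
  then show "i < m \<and> j < n" using m n by (auto simp: R_def rect_iff)
 qed
 then show ?thesis by (rule finI)
qed

lemma fin_mult_right: assumes "fin A" shows "fin (A * X)"
 using fin_mult_left[OF fin_tp[OF assms], of "tp X"] fin_tp by (force simp flip: tp_mult)

definition tr :: "imat => complex" where "tr A = (\<Sum>i | ent A i i ~= 0. ent A i i)"

lemma tr_eq: assumes "A \<in> cor n" "n \<le> m" shows "tr A = (\<Sum>i<m. ent A i i)"
 unfolding tr_def using assms by (intro sum.mono_neutral_left) (auto simp: rect_iff intro: less_le_trans)

lemma tr_commute: assumes "fin A" "fin B" shows "tr (A * B) = tr (B * A)"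
proof -
 obtain n where n: "A \<in> cor n" "B \<in> cor n" using assms fin_common by blast
 have e: "ent (X * Y) i i = (\<Sum>k<n. ent X i k * ent Y k i)" if "X \<in> cor n" for X Y i
  using that by (intro ent_mult) (auto simp: rect_iff)
 have "tr (A * B) = (\<Sum>i<n. \<Sum>k<n. ent A i k * ent B k i)"
  using n by (simp add: tr_eq[OF rect_mult[OF n] order_refl] e)
 also have "\<dots> = (\<Sum>k<n. \<Sum>i<n. ent A i k * ent B k i)" by (rule sum.swap)
 also have "\<dots> = tr (B * A)" using n by (simp add: tr_eq[OF rect_mult[OF n(2,1)] order_refl] e mult.commute)
 finally show ?thesis .
qed

lemma tr_diff: "fin A ==> fin B ==> tr (A - B) = tr A - tr B"
 by (erule (1) fin_common) (simp add: tr_eq[OF rect_diff, OF _ _ order_refl] tr_eq[OF _ order_refl] sum_subtractf)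

lemma tr_scl: "fin A ==> tr (scl c A) = c * tr A"
 unfolding fin_def by (auto simp: tr_eq[OF rect_scl, OF _ order_refl] tr_eq[OF _ order_refl] sum_distrib_left)

lemma tr_idm: "tr (idm n) = of_nat n" by (simp add: tr_eq[OF idm_cor order_refl] ent_idm)

text \<open>If \<open>s < r\<close>, both factors fit into the corner of size \<open>r\<close>,
  where a one-sided inverse is two-sided. Then \<open>idm s\<close> would fix \<open>idm r\<close>,
  although it omits the coordinate \<open>s\<close>.\<close>

lemma idm_le: assumes "idm r = M * idm s * L" shows "r \<le> s"
proof (rule ccontr)
 assume "\<not> r \<le> s"
 then have sr: "s < r" by simp
 define M1 L1 where "M1 = idm r * M * idm s" and "L1 = idm s * L * idm r"
 have c: "M1 \<in> cor r" "L1 \<in> cor r" using sr unfolding M1_def L1_def by (auto intro: rect_mono[OF idm_rect])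
 have "M1 * L1 = idm r * (M * idm s * L) * idm r" by (simp add: M1_def L1_def assoc)
 then have "L1 * M1 = idm r" using assms[symmetric] c cor_inverse_commutes[OF c] by simp
 moreover have "idm s * L1 = L1" by (simp add: L1_def flip: assoc)
 ultimately have "idm s * idm r = idm r" by (metis assoc)
 then have "ent (idm s * idm r) s s = ent (idm r) s s" by simp
 with sr show False by (simp add: ent_idm)
qed

lemma adjoint_mult_self_eq_0: assumes "cj (tp A) * A = 0" shows "A = 0"
proof (rule imat_eqI)
 fix i j
 have "0 = ent (cj (tp A) * A) j j" using assms by simp
 also have "\<dots> = (\<Sum>k | ent A k j ~= 0. cnj (ent A k j) * ent A k j)"
  by (subst ent_mult[of "{k. ent A k j ~= 0}"]) (auto simp: finite_col)
 also have "\<dots> = of_real (\<Sum>k | ent A k j ~= 0. (cmod (ent A k j))\<^sup>2)"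
  unfolding of_real_sum by (intro sum.cong refl) (metis complex_norm_square mult.commute of_real_power)
 finally have "(\<Sum>k | ent A k j ~= 0. (cmod (ent A k j))\<^sup>2) = 0" by (metis of_real_eq_0_iff)
 then have "\<forall>k\<in>{k. ent A k j ~= 0}. (cmod (ent A k j))\<^sup>2 = 0"
  by (subst (asm) sum_nonneg_eq_0_iff) (auto simp: finite_col)
 then show "ent A i j = ent 0 i j" by auto
qed

text \<open>The Gram matrix \<open>cj (tp B) * B\<close> is injective along with \<open>B\<close>,
  hence invertible in the corner of size \<open>r\<close>.\<close>

lemma left_inverse_of_injective:
 assumes B: "fin B" "B * idm r = B" and inj: "\<And>Y. B * Y = 0 ==> idm r * Y = 0"
 obtains B' where "B' * B = idm r" "idm r * B' = B'" "fin B'"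
proof -
 define G where "G = cj (tp B) * B"
 have cj: "idm r * cj (tp B) = cj (tp B)" using arg_cong[OF B(2), of "\<lambda>X. cj (tp X)"] by (simp add: tp_mult cj_mult)
 have G: "G \<in> cor r" using B cj by (simp add: rect_def G_def assoc cj[THEN assoc_rule])
 obtain G' where G': "G' \<in> cor r" "G' * G = idm r"
 proof (rule cor_invertible[OF G])
  fix Y assume "G * Y = 0"
  have "cj (tp (B * Y)) * (B * Y) = cj (tp Y) * (G * Y)" by (simp add: G_def tp_mult cj_mult assoc)
  then have "cj (tp (B * Y)) * (B * Y) = 0" using \<open>G * Y = 0\<close> by simp
  then have "B * Y = 0" by (rule adjoint_mult_self_eq_0)
  then show "idm r * Y = 0" by (rule inj)
 qed auto
 show thesis
 proof (rule that[of "G' * cj (tp B)"])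
  show "G' * cj (tp B) * B = idm r" using G' by (simp add: G_def assoc)
  show "idm r * (G' * cj (tp B)) = G' * cj (tp B)" using G' by (simp add: rectD flip: assoc)
  show "fin (G' * cj (tp B))" using G' by (intro fin_mult_right) (rule finI)
 qed
qed

text \<open>A nonzero kernel column lets one coordinate \<open>p\<close> be eliminated:
  \<open>K\<close> differs from the identity by multiples of that column, has zero row
  \<open>p\<close>, and leaves \<open>B * idm r\<close> unchanged. The transposition
  \<open>t\<close> moves \<open>p\<close> to the last place.\<close>

lemma reduce_rank:
 assumes Y: "B * idm r * Y = 0" "idm r * Y ~= 0"
 obtains P Q where "B * idm r = P * idm (r - 1) * Q" "r > 0"
proof -
 obtain p q where "ent (idm r * Y) p q ~= 0" using Y(2) imat_eqI[of "idm r * Y" 0] by auto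
 then have p: "p < r" "ent Y p q ~= 0" by (auto split: if_splits)
 define U where "U = of_m (mat (q + 1) r (\<lambda>(i, j). if i = q \<and> j = p then 1 / ent Y p q else 0))"
 have entU: "ent U i j = (if i = q \<and> j = p then 1 / ent Y p q else 0)" for i j using p by (auto simp: U_def ent_of_m)
 define K where "K = idm r - idm r * Y * U"
 have "ent (idm r * Y * U) i j = (\<Sum>k\<in>{q}. ent (idm r * Y) i k * ent U k j)" for i j
  by (intro ent_mult) (auto simp: entU split: if_splits)
 then have entK: "ent K i j = (if i < r then (if i = j then 1 else 0) - (if j = p then ent Y i q / ent Y p q else 0) else 0)" for i j
  by (auto simp: K_def entU ent_idm)
 define t where "t i = (if i = p then r - 1 else if i = r - 1 then p else i)" for i
 define S where "S = of_m (mat r r (\<lambda>(i, j). if j = t i then 1 else 0))"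
 have t: "t i < r" "t (t i) = i" if "i < r" for i using that p(1) by (auto simp: t_def)
 have S: "ent (S * M) i j = (if i < r then ent M (t i) j else 0)" for M i j
  using t by (subst ent_mult[of "{t i}"]) (auto simp: S_def ent_of_m split: if_splits)
 have SS: "S * S = idm r" by (rule imat_eqI) (auto simp: S, auto simp: S_def ent_of_m ent_idm t)
 have SK: "S * K = idm (r - 1) * (S * K)"
 proof (rule imat_eqI)
  fix i j
  have "ent K p j = 0" using p(2) by (auto simp: entK)
  then show "ent (S * K) i j = ent (idm (r - 1) * (S * K)) i j"
   using p(1) by (cases "i = r - 1") (auto simp: S t_def)
 qed
 have "K = S * S * K" unfolding SS by (simp add: K_def right_diff_distrib flip: assoc)
 also have "\<dots> = S * idm (r - 1) * (S * K)" using SK by (simp add: assoc)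
 finally have "B * idm r * K = B * idm r * S * idm (r - 1) * (S * K)" by (metis assoc)
 moreover have "B * idm r * K = B * idm r"
  using arg_cong[OF Y(1), of "\<lambda>M. M * U"] by (simp add: K_def right_diff_distrib assoc)
 ultimately show thesis using that p by force
qed

text \<open>A rank factorization together with one-sided inverses of both factors; ranks are
  compared by composing with these inverses.\<close>

definition has_rank :: "imat => nat => bool" where
 "has_rank A r \<longleftrightarrow> (\<exists>B C B' C'. A = B * C \<and> B * idm r = B \<and> idm r * C = C \<and> B' * B = idm r \<and> C * C' = idm r
   \<and> idm r * B' = B' \<and> C' * idm r = C')"

text \<open>Among all factorizations through some \<open>idm r\<close> take the smallest
  \<open>r\<close>. By \<open>reduce_rank\<close> neither \<open>B\<close> nor \<open>tp C\<close>
  then has a kernel, so both factors have one-sided inverses.\<close>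

lemma has_rank_exists: assumes "fin A" shows "\<exists>r. has_rank A r"
proof -
 obtain n where "A \<in> cor n" using assms fin_def by blast
 then have "A = A * idm n * 1" by (simp add: rectD)
 then have ex: "\<exists>r. \<exists>B C. A = B * idm r * C" by blast
 define r where "r = (LEAST r. \<exists>B C. A = B * idm r * C)"
 obtain B0 C0 where A0: "A = B0 * idm r * C0" using LeastI_ex[OF ex] unfolding r_def by blast
 have min: "\<not> (\<exists>B C. A = B * idm (r - 1) * C)" if "r > 0"
  using that not_less_Least[of "r - 1" "\<lambda>r. \<exists>B C. A = B * idm r * C"] by (simp add: r_def)
 define B C where "B = B0 * idm r" and "C = idm r * C0"
 have A: "A = B * C" by (simp add: A0 B_def C_def assoc)
 have BC: "B * idm r = B" "idm r * C = C" by (simp_all add: B_def C_def assoc)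
 have fin: "fin B" "fin C" by (auto simp: B_def C_def intro: fin_mult_left fin_mult_right)
 have injB: "idm r * Y = 0" if "B * Y = 0" for Y
 proof (rule ccontr)
  assume "idm r * Y ~= 0"
  moreover have "B0 * idm r * Y = 0" using that by (simp add: B_def)
  ultimately obtain P Q where PQ: "B0 * idm r = P * idm (r - 1) * Q" "r > 0" using reduce_rank by blast
  then have "A = P * idm (r - 1) * (Q * C0)" by (simp add: A0 assoc)
  with min PQ(2) show False by blast
 qed
 have injC: "idm r * Y = 0" if "tp C * Y = 0" for Y
 proof (rule ccontr)
  assume "idm r * Y ~= 0"
  moreover have "tp C0 * idm r * Y = 0" using that by (simp add: C_def tp_mult)
  ultimately obtain P Q where PQ: "tp C0 * idm r = P * idm (r - 1) * Q" "r > 0" using reduce_rank by blast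
  then have "idm r * C0 = tp Q * idm (r - 1) * tp P" by (metis tp_mult tp_idm tp_simps(1) assoc)
  then have "A = (B0 * tp Q) * idm (r - 1) * tp P" by (simp add: A0 assoc)
  with min PQ(2) show False by blast
 qed
 obtain B' where B': "B' * B = idm r" "idm r * B' = B'" "fin B'"
  using left_inverse_of_injective[OF fin(1) BC(1) injB] by blast
 have "tp C * idm r = tp C" using BC(2) by (metis tp_mult tp_idm)
 then obtain D where D: "D * tp C = idm r" "idm r * D = D"
  using left_inverse_of_injective[OF fin_tp[OF fin(2)] _ injC] by blast
 then have "C * tp D = idm r" "tp D * idm r = tp D" by (metis tp_mult tp_idm tp_simps(1))+
 then show ?thesis unfolding has_rank_def using A BC B' by blast
qed

lemma has_rank_le:
 assumes "has_rank A r" "A = X * idm s * Y" shows "r \<le> s"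
proof -
 obtain B C B' C' where *: "A = B * C" "B * idm r = B" "idm r * C = C" "B' * B = idm r" "C * C' = idm r"
  using assms(1) has_rank_def by metis
 have "idm r = B' * B * (C * C')" using * by simp
 also have "\<dots> = B' * A * C'" unfolding *(1) by (simp add: assoc)
 also have "\<dots> = B' * X * idm s * (Y * C')" unfolding assms(2) by (simp add: assoc)
 finally show ?thesis by (rule idm_le)
qed

definition rk :: "imat => nat" where "rk A = (SOME r. has_rank A r)"

lemma has_rank_rk: "fin A ==> has_rank A (rk A)" unfolding rk_def using has_rank_exists someI_ex by metis

lemma rk_leI: "fin A ==> A = X * idm s * Y ==> rk A \<le> s" using has_rank_le has_rank_rk by blast

lemma rk_factor:
 assumes "fin A"
 obtains B C B' C' where "A = B * C" "B * idm (rk A) = B" "idm (rk A) * C = C"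
  "B' * B = idm (rk A)" "C * C' = idm (rk A)" "idm (rk A) * B' = B'" "C' * idm (rk A) = C'"
  "fin B" "fin C" "fin B'" "fin C'"
proof -
 obtain B C B' C' where *: "A = B * C" "B * idm (rk A) = B" "idm (rk A) * C = C"
  "B' * B = idm (rk A)" "C * C' = idm (rk A)" "idm (rk A) * B' = B'" "C' * idm (rk A) = C'"
  using has_rank_rk[OF assms] unfolding has_rank_def by metis
 moreover have "fin B" "fin C" "fin B'" "fin C'" by (metis * fin_mult_left fin_mult_right fin_simps(2))+
 ultimately show thesis using that by blast
qed

lemma has_rank_unique: assumes "has_rank A r" "fin A" shows "rk A = r"
proof (rule antisym)
 obtain B C B' C' where *: "A = B * C" "B * idm r = B" "idm r * C = C" "B' * B = idm r" "C * C' = idm r"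
  using assms(1) has_rank_def by metis
 then have "A = B * idm r * C" by (simp add: assoc)
 then show "rk A \<le> r" using assms by (intro rk_leI)
 obtain B C where "A = B * C" "B * idm (rk A) = B" using assms rk_factor by metis
 then have "A = B * idm (rk A) * C" by simp
 then show "r \<le> rk A" using assms has_rank_le by blast
qed

lemma rk_mult_le: assumes "fin A" shows "rk (X * A * Y) \<le> rk A"
proof -
 obtain B C where "A = B * C" "B * idm (rk A) = B" using assms rk_factor by metis
 then have "X * A * Y = (X * B) * idm (rk A) * (C * Y)" by (metis assoc)
 moreover have "fin (X * A * Y)" using assms by (intro fin_mult_right fin_mult_left)
 ultimately show ?thesis by (intro rk_leI)
qed

lemma rk_mult_left_le: "fin A ==> rk (X * A) \<le> rk A" using rk_mult_le[of A X 1] by simp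

lemma rk_mult_right_le: "fin A ==> rk (A * X) \<le> rk A" using rk_mult_le[of A 1 X] by simp

lemma rk_0 [simp]: "rk 0 = 0" using rk_leI[of 0 0 0 0] by simp

lemma rk_eq_0: "fin A ==> rk A = 0 ==> A = 0" by (metis rk_factor idm_0 mult_zero_left mult_zero_right)

lemma rk_idm [simp]: "rk (idm n) = n" by (rule has_rank_unique) (auto simp: has_rank_def intro!: exI[of _ "idm n"])

lemma rk_tp: assumes "fin A" shows "rk (tp A) = rk A"
proof -
 have "rk (tp A) \<le> rk A" if fin: "fin A" for A
 proof -
  obtain B C where "A = B * C" "B * idm (rk A) = B" using fin rk_factor by metis
  then have "tp A = tp C * idm (rk A) * tp B" by (metis tp_mult tp_idm assoc)
  then show ?thesis using fin by (intro rk_leI fin_tp)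
 qed
 from this[OF assms] this[OF fin_tp[OF assms]] show ?thesis by simp
qed

lemma rk_scl: assumes "fin A" "c ~= 0" shows "rk (scl c A) = rk A"
proof (rule antisym)
 show "rk (scl c A) \<le> rk A" using rk_mult_le[OF assms(1), of "scl c 1" 1] by simp
 show "rk A \<le> rk (scl c A)" using rk_mult_le[OF fin_scl[OF assms(1)], of "scl (inverse c) 1" c 1] assms by simp
qed

lemma rk_add_le: assumes fin: "fin A" "fin B" shows "rk (A + B) \<le> rk A + rk B"
proof -
 define r s where "r = rk A" and "s = rk B"
 obtain B1 C1 where 1: "A = B1 * C1" "B1 * idm r = B1" "idm r * C1 = C1"
  using rk_factor[OF fin(1)] unfolding r_def by metis
 obtain B2 C2 where 2: "B = B2 * C2" "B2 * idm s = B2" "idm s * C2 = C2"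
  using rk_factor[OF fin(2)] unfolding s_def by metis
 \<comment> \<open>The shift places the second factorization behind the first one, in a space of
   dimension \<open>r + s\<close>.\<close>
 define T where "T = shift r"
 have T: "T * idm (r + s) = idm s * T" using idm_shift[of s r] by (simp add: T_def right_diff_distrib add.commute)
 have a: "B1 * idm (r + s) = B1" using 1(2) by (metis idm_mult_idm min_absorb1 le_add1 assoc)
 have b: "B1 * tp T = 0" using 1(2) by (metis T_def idm_tp_shift assoc mult_zero_right)
 have c: "T * C1 = 0" using 1(3) by (metis T_def shift_idm assoc mult_zero_left)
 have d: "T * tp T = 1" by (simp add: T_def)
 have "(B1 + B2 * T) * idm (r + s) * (C1 + tp T * C2) = (B1 + B2 * T) * (C1 + tp T * C2)"
 proof -
  have "(B1 + B2 * T) * idm (r + s) = B1 + B2 * T"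
   using a 2 by (simp add: distrib_right assoc T 2(2)[THEN assoc_rule])
  then show ?thesis by simp
 qed
 also have "\<dots> = B1 * C1 + B1 * tp T * C2 + B2 * (T * C1) + B2 * (T * tp T) * C2" by (simp add: algebra_simps)
 also have "\<dots> = A + B" using b c d 1 2 by simp
 finally show ?thesis
  using fin by (intro rk_leI[of "A + B" "B1 + B2 * T" "rk A + rk B" "C1 + tp T * C2"]) (auto simp: r_def s_def intro: fin_add)
qed

text \<open>\<open>P\<close> separates the images and \<open>Q\<close> the sources, so the one-sided
  inverses of the two factorizations combine to carry \<open>A + B\<close> to
  \<open>idm (r + s)\<close>.\<close>

lemma rk_direct:
 assumes fin: "fin A" "fin B" and P: "P * A = A" "P * B = 0" and Q: "A * Q = A" "B * Q = 0"
 shows "rk (A + B) = rk A + rk B"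
proof (rule antisym)
 show "rk (A + B) \<le> rk A + rk B" using fin by (rule rk_add_le)
 define r s where "r = rk A" and "s = rk B"
 obtain B1 C1 B1' C1' where 1: "A = B1 * C1" "B1 * idm r = B1" "idm r * C1 = C1" "B1' * B1 = idm r" "C1 * C1' = idm r"
  using rk_factor[OF fin(1)] unfolding r_def by metis
 obtain B2 C2 B2' C2' where 2: "B = B2 * C2" "B2 * idm s = B2" "idm s * C2 = C2" "B2' * B2 = idm s" "C2 * C2' = idm s"
  using rk_factor[OF fin(2)] unfolding s_def by metis
 define T where "T = shift r"
 have T: "idm s * T = T * idm (r + s)" using idm_shift[of s r] by (simp add: T_def right_diff_distrib add.commute)
 have TT: "tp T * T = 1 - idm r" by (simp add: T_def tp_shift_shift)
 define L where "L = B1' * P + tp T * B2' * (1 - P)"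
 define R where "R = Q * C1' + (1 - Q) * C2' * T"
 have A: "B1' * A * C1' = idm r"
 proof -
  have "B1' * A * C1' = (B1' * B1) * (C1 * C1')" by (simp add: 1(1) assoc)
  then show ?thesis using 1 by simp
 qed
 have B: "B2' * B * C2' = idm s"
 proof -
  have "B2' * B * C2' = (B2' * B2) * (C2 * C2')" by (simp add: 2(1) assoc)
  then show ?thesis using 2 by simp
 qed
 have LM: "L * (A + B) = B1' * A + tp T * B2' * B" using P by (simp add: L_def algebra_simps)
 have "L * (A + B) * R = B1' * (A * Q) * C1' + B1' * (A - A * Q) * C2' * T
   + tp T * B2' * (B * Q) * C1' + tp T * B2' * (B - B * Q) * C2' * T"
  unfolding LM by (simp add: R_def algebra_simps)
 also have "\<dots> = B1' * A * C1' + tp T * (B2' * B * C2') * T" using Q by (simp add: assoc)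
 also have "\<dots> = idm r + tp T * T * idm (r + s)" unfolding A B by (simp add: assoc T)
 also have "\<dots> = idm (r + s)" by (simp add: TT left_diff_distrib)
 finally have LMR: "L * (A + B) * R = idm (r + s)" .
 obtain U V where "A + B = U * V" "U * idm (rk (A + B)) = U" using rk_factor[OF fin_add[OF fin]] by metis
 then have "idm (r + s) = (L * U) * idm (rk (A + B)) * (V * R)" using LMR by (metis assoc)
 then show "rk A + rk B \<le> rk (A + B)" unfolding r_def s_def by (rule idm_le)
qed

text \<open>In a rank factorization \<open>P = B * C\<close> of an idempotent, \<open>C * B\<close>
  is the identity of size \<open>rk P\<close>, and the trace is cyclic.\<close>

lemma rk_idempotent: assumes "fin P" "P * P = P" shows "tr P = of_nat (rk P)"
proof -
 obtain B C B' C' where *: "P = B * C" "B * idm (rk P) = B" "idm (rk P) * C = C"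
  "B' * B = idm (rk P)" "C * C' = idm (rk P)" "fin B" "fin C" using rk_factor[OF assms(1)] by metis
 have "B' * (P * P) * C' = (B' * B) * C * B * (C * C')" unfolding *(1) by (simp add: assoc)
 moreover have "B' * P * C' = (B' * B) * (C * C')" unfolding *(1) by (simp add: assoc)
 ultimately have "idm (rk P) * (C * B) * idm (rk P) = idm (rk P)"
  unfolding assms(2) using *(4,5) by (simp add: assoc)
 then have "C * B = idm (rk P)" by (simp add: assoc *(2) *(3)[THEN assoc_rule])
 moreover have "tr P = tr (C * B)" unfolding *(1) using * by (intro tr_commute)
 ultimately show ?thesis by (simp add: tr_idm)
qed

lemma regular: assumes "fin A" obtains G where "fin G" "A * G * A = A"
proof -
 obtain B C B' C' where *: "A = B * C" "B * idm (rk A) = B" "idm (rk A) * C = C"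
  "B' * B = idm (rk A)" "C * C' = idm (rk A)" "fin B'" "fin C'" using rk_factor[OF assms] by metis
 have "A * (C' * B') * A = B * (C * C') * (B' * B) * C" unfolding *(1) by (simp add: assoc)
 also have "\<dots> = A" using * by simp
 finally show thesis using that[of "C' * B'"] * by (simp add: fin_mult_left)
qed

lemma left_factor:
 assumes "fin A" "\<And>Y. A * Y = 0 ==> P * Y = 0"
 obtains G where "fin G" "P = P * G * A"
proof -
 obtain G where G: "fin G" "A * G * A = A" using regular[OF assms(1)] .
 then have "A * (1 - G * A) = 0" by (simp add: right_diff_distrib assoc)
 then have "P * (1 - G * A) = 0" by (rule assms(2))
 then show thesis using that[of G] G by (simp add: right_diff_distrib assoc)
qed

text \<open>The defect \<open>P - X * Y\<close> is idempotent with trace \<open>0\<close>, so its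
  rank vanishes.\<close>

lemma idempotent_left_inverse:
 assumes "fin P" "P * P = P" "X = P * X" "X = X * P" "Y = P * Y" "Y = Y * P" "Y * X = P"
 shows "X * Y = P"
proof -
 have fin: "fin X" "fin Y" using assms by (metis fin_mult_right)+
 define D where "D = P - X * Y"
 have "X * Y * (X * Y) = X * (Y * X) * Y" by (simp add: assoc)
 also have "\<dots> = X * Y" using assms by metis
 finally have XYXY: "X * Y * (X * Y) = X * Y" .
 moreover have "P * (X * Y) = X * Y" "X * Y * P = X * Y" using assms by (metis assoc)+
 ultimately have "D * D = D" using assms(2) by (simp add: D_def algebra_simps)
 moreover have finD: "fin D" using fin assms by (auto simp: D_def intro: fin_diff fin_mult_left)
 moreover have "tr D = 0" using fin assms by (simp add: D_def tr_diff fin_mult_left tr_commute[of X Y])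
 ultimately have "rk D = 0" using rk_idempotent[of D] by simp
 then have "D = 0" using finD rk_eq_0 by blast
 then show ?thesis by (simp add: D_def)
qed

lemma idempotent_invertible:
 assumes P: "fin P" "P * P = P" and X: "P * X = X" "X * P = X" and inj: "\<And>Y. X * Y = 0 ==> P * Y = 0"
 obtains Z where "Z * X = P" "X * Z = P" "P * Z = Z" "Z * P = Z"
proof -
 have "fin X" using P X by (metis fin_mult_right)
 then obtain G where G: "P = P * G * X" using left_factor[of X P] inj by blast
 define Z where "Z = P * G * P"
 have "Z * X = P" using G X P by (simp add: Z_def assoc)
 moreover have "P * Z = Z" "Z * P = Z" using P by (simp_all add: Z_def assoc P(2)[THEN assoc_rule])
 moreover have "X * Z = P" using idempotent_left_inverse[OF P, of X Z] calculation X by simp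
 ultimately show thesis using that by blast
qed

text \<open>Frobenius' rank inequality. The idempotent \<open>Q\<close> splits off the part of
  \<open>A\<close> on which left multiplication by \<open>X\<close> loses nothing; \<open>X\<close>
  kills the rest.\<close>

lemma rk_frobenius:
 assumes "fin A"
 shows "rk (X * A) + rk (A * Y) \<le> rk A + rk (X * A * Y)"
proof -
 have finXA: "fin (X * A)" using assms by (rule fin_mult_left)
 obtain G where G: "fin G" "X * A * G * (X * A) = X * A" using regular[OF finXA] .
 define Q where "Q = G * X * A"
 have QQ: "Q * Q = Q" using G(2) by (simp add: Q_def assoc)
 have XAQ: "X * A * Q = X * A" using G(2) by (simp add: Q_def assoc)
 have fin: "fin (A * Q)" "fin (A * (1 - Q))" using assms by (auto intro: fin_mult_right)
 have "A * G * X * (A * Q) = A * (Q * Q)" by (simp add: Q_def assoc)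
 then have 1: "A * G * X * (A * Q) = A * Q" by (simp add: QQ)
 have "A * G * X * (A * (1 - Q)) = A * (Q * (1 - Q))" by (simp add: Q_def assoc)
 then have 2: "A * G * X * (A * (1 - Q)) = 0" by (simp add: right_diff_distrib QQ)
 have 3: "A * Q * Q = A * Q" "A * (1 - Q) * Q = 0" using QQ by (simp_all add: algebra_simps)
 have "rk A = rk (A * Q + A * (1 - Q))" by (simp add: algebra_simps)
 also have "\<dots> = rk (A * Q) + rk (A * (1 - Q))" using rk_direct[OF fin 1 2 3] .
 finally have rA: "rk A = rk (A * Q) + rk (A * (1 - Q))" .
 have "rk (X * A) \<le> rk (A * Q)" using rk_mult_left_le[OF fin(1), of X] XAQ by (simp flip: assoc)
 moreover have "rk (A * Y) \<le> rk (A * Q * Y) + rk (A * (1 - Q) * Y)"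
 proof -
  have "A * Y = A * Q * Y + A * (1 - Q) * Y" by (simp add: algebra_simps)
  then show ?thesis using rk_add_le[OF fin_mult_right[OF fin(1)] fin_mult_right[OF fin(2)]] by metis
 qed
 moreover have "rk (A * Q * Y) \<le> rk (X * A * Y)"
  using rk_mult_left_le[OF fin_mult_right[OF finXA, of Y], of "A * G"] by (simp add: Q_def assoc)
 moreover have "rk (A * (1 - Q) * Y) \<le> rk (A * (1 - Q))" using fin rk_mult_right_le by blast
 ultimately show ?thesis using rA by linarith
qed

text \<open>A rank factorization compresses \<open>A\<close> to an invertible skew matrix of size
  \<open>rk A\<close>. Its determinant is invariant under transposition and yet multiplied by
  \<open>(-1) ^ rk A\<close>.\<close>

lemma even_rk_skew: assumes "fin A" "tp A = - A" shows "even (rk A)"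
proof -
 define r where "r = rk A"
 obtain B C B' C' where *: "A = B * C" "B * idm r = B" "idm r * C = C" "B' * B = idm r" "C * C' = idm r"
  "idm r * B' = B'" "C' * idm r = C'" "fin B" "fin C" "fin B'" "fin C'"
  using rk_factor[OF assms(1)] unfolding r_def by metis
 \<comment> \<open>Chosen so that \<open>B * M = tp C\<close>; then \<open>A\<close> is the
   congruence transform \<open>B * tp M * tp B\<close>.\<close>
 define M where "M = - C * tp B'"
 have tB: "tp B * tp B' = idm r" using *(4) by (metis tp_mult tp_idm)
 have sk: "B * C = - (tp C * tp B)" using assms(2) unfolding *(1) tp_mult by simp
 have "tp C * (tp B * tp B') = - (B * C) * tp B'" using sk by (simp add: assoc)
 moreover have "tp C * idm r = tp C" using *(3) by (metis tp_mult tp_idm)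
 ultimately have BM: "B * M = tp C" using tB by (simp add: M_def assoc)
 have M: "M \<in> cor r"
 proof -
  have "tp B' * idm r = tp B'" using *(6) by (metis tp_mult tp_idm)
  then show ?thesis using *(3) by (simp add: rect_def M_def assoc *(3)[THEN assoc_rule])
 qed
 have "C = tp M * tp B" using BM by (metis tp_mult tp_simps(1))
 then have "B * tp M * tp B = - (B * M * tp B)" using sk BM by (simp add: assoc)
 then have "B' * (B * tp M * tp B) * tp B' = - (B' * (B * M * tp B) * tp B')" by simp
 then have "(B' * B) * tp M * (tp B * tp B') = - ((B' * B) * M * (tp B * tp B'))" by (simp add: assoc)
 then have skM: "tp M = - M" using *(4) tB M rect_tp[OF M] by (simp add: rectD)
 have "idm r * tp C' * B * M = idm r * tp C' * tp C" by (simp add: BM assoc)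
 also have "\<dots> = idm r" using *(5) by (metis tp_mult tp_idm idm_mult_idm min.idem assoc)
 finally have inv: "(idm r * (tp C' * B) * idm r) * M = idm r" using M by (simp add: assoc rectD)
 have "dt r M ~= 0" using dt_mult[OF idm_rect M, of "tp C' * B"] inv by (auto simp: dt_idm assoc)
 moreover have "dt r M = (-1) ^ r * dt r M" using dt_tp[of r M] skM dt_minus by metis
 ultimately show ?thesis unfolding r_def[symmetric] by (auto simp: uminus_power_if split: if_splits)
qed

section \<open>Polynomials in a matrix and square roots\<close>

lemma cor_mult: "A \<in> cor n ==> B \<in> cor n ==> A * B \<in> cor n" by (rule rect_mult)

definition peval :: "complex poly => imat => imat" where
 "peval p A = fold_coeffs (\<lambda>a B. scl a 1 + A * B) p 0"

lemma peval_0 [simp]: "peval 0 A = 0" by (simp add: peval_def)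

lemma peval_pCons [simp]: "peval (pCons a p) A = scl a 1 + A * peval p A"
 by (cases "p = 0 \<and> a = 0") (auto simp: peval_def)

lemma peval_1 [simp]: "peval 1 A = 1" by (simp add: one_pCons)

lemma peval_add [simp]: "peval (p + q) A = peval p A + peval q A"
 by (induction p q rule: poly_induct2) (simp_all add: algebra_simps imat.scale_left_distrib)

lemma peval_smult [simp]: "peval (smult c p) A = scl c (peval p A)"
 by (induction p) (simp_all add: imat.scale_right_distrib)

lemma peval_minus [simp]: "peval (- p) A = - peval p A" using peval_smult[of "-1" p A] by simp

lemma peval_diff [simp]: "peval (p - q) A = peval p A - peval q A" using peval_add[of p "- q" A] by simp

lemma peval_commute: "A * B = B * A ==> peval p A * B = B * peval p A"
 by (induction p) (simp_all add: distrib_left distrib_right assoc, simp flip: assoc)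

lemma peval_mult [simp]: "peval (p * q) A = peval p A * peval q A"
 by (induction p) (simp_all add: distrib_right assoc)

lemma peval_cor_commute: "A \<in> cor n ==> peval p A * idm n = idm n * peval p A" by (rule peval_commute) (simp add: rectD)

lemma peval_cor: assumes "A \<in> cor n" shows "idm n * peval p A \<in> cor n"
 unfolding rect_def by (simp add: assoc peval_cor_commute[OF assms])

lemma peval_conj:
 assumes PQ: "P \<in> cor n" "Q \<in> cor n" "P * Q = idm n" "Q * P = idm n" and B: "B \<in> cor n"
 shows "P * (idm n * peval p B) * Q = idm n * peval p (P * B * Q)"
proof (induction p)
 case (pCons a p)
 define C where "C = P * B * Q"
 define b where "b = idm n * peval p B"
 have "idm n * (B * peval p B) = B * b" using rectD[OF B, THEN assoc_rule] by (simp add: b_def)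
 moreover have "P * (B * b) * Q = C * (P * b * Q)" by (simp add: C_def b_def assoc PQ(4)[THEN assoc_rule])
 moreover have "P * b * Q = idm n * peval p C" using pCons.IH by (simp add: b_def C_def)
 moreover have "C * (idm n * peval p C) = idm n * (C * peval p C)"
  using rect_mult[OF rect_mult[OF PQ(1) B] PQ(2)] rectD[THEN assoc_rule] by (simp add: C_def)
 ultimately show ?case using PQ by (simp add: C_def[symmetric] distrib_left distrib_right rectD)
qed simp

text \<open>The factor of index \<open>k\<close> maps the span of the first \<open>k + 1\<close>
  coordinates into that of the first \<open>k\<close>: the Cayley-Hamilton theorem for triangular
  matrices.\<close>

lemma triangular_annihilated:
 fixes B :: imat and p :: "nat => complex poly"
 assumes B: "\<And>i j. j < i ==> ent B i j = 0"
 shows "peval (\<Prod>i<k. [:- ent B i i, 1:]) B * idm k = 0"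
proof (induction k)
 case (Suc k)
 define D where "D = B - scl (ent B k k) 1"
 have D: "D * idm (Suc k) = idm k * (D * idm (Suc k))" by (rule imat_eqI) (auto simp: D_def ent_one B less_Suc_eq)
 have "peval (\<Prod>i<Suc k. [:- ent B i i, 1:]) B = peval (\<Prod>i<k. [:- ent B i i, 1:]) B * D"
  by (simp add: D_def right_diff_distrib peval_commute)
 also have "\<dots> * idm (Suc k) = peval (\<Prod>i<k. [:- ent B i i, 1:]) B * idm k * (D * idm (Suc k))"
  using D by (simp only: assoc)
 finally show ?case using Suc.IH by simp
qed simp

lemma quadratic_root: assumes "(a::complex) ~= 0 \<or> (b ~= 0)" shows "\<exists>z. a * z\<^sup>2 + b * z + c = 0"
proof -
 have "\<not> constant (poly [:c, b, a:])" using assms by (auto simp: constant_degree)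
 then obtain z where "poly [:c, b, a:] z = 0" using fundamental_theorem_of_algebra by blast
 then show ?thesis by (intro exI[of _ z]) (simp add: power2_eq_square algebra_simps)
qed

text \<open>Repeated roots are allowed. In the induction \<open>r\<close> is corrected by a multiple
  \<open>c\<close> of the product \<open>f\<close> found so far, which gives a quadratic equation
  for \<open>c\<close> at the new root \<open>b k\<close>. It degenerates only if \<open>f\<close>
  and \<open>r\<close> both vanish there, and then \<open>b k = 0\<close>.\<close>

lemma polynomial_square_root:
 fixes b :: "nat => complex"
 assumes "\<And>i. i < k ==> b i ~= 0"
 shows "\<exists>r. (\<Prod>i<k. [:- b i, 1:]) dvd r * r - [:0, 1:]" using assms
proof (induction k)
 case (Suc k)
 define f where "f = (\<Prod>i<k. [:- b i, 1:])"
 obtain r u where ru: "r * r - [:0, 1:] = f * u" using Suc by (auto simp: f_def elim!: dvdE)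
 define m where "m = b k"
 have "poly f m ~= 0 \<or> 2 * poly r m ~= 0"
 proof (rule ccontr)
  assume "\<not> ?thesis"
  then have "poly f m = 0" "poly r m = 0" by auto
  moreover have "poly (r * r - [:0, 1:]) m = poly (f * u) m" by (simp only: ru)
  ultimately have "m = 0" by simp
  with Suc.prems show False by (simp add: m_def)
 qed
 then obtain c where c: "poly f m * c\<^sup>2 + 2 * poly r m * c + poly u m = 0" using quadratic_root by blast
 define w where "w = u + smult c r + smult c r + smult (c\<^sup>2) f"
 have "poly w m = 0" using c by (simp add: w_def algebra_simps)
 then obtain w' where w': "w = [:- m, 1:] * w'" by (auto simp: poly_eq_0_iff_dvd elim!: dvdE)
 have "(r + smult c f) * (r + smult c f) - [:0, 1:] = f * w"
  using ru by (simp add: w_def algebra_simps power2_eq_square)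
 also have "\<dots> = f * [:- m, 1:] * w'" by (simp only: w' assoc)
 finally have "f * [:- m, 1:] dvd (r + smult c f) * (r + smult c f) - [:0, 1:]" by (metis dvd_triv_left)
 then show ?case unfolding f_def m_def by (intro exI[of _ "r + smult c f"]) (simp add: f_def mult.commute)
qed (intro exI, simp)

definition sim :: "nat => imat => imat => bool" where
 "sim n A B \<longleftrightarrow> A \<in> cor n \<and> B \<in> cor n \<and>
   (\<exists>P\<in>cor n. \<exists>Q\<in>cor n. P * Q = idm n \<and> Q * P = idm n \<and> A = P * B * Q)"

lemma sim_of_m: assumes "M \<in> carrier_mat n n" "similar_mat M M'" shows "sim n (of_m M) (of_m M')"
proof -
 obtain P Q where "similar_mat_wit M M' P Q" using assms(2) similar_mat_def by blast
 then have *: "M' \<in> carrier_mat n n" "P \<in> carrier_mat n n" "Q \<in> carrier_mat n n"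
  "P * Q = 1\<^sub>m n" "Q * P = 1\<^sub>m n" "M = P * M' * Q" using assms(1) by (auto simp: similar_mat_wit_def Let_def)
 have "of_m P * of_m Q = idm n" "of_m Q * of_m P = idm n" using * by (metis of_m_mult of_m_one)+
 moreover have "of_m M = of_m P * of_m M' * of_m Q" using * by (metis of_m_mult mult_carrier_mat)
 ultimately show ?thesis unfolding sim_def using * assms(1) of_m_rect by metis
qed

lemma sim_to_m: assumes "sim n A B" shows "similar_mat (to_m n n A) (to_m n n B)"
proof -
 obtain P Q where *: "A \<in> cor n" "B \<in> cor n" "P \<in> cor n" "Q \<in> cor n"
  "P * Q = idm n" "Q * P = idm n" "A = P * B * Q" using assms by (auto simp: sim_def)
 show ?thesis
 proof (rule similar_matI[of _ _ "to_m n n P" "to_m n n Q" n])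
  show "to_m n n P * to_m n n Q = 1\<^sub>m n" "to_m n n Q * to_m n n P = 1\<^sub>m n" using * by (metis to_m_mult to_m_idm)+
  show "to_m n n A = to_m n n P * to_m n n B * to_m n n Q" using * by (metis to_m_mult rect_mult)
 qed auto
qed

lemma sim_sym: "sim n A B ==> sim n B A"
proof -
 assume "sim n A B"
 then obtain P Q where *: "A \<in> cor n" "B \<in> cor n" "P \<in> cor n" "Q \<in> cor n"
  "P * Q = idm n" "Q * P = idm n" "A = P * B * Q" by (auto simp: sim_def)
 have "Q * A * P = (Q * P) * B * (Q * P)" unfolding *(7) by (simp add: assoc)
 then have "B = Q * A * P" using * by (simp add: rectD)
 then show "sim n B A" using * unfolding sim_def by blast
qed

lemma sim_trans: assumes "sim n A B" "sim n B C" shows "sim n A C"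
proof -
 obtain P Q where 1: "A \<in> cor n" "B \<in> cor n" "P \<in> cor n" "Q \<in> cor n"
  "P * Q = idm n" "Q * P = idm n" "A = P * B * Q" using assms by (auto simp: sim_def)
 obtain R S where 2: "C \<in> cor n" "R \<in> cor n" "S \<in> cor n"
  "R * S = idm n" "S * R = idm n" "B = R * C * S" using assms by (auto simp: sim_def)
 have "A = (P * R) * C * (S * Q)" by (simp add: 1(7) 2(6) assoc)
 moreover have "(P * R) * (S * Q) = P * (R * S) * Q" "(S * Q) * (P * R) = S * (Q * P) * R" by (simp_all add: assoc)
 then have "(P * R) * (S * Q) = idm n" "(S * Q) * (P * R) = idm n" using 1 2 by (simp_all add: rectD)
 moreover have "P * R \<in> cor n" "S * Q \<in> cor n" using 1 2 by (auto intro: cor_mult)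
 ultimately show ?thesis using 1(1) 2(1) unfolding sim_def by blast
qed

lemma sim_refl: "A \<in> cor n ==> sim n A A" unfolding sim_def by (intro conjI bexI[of _ "idm n"]) (simp_all add: rectD)

lemma sim_power: assumes "sim n A B" shows "sim n (idm n * A ^ k) (idm n * B ^ k)"
proof -
 obtain P Q where *: "A \<in> cor n" "B \<in> cor n" "P \<in> cor n" "Q \<in> cor n"
  "P * Q = idm n" "Q * P = idm n" "A = P * B * Q" using assms by (auto simp: sim_def)
 have "peval (monom 1 k) M = M ^ k" for M by (induction k) (simp_all add: monom_0 monom_Suc)
 then have "idm n * A ^ k = P * (idm n * B ^ k) * Q" using peval_conj[OF *(3-6,2), of "monom 1 k"] *(7) by metis
 then show ?thesis using * peval_cor[of _ n "monom 1 k"] \<open>\<And>M. peval (monom 1 k) M = M ^ k\<close> unfolding sim_def by metis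
qed

lemma sim_rk: assumes "sim n A B" shows "rk A = rk B"
proof -
 have "rk A \<le> rk B" if "sim n A B" for A B using that rk_mult_le finI unfolding sim_def by metis
 with assms sim_sym show ?thesis by (meson antisym)
qed

lemma dt_sim: assumes "sim n A B" shows "dt n A = dt n B"
proof -
 obtain P Q where *: "B \<in> cor n" "P \<in> cor n" "Q \<in> cor n" "P * Q = idm n" "A = P * B * Q"
  using assms by (auto simp: sim_def)
 have "dt n P * dt n Q = 1" using dt_mult[OF *(2,3)] by (simp add: *(4) dt_idm)
 then show ?thesis using * by (simp add: dt_mult[of _ n] cor_mult)
qed

lemma sim_triangular:
 assumes "A \<in> cor n"
 obtains B where "sim n A B" "\<And>i j. j < i ==> ent B i j = 0"
proof -
 define M where "M = to_m n n A"
 obtain es where "char_poly M = (\<Prod>a\<leftarrow>es. [:- a, 1:])" using char_poly_factorized[of M n] by (auto simp: M_def)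
 then obtain C where C: "C \<in> carrier_mat n n" "upper_triangular C" "similar_mat M C"
  using schur_decomposition_exists[of M n es] by (auto simp: M_def)
 show thesis
 proof (rule that[of "of_m C"])
  show "sim n A (of_m C)" using sim_of_m[OF _ C(3), of n] assms by (simp add: M_def of_m_to_m)
 qed (use C in \<open>auto simp: ent_of_m\<close>)
qed

lemma dt_triangular:
 assumes B: "\<And>i j. j < i ==> ent B i j = 0" shows "dt n B = (\<Prod>i<n. ent B i i)"
proof -
 have "upper_triangular (to_m n n B)" using B by (auto simp: to_m_def)
 then have "dt n B = prod_list (diag_mat (to_m n n B))" unfolding dt_def by (intro det_upper_triangular) auto
 then show ?thesis by (simp add: prod_list_diag_prod to_m_def lessThan_atLeast0)
qed

text \<open>In triangular form the diagonal of an idempotent consists of zeros and ones; the number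
  of ones is the trace, hence the rank.\<close>

lemma dt_involution:
 assumes P: "P \<in> cor n" "P * P = P"
 shows "dt n (idm n - scl 2 P) = (-1) ^ rk P"
proof -
 obtain B where B: "sim n P B" "\<And>i j. j < i ==> ent B i j = 0" using sim_triangular[OF P(1)] by blast
 obtain X Y where *: "B \<in> cor n" "X \<in> cor n" "Y \<in> cor n" "X * Y = idm n" "Y * X = idm n" "P = X * B * Y"
  using B(1) by (auto simp: sim_def)
 have YPX: "B = Y * P * X"
 proof -
  have "Y * P * X = (Y * X) * B * (Y * X)" by (simp only: *(6) assoc)
  then show ?thesis using * by (simp add: rectD)
 qed
 have "B * B = Y * P * X * (Y * P * X)" by (simp only: YPX[symmetric])
 also have "\<dots> = Y * (P * (X * Y * P)) * X" by (simp only: assoc)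
 also have "\<dots> = B" unfolding *(4) rectD(1)[OF P(1)] P(2) by (rule YPX[symmetric])
 finally have BB: "B * B = B" .
 have diag: "ent B i i = 0 \<or> ent B i i = 1" for i
 proof -
  have "ent B i i = (\<Sum>k<n. ent B i k * ent B k i)"
   using arg_cong[OF BB, of "\<lambda>M. ent M i i"] *(1) ent_mult[of "{..<n}" B i B i] by (auto simp: rect_iff)
  also have "\<dots> = (\<Sum>k<n. if k = i then ent B i i * ent B i i else 0)"
   by (intro sum.cong) (auto, metis B(2) linorder_neqE_nat)
  also have "\<dots> = ent B i i * ent B i i" using *(1) by (auto simp: rect_iff)
  finally show ?thesis by auto
 qed
 define S where "S = {i \<in> {..<n}. ent B i i = 1}"
 have "of_nat (rk P) = (\<Sum>i<n. ent B i i)"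
  using rk_idempotent[of B] BB *(1) sim_rk[OF B(1)] tr_eq[OF *(1) order_refl] finI by metis
 also have "\<dots> = (\<Sum>i<n. of_bool (ent B i i = 1))" using diag by (intro sum.cong refl) force
 also have "\<dots> = of_nat (card S)" by (simp add: S_def Int_def)
 finally have rk: "rk P = card S" by (simp only: of_nat_eq_iff)
 have "sim n (idm n - scl 2 P) (idm n - scl 2 B)" unfolding sim_def using * P
  by (intro conjI bexI[of _ X] bexI[of _ Y]) (auto simp: algebra_simps rectD intro!: rect_diff rect_scl)
 then have "dt n (idm n - scl 2 P) = (\<Prod>i<n. ent (idm n - scl 2 B) i i)"
  using dt_sim dt_triangular[of "idm n - scl 2 B"] B(2) by (simp add: ent_idm)
 also have "\<dots> = (\<Prod>i<n. if i \<in> S then -1 else 1)" using diag by (intro prod.cong refl) (force simp: S_def ent_idm)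
 also have "\<dots> = (-1) ^ card S" by (simp add: prod.If_cases S_def Int_def)
 finally show ?thesis by (simp add: rk)
qed

text \<open>The root is a polynomial in \<open>A\<close>, so it commutes with all that commutes with
  \<open>A\<close> and is self-adjoint when \<open>A\<close> is. The applications rest on
  this.\<close>

lemma square_root:
 assumes A: "A \<in> cor n" and inv: "A' \<in> cor n" "A * A' = idm n"
 obtains r where "idm n * peval r A * (idm n * peval r A) = A"
proof -
 obtain B where B: "sim n A B" "\<And>i j. j < i ==> ent B i j = 0" using sim_triangular[OF A] by blast
 then obtain P Q where PQ: "B \<in> cor n" "P \<in> cor n" "Q \<in> cor n"
  "P * Q = idm n" "Q * P = idm n" "A = P * B * Q" by (auto simp: sim_def)
 have "dt n B ~= 0" using cor_invertible_dt[OF A inv] dt_sim[OF B(1)] by auto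
 then have nz: "\<forall>i<n. ent B i i ~= 0" using dt_triangular[of B n] B(2) by simp
 then obtain r where r: "(\<Prod>i<n. [:- ent B i i, 1:]) dvd r * r - [:0, 1:]"
  using polynomial_square_root[of n "\<lambda>i. ent B i i"] nz by blast
 have "peval (\<Prod>i<n. [:- ent B i i, 1:]) B * idm n = 0" using B(2) by (rule triangular_annihilated)
 moreover obtain w where w: "r * r - [:0, 1:] = (\<Prod>i<n. [:- ent B i i, 1:]) * w" using r by (rule dvdE)
 have "peval (r * r - [:0, 1:]) B = peval w B * peval (\<Prod>i<n. [:- ent B i i, 1:]) B"
  unfolding w by (subst mult.commute) (rule peval_mult)
 ultimately have "peval (r * r - [:0, 1:]) B * idm n = 0" by (simp only: assoc mult_zero_right)
 then have "peval (r * r) B * idm n = B" using PQ(1) by (simp add: left_diff_distrib rectD)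
 then have "idm n * peval (r * r) B = B" by (simp only: peval_cor_commute[OF PQ(1)])
 then have "idm n * peval (r * r) A = A" using peval_conj[OF PQ(2-5,1), of "r * r"] PQ(6) by simp
 moreover have "idm n * peval r A * (idm n * peval r A) = idm n * peval (r * r) A"
  by (simp add: assoc) (metis peval_cor_commute[OF A] assoc idm_mult_idm min.idem)
 ultimately show thesis using that by simp
qed

section \<open>Bilinear forms\<close>

locale bilinear_form =
 fixes N :: nat and J J' :: imat and \<epsilon> :: complex
 assumes J: "J \<in> cor N" and J': "J' \<in> cor N" and JJ': "J * J' = idm N"
  and tpJ: "tp J = scl \<epsilon> J" and eps: "\<epsilon> = 1 \<or> \<epsilon> = -1"
begin

definition star :: "imat => imat" where "star A = J' * tp A * J"

lemma J'J: "J' * J = idm N" using cor_inverse_commutes[OF J J' JJ'] .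

lemma eps2 [simp]: "\<epsilon> * \<epsilon> = 1" using eps by auto

lemma tpJ': "tp J' = scl \<epsilon> J'"
proof -
 have "tp J' * tp J = idm N" using arg_cong[OF JJ', of tp] by (simp add: tp_mult)
 then have "scl \<epsilon> (tp J' * J) = idm N" by (simp add: tpJ)
 then have "scl \<epsilon> (tp J' * J * J') = J'" using J' by (metis rectD(1) scl_mult_left)
 then have "scl \<epsilon> (tp J') = J'" using rectD(2)[OF rect_tp[OF J']] by (simp add: assoc JJ')
 then show ?thesis by (metis eps2 imat.scale_one imat.scale_scale)
qed

lemma star_cor: "star A \<in> cor N"
 unfolding star_def rect_def using J J' by (simp add: assoc rectD) (simp add: rectD flip: assoc)

lemma star_add: "star (A + B) = star A + star B"
 and star_diff: "star (A - B) = star A - star B"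
 and star_minus: "star (- A) = - star A"
 and star_scl: "star (scl c A) = scl c (star A)"
 and star_0 [simp]: "star 0 = 0" by (simp_all add: star_def algebra_simps)

lemma star_sum: "star (\<Sum>x\<in>S. f x) = (\<Sum>x\<in>S. star (f x))" by (simp add: star_def tp_sum sum_distrib)

lemma star_idm [simp]: "star (idm N) = idm N" using J' by (simp add: star_def J'J rectD)

lemma star_mult: assumes "A \<in> cor N" shows "star (A * B) = star B * star A"
proof -
 have "star B * star A = J' * tp B * (J * J') * tp A * J" by (simp add: star_def assoc)
 also have "\<dots> = J' * tp B * (idm N * tp A) * J" by (simp add: JJ' assoc)
 finally show ?thesis using rectD(1)[OF rect_tp[OF assms]] by (simp add: star_def tp_mult assoc)
qed

lemma star_star: assumes "A \<in> cor N" shows "star (star A) = A"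
proof -
 have "star (star A) = scl (\<epsilon> * \<epsilon>) (J' * J * A * (J' * J))" by (simp add: star_def tp_mult tpJ tpJ' assoc)
 then show ?thesis using assms by (simp add: J'J rectD)
qed

lemma J_star: "A \<in> cor N ==> J * star A = tp A * J" using rectD(1)[OF rect_tp] by (simp add: star_def JJ' flip: assoc)

lemma star_power: assumes "A \<in> cor N" shows "star (idm N * A ^ k) = idm N * star A ^ k"
proof (induction k)
 case (Suc k)
 have "star (idm N * A ^ Suc k) = star (A * (idm N * A ^ k))" using assms by (simp add: rectD flip: assoc)
 also have "\<dots> = idm N * star A ^ k * star A" using assms Suc.IH by (simp add: star_mult)
 finally show ?case by (simp add: assoc power_commutes)
qed simp

lemma star_peval: assumes "A \<in> cor N" shows "star (idm N * peval p A) = idm N * peval p (star A)"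
proof (induction p)
 case (pCons a p)
 have "star (idm N * peval (pCons a p) A) = star (scl a (idm N) + A * (idm N * peval p A))"
  using assms by (simp add: distrib_left rectD flip: assoc)
 also have "\<dots> = scl a (idm N) + idm N * peval p (star A) * star A"
  using assms pCons.IH by (simp add: star_add star_scl star_mult)
 also have "\<dots> = idm N * peval (pCons a p) (star A)" by (simp add: distrib_left assoc peval_commute)
 finally show ?case .
qed simp

lemma dt_star: "A \<in> cor N ==> dt N (star A) = dt N A"
proof -
 assume A: "A \<in> cor N"
 have "dt N J' * dt N J = 1" using dt_mult[OF J' J] by (simp add: J'J dt_idm)
 moreover have "dt N (star A) = dt N J' * dt N A * dt N J"
  unfolding star_def using A J J' by (simp add: dt_mult[of _ N] cor_mult rect_tp dt_tp)
 ultimately show ?thesis by simp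
qed

lemma rk_star: assumes "A \<in> cor N" shows "rk (star A) = rk A"
proof -
 have "rk (star A) \<le> rk A" if "A \<in> cor N" for A
  using rk_mult_le[of "tp A" J' J] rk_tp[of A] finI[OF that] by (simp add: star_def fin_tp)
 from this[OF assms] this[OF star_cor, of A] show ?thesis using star_star[OF assms] by simp
qed

text \<open>The condition on \<open>star A\<close> says that \<open>J * A\<close> is skew-symmetric,
  and \<open>J\<close> is invertible.\<close>

lemma even_rk_skew_form:
 assumes "A \<in> cor N" "star A = scl (- \<epsilon>) A" shows "even (rk A)"
proof -
 have "tp (J * A) = - (J * A)"
 proof -
  have "tp (J * A) = scl \<epsilon> (tp A * J)" by (simp add: tp_mult tpJ)
  also have "\<dots> = scl \<epsilon> (J * star A)" by (simp only: J_star[OF assms(1)])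
  also have "\<dots> = - (J * A)" unfolding assms(2) by simp
  finally show ?thesis .
 qed
 moreover have fA: "fin A" using assms finI by blast
 ultimately have "even (rk (J * A))" by (intro even_rk_skew fin_mult_left)
 moreover have "rk (J * A) = rk A"
 proof (rule antisym)
  show "rk (J * A) \<le> rk A" using fA by (rule rk_mult_left_le)
  have "A = J' * (J * A)" using assms(1) J'J by (simp add: rectD flip: assoc)
  then show "rk A \<le> rk (J * A)" using rk_mult_left_le fA fin_mult_left by metis
 qed
 ultimately show ?thesis by simp
qed

definition isometry :: "imat => bool" where
 "isometry g \<longleftrightarrow> g \<in> cor N \<and> star g * g = idm N"

lemma isometryD: assumes "isometry g" shows "g \<in> cor N" "star g * g = idm N" "g * star g = idm N" "isometry (star g)"
proof -
 show *: "g \<in> cor N" "star g * g = idm N" using assms by (auto simp: isometry_def)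
 show "g * star g = idm N" using cor_inverse_commutes[OF star_cor *] .
 then show "isometry (star g)" unfolding isometry_def using star_star[OF *(1)] star_cor by simp
qed

lemma isometry_mult: assumes "isometry g" "isometry h" shows "isometry (g * h)"
proof -
 note g = isometryD[OF assms(1)] note h = isometryD[OF assms(2)]
 have "star (g * h) * (g * h) = star h * (star g * g) * h" using g(1) by (simp add: star_mult assoc)
 then show ?thesis using g h by (simp add: isometry_def cor_mult rectD(2)[OF star_cor])
qed

lemma dt_isometry: assumes "isometry g" shows "dt N g = 1 \<or> dt N g = -1"
proof -
 note g = isometryD[OF assms]
 have "dt N g * dt N g = 1" using dt_mult[OF star_cor g(1), of g] g by (simp add: dt_star dt_idm)
 then show ?thesis by (simp add: square_eq_1_iff)
qed

text \<open>With a square root \<open>s\<close> of \<open>g\<close> that is a polynomial in \<open>g\<close>, the involution \<open>star s * s\<close> is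
 self-adjoint and has the same determinant as \<open>g\<close>.\<close>

lemma isometry_projection:
 assumes "isometry g"
 obtains P where "P \<in> cor N" "P * P = P" "star P = P" "dt N g = (-1) ^ rk P"
  "\<And>B. B \<in> cor N ==> B * g = g * B ==> B * P = P * B"
proof -
 note g = isometryD[OF assms]
 obtain r where r: "idm N * peval r g * (idm N * peval r g) = g" using square_root[OF g(1) star_cor g(3)] .
 define s where "s = idm N * peval r g"
 have s: "s \<in> cor N" "s * s = g" using peval_cor[OF g(1)] r by (auto simp: s_def)
 have star_s: "star s = idm N * peval r (star g)" using g by (simp add: s_def star_peval)
 have comm: "B * s = s * B" if "B \<in> cor N" "B * g = g * B" for B
  using that(1) peval_commute[OF that(2)[symmetric], of r] by (simp add: s_def assoc rectD[THEN assoc_rule] rectD)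
 have comm': "B * star s = star s * B" if "B \<in> cor N" "B * g = g * B" for B
 proof -
  have "star g * (B * g) * star g = star g * (g * B) * star g" using that by simp
  then have "star g * B * (g * star g) = (star g * g) * B * star g" by (simp add: assoc)
  then have "star g * B = B * star g" using g that star_cor by (simp add: assoc rectD rectD[THEN assoc_rule])
  from peval_commute[OF this, of r] show ?thesis using that(1)
   by (simp add: star_s assoc rectD rectD[THEN assoc_rule])
 qed
 define t where "t = star s * s"
 have "s * g = g * s" using s(2) by (metis assoc)
 then have ss: "s * star s = star s * s" by (rule comm'[OF s(1)])
 have star_s2: "star s * star s = star g" using star_mult[OF s(1), of s] s by simp
 have "t * t = star s * (s * star s) * s" by (simp add: t_def assoc)
 also have "\<dots> = star s * star s * (s * s)" by (simp add: ss assoc)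
 also have "\<dots> = idm N" using star_s2 s g by simp
 finally have tt: "t * t = idm N" .
 have t: "t \<in> cor N" "star t = t" using s star_cor by (auto simp: t_def cor_mult star_mult star_star)
 \<comment> \<open>The projection onto the \<open>-1\<close> eigenspace of the involution
   \<open>t\<close>, so that \<open>t = idm N - scl 2 P\<close>.\<close>
 define P where "P = scl (1/2) (idm N - t)"
 have half: "scl (1/4) M + scl (1/4) M = scl (1/2) M" for M by (simp flip: imat.scale_left_distrib)
 have "P * P = scl (1/4) (idm N - t) + scl (1/4) (idm N - t)"
  using t by (simp add: P_def left_diff_distrib right_diff_distrib tt rectD imat.scale_right_diff_distrib)
 then have PP: "P * P = P" by (simp only: half P_def)
 show thesis
 proof (rule that[of P])
  show P: "P \<in> cor N" unfolding P_def by (intro rect_scl rect_diff idm_cor t)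
  show "P * P = P" by fact
  show "star P = P" using t by (simp add: P_def star_scl star_diff)
  have "idm N - scl 2 P = t" by (simp add: P_def)
  then have "dt N t = (-1) ^ rk P" using dt_involution[OF P PP] by simp
  moreover have "dt N t = dt N s * dt N s" using s star_cor by (simp add: t_def dt_mult dt_star)
  moreover have "dt N g = dt N s * dt N s" using dt_mult[OF s(1) s(1)] s(2) by simp
  ultimately show "dt N g = (-1) ^ rk P" by simp
  fix B assume B: "B \<in> cor N" "B * g = g * B"
  have "B * t = t * B" using comm[OF B] comm'[OF B] by (metis t_def assoc)
  then show "B * P = P * B" using B(1) by (simp add: P_def right_diff_distrib left_diff_distrib rectD)
 qed
qed

text \<open>For \<open>\<epsilon> = -1\<close> a self-adjoint projection is skew for the form, so
  its rank is even.\<close>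

lemma dt_symplectic: assumes "isometry g" "\<epsilon> = -1" shows "dt N g = 1"
proof -
 obtain P where P: "P \<in> cor N" "star P = P" "dt N g = (-1) ^ rk P" using isometry_projection[OF assms(1)] by metis
 have "even (rk P)" using P assms by (intro even_rk_skew_form) auto
 then show ?thesis using P by simp
qed

text \<open>Polar decomposition of the conjugating matrix \<open>P\<close>:
  \<open>star P * P\<close> commutes with \<open>A\<close>, hence so does its polynomial square root
  \<open>s\<close>, and \<open>P\<close> times the inverse of \<open>s\<close> is an isometry with
  the same effect on \<open>A\<close>.\<close>

lemma conjugate_by_isometry:
 assumes "A \<in> cor N" "star A = - A" "star B = - B" "sim N B A"
 obtains g where "isometry g" "B = g * A * star g"
proof -
 obtain P Q where PQ: "B \<in> cor N" "P \<in> cor N" "Q \<in> cor N" "P * Q = idm N" "Q * P = idm N" "B = P * A * Q"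
  using assms(4) by (auto simp: sim_def)
 define h where "h = star P * P"
 have h: "h \<in> cor N" "star h = h" using PQ star_cor by (auto simp: h_def cor_mult star_mult star_star)
 have "star Q * star P = idm N" "star P * star Q = idm N"
  using star_mult[OF PQ(2), of Q] star_mult[OF PQ(3), of P] PQ(4,5) by (metis star_idm)+
 then have "h * (Q * star Q) = idm N"
  using PQ by (simp add: h_def assoc PQ(4)[THEN assoc_rule] rectD(1)[OF star_cor])
 moreover have Qc: "Q * star Q \<in> cor N" using PQ star_cor by (simp add: cor_mult)
 ultimately obtain r where r: "idm N * peval r h * (idm N * peval r h) = h" using square_root[OF h(1)] by blast
 have BP: "B * P = P * A" using PQ assms(1) by (simp add: assoc rectD)
 have "star (B * P) = star (P * A)" by (simp add: BP)
 then have "star P * B = A * star P" using PQ assms by (simp add: star_mult)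
 then have Ah: "h * A = A * h" using BP by (metis h_def assoc)
 define s where "s = idm N * peval r h"
 have s: "s \<in> cor N" "s * s = h" "star s = s" using h r by (auto simp: s_def peval_cor star_peval)
 have sA: "s * A = A * s"
  using assms(1) peval_commute[OF Ah, of r] by (simp add: s_def assoc rectD rectD[THEN assoc_rule])
 define s' where "s' = s * (Q * star Q)"
 have s': "s' \<in> cor N" "s * s' = idm N" "s' * s = idm N"
 proof -
  show a: "s' \<in> cor N" using s Qc by (simp add: s'_def cor_mult)
  show b: "s * s' = idm N" using \<open>h * (Q * star Q) = idm N\<close> by (simp add: s'_def s(2)[symmetric] assoc)
  show "s' * s = idm N" using cor_inverse_commutes[OF s(1) a b] .
 qed
 have star_s': "star s' = s'"
 proof -
  have "s * star s' = idm N" using star_mult[OF s'(1), of s] s' s by simp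
  then have "s' * (s * star s') = s'" using s' by (simp add: rectD)
  then show ?thesis using s' rectD(1)[OF star_cor] by (simp flip: assoc)
 qed
 define g where "g = P * s'"
 have "star g * g = s' * (star P * P) * s'" using PQ by (simp add: g_def star_mult star_s' assoc)
 also have "\<dots> = (s' * s) * (s * s')" by (simp add: h_def[symmetric] s(2)[symmetric] assoc)
 finally have g: "isometry g" using PQ s' by (simp add: isometry_def g_def cor_mult)
 have "g * s = P" using PQ s' by (simp add: g_def assoc rectD)
 have "B * g = P * A * s'" using BP by (simp add: g_def flip: assoc)
 also have "\<dots> = g * (s * A) * s'" using \<open>g * s = P\<close> by (simp flip: assoc)
 also have "\<dots> = g * A * (s * s')" by (simp add: sA assoc)
 also have "\<dots> = g * A" using s' assms(1) by (simp add: assoc rectD)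
 finally have "B * (g * star g) = g * A * star g" by (simp flip: assoc)
 then show thesis using that[OF g] isometryD(3)[OF g] PQ by (simp add: rectD)
qed

end

text \<open>\<open>J' * K\<close> is self-adjoint for \<open>J\<close>, hence so is its polynomial
  square root \<open>S\<close>, and \<open>tp S * J * S = J * S * S = K\<close>.\<close>

lemma forms_congruent:
 assumes "bilinear_form N J J' e" "bilinear_form N K K' e"
 obtains S S' where "S \<in> cor N" "S' \<in> cor N" "S * S' = idm N" "S' * S = idm N" "tp S * J * S = K"
proof -
 interpret J: bilinear_form N J J' e by fact
 interpret K: bilinear_form N K K' e by fact
 define h where "h = J' * K"
 have h: "h \<in> cor N" using J.J' K.J by (simp add: h_def cor_mult)
 have "h * (K' * J) = J' * (K * K') * J" by (simp add: h_def assoc)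
 then have hinv: "h * (K' * J) = idm N" using J.J' J.J'J K.JJ' by (simp add: rectD)
 have c: "K' * J \<in> cor N" using J.J K.J' by (simp add: cor_mult)
 obtain r where r: "idm N * peval r h * (idm N * peval r h) = h" using square_root[OF h c hinv] .
 have "J.star h = scl (e * e) (J' * K * (J' * J))" by (simp add: J.star_def h_def tp_mult K.tpJ J.tpJ' assoc)
 then have star_h: "J.star h = h" using K.J J.J'J by (simp add: h_def rectD assoc)
 define S where "S = idm N * peval r h"
 have S: "S \<in> cor N" "S * S = h" "J.star S = S" using h r star_h by (auto simp: S_def peval_cor J.star_peval)
 have "tp S * J = J * S" using J.J_star[OF S(1)] S(3) by simp
 then have "tp S * J * S = J * (S * S)" by (simp add: assoc)
 also have "\<dots> = K" using K.J J.JJ' by (simp add: S h_def rectD flip: assoc)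
 finally have "tp S * J * S = K" .
 moreover have "S * (S * (K' * J)) = idm N" using S hinv by (simp flip: assoc)
 moreover have "S * (K' * J) \<in> cor N" using S c by (simp add: cor_mult)
 ultimately show thesis using that S(1) cor_inverse_commutes by blast
qed

section \<open>Algebraic representations of \<open>SL\<^sub>2\<close>\<close>

subsection \<open>Laurent expansions\<close>

lemma rect_ent_0: "A \<in> rect m n ==> \<not> (i < m \<and> j < n) ==> ent A i j = 0" unfolding rect_iff by blast

text \<open>After multiplication by a power of \<open>s\<close>, each entry is a polynomial with
  infinitely many roots.\<close>

lemma laurent_zero:
 fixes A :: "int => imat"
 assumes fin: "finite Z" and zero: "\<And>s. s ~= 0 ==> (\<Sum>z\<in>Z. scl (s powi z) (A z)) = 0" and z: "z \<in> Z"
 shows "A z = 0"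
proof (rule imat_eqI)
 fix i j
 define D where "D = nat (Max (abs ` Z))"
 have D: "- int D \<le> z" if "z \<in> Z" for z using that fin Max_ge[of "abs ` Z" "\<bar>z\<bar>"] by (simp add: D_def abs_le_iff)
 define p where "p = (\<Sum>z\<in>Z. monom (ent (A z) i j) (nat (z + int D)))"
 have "poly p s = 0" if "s ~= 0" for s
 proof -
  have "poly p s = (\<Sum>z\<in>Z. s ^ D * (s powi z * ent (A z) i j))" unfolding p_def poly_sum
  proof (intro sum.cong refl)
   fix z assume "z \<in> Z"
   then have "z + int D \<ge> 0" using D by force
   then have "s ^ nat (z + int D) = s powi (z + int D)" by (simp add: power_int_nonneg_exp)
   also have "\<dots> = s powi z * s ^ D" using that by (simp add: power_int_add)
   finally show "poly (monom (ent (A z) i j) (nat (z + int D))) s = s ^ D * (s powi z * ent (A z) i j)"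
    by (simp add: poly_monom)
  qed
  also have "\<dots> = s ^ D * ent (\<Sum>z\<in>Z. scl (s powi z) (A z)) i j" by (simp add: sum_distrib_left)
  finally show ?thesis using zero[OF that] by simp
 qed
 then have "UNIV - {0} \<subseteq> {s. poly p s = 0}" by auto
 moreover have "infinite (UNIV - {0 :: complex})" by (simp add: infinite_UNIV_char_0)
 ultimately have "p = 0" using poly_roots_finite finite_subset by blast
 have "coeff p (nat (z + int D)) = (\<Sum>y\<in>Z. if y = z then ent (A y) i j else 0)" unfolding p_def coeff_sum
 proof (intro sum.cong refl)
  fix y assume "y \<in> Z"
  then have "nat (y + int D) = nat (z + int D) \<longleftrightarrow> y = z" using D[OF z] D[of y] by auto
  then show "coeff (monom (ent (A y) i j) (nat (y + int D))) (nat (z + int D))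
    = (if y = z then ent (A y) i j else 0)" by (simp add: coeff_monom)
 qed
 then show "ent (A z) i j = ent 0 i j" using \<open>p = 0\<close> fin z by simp
qed

lemma laurent_unique:
 fixes A B :: "int => imat"
 assumes "finite Z" "\<And>s. s ~= 0 ==> (\<Sum>z\<in>Z. scl (s powi z) (A z)) = (\<Sum>z\<in>Z. scl (s powi z) (B z))" "z \<in> Z"
 shows "A z = B z"
 using laurent_zero[of Z "\<lambda>z. A z - B z" z] assms by (simp add: imat.scale_right_diff_distrib sum_subtractf)

lemma polynomial_unique:
 fixes A B :: "nat => imat"
 assumes "\<And>t. (\<Sum>k\<le>D. scl (t ^ k) (A k)) = (\<Sum>k\<le>D. scl (t ^ k) (B k))" "k \<le> D"
 shows "A k = B k"
proof -
 have e: "(\<Sum>k\<le>D. scl (t ^ k) (F k)) = (\<Sum>z\<in>int ` {..D}. scl (t powi z) (F (nat z)))" for t and F :: "nat => imat"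
  by (simp add: sum.reindex)
 show ?thesis using laurent_unique[of "int ` {..D}" "\<lambda>z. A (nat z)" "\<lambda>z. B (nat z)" "int k"] assms by (simp add: e)
qed

lemma laurent_group:
 fixes A :: "'x => imat"
 assumes "finite I"
 shows "(\<Sum>x\<in>I. scl (s powi e x) (A x)) = (\<Sum>z\<in>e ` I. scl (s powi z) (\<Sum>x | x \<in> I \<and> e x = z. A x))"
proof -
 have "(\<Sum>x\<in>I. scl (s powi e x) (A x)) = (\<Sum>z\<in>e ` I. \<Sum>x | x \<in> I \<and> e x = z. scl (s powi e x) (A x))"
  using assms by (rule sum.image_gen)
 also have "\<dots> = (\<Sum>z\<in>e ` I. scl (s powi z) (\<Sum>x | x \<in> I \<and> e x = z. A x))"
  unfolding imat.scale_sum_right by (intro sum.cong refl) auto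
 finally show ?thesis .
qed

definition poly_map :: "(complex => imat) => bool" where
 "poly_map F \<longleftrightarrow> (\<exists>D A. \<forall>t. F t = (\<Sum>k\<le>D. scl (t ^ k) (A k)))"

lemma poly_mapI: "(\<And>t. F t = (\<Sum>k\<le>D. scl (t ^ k) (A k))) ==> poly_map F"
 unfolding poly_map_def by (intro exI[of _ D] exI[of _ A]) simp

lemma poly_map_const: "poly_map (\<lambda>t. Y)" by (rule poly_mapI[where D = 0 and A = "\<lambda>_. Y"]) simp

lemma poly_map_mult: assumes "poly_map F" "poly_map G" shows "poly_map (\<lambda>t. F t * G t)"
proof -
 obtain D A E B where F: "\<And>t. F t = (\<Sum>k\<le>D. scl (t ^ k) (A k))" and G: "\<And>t. G t = (\<Sum>k\<le>(E::nat). scl (t ^ k) (B k))"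
  using assms unfolding poly_map_def by metis
 define I where "I = {..D} \<times> {..E}"
 have "F t * G t = (\<Sum>n\<le>D + E. scl (t ^ n) (\<Sum>x | x \<in> I \<and> fst x + snd x = n. A (fst x) * B (snd x)))" for t
 proof -
  have "F t * G t = (\<Sum>j\<le>D. \<Sum>k\<le>E. scl (t ^ j) (A j) * scl (t ^ k) (B k))" unfolding F G by (rule sum_product)
  also have "\<dots> = (\<Sum>x\<in>I. scl (t ^ (fst x + snd x)) (A (fst x) * B (snd x)))"
   by (simp add: I_def sum.cartesian_product' power_add mult.commute)
  also have "\<dots> = (\<Sum>n\<le>D + E. \<Sum>x | x \<in> I \<and> fst x + snd x = n. scl (t ^ (fst x + snd x)) (A (fst x) * B (snd x)))"
   by (intro sum.group[symmetric]) (auto simp: I_def)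
  also have "\<dots> = (\<Sum>n\<le>D + E. scl (t ^ n) (\<Sum>x | x \<in> I \<and> fst x + snd x = n. A (fst x) * B (snd x)))"
   unfolding imat.scale_sum_right by (intro sum.cong) auto
  finally show ?thesis .
 qed
 then show ?thesis by (rule poly_mapI)
qed

lemma poly_map_uminus: assumes "poly_map F" shows "poly_map (\<lambda>t. F (- t))"
proof -
 obtain D A where F: "\<And>t. F t = (\<Sum>k\<le>D. scl (t ^ k) (A k))" using assms unfolding poly_map_def by metis
 have "F (- t) = (\<Sum>k\<le>D. scl (t ^ k) (scl ((-1) ^ k) (A k)))" for t
  unfolding F by (intro sum.cong refl) (simp add: power_minus[of t] mult.commute)
 then show ?thesis by (rule poly_mapI)
qed

text \<open>A function that is polynomial in \<open>t\<close> and also in \<open>inverse t\<close>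
  has only a constant Laurent coefficient.\<close>

lemma poly_map_constant:
 assumes "poly_map F" "poly_map G" and eq: "\<And>t. t ~= 0 ==> F (inverse t) = G t"
 shows "F t = F 0"
proof -
 obtain D A E B where F: "\<And>t. F t = (\<Sum>k\<le>D. scl (t ^ k) (A k))" and G: "\<And>t. G t = (\<Sum>k\<le>(E::nat). scl (t ^ k) (B k))"
  using assms(1,2) unfolding poly_map_def by metis
 define A' B' where "A' z = (if z \<le> 0 then A (nat (- z)) else 0)" and "B' z = (if z \<ge> 0 then B (nat z) else 0)" for z
 have "(\<Sum>z\<in>{- int D..int E}. scl (t powi z) (A' z)) = (\<Sum>z\<in>{- int D..int E}. scl (t powi z) (B' z))" if "t ~= 0" for t
 proof -
  have "F (inverse t) = (\<Sum>z\<in>{- int D..0}. scl (t powi z) (A' z))"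
   unfolding F A'_def by (intro sum.reindex_bij_witness[of _ "\<lambda>z. nat (- z)" "\<lambda>k. - int k"])
    (auto simp: power_int_minus power_inverse)
  also have "\<dots> = (\<Sum>z\<in>{- int D..int E}. scl (t powi z) (A' z))" by (intro sum.mono_neutral_left) (auto simp: A'_def)
  finally have 1: "F (inverse t) = \<dots>" .
  have "G t = (\<Sum>z\<in>{0..int E}. scl (t powi z) (B' z))"
   unfolding G B'_def by (intro sum.reindex_bij_witness[of _ nat int]) auto
  also have "\<dots> = (\<Sum>z\<in>{- int D..int E}. scl (t powi z) (B' z))" by (intro sum.mono_neutral_left) (auto simp: B'_def)
  finally show ?thesis using 1 eq[OF that] by simp
 qed
 note AB = laurent_unique[OF _ this]
 have "A k = 0" if "k \<le> D" "k ~= 0" for k using AB[of "- int k"] that by (simp add: A'_def B'_def)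
 then have "F t = (\<Sum>k\<le>D. if k = 0 then A 0 else 0)" for t unfolding F by (intro sum.cong) auto
 then show ?thesis by simp
qed

subsection \<open>Generators of \<open>SL\<^sub>2\<close>\<close>

definition mat2 :: "complex => complex => complex => complex => complex mat" where
 "mat2 a b c d = mat_of_rows_list 2 [[a, b], [c, d]]"

lemma mat2_carrier [simp]: "mat2 a b c d \<in> carrier_mat 2 2"
 by (simp add: mat2_def mat_of_rows_list_def numeral_2_eq_2)

lemma mat2_entries [simp]:
 "mat2 a b c d $$ (0, 0) = a" "mat2 a b c d $$ (0, Suc 0) = b"
 "mat2 a b c d $$ (Suc 0, 0) = c" "mat2 a b c d $$ (Suc 0, Suc 0) = d"
 by (simp_all add: mat2_def mat_of_rows_list_def)

lemma mat2_mult: "mat2 a b c d * mat2 a' b' c' d' = mat2 (a*a'+b*c') (a*b'+b*d') (c*a'+d*c') (c*b'+d*d')"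
proof (rule eq_matI)
 fix i j
 assume "i < dim_row (mat2 (a*a'+b*c') (a*b'+b*d') (c*a'+d*c') (c*b'+d*d'))"
  "j < dim_col (mat2 (a*a'+b*c') (a*b'+b*d') (c*a'+d*c') (c*b'+d*d'))"
 then have "i = 0 \<or> i = 1" "j = 0 \<or> j = 1" by (auto simp: mat2_def mat_of_rows_list_def)
 then show "(mat2 a b c d * mat2 a' b' c' d') $$ (i, j) = mat2 (a*a'+b*c') (a*b'+b*d') (c*a'+d*c') (c*b'+d*d') $$ (i, j)"
  using carrier_matD[OF mat2_carrier] by (auto simp: scalar_prod_def numeral_2_eq_2)
qed (simp_all add: carrier_matD[OF mat2_carrier])

lemma mat2_one: "mat2 1 0 0 1 = 1\<^sub>m 2"
proof (rule eq_matI)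
 fix i j
 assume "i < dim_row (1\<^sub>m 2 :: complex mat)" "j < dim_col (1\<^sub>m 2 :: complex mat)"
 then have "i = 0 \<or> i = 1" "j = 0 \<or> j = 1" by auto
 then show "mat2 1 0 0 1 $$ (i, j) = 1\<^sub>m 2 $$ (i, j)" by auto
qed (simp_all add: carrier_matD[OF mat2_carrier])

lemma mat2_eta: "x \<in> carrier_mat 2 2 ==> x = mat2 (x $$ (0,0)) (x $$ (0,1)) (x $$ (1,0)) (x $$ (1,1))"
proof (rule eq_matI)
 fix i j
 assume "i < dim_row (mat2 (x $$ (0,0)) (x $$ (0,1)) (x $$ (1,0)) (x $$ (1,1)))"
  "j < dim_col (mat2 (x $$ (0,0)) (x $$ (0,1)) (x $$ (1,0)) (x $$ (1,1)))"
 then have "i = 0 \<or> i = 1" "j = 0 \<or> j = 1" by (auto simp: mat2_def mat_of_rows_list_def)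
 then show "x $$ (i, j) = mat2 (x $$ (0,0)) (x $$ (0,1)) (x $$ (1,0)) (x $$ (1,1)) $$ (i, j)" by auto
qed (simp_all add: carrier_matD[OF mat2_carrier])

lemma det_mat2: "Determinant.det (mat2 a b c d) = a * d - b * c"
proof -
 have c: "mat_delete (mat2 a b c d) i j \<in> carrier_mat 1 1" for i j
  using mat_delete_carrier[OF mat2_carrier, of a b c d i j] by simp
 have "Determinant.det (mat2 a b c d) = (\<Sum>j<2. mat2 a b c d $$ (0, j) * cofactor (mat2 a b c d) 0 j)"
  by (rule laplace_expansion_row[OF mat2_carrier]) simp
 then have "Determinant.det (mat2 a b c d)
   = (\<Sum>j<2. mat2 a b c d $$ (0, j) * ((-1) ^ (0 + j) * mat_delete (mat2 a b c d) 0 j $$ (0, 0)))"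
  by (simp only: cofactor_def det_single[OF c])
 then show ?thesis by (simp add: mat_delete_def carrier_matD[OF mat2_carrier] numeral_2_eq_2)
qed

lemma mat2_SL2: "mat2 a b c d \<in> carrier SL2 \<longleftrightarrow> a * d - b * c = 1" by (simp add: SL2_def matrix_group_def det_mat2)

lemma SL2_cases:
 assumes "x \<in> carrier SL2"
 obtains a b c d where "x = mat2 a b c d" "a * d - b * c = 1"
proof -
 have "x \<in> carrier_mat 2 2" using assms by (simp add: SL2_def matrix_group_def)
 then show thesis using mat2_eta[of x] mat2_SL2 assms that by metis
qed

lemma SL2_simps: "\<one>\<^bsub>SL2\<^esub> = 1\<^sub>m 2" "x \<otimes>\<^bsub>SL2\<^esub> y = x * y" by (simp_all add: SL2_def matrix_group_def)

lemma SL2_one: "1\<^sub>m 2 \<in> carrier SL2" using mat2_SL2[of 1 0 0 1] by (simp add: mat2_one)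

lemma SL2_mult: "x \<in> carrier SL2 ==> y \<in> carrier SL2 ==> x * y \<in> carrier SL2"
 by (auto simp: SL2_def matrix_group_def det_mult[of _ 2])

abbreviation "upp t \<equiv> mat2 1 t 0 1"
abbreviation "low t \<equiv> mat2 1 0 t 1"
abbreviation "dgm s \<equiv> mat2 s 0 0 (inverse s)"
abbreviation "wey \<equiv> mat2 0 1 (-1) 0"

text \<open>Bruhat decomposition: a matrix with lower left entry \<open>0\<close> is diagonal times
  unipotent, any other one is
  \<open>upp (a / c) * dgm (- 1 / c) * wey * upp (d / c)\<close>.\<close>

lemma SL2_induct [consumes 1, case_names upp dgm wey mult]:
 assumes x: "x \<in> carrier SL2"
  and upp: "\<And>t. P (upp t)" and dgm: "\<And>s. s ~= 0 ==> P (dgm s)" and wey: "P wey"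
  and mult: "\<And>x y. x \<in> carrier SL2 ==> y \<in> carrier SL2 ==> P x ==> P y ==> P (x * y)"
 shows "P x"
proof -
 obtain a b c d where x: "x = mat2 a b c d" "a * d - b * c = 1" using SL2_cases[OF x] .
 show ?thesis
 proof (cases "c = 0")
  case True
  then have "a ~= 0" "d = inverse a" using x(2) inverse_unique[of a d] by auto
  then have "x = dgm a * upp (b / a)" using True by (simp add: x(1) mat2_mult)
  then show ?thesis using mult[OF _ _ dgm upp, of a "b / a"] \<open>a ~= 0\<close> by (simp add: mat2_SL2)
 next
  case False
  have "b * c = a * d - 1" using x(2) by (simp only: diff_eq_eq eq_diff_eq add.commute)
  then have "b = (a * d - 1) / c" using False by (simp only: nonzero_eq_divide_eq not_False_eq_True)
  then have "b = a * (d / c) - 1 / c" by (simp only: diff_divide_distrib times_divide_eq_right)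
  moreover have "upp (a / c) * (dgm (- 1 / c) * (wey * upp (d / c))) = mat2 a (a * (d / c) - 1 / c) c d"
   using False by (simp add: mat2_mult)
  ultimately have "x = upp (a / c) * (dgm (- 1 / c) * (wey * upp (d / c)))" by (simp only: x(1))
  moreover have "P (dgm (- 1 / c) * (wey * upp (d / c)))"
   using False by (intro mult dgm wey upp) (auto simp: mat2_SL2 mat2_mult)
  then have "P (upp (a / c) * (dgm (- 1 / c) * (wey * upp (d / c))))"
   by (rule mult[OF _ _ upp, rotated 2]) (use False in \<open>auto simp: mat2_SL2 mat2_mult\<close>)
  ultimately show ?thesis by simp
 qed
qed

definition SL2_monomial :: "complex mat => nat \<times> nat \<times> nat \<times> nat => complex" where
 "SL2_monomial x = (\<lambda>(i, j, k, l). x $$ (0,0) ^ i * x $$ (0,1) ^ j * x $$ (1,0) ^ k * x $$ (1,1) ^ l)"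

section \<open>Weights and the nilpotent generator of an algebraic representation\<close>

locale sl2_rep =
 fixes N :: nat and \<tau> :: "complex mat => imat"
 assumes \<tau>_cor: "x \<in> carrier SL2 ==> \<tau> x \<in> cor N"
  and \<tau>_mult: "x \<in> carrier SL2 ==> y \<in> carrier SL2 ==> \<tau> (x * y) = \<tau> x * \<tau> y"
  and \<tau>_one: "\<tau> (1\<^sub>m 2) = idm N"
  and \<tau>_regular: "\<exists>S C. finite S \<and> (\<forall>x\<in>carrier SL2. \<tau> x = (\<Sum>m\<in>S. scl (SL2_monomial x m) (C m)))"
begin

lemma regular_expansion:
 obtains S C where "finite S" "\<And>x. x \<in> carrier SL2 ==> \<tau> x = (\<Sum>m\<in>S. scl (SL2_monomial x m) (C m))" "\<And>m. C m \<in> cor N"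
proof -
 obtain S C where S: "finite S" "\<And>x. x \<in> carrier SL2 ==> \<tau> x = (\<Sum>m\<in>S. scl (SL2_monomial x m) (C m))"
  using \<tau>_regular by blast
 have "\<tau> x = (\<Sum>m\<in>S. scl (SL2_monomial x m) (idm N * C m * idm N))" if "x \<in> carrier SL2" for x
 proof -
  have "\<tau> x = idm N * \<tau> x * idm N" using \<tau>_cor[OF that] by (simp add: rectD)
  then show ?thesis unfolding S(2)[OF that] by (simp only: sum_distrib scl_mult)
 qed
 then show thesis by (intro that[of S "\<lambda>m. idm N * C m * idm N"] S(1) idm_rect)
qed

text \<open>A derivative, so as to agree with \<open>nilpotent_of_phi\<close>;
  \<open>nil_eqI\<close> recovers the algebraic description as a linear coefficient.\<close>

definition nil :: imat where
 "nil = of_m (mat N N (\<lambda>(i, j). deriv (\<lambda>t. ent (\<tau> (upp t)) i j) 0))"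

lemma nil_cor: "nil \<in> cor N" unfolding nil_def by (rule of_m_rect) simp

lemma nil_eqI:
 assumes A: "\<And>t. \<tau> (upp t) = (\<Sum>k\<le>D. scl (t ^ k) (A k))" "A 1 \<in> cor N" and D: "D \<ge> 1"
 shows "nil = A 1"
proof (rule imat_eqI)
 fix i j
 define p where "p = (\<Sum>k\<le>D. monom (ent (A k) i j) k)"
 have "(\<lambda>t. ent (\<tau> (upp t)) i j) = poly p" by (simp add: A(1) p_def poly_sum poly_monom fun_eq_iff mult.commute)
 moreover have "deriv (poly p) 0 = ent (A 1) i j" using DERIV_imp_deriv[OF poly_DERIV[of p 0]] D
  by (simp add: poly_0_coeff_0 coeff_pderiv p_def coeff_sum coeff_monom)
 ultimately show "ent nil i j = ent (A 1) i j" using rect_ent_0[OF A(2), of i j] rect_ent_0[OF nil_cor, of i j]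
  by (cases "i < N \<and> j < N") (auto simp: nil_def ent_of_m)
qed

lemma weights_exist:
 "\<exists>P D. (\<forall>s. s ~= 0 --> \<tau> (dgm s) = (\<Sum>z\<in>{-int D..int D}. scl (s powi z) (P z))) \<and>
   (\<forall>z. P z \<in> cor N) \<and> (\<forall>z. \<bar>z\<bar> > int D --> P z = 0)"
proof -
 obtain S C where S: "finite S" "\<And>x. x \<in> carrier SL2 ==> \<tau> x = (\<Sum>m\<in>S. scl (SL2_monomial x m) (C m))" "\<And>m. C m \<in> cor N"
  using regular_expansion by blast
 define e :: "nat \<times> nat \<times> nat \<times> nat => int" where "e = (\<lambda>(i, j, k, l). int i - int l)"
 \<comment> \<open>The off-diagonal entries of \<open>dgm s\<close> are \<open>0\<close>, so only
   monomials with \<open>j = k = 0\<close> survive.\<close>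
 define B where "B = (\<lambda>(i, j, k, l). scl (0 ^ j * 0 ^ k) (C (i, j, k, l)))"
 define P where "P z = (\<Sum>m | m \<in> S \<and> e m = z. B m)" for z
 define D where "D = nat (Max (abs ` e ` S))"
 have D: "\<bar>e m\<bar> \<le> int D" if "m \<in> S" for m
 proof -
  have "\<bar>e m\<bar> \<le> Max (abs ` e ` S)" using that S(1) by (intro Max_ge) auto
  then show ?thesis unfolding D_def by linarith
 qed
 have P0: "P z = 0" if "z \<notin> e ` S" for z unfolding P_def using that by (intro sum.neutral) blast
 have "\<tau> (dgm s) = (\<Sum>z\<in>{-int D..int D}. scl (s powi z) (P z))" if s: "s ~= 0" for s
 proof -
  have "\<tau> (dgm s) = (\<Sum>m\<in>S. scl (s powi e m) (B m))"
   using s by (subst S(2)) (auto simp: mat2_SL2 B_def SL2_monomial_def e_def power_int_diff power_inverse divide_inverse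
    mult_ac intro!: sum.cong)
  also have "\<dots> = (\<Sum>z\<in>e ` S. scl (s powi z) (P z))" unfolding P_def by (rule laurent_group[OF S(1)])
  also have "\<dots> = (\<Sum>z\<in>{-int D..int D}. scl (s powi z) (P z))"
   using D P0 by (intro sum.mono_neutral_left) (auto simp: abs_le_iff minus_le_iff)
  finally show ?thesis .
 qed
 moreover have "P z \<in> cor N" for z unfolding P_def B_def using S(3) by (intro rect_sum) (auto intro: rect_scl)
 moreover have "P z = 0" if "\<bar>z\<bar> > int D" for z using that D by (intro P0) force
 ultimately show ?thesis by blast
qed

definition wt :: "int => imat" where
 "wt = (SOME P. \<exists>D. (\<forall>s. s ~= 0 --> \<tau> (dgm s) = (\<Sum>z\<in>{-int D..int D}. scl (s powi z) (P z))) \<and>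
   (\<forall>z. P z \<in> cor N) \<and> (\<forall>z. \<bar>z\<bar> > int D --> P z = 0))"

lemma weights:
 obtains D where "\<And>s. s ~= 0 ==> \<tau> (dgm s) = (\<Sum>z\<in>{-int D..int D}. scl (s powi z) (wt z))"
  "\<And>z. wt z \<in> cor N" "\<And>z. \<bar>z\<bar> > int D ==> wt z = 0" using someI_ex[OF weights_exist] unfolding wt_def by blast

definition wbound :: nat where
 "wbound = (SOME D. (\<forall>s. s ~= 0 --> \<tau> (dgm s) = (\<Sum>z\<in>{-int D..int D}. scl (s powi z) (wt z))) \<and>
   (\<forall>z. \<bar>z\<bar> > int D --> wt z = 0))"

lemma dgm_expansion: "s ~= 0 ==> \<tau> (dgm s) = (\<Sum>z\<in>{-int wbound..int wbound}. scl (s powi z) (wt z))"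
 and wt_outside: "\<bar>z\<bar> > int wbound ==> wt z = 0"
proof -
 have "\<exists>D. (\<forall>s. s ~= 0 --> \<tau> (dgm s) = (\<Sum>z\<in>{-int D..int D}. scl (s powi z) (wt z))) \<and>
   (\<forall>z. \<bar>z\<bar> > int D --> wt z = 0)" using weights by metis
 from someI_ex[OF this]
 show "s ~= 0 ==> \<tau> (dgm s) = (\<Sum>z\<in>{-int wbound..int wbound}. scl (s powi z) (wt z))"
  "\<bar>z\<bar> > int wbound ==> wt z = 0" unfolding wbound_def by blast+
qed

lemma wt_cor: "wt z \<in> cor N" using weights by metis

abbreviation "wts \<equiv> {-int wbound..int wbound}"

lemma wt_notin: "z \<notin> wts ==> wt z = 0" by (intro wt_outside) auto

lemma sum_wt: "(\<Sum>z\<in>wts. wt z) = idm N" using dgm_expansion[of 1] by (simp add: mat2_one \<tau>_one)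

lemma dgm_mult: "s ~= 0 ==> t ~= 0 ==> \<tau> (dgm (s * t)) = \<tau> (dgm s) * \<tau> (dgm t)"
proof -
 assume st: "s ~= 0" "t ~= 0"
 have "\<tau> (dgm (s * t)) = \<tau> (dgm s * dgm t)" by (simp add: mat2_mult)
 also have "\<dots> = \<tau> (dgm s) * \<tau> (dgm t)" using st by (intro \<tau>_mult) (simp_all add: mat2_SL2)
 finally show ?thesis .
qed

lemma wt_dgm: assumes "t ~= 0" shows "wt z * \<tau> (dgm t) = scl (t powi z) (wt z)"
proof (cases "z \<in> wts")
 case True
 have "(\<Sum>z\<in>wts. scl (s powi z) (wt z * \<tau> (dgm t))) = (\<Sum>z\<in>wts. scl (s powi z) (scl (t powi z) (wt z)))"
  if "s ~= 0" for s
 proof -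
  have "(\<Sum>z\<in>wts. scl (s powi z) (wt z * \<tau> (dgm t))) = \<tau> (dgm s) * \<tau> (dgm t)"
   using that by (simp add: dgm_expansion[of s] sum_distrib_right)
  also have "\<dots> = \<tau> (dgm (s * t))" using dgm_mult[OF that assms] by (rule sym)
  also have "\<dots> = (\<Sum>z\<in>wts. scl (s powi z) (scl (t powi z) (wt z)))"
   using that assms by (subst dgm_expansion) (simp_all add: power_int_mult_distrib)
  finally show ?thesis .
 qed
 from laurent_unique[OF _ this True] show ?thesis by simp
qed (simp add: wt_notin)

lemma wt_wt: "wt z * wt w = (if z = w then wt z else 0)"
proof (cases "w \<in> wts")
 case True
 have "(\<Sum>w\<in>wts. scl (t powi w) (wt z * wt w)) = (\<Sum>w\<in>wts. scl (t powi w) (if z = w then wt z else 0))"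
  if "t ~= 0" for t
 proof -
  have "(\<Sum>w\<in>wts. scl (t powi w) (wt z * wt w)) = wt z * \<tau> (dgm t)"
   using that by (simp add: dgm_expansion sum_distrib_left)
  also have "\<dots> = scl (t powi z) (wt z)" using that by (rule wt_dgm)
  also have "\<dots> = (\<Sum>w\<in>wts. if w = z then scl (t powi z) (wt z) else 0)" by (simp add: wt_notin)
  also have "\<dots> = (\<Sum>w\<in>wts. scl (t powi w) (if z = w then wt z else 0))" by (intro sum.cong) auto
  finally show ?thesis .
 qed
 from laurent_unique[OF _ this True] show ?thesis by simp
qed (auto simp: wt_notin)

lemma dgm_wt: assumes "t ~= 0" shows "\<tau> (dgm t) * wt z = scl (t powi z) (wt z)"
proof -
 have "\<tau> (dgm t) * wt z = (\<Sum>w\<in>wts. if w = z then scl (t powi z) (wt z) else 0)"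
  using assms by (simp add: dgm_expansion sum_distrib_right wt_wt if_distrib cong: if_cong)
 then show ?thesis by (simp add: wt_notin)
qed

lemma cor_wt_decomp: "A \<in> cor N ==> A = (\<Sum>z\<in>wts. wt z * A)" "A \<in> cor N ==> A = (\<Sum>z\<in>wts. A * wt z)"
 by (simp_all add: sum_wt rectD flip: sum_distrib_right sum_distrib_left)

lemma gradedI:
 assumes A: "A \<in> cor N" and zero: "\<And>w z. w ~= z + a ==> wt w * A * wt z = 0"
 shows "A * wt z = wt (z + a) * A"
proof -
 have "A * wt z = (\<Sum>w\<in>wts. wt w * (A * wt z))" using A wt_cor cor_mult by (intro cor_wt_decomp) blast
 also have "\<dots> = (\<Sum>w\<in>wts. if w = z + a then wt (z + a) * A * wt z else 0)"
  using zero by (intro sum.cong) (auto simp: assoc)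
 also have "\<dots> = wt (z + a) * A * wt z" by (simp add: wt_notin)
 finally have 1: "A * wt z = wt (z + a) * A * wt z" .
 have "wt (z + a) * A = (\<Sum>w\<in>wts. wt (z + a) * A * wt w)" using A wt_cor cor_mult by (intro cor_wt_decomp) blast
 also have "\<dots> = (\<Sum>w\<in>wts. if w = z then wt (z + a) * A * wt z else 0)" using zero by (intro sum.cong) auto
 also have "\<dots> = wt (z + a) * A * wt z" by (simp add: wt_notin)
 finally show ?thesis using 1 by simp
qed

text \<open>As \<open>2\<close> is not a root of unity, the single element \<open>dgm 2\<close>
  already separates all weights.\<close>

lemma shift_weight:
 assumes A: "A \<in> cor N" and c: "\<tau> (dgm 2) * A = scl (2 powi a) (A * \<tau> (dgm 2))"
 shows "A * wt z = wt (z + a) * A"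
proof (rule gradedI[OF A])
 fix w z assume that: "w ~= z + a"
 have "wt w * (\<tau> (dgm 2) * A) * wt z = wt w * scl (2 powi a) (A * \<tau> (dgm 2)) * wt z" by (simp only: c)
 then have "scl (2 powi w) (wt w * A * wt z) = scl (2 powi (z + a)) (wt w * A * wt z)"
  using wt_dgm[of 2 w] dgm_wt[of 2 z] by (simp add: assoc power_int_add) (simp add: assoc[symmetric] mult.commute)
 then have "scl (2 powi w - 2 powi (z + a)) (wt w * A * wt z) = 0" by (simp add: imat.scale_left_diff_distrib)
 moreover have "(2::complex) powi w ~= 2 powi (z + a)"
 proof
  assume "(2::complex) powi w = 2 powi (z + a)"
  then have "complex_of_real (2 powi w) = complex_of_real (2 powi (z + a))" by simp
  then have "(2::real) powi w = 2 powi (z + a)" by (simp only: of_real_eq_iff)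
  moreover have "w < z + a \<or> z + a < w" using that by linarith
  ultimately show False
   using power_int_strict_increasing[of w "z + a" "2::real"] power_int_strict_increasing[of "z + a" w "2::real"] by auto
 qed
 ultimately show "wt w * A * wt z = 0" by simp
qed

text \<open>The factor \<open>idm N\<close> turns the zeroth power into the unit of the
  corner.\<close>

definition div_pow :: "nat => imat" where
 "div_pow k = scl (1 / fact k) (idm N * nil ^ k)"

text \<open>The representation of \<open>upp t\<close> is the exponential of \<open>t\<close> times
  \<open>nil\<close>. Comparing coefficients in the addition law for \<open>upp\<close> expresses
  \<open>A 1 * A k\<close> as \<open>k + 1\<close> times \<open>A (k + 1)\<close>, so the
  coefficients are divided powers.\<close>

lemma upp_coefficients:
 obtains D where "\<And>t. \<tau> (upp t) = (\<Sum>k\<le>D. scl (t ^ k) (div_pow k))" "\<And>k. k > D ==> div_pow k = 0" "D \<ge> 1"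
proof -
 obtain S C where S: "finite S" "\<And>x. x \<in> carrier SL2 ==> \<tau> x = (\<Sum>m\<in>S. scl (SL2_monomial x m) (C m))" "\<And>m. C m \<in> cor N"
  using regular_expansion by blast
 define e :: "nat \<times> nat \<times> nat \<times> nat => nat" where "e = (\<lambda>(i, j, k, l). j)"
 define B where "B = (\<lambda>(i, j, k, l). scl (0 ^ k) (C (i, j, k, l)))"
 define A where "A n = sum B {m \<in> S. e m = n}" for n
 define D where "D = Max (insert 1 (e ` S))"
 have D: "D \<ge> 1" "\<And>m. m \<in> S ==> e m \<le> D" unfolding D_def using S(1) by (auto intro!: Max_ge)
 have A0: "A k = 0" if "k > D" for k unfolding A_def using D(2) that by (intro sum.neutral) force
 have A: "\<tau> (upp t) = (\<Sum>k\<le>D. scl (t ^ k) (A k))" for t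
 proof -
  have "\<tau> (upp t) = (\<Sum>m\<in>S. scl (t ^ e m) (B m))"
   by (subst S(2)) (auto simp: mat2_SL2 B_def SL2_monomial_def e_def intro!: sum.cong)
  also have "\<dots> = (\<Sum>k\<le>D. \<Sum>m | m \<in> S \<and> e m = k. scl (t ^ e m) (B m))"
   using D(2) by (intro sum.group[OF S(1), symmetric]) auto
  also have "\<dots> = (\<Sum>k\<le>D. scl (t ^ k) (A k))" unfolding A_def imat.scale_sum_right by (intro sum.cong) auto
  finally show ?thesis .
 qed
 have "A k \<in> cor N" for k unfolding A_def B_def using S(3) by (intro rect_sum) (auto intro: rect_scl)
 then have A1: "A 1 = nil" using nil_eqI[OF A _ D(1)] by simp
 have add: "\<tau> (upp (s + t)) = \<tau> (upp s) * \<tau> (upp t)" for s t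
  using \<tau>_mult[of "upp s" "upp t"] by (simp add: mat2_SL2 mat2_mult add.commute)
 have deriv: "A 1 * \<tau> (upp t) = (\<Sum>n\<le>D. scl (of_nat n * t ^ (n - 1)) (A n))" for t
 proof -
  have "(\<Sum>k\<le>D. scl (s ^ k) (A k * \<tau> (upp t))) = (\<Sum>k\<le>D. scl (s ^ k) (\<Sum>n\<le>D. scl (of_nat (n choose k) * t ^ (n - k)) (A n)))" for s
  proof -
   have "(\<Sum>k\<le>D. scl (s ^ k) (A k * \<tau> (upp t))) = \<tau> (upp s) * \<tau> (upp t)" by (simp add: A[of s] sum_distrib_right)
   also have "\<dots> = (\<Sum>n\<le>D. scl ((s + t) ^ n) (A n))" by (subst add[symmetric]) (rule A)
   also have "\<dots> = (\<Sum>n\<le>D. \<Sum>k\<le>D. scl (s ^ k * (of_nat (n choose k) * t ^ (n - k))) (A n))"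
   proof (intro sum.cong refl)
    fix n assume n: "n \<in> {..D}"
    have "(s + t) ^ n = (\<Sum>k\<le>n. s ^ k * (of_nat (n choose k) * t ^ (n - k)))"
     unfolding binomial_ring by (intro sum.cong) (auto simp: mult_ac)
    also have "\<dots> = (\<Sum>k\<le>D. s ^ k * (of_nat (n choose k) * t ^ (n - k)))"
     using n by (intro sum.mono_neutral_left) auto
    finally show "scl ((s + t) ^ n) (A n) = (\<Sum>k\<le>D. scl (s ^ k * (of_nat (n choose k) * t ^ (n - k))) (A n))"
     by (simp add: imat.scale_sum_left)
   qed
   also have "\<dots> = (\<Sum>k\<le>D. \<Sum>n\<le>D. scl (s ^ k * (of_nat (n choose k) * t ^ (n - k))) (A n))" by (rule sum.swap)
   finally show ?thesis by (simp add: imat.scale_sum_right)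
  qed
  from polynomial_unique[OF this D(1)] show ?thesis by simp
 qed
 have step: "A 1 * A k = scl (of_nat (Suc k)) (A (Suc k))" if "k \<le> D" for k
 proof -
  have "(\<Sum>k\<le>D. scl (t ^ k) (A 1 * A k)) = (\<Sum>k\<le>D. scl (t ^ k) (scl (of_nat (Suc k)) (A (Suc k))))" for t
  proof -
   have "(\<Sum>k\<le>D. scl (t ^ k) (A 1 * A k)) = A 1 * \<tau> (upp t)" by (simp add: A sum_distrib_left)
   also have "\<dots> = (\<Sum>n\<le>Suc D. scl (of_nat n * t ^ (n - 1)) (A n))" unfolding deriv by (simp add: A0)
   also have "\<dots> = (\<Sum>k\<le>D. scl (of_nat (Suc k) * t ^ k) (A (Suc k)))" by (subst sum.atMost_Suc_shift) simp
   finally show ?thesis by (simp add: mult.commute)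
  qed
  from polynomial_unique[OF this that] show ?thesis .
 qed
 have A0_idm: "A 0 = idm N"
 proof -
  have "idm N = (\<Sum>k\<le>D. scl (0 ^ k) (A k))" using A[of 0] by (simp add: mat2_one \<tau>_one)
  also have "\<dots> = (\<Sum>k\<le>D. if k = 0 then A 0 else 0)" by (intro sum.cong) auto
  finally show ?thesis by simp
 qed
 \<comment> \<open>The range includes \<open>Suc D\<close>, where \<open>A\<close> vanishes; this is
   what makes \<open>nil\<close> nilpotent.\<close>
 have Ak: "A k = div_pow k" if "k \<le> Suc D" for k using that
 proof (induction k)
  case 0
  then show ?case by (simp add: A0_idm div_pow_def)
 next
  case (Suc k)
  have "scl (of_nat (Suc k)) (A (Suc k)) = nil * div_pow k" using step[of k] Suc A1 by simp
  also have "nil * div_pow k = scl (1 / fact k) (idm N * nil ^ Suc k)"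
   using nil_cor by (simp add: div_pow_def rectD flip: assoc)
  finally have "scl (inverse (of_nat (Suc k))) (scl (of_nat (Suc k)) (A (Suc k)))
    = scl (inverse (of_nat (Suc k))) (scl (1 / fact k) (idm N * nil ^ Suc k))" by simp
  then show ?case by (simp add: div_pow_def field_simps del: of_nat_Suc power_Suc)
 qed
 show thesis
 proof (rule that[of D])
  show "\<tau> (upp t) = (\<Sum>k\<le>D. scl (t ^ k) (div_pow k))" for t unfolding A by (intro sum.cong) (auto simp: Ak)
  fix k assume "k > D"
  have "div_pow (Suc D) = 0" using Ak[of "Suc D"] A0 by simp
  then have z: "idm N * nil ^ Suc D = 0" by (simp add: div_pow_def del: power_Suc fact_Suc)
  have "nil ^ k = nil ^ Suc D * nil ^ (k - Suc D)" using \<open>k > D\<close> by (metis Suc_leI le_add_diff_inverse power_add)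
  then have "idm N * nil ^ k = 0" using z by (metis assoc mult_zero_left)
  then show "div_pow k = 0" by (simp add: div_pow_def)
 qed (rule D(1))
qed

lemma div_pow_1: "div_pow 1 = nil" using nil_cor by (simp add: div_pow_def rectD)

section \<open>The Weyl element and rigidity of polynomial one-parameter families\<close>

definition weyl :: imat where "weyl = \<tau> wey"
definition weyl' :: imat where "weyl' = \<tau> (mat2 0 (-1) 1 0)"

lemma weyl: "weyl \<in> cor N" "weyl' \<in> cor N" "weyl * weyl' = idm N" "weyl' * weyl = idm N"
 using \<tau>_mult[of wey "mat2 0 (-1) 1 0"] \<tau>_mult[of "mat2 0 (-1) 1 0" wey]
 by (auto simp: weyl_def weyl'_def mat2_SL2 mat2_mult mat2_one \<tau>_one intro!: \<tau>_cor)

lemma poly_map_upp: "poly_map (\<lambda>t. \<tau> (upp t))" unfolding poly_map_def using upp_coefficients by metis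

lemma poly_map_low: "poly_map (\<lambda>t. \<tau> (low t))"
proof -
 have "(\<lambda>t. \<tau> (low t)) = (\<lambda>t. weyl' * \<tau> (upp (- t)) * weyl)"
  using \<tau>_mult[of "mat2 0 (-1) 1 0" "upp (- t)" for t] \<tau>_mult[of "mat2 0 (-1) 1 0 * upp (- t)" wey for t]
  by (simp add: weyl_def weyl'_def mat2_SL2 mat2_mult)
 then show ?thesis by (simp only: poly_map_mult poly_map_const poly_map_uminus[OF poly_map_upp])
qed

lemma nil_wt: "nil * wt z = wt (z + 2) * nil"
proof (rule shift_weight[OF nil_cor])
 obtain D where D: "\<And>t. \<tau> (upp t) = (\<Sum>k\<le>D. scl (t ^ k) (div_pow k))" "D \<ge> 1" using upp_coefficients by metis
 have "(\<Sum>k\<le>D. scl (t ^ k) (\<tau> (dgm 2) * div_pow k)) = (\<Sum>k\<le>D. scl (t ^ k) (scl (4 ^ k) (div_pow k * \<tau> (dgm 2))))" for t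
 proof -
  have "dgm 2 * upp t = upp (4 * t) * dgm 2" by (simp add: mat2_mult)
  then have "\<tau> (dgm 2) * \<tau> (upp t) = \<tau> (upp (4 * t)) * \<tau> (dgm 2)"
   using \<tau>_mult[of "dgm 2" "upp t"] \<tau>_mult[of "upp (4 * t)" "dgm 2"] by (simp add: mat2_SL2)
  then show ?thesis by (simp add: D(1) sum_distrib power_mult_distrib mult.commute)
 qed
 from polynomial_unique[OF this D(2)]
 show "\<tau> (dgm 2) * nil = scl (2 powi 2) (nil * \<tau> (dgm 2))" by (simp only: div_pow_1) simp
qed

lemma power_shift_wt:
 assumes "\<And>z. X * wt z = wt (z + 2) * X" shows "X ^ k * wt z = wt (z + 2 * int k) * X ^ k"
proof (induction k)
 case (Suc k)
 have "X ^ Suc k * wt z = X * wt (z + 2 * int k) * X ^ k" by (simp add: Suc.IH assoc)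
 also have "X * wt (z + 2 * int k) = wt (z + 2 * int (Suc k)) * X" unfolding assms by (simp add: algebra_simps)
 finally show ?case by (simp add: assoc)
qed simp

lemmas nil_power_wt = power_shift_wt[OF nil_wt]

lemma div_pow_wt: "div_pow k * wt z = wt (z + 2 * int k) * div_pow k"
proof -
 have "idm N * wt (z + 2 * int k) = wt (z + 2 * int k) * idm N" using rectD[OF wt_cor] by simp
 then show ?thesis by (simp add: div_pow_def assoc nil_power_wt) (simp flip: assoc)
qed

lemma weyl_dgm: "s ~= 0 ==> weyl * \<tau> (dgm s) = \<tau> (dgm (inverse s)) * weyl"
 using \<tau>_mult[of wey "dgm s"] \<tau>_mult[of "dgm (inverse s)" wey] by (simp add: weyl_def mat2_SL2 mat2_mult)

lemma weyl_wt: "weyl * wt z = wt (- z) * weyl"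
proof (cases "z \<in> wts")
 case True
 have "(\<Sum>z\<in>wts. scl (s powi z) (weyl * wt z)) = (\<Sum>z\<in>wts. scl (s powi z) (wt (- z) * weyl))" if "s ~= 0" for s
 proof -
  have "(\<Sum>z\<in>wts. scl (s powi z) (weyl * wt z)) = weyl * \<tau> (dgm s)"
   using that by (simp add: dgm_expansion sum_distrib_left)
  also have "\<dots> = \<tau> (dgm (inverse s)) * weyl" using that by (rule weyl_dgm)
  also have "\<dots> = (\<Sum>z\<in>wts. scl (inverse s powi z) (wt z * weyl))"
   using that by (simp only: dgm_expansion[of "inverse s"] sum_distrib_right scl_mult_left inverse_nonzero_iff_nonzero not_False_eq_True)
  also have "\<dots> = (\<Sum>z\<in>wts. scl (s powi z) (wt (- z) * weyl))"
   using that by (intro sum.reindex_bij_witness[of _ uminus uminus]) (auto simp: power_int_minus power_int_inverse)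
  finally show ?thesis .
 qed
 from laurent_unique[OF _ this True] show ?thesis by simp
qed (auto simp: wt_notin)

text \<open>An identity in \<open>SL2\<close> in which the lower unipotent depends on
  \<open>inverse t\<close> and the upper ones on \<open>t\<close>; it is the source of both rigidity
  arguments that follow.\<close>

lemma lower_upper: assumes "t ~= 0" shows "\<tau> (low (- inverse t)) * \<tau> (upp t) = \<tau> (upp (- t)) * \<tau> (dgm t) * weyl"
proof -
 have "low (- inverse t) * upp t = upp (- t) * dgm t * wey" using assms by (simp add: mat2_mult)
 moreover have "upp (- t) * dgm t \<in> carrier SL2" using assms by (simp add: mat2_mult mat2_SL2)
 ultimately show ?thesis using assms \<tau>_mult[of "low (- inverse t)" "upp t"] \<tau>_mult[of "upp (- t) * dgm t" wey]
  \<tau>_mult[of "upp (- t)" "dgm t"] by (simp add: weyl_def mat2_SL2)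
qed

text \<open>If \<open>nil ^ m\<close> kills a vector \<open>V\<close> of weight \<open>- m\<close>, then the component of weight \<open>m\<close> of
 \<open>lower_upper\<close>, applied to \<open>V\<close> and divided by \<open>t ^ m\<close>, expresses \<open>weyl * V\<close> as a polynomial in
 \<open>1 / t\<close> without constant term.\<close>

lemma nil_power_injective:
 assumes "nil ^ m * wt (- int m) * Y = 0" shows "wt (- int m) * Y = 0"
proof -
 define V where "V = wt (- int m) * Y"
 obtain D where D: "\<And>t. \<tau> (upp t) = (\<Sum>k\<le>D. scl (t ^ k) (div_pow k))" "\<And>k. k > D ==> div_pow k = 0"
  using upp_coefficients by metis
 have NV: "div_pow k * V = 0" if "k \<ge> m" for k
 proof -
  have "nil ^ k = nil ^ (k - m) * nil ^ m" using that by (simp flip: power_add)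
  moreover have "nil ^ m * V = 0" using assms by (simp add: V_def assoc)
  ultimately have "nil ^ k * V = 0" by (simp add: assoc)
  then show ?thesis by (simp add: div_pow_def assoc)
 qed
 have U: "\<tau> (upp t) * V = (\<Sum>k<m. scl (t ^ k) (div_pow k * V))" for t
  unfolding D(1) sum_distrib_right scl_mult_left by (rule sum.mono_neutral_cong) (auto simp: NV D(2))
 define K where "K s = (\<Sum>k<m. scl (s ^ (m - k)) (div_pow k * V))" for s
 have "K s = (\<Sum>k\<le>m. scl (s ^ k) (if k = 0 then 0 else div_pow (m - k) * V))" for s
 proof -
  have "K s = (\<Sum>k\<in>{1..m}. scl (s ^ k) (if k = 0 then 0 else div_pow (m - k) * V))"
   unfolding K_def by (intro sum.reindex_bij_witness[of _ "\<lambda>k. m - k" "\<lambda>k. m - k"]) auto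
  also have "\<dots> = (\<Sum>k\<le>m. scl (s ^ k) (if k = 0 then 0 else div_pow (m - k) * V))"
   by (intro sum.mono_neutral_left) auto
  finally show ?thesis .
 qed
 then have K: "poly_map K" by (rule poly_mapI)
 have key: "wt (int m) * \<tau> (low (- inverse t)) * K (inverse t) = weyl * V" if t: "t ~= 0" for t
 proof -
  have "inverse t ^ (m - k) = inverse t ^ m * t ^ k" if "k < m" for k
   using t that by (simp add: power_diff power_inverse divide_inverse)
  then have Kt: "K (inverse t) = scl (inverse t ^ m) (\<tau> (upp t) * V)"
   unfolding K_def U imat.scale_sum_right by (intro sum.cong) simp_all
  have "wt (int m) * \<tau> (low (- inverse t)) * (\<tau> (upp t) * V) = wt (int m) * (\<tau> (low (- inverse t)) * \<tau> (upp t)) * V"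
   by (simp add: assoc)
  also have "\<dots> = wt (int m) * \<tau> (upp (- t)) * (\<tau> (dgm t) * (weyl * wt (- int m))) * Y"
   using t by (simp add: lower_upper assoc V_def)
  also have "\<dots> = scl (t powi int m) (wt (int m) * \<tau> (upp (- t)) * wt (int m) * weyl * Y)"
   by (simp add: weyl_wt dgm_wt[OF t] assoc[symmetric] del: power_int_of_nat)
  also have "wt (int m) * \<tau> (upp (- t)) * wt (int m) = wt (int m)"
  proof -
   have "wt (int m) * div_pow k * wt (int m) = (if k = 0 then wt (int m) else 0)" for k
   proof -
    have "wt (int m) * div_pow k * wt (int m) = wt (int m) * wt (int m + 2 * int k) * div_pow k"
     by (simp only: assoc div_pow_wt)
    then show ?thesis by (cases "k = 0") (simp_all add: wt_wt div_pow_def rectD[OF wt_cor])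
   qed
   note component = this
   have "wt (int m) * \<tau> (upp (- t)) * wt (int m) = (\<Sum>k\<le>D. scl ((- t) ^ k) (wt (int m) * div_pow k * wt (int m)))"
    by (simp add: D sum_distrib)
   also have "\<dots> = (\<Sum>k\<le>D. if k = 0 then wt (int m) else 0)" by (intro sum.cong refl) (simp add: component)
   finally show ?thesis by simp
  qed
  also have "wt (int m) * weyl * Y = weyl * V" by (simp add: V_def weyl_wt assoc[symmetric])
  finally show ?thesis using t by (simp add: Kt flip: power_mult_distrib)
 qed
 \<comment> \<open>By \<open>key\<close> this polynomial in \<open>s\<close> takes one value for all
   nonzero \<open>s\<close>, hence also at \<open>s = 0\<close>, where \<open>K\<close> vanishes
   because all its exponents \<open>m - k\<close> are positive.\<close>
 have "wt (int m) * \<tau> (low (- 1)) * K 1 = wt (int m) * \<tau> (low (- 0)) * K 0"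
  by (rule poly_map_constant[of "\<lambda>s. wt (int m) * \<tau> (low (- s)) * K s" "\<lambda>_. weyl * V"])
   (intro poly_map_mult poly_map_const K poly_map_uminus[OF poly_map_low] key | assumption)+
 moreover have "K 0 = 0" unfolding K_def by (intro sum.neutral) auto
 ultimately have "weyl * V = 0" using key[of 1] by simp
 then have "weyl' * weyl * V = 0" by (simp add: assoc)
 then have "idm N * wt (- int m) * Y = 0" by (simp only: weyl V_def assoc)
 then show ?thesis by (simp only: rectD[OF wt_cor])
qed

text \<open>The conjugate of \<open>Y\<close> by \<open>low t\<close> is a polynomial in \<open>t\<close> and, by \<open>lower_upper\<close>, also in \<open>1 / t\<close>,
 hence constant.\<close>

lemma commutes_with_rep:
 assumes Y: "Y \<in> cor N" and nil: "nil * Y = Y * nil" and wt: "\<And>z. wt z * Y = Y * wt z"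
  and x: "x \<in> carrier SL2"
 shows "\<tau> x * Y = Y * \<tau> x"
proof -
 obtain D where D: "\<And>t. \<tau> (upp t) = (\<Sum>k\<le>D. scl (t ^ k) (div_pow k))" using upp_coefficients by metis
 have nk: "nil ^ k * Y = Y * nil ^ k" for k by (induction k) (simp_all add: assoc nil, simp add: nil flip: assoc)
 have u: "\<tau> (upp t) * Y = Y * \<tau> (upp t)" for t unfolding D div_pow_def using Y nk
  by (simp add: sum_distrib assoc) (simp add: rectD flip: assoc)
 have d: "\<tau> (dgm s) * Y = Y * \<tau> (dgm s)" if "s ~= 0" for s using that by (simp add: dgm_expansion sum_distrib wt)
 define Y' where "Y' = weyl * Y * weyl'"
 have d': "\<tau> (dgm s) * Y' = Y' * \<tau> (dgm s)" if "s ~= 0" for s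
 proof -
  have w: "\<tau> (dgm s) * weyl = weyl * \<tau> (dgm (inverse s))" "weyl' * \<tau> (dgm s) = \<tau> (dgm (inverse s)) * weyl'"
   using that \<tau>_mult[of "dgm s" wey] \<tau>_mult[of wey "dgm (inverse s)"] \<tau>_mult[of "mat2 0 (-1) 1 0" "dgm s"]
    \<tau>_mult[of "dgm (inverse s)" "mat2 0 (-1) 1 0"] by (simp_all add: weyl_def weyl'_def mat2_SL2 mat2_mult)
  have "\<tau> (dgm s) * Y' = weyl * (\<tau> (dgm (inverse s)) * Y) * weyl'" by (simp add: Y'_def w(1) flip: assoc)
  also have "\<dots> = weyl * (Y * \<tau> (dgm (inverse s))) * weyl'" using d[of "inverse s"] that by simp
  finally show ?thesis using w(2) by (simp add: Y'_def assoc)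
 qed
 have upp_inv: "\<tau> (upp t) * \<tau> (upp (- t)) = idm N" and low_inv: "\<tau> (low t) * \<tau> (low (- t)) = idm N" for t
  using \<tau>_mult[of "upp t" "upp (- t)"] \<tau>_mult[of "low t" "low (- t)"]
  by (simp_all add: mat2_SL2 mat2_mult mat2_one \<tau>_one)
 have cor: "\<tau> (upp t) \<in> cor N" "\<tau> (low t) \<in> cor N" for t by (auto intro!: \<tau>_cor simp: mat2_SL2)
 have key: "\<tau> (low (- inverse t)) * Y * \<tau> (low (inverse t)) = \<tau> (upp (- t)) * Y' * \<tau> (upp t)" if t: "t ~= 0" for t
 proof -
  define l u u' dd where "l = \<tau> (low (- inverse t))" and "u = \<tau> (upp t)" and "u' = \<tau> (upp (- t))"
   and "dd = \<tau> (dgm t)"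
  have dd: "dd \<in> cor N" using t by (auto simp: dd_def mat2_SL2 intro!: \<tau>_cor)
  have uu': "u * u' = idm N" using upp_inv[of t] by (simp add: u_def u'_def)
  have c: "l \<in> cor N" "u \<in> cor N" "u' \<in> cor N" by (auto simp: l_def u_def u'_def cor)
  have l1: "l * u = u' * dd * weyl" using lower_upper[OF t] by (simp add: l_def u_def u'_def dd_def)
  have "l * (u * u') = u' * dd * weyl * u'" using l1 by (simp flip: assoc)
  then have l: "l = u' * dd * weyl * u'" using uu' c by (simp add: rectD)
  have ul: "u * l = dd * weyl * u'"
   unfolding l using uu' dd by (simp add: assoc uu'[THEN assoc_rule] rectD[OF dd, THEN assoc_rule])
  have "l * Y = u' * dd * weyl * (u' * Y)" by (simp add: l assoc)
  also have "u' * Y = Y * u'" using u[of "- t"] by (simp add: u'_def)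
  also have "u' * dd * weyl * (Y * u') = u' * dd * (Y' * weyl) * u'"
   using weyl Y by (simp add: Y'_def assoc rectD weyl(4)[THEN assoc_rule] rectD[OF Y, THEN assoc_rule])
  also have "\<dots> = u' * Y' * (u * l)" using d'[OF t] by (simp add: ul dd_def[symmetric] assoc) (simp flip: assoc)
  finally have "l * Y * \<tau> (low (inverse t)) = u' * Y' * u * (l * \<tau> (low (inverse t)))" by (simp add: assoc)
  moreover have "l * \<tau> (low (inverse t)) = idm N" using low_inv[of "- inverse t"] by (simp add: l_def)
  ultimately show ?thesis using c by (simp add: l_def u_def u'_def assoc rectD)
 qed
 have low: "\<tau> (low r) * Y = Y * \<tau> (low r)" for r
 proof -
  have "\<tau> (low (- (- r))) * Y * \<tau> (low (- r)) = \<tau> (low (- 0)) * Y * \<tau> (low 0)"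
   by (rule poly_map_constant[of "\<lambda>t. \<tau> (low (- t)) * Y * \<tau> (low t)" "\<lambda>t. \<tau> (upp (- t)) * Y' * \<tau> (upp t)"])
    (intro poly_map_mult poly_map_const poly_map_upp poly_map_low poly_map_uminus[OF poly_map_upp]
     poly_map_uminus[OF poly_map_low] key | assumption)+
  then have "\<tau> (low r) * Y * (\<tau> (low (- r)) * \<tau> (low r)) = Y * \<tau> (low r)"
   using Y by (simp add: mat2_one \<tau>_one rectD flip: assoc)
  then show ?thesis using low_inv[of "- r"] Y by (simp add: assoc rectD)
 qed
 have wey: "\<tau> wey * Y = Y * \<tau> wey"
 proof -
  have "wey = upp 1 * (low (- 1) * upp 1)" by (simp add: mat2_mult)
  then have "\<tau> wey = \<tau> (upp 1) * (\<tau> (low (- 1)) * \<tau> (upp 1))"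
   using \<tau>_mult[of "upp 1" "low (- 1) * upp 1"] \<tau>_mult[of "low (- 1)" "upp 1"] by (simp add: mat2_SL2 mat2_mult)
  then show ?thesis using low[of "- 1"] u[of 1] by (simp add: assoc) (metis assoc)
 qed
 from x show ?thesis
 proof (induction rule: SL2_induct)
  case (mult x y)
  then show ?case by (simp add: \<tau>_mult assoc) (simp flip: assoc)
 qed (use u d wey in auto)
qed

end

section \<open>Nilpotent matrices\<close>

subsection \<open>Direct sums\<close>

lemma ent_tp_shift_mult: "ent (tp (shift n) * A) i j = (if n \<le> i then ent A (i - n) j else 0)"
proof -
 have "ent (tp (shift n) * A) i j = ent (tp (tp A * shift n)) i j" by (simp add: tp_mult)
 then show ?thesis by (simp only: ent_tp ent_mult_shift)
qed

lemma shift_cor: assumes "A \<in> cor n" shows "shift n * A = 0" "A * tp (shift n) = 0"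
proof -
 have "shift n * (idm n * A) = 0" "(A * idm n) * tp (shift n) = 0" by (simp add: assoc[symmetric]) (simp add: assoc)
 then show "shift n * A = 0" "A * tp (shift n) = 0" using assms by (simp_all add: rectD)
qed

lemma idm_power_cor: "A \<in> cor n ==> idm n * A ^ k \<in> cor n"
 using rect_power[of A n k] by (cases "k = 0") (simp_all add: rectD)

definition dirsum :: "nat => imat => imat => imat" where
 "dirsum n A B = A + tp (shift n) * B * shift n"

lemma ent_dirsum: "ent (dirsum n A B) i j = ent A i j + (if n \<le> i \<and> n \<le> j then ent B (i - n) (j - n) else 0)"
 by (auto simp: dirsum_def assoc ent_tp_shift_mult ent_mult_shift)

lemma dirsum_cor: "A \<in> cor a ==> B \<in> cor b ==> dirsum a A B \<in> cor (a + b)"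
proof -
 assume c: "A \<in> cor a" "B \<in> cor b"
 show ?thesis unfolding rect_iff
 proof (intro allI impI)
  fix i j assume "ent (dirsum a A B) i j ~= 0"
  then have "ent A i j ~= 0 \<or> a \<le> i \<and> a \<le> j \<and> ent B (i - a) (j - a) ~= 0" by (auto simp: ent_dirsum split: if_splits)
  then show "i < a + b \<and> j < a + b"
  proof
   assume "ent A i j ~= 0"
   then show ?thesis using c(1) unfolding rect_iff by fastforce
  next
   assume "a \<le> i \<and> a \<le> j \<and> ent B (i - a) (j - a) ~= 0"
   moreover from this have "i - a < b \<and> j - a < b" using c(2) unfolding rect_iff by blast
   ultimately show ?thesis by auto
  qed
 qed
qed

lemma dirsum_mult:
 assumes "A \<in> cor a" "A' \<in> cor a"
 shows "dirsum a A B * dirsum a A' B' = dirsum a (A * A') (B * B')"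
proof -
 note z = shift_cor[OF assms(1)] shift_cor[OF assms(2)]
 show ?thesis
  unfolding dirsum_def by (simp add: distrib_left distrib_right assoc z z[THEN assoc_rule] shift_tp_shift[THEN assoc_rule])
qed

lemma tp_dirsum: "tp (dirsum a A B) = dirsum a (tp A) (tp B)" by (simp add: dirsum_def tp_mult assoc)

lemma scl_dirsum: "scl c (dirsum a A B) = dirsum a (scl c A) (scl c B)"
 by (rule imat_eqI) (simp add: ent_dirsum distrib_left)

lemma minus_dirsum: "- dirsum a A B = dirsum a (- A) (- B)" by (rule imat_eqI) (simp add: ent_dirsum)

lemma dirsum_idm: "dirsum a (idm a) (idm b) = idm (a + b)" by (rule imat_eqI) (auto simp: ent_dirsum ent_idm)

lemma dirsum_assoc: "dirsum a A (dirsum b B C) = dirsum (a + b) (dirsum a A B) C"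
 by (rule imat_eqI) (auto simp: ent_dirsum)

lemma dirsum_power: assumes "A \<in> cor a" "B \<in> cor b"
 shows "idm (a + b) * dirsum a A B ^ k = dirsum a (idm a * A ^ k) (idm b * B ^ k)"
proof (induction k)
 case 0
 then show ?case by (simp add: dirsum_idm)
next
 case (Suc k)
 have "idm (a + b) * dirsum a A B ^ Suc k = idm (a + b) * dirsum a A B ^ k * dirsum a A B"
  by (simp add: assoc power_commutes)
 also have "\<dots> = dirsum a (idm a * A ^ k * A) (idm b * B ^ k * B)"
 proof (unfold Suc.IH, rule dirsum_mult)
 qed (use assms in \<open>auto intro: idm_power_cor\<close>)
 finally show ?case by (simp add: assoc power_commutes)
qed

lemma rk_dirsum: assumes "A \<in> cor a" "B \<in> cor b" shows "rk (dirsum a A B) = rk A + rk B"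
proof -
 have fin: "fin A" "fin B" using assms finI by blast+
 then have "fin (tp (shift a) * B * shift a)" by (intro fin_mult_left fin_mult_right)
 then have "rk (dirsum a A B) = rk A + rk (tp (shift a) * B * shift a)" unfolding dirsum_def using fin assms
  by (intro rk_direct[of _ _ "idm a" "idm a"]) (simp_all add: rectD assoc idm_tp_shift[THEN assoc_rule])
 also have "rk (tp (shift a) * B * shift a) = rk B"
 proof (rule antisym)
  show "rk (tp (shift a) * B * shift a) \<le> rk B" using fin(2) by (rule rk_mult_le)
  have "shift a * (tp (shift a) * B * shift a) * tp (shift a) = B"
   by (simp add: assoc shift_tp_shift[THEN assoc_rule])
  then show "rk B \<le> rk (tp (shift a) * B * shift a)"
   using rk_mult_le[OF \<open>fin (tp (shift a) * B * shift a)\<close>] by metis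
 qed
 finally show ?thesis .
qed

lemma sim_dirsum: assumes "sim a A A'" "sim b B B'" shows "sim (a + b) (dirsum a A B) (dirsum a A' B')"
proof -
 obtain P Q where 1: "A \<in> cor a" "A' \<in> cor a" "P \<in> cor a" "Q \<in> cor a"
  "P * Q = idm a" "Q * P = idm a" "A = P * A' * Q" using assms(1) by (auto simp: sim_def)
 obtain R S where 2: "B \<in> cor b" "B' \<in> cor b" "R \<in> cor b" "S \<in> cor b"
  "R * S = idm b" "S * R = idm b" "B = R * B' * S" using assms(2) by (auto simp: sim_def)
 have "dirsum a A B = dirsum a P R * dirsum a A' B' * dirsum a Q S" using 1 2 by (simp add: dirsum_mult cor_mult)
 moreover have "dirsum a P R * dirsum a Q S = idm (a + b)" "dirsum a Q S * dirsum a P R = idm (a + b)"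
  using 1 2 by (simp_all add: dirsum_mult dirsum_idm)
 ultimately show ?thesis unfolding sim_def using 1 2 dirsum_cor by blast
qed

lemma sim_dirsum_swap: assumes "A \<in> cor a" "B \<in> cor b" shows "sim (a + b) (dirsum a A B) (dirsum b B A)"
proof -
 define S where "S a b = idm a * shift b + tp (shift a) * idm b" for a b
 have S_mult: "S a b * S b a = idm (a + b)" for a b
 proof -
  have "S a b * S b a = idm a + tp (shift a) * idm b * shift a"
   by (simp add: S_def distrib_left distrib_right assoc shift_tp_shift[THEN assoc_rule]
     shift_idm[THEN assoc_rule] idm_tp_shift[THEN assoc_rule])
  then show ?thesis by (simp add: dirsum_def flip: dirsum_idm)
 qed
 have S_cor: "S a b \<in> cor (a + b)" for a b
  unfolding rect_iff S_def by (auto simp: ent_shift ent_tp_shift_mult ent_idm split: if_splits)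
 note A = rectD[OF assms(1)] shift_cor[OF assms(1)]
 note B = rectD[OF assms(2)] shift_cor[OF assms(2)]
 have "dirsum a A B = S a b * dirsum b B A * S b a"
  by (simp add: S_def dirsum_def distrib_left distrib_right assoc shift_tp_shift[THEN assoc_rule]
    A B A[THEN assoc_rule] B[THEN assoc_rule] idm_tp_shift[THEN assoc_rule] shift_idm[THEN assoc_rule])
 moreover have "dirsum b B A \<in> cor (a + b)" using dirsum_cor[OF assms(2,1)] by (simp add: add.commute)
 moreover have "S b a \<in> cor (a + b)" "S b a * S a b = idm (a + b)"
  using S_cor[of b a] S_mult[of b a] by (simp_all add: add.commute)
 ultimately show ?thesis unfolding sim_def using S_mult S_cor dirsum_cor[OF assms] by blast
qed

subsection \<open>Jordan matrices\<close>

definition jblock :: "nat => imat" where "jblock k = shift 1 * idm k"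

lemma ent_jblock: "ent (jblock k) i j = (if j = Suc i \<and> j < k then 1 else 0)" by (auto simp: jblock_def ent_shift)

lemma jblock_cor: "jblock k \<in> cor k" by (auto simp: rect_iff ent_jblock)

lemma jblock_power: "idm k * jblock k ^ m = shift m * idm k"
proof -
 have "jblock k ^ m * idm k = shift m * idm k"
 proof (induction m)
  case 0
  have "shift 0 = 1" by (rule imat_eqI) (auto simp: ent_shift ent_one)
  then show ?case by simp
 next
  case (Suc m)
  have "jblock k ^ Suc m * idm k = jblock k * (shift m * idm k)" by (simp add: assoc Suc.IH)
  also have "\<dots> = shift (Suc m) * idm k" by (rule imat_eqI) (auto simp: jblock_def assoc ent_shift_mult ent_shift)
  finally show ?case .
 qed
 moreover have "jblock k ^ m * idm k = idm k * jblock k ^ m"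
  using rectD[OF rect_power[OF jblock_cor[of k], of m]] by (cases "m = 0") simp_all
 ultimately show ?thesis by simp
qed

lemma rk_jblock: "rk (idm k * jblock k ^ m) = k - m"
proof -
 have e: "shift m * idm k = idm (k - m) * shift m" by (rule imat_eqI) (auto simp: ent_shift)
 have "rk (idm (k - m) * shift m) \<le> rk (idm (k - m))" by (intro rk_mult_right_le) simp
 moreover have "rk (idm (k - m) * shift m * tp (shift m)) \<le> rk (idm (k - m) * shift m)"
  by (intro rk_mult_right_le fin_mult_right) simp
 then have "k - m \<le> rk (idm (k - m) * shift m)" by (simp add: assoc)
 ultimately show ?thesis by (simp add: jblock_power e)
qed

fun jmat :: "(nat \<times> complex) list => imat" where
 "jmat [] = 0"
| "jmat ((k, a) # xs) = dirsum k (scl a (idm k) + jblock k) (jmat xs)"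

lemma jmat_cor: "jmat xs \<in> cor (sum_list (map fst xs))"
 by (induction xs rule: jmat.induct) (simp_all add: dirsum_cor rect_add rect_scl jblock_cor)

lemma of_m_jordan_matrix: "of_m (jordan_matrix xs) = jmat xs"
proof (induction xs rule: jmat.induct)
 case 1
 then show ?case by (intro imat_eqI) (simp add: ent_of_m jordan_matrix_def)
next
 case (2 k a xs)
 define m where "m = sum_list (map fst xs)"
 have "of_m (jordan_matrix ((k, a) # xs)) = dirsum k (of_m (jordan_block k a)) (of_m (jordan_matrix xs))"
  unfolding jordan_matrix_def by (rule imat_eqI) (auto simp: Let_def ent_dirsum ent_of_m)
 also have "of_m (jordan_block k a) = scl a (idm k) + jblock k"
  by (rule imat_eqI) (auto simp: ent_of_m ent_idm ent_jblock)
 finally show ?case by (simp add: 2)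
qed

lemma jmat_append: "jmat (xs @ ys) = dirsum (sum_list (map fst xs)) (jmat xs) (jmat ys)"
proof (induction xs rule: jmat.induct)
 case 1
 show ?case by (rule imat_eqI) (simp add: ent_dirsum)
qed (simp_all add: dirsum_assoc)

text \<open>Needed because a Jordan form lists its blocks in arbitrary order, whereas a partition is
  sorted. A block moves past others by \<open>sim_dirsum_swap\<close>.\<close>

lemma sim_jmat_permutation:
 "mset xs = mset ys ==> sim (sum_list (map fst xs)) (jmat xs) (jmat ys)"
proof (induction xs arbitrary: ys)
 case Nil
 then show ?case by (simp add: sim_refl)
next
 case (Cons x xs)
 obtain k a where x: "x = (k, a)" by force
 from Cons.prems have "x \<in> set ys" by (metis list.set_intros(1) mset_eq_setD)
 then obtain us vs where ys: "ys = us @ x # vs" by (meson split_list)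
 have mset: "mset xs = mset (us @ vs)" using Cons.prems by (simp add: ys)
 define B m where "B = scl a (idm k) + jblock k" and "m = sum_list (map fst us)"
 have B: "B \<in> cor k" by (simp add: B_def rect_add rect_scl jblock_cor)
 have sum: "sum_list (map fst xs) = m + sum_list (map fst vs)"
  using arg_cong[OF mset, of "\<lambda>M. sum_mset (image_mset fst M)"]
  by (simp add: m_def flip: sum_mset_sum_list mset_map)
 have step: "sim (k + sum_list (map fst xs)) (dirsum k B (jmat xs)) (dirsum k B (jmat (us @ vs)))"
  by (intro sim_dirsum sim_refl B Cons.IH mset)
 have "sim ((k + m) + sum_list (map fst vs)) (dirsum (k + m) (dirsum k B (jmat us)) (jmat vs))
   (dirsum (k + m) (dirsum m (jmat us) B) (jmat vs))"
  using B jmat_cor[of us] jmat_cor[of vs] by (intro sim_dirsum sim_refl sim_dirsum_swap) (simp_all add: m_def)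
 then have "sim (k + sum_list (map fst xs)) (dirsum k B (jmat (us @ vs))) (jmat ys)"
  by (simp add: ys x sum jmat_append dirsum_assoc B_def m_def ac_simps)
 with step show ?case using sim_trans by (fastforce simp: x B_def)
qed

text \<open>The first basis vector of a block is an eigenvector for its eigenvalue \<open>a\<close>,
  so a vanishing power forces \<open>a ^ m = 0\<close>. A block of size \<open>0\<close> would have
  no such vector.\<close>

lemma jmat_nilpotent:
 assumes "0 \<notin> fst ` set xs" "idm (sum_list (map fst xs)) * jmat xs ^ m = 0" "m > 0"
 shows "snd ` set xs \<subseteq> {0}" using assms
proof (induction xs rule: jmat.induct)
 case (2 k a xs)
 define B M where "B = scl a (idm k) + jblock k" and "M = sum_list (map fst xs)"
 have B: "B \<in> cor k" by (simp add: B_def rect_add rect_scl jblock_cor)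
 have "idm (k + M) * dirsum k B (jmat xs) ^ m = 0" using "2.prems"(2) by (simp add: B_def M_def)
 then have z: "dirsum k (idm k * B ^ m) (idm M * jmat xs ^ m) = 0"
  using dirsum_power[OF B jmat_cor[of xs], folded M_def] by simp
 have 1: "idm k * B ^ m = 0"
 proof -
  have "idm k * dirsum k (idm k * B ^ m) (idm M * jmat xs ^ m) = idm k * B ^ m"
   by (simp add: dirsum_def distrib_left assoc idm_tp_shift[THEN assoc_rule])
  then show ?thesis by (simp add: z)
 qed
 have 2: "idm M * jmat xs ^ m = 0"
 proof (rule imat_eqI)
  fix i j
  have "ent (dirsum k (idm k * B ^ m) (idm M * jmat xs ^ m)) (i + k) (j + k) = ent (idm M * jmat xs ^ m) i j"
   by (simp add: ent_dirsum 1)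
  then show "ent (idm M * jmat xs ^ m) i j = ent 0 i j" by (simp add: z)
 qed
 have "B ^ m * idm 1 = scl (a ^ m) (idm 1)" for m
 proof (induction m)
  case (Suc m)
  have "jblock k * idm 1 = 0" by (rule imat_eqI) (simp add: ent_jblock)
  moreover have "idm k * idm 1 = idm 1" using "2.prems"(1) by (cases k) simp_all
  ultimately have "B * idm 1 = scl a (idm 1)" by (simp only: B_def distrib_right scl_mult_left) simp
  then show ?case using Suc by (simp add: assoc mult.commute)
 qed simp
 moreover have "B ^ m = idm k * B ^ m" using B \<open>m > 0\<close> by (simp add: rectD[OF rect_power])
 ultimately have "scl (a ^ m) (idm 1) = 0" using 1 by (metis mult_zero_left)
 moreover have "idm 1 ~= 0" using rk_idm[of 1] by (metis rk_0 zero_neq_one)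
 ultimately have "a = 0" by simp
 then show ?case using 2 "2.IH" "2.prems" by (simp add: M_def)
qed simp

definition jordan_type :: "nat => imat => nat list => bool" where
 "jordan_type N A p \<longleftrightarrow> is_partition p \<and> sum_list p = N \<and> sim N A (jmat (map (\<lambda>k. (k, 0)) p))"

lemma fst_map_pair [simp]: "map fst (map (\<lambda>k. (k, 0)) p) = p" by (simp add: comp_def)

lemma jordan_type_iff:
 assumes "M \<in> carrier_mat N N"
 shows "jordan_type N (of_m M) p \<longleftrightarrow> is_partition p \<and> jordan_nf M (map (\<lambda>k. (k, 0)) p)"
proof -
 have c: "jordan_matrix (map (\<lambda>k. (k, 0)) p) \<in> carrier_mat (sum_list p) (sum_list p)"
  using jordan_matrix_carrier[of "map (\<lambda>k. (k, 0)) p"] by (simp only: fst_map_pair)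
 have "0 \<notin> fst ` set (map (\<lambda>k. (k, 0)) p) \<longleftrightarrow> 0 \<notin> set p" by force
 moreover have "similar_mat M (jordan_matrix (map (\<lambda>k. (k, 0)) p)) \<longleftrightarrow>
   sum_list p = N \<and> sim N (of_m M) (jmat (map (\<lambda>k. (k, 0)) p))"
 proof
  assume s: "similar_mat M (jordan_matrix (map (\<lambda>k. (k, 0)) p))"
  then obtain m where "{M, jordan_matrix (map (\<lambda>k. (k, 0)) p)} \<subseteq> carrier_mat m m" using similar_matD[OF s] by blast
  then have "sum_list p = N" using assms c by (metis carrier_matD(1) insert_subset)
  then show "sum_list p = N \<and> sim N (of_m M) (jmat (map (\<lambda>k. (k, 0)) p))"
   using sim_of_m[OF assms s] by (simp add: of_m_jordan_matrix)
 next
  assume s: "sum_list p = N \<and> sim N (of_m M) (jmat (map (\<lambda>k. (k, 0)) p))"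
  then have "similar_mat (to_m N N (of_m M)) (to_m N N (of_m (jordan_matrix (map (\<lambda>k. (k, 0)) p))))"
   by (intro sim_to_m) (simp add: of_m_jordan_matrix)
  then show "similar_mat M (jordan_matrix (map (\<lambda>k. (k, 0)) p))" using to_m_of_m[OF assms] to_m_of_m[OF c] s by simp
 qed
 ultimately show ?thesis by (auto simp: jordan_type_def jordan_nf_def is_partition_def)
qed

lemma jordan_type_exists:
 assumes "A \<in> cor N" "idm N * A ^ m = 0"
 obtains p where "jordan_type N A p"
proof -
 define M where "M = to_m N N A"
 have M: "M \<in> carrier_mat N N" "of_m M = A" using assms(1) by (simp_all add: M_def of_m_to_m)
 obtain as where as: "char_poly M = (\<Prod>a\<leftarrow>as. [:- a, 1:])" using char_poly_factorized[OF M(1)] by blast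
 then obtain xs where xs: "jordan_nf M xs" using jordan_nf_exists[OF M(1)] by blast
 then have s: "similar_mat M (jordan_matrix xs)" "0 \<notin> fst ` set xs" by (auto simp: jordan_nf_def)
 have sim: "sim N A (jmat xs)" using sim_of_m[OF M(1) s(1)] by (simp add: M of_m_jordan_matrix)
 obtain k where "{M, jordan_matrix xs} \<subseteq> carrier_mat k k" using similar_matD[OF s(1)] by blast
 then have N: "sum_list (map fst xs) = N" using M(1) by (metis carrier_matD(1) insert_subset jordan_matrix_dim(1))
 have "idm N * A ^ Suc m = 0" using assms(2) by (simp only: power_Suc2 assoc[symmetric]) simp
 then have "rk (idm N * jmat xs ^ Suc m) = 0" using sim_rk[OF sim_power[OF sim, of "Suc m"]] by simp
 then have "idm N * jmat xs ^ Suc m = 0" by (intro rk_eq_0 fin_mult_right) simp_all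
 then have "snd ` set xs \<subseteq> {0}" using jmat_nilpotent[OF s(2), of "Suc m"] by (simp add: N)
 then have xs0: "xs = map (\<lambda>k. (k, 0)) (map fst xs)" by (induction xs) auto
 define p where "p = rev (sort (map fst xs))"
 have "mset (map (\<lambda>k. (k, 0 :: complex)) (map fst xs)) = mset (map (\<lambda>k. (k, 0)) p)"
  unfolding p_def by (simp only: mset_map mset_rev mset_sort)
 then have "sim N (jmat xs) (jmat (map (\<lambda>k. (k, 0)) p))" using sim_jmat_permutation[of xs] xs0 N by metis
 moreover have "is_partition p" using s(2) by (auto simp: is_partition_def p_def sorted_wrt_rev)
 moreover have "sum_list p = N" unfolding p_def using N by (metis mset_rev mset_sort sum_mset_sum_list)
 ultimately show thesis using that sim_trans[OF sim] unfolding jordan_type_def by blast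
qed

lemma rk_jmat: "rk (idm (sum_list p) * jmat (map (\<lambda>k. (k, 0)) p) ^ m) = excess p m"
proof (induction p)
 case Nil
 then show ?case by (simp add: excess_def)
next
 case (Cons k p)
 define M where "M = jmat (map (\<lambda>k. (k, 0)) p)"
 have M: "M \<in> cor (sum_list p)" using jmat_cor[of "map (\<lambda>k. (k, 0)) p"] by (simp only: M_def fst_map_pair)
 have "idm (k + sum_list p) * dirsum k (jblock k) M ^ m = dirsum k (idm k * jblock k ^ m) (idm (sum_list p) * M ^ m)"
  by (rule dirsum_power[OF jblock_cor M])
 then have "rk (idm (k + sum_list p) * dirsum k (jblock k) M ^ m) = (k - m) + excess p m"
  using rk_dirsum[OF idm_power_cor[OF jblock_cor] idm_power_cor[OF M]] Cons.IH by (simp add: rk_jblock M_def)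
 then show ?case by (simp add: M_def excess_def)
qed

lemma jordan_type_rk: "jordan_type N A p ==> rk (idm N * A ^ m) = excess p m"
 using sim_rk[OF sim_power] rk_jmat unfolding jordan_type_def by metis

lemma excess_Suc: "excess p k = excess p (Suc k) + exceeding p k"
 by (induction p) (auto simp: excess_def exceeding_def)

lemma partition_eq_excessI:
 assumes "is_partition p" "is_partition q" "\<And>k. excess p k = excess q k"
 shows "p = q"
proof (rule conjugate_inject[OF assms(1,2)], rule partition_eqI[OF conjugate_is_partition conjugate_is_partition])
 fix i show "part (conjugate_partition p) i = part (conjugate_partition q) i"
  using excess_Suc[of p i] excess_Suc[of q i] assms(3) by (simp add: part_conjugate)
qed

lemma jordan_type_unique: "jordan_type N A p ==> jordan_type N A q ==> p = q"
 by (rule partition_eq_excessI) (auto simp: jordan_type_def dest: jordan_type_rk, metis jordan_type_def jordan_type_rk)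

lemma jordan_type_sim: "sim N B A ==> jordan_type N A p ==> jordan_type N B p"
 unfolding jordan_type_def using sim_trans by blast

lemma sim_of_jordan_type: "jordan_type N A p ==> jordan_type N B p ==> sim N A B"
 unfolding jordan_type_def using sim_trans sim_sym by blast

text \<open>The number of Jordan blocks of size \<open>k\<close> is a second difference of ranks of
  powers.\<close>

lemma count_excess: "k > 0 ==> count_list p k + 2 * excess p k = excess p (k - 1) + excess p (k + 1)"
 using count_list_exceeding[of k p] excess_Suc[of p "k - 1"] excess_Suc[of p k] by simp


subsection \<open>Forms adapted to a nilpotent matrix\<close>

text \<open>Alternating signs make a Jordan block skew-adjoint and give the form the sign
  \<open>(-1) ^ (k + 1)\<close>. This is why blocks of one parity stand alone and the others are
  taken in pairs.\<close>

definition antidiagonal :: "nat => imat" where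
 "antidiagonal k = of_m (mat k k (\<lambda>(i, j). if i + j + 1 = k then (-1) ^ i else 0))"

lemma ent_antidiagonal: "ent (antidiagonal k) i j = (if i + j + 1 = k then (-1) ^ i else 0)"
 by (auto simp: antidiagonal_def ent_of_m)

lemma antidiagonal_cor: "antidiagonal k \<in> cor k" unfolding antidiagonal_def by (rule of_m_rect) simp

lemma tp_antidiagonal: "tp (antidiagonal k) = scl ((-1) ^ (k + 1)) (antidiagonal k)"
 by (rule imat_eqI) (auto simp: ent_antidiagonal minus_one_power_iff)

lemma antidiagonal_square: "antidiagonal k * antidiagonal k = scl ((-1) ^ (k + 1)) (idm k)"
proof (rule imat_eqI)
 fix i j
 have "ent (antidiagonal k * antidiagonal k) i j
   = (\<Sum>l\<in>{k - 1 - i}. ent (antidiagonal k) i l * ent (antidiagonal k) l j)"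
  by (rule ent_mult) (auto simp: ent_antidiagonal split: if_splits)
 also have "\<dots> = ent (scl ((-1) ^ (k + 1)) (idm k)) i j"
 proof (cases "i < k")
  case True
  then show ?thesis by (auto simp: ent_antidiagonal ent_idm minus_one_power_iff)
 qed (auto simp: ent_antidiagonal ent_idm)
 finally show "ent (antidiagonal k * antidiagonal k) i j = ent (scl ((-1) ^ (k + 1)) (idm k)) i j" .
qed

lemma antidiagonal_jblock: "tp (jblock k) * antidiagonal k = - (antidiagonal k * jblock k)"
proof (rule imat_eqI)
 fix i j
 have "ent (tp (jblock k) * antidiagonal k) i j = (if 1 \<le> i \<and> i < k then ent (antidiagonal k) (i - 1) j else 0)"
  by (simp add: jblock_def tp_mult assoc ent_tp_shift_mult)
 moreover have "ent (antidiagonal k * jblock k) i j = (if 1 \<le> j \<and> j < k then ent (antidiagonal k) i (j - 1) else 0)"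
  by (simp add: jblock_def ent_mult_shift flip: assoc)
 ultimately show "ent (tp (jblock k) * antidiagonal k) i j = ent (- (antidiagonal k * jblock k)) i j"
  by (cases i; cases j) (auto simp: ent_antidiagonal)
qed

definition adapted_form :: "complex => nat => imat => imat => imat => bool" where
 "adapted_form \<epsilon> N A K K' \<longleftrightarrow> bilinear_form N K K' \<epsilon> \<and> tp A * K = - (K * A)"

lemma adapted_form_dirsum:
 assumes "adapted_form \<epsilon> a A K K'" "adapted_form \<epsilon> b B L L'" "A \<in> cor a"
 shows "adapted_form \<epsilon> (a + b) (dirsum a A B) (dirsum a K L) (dirsum a K' L')"
proof -
 interpret K: bilinear_form a K K' \<epsilon> using assms(1) by (simp add: adapted_form_def)
 interpret L: bilinear_form b L L' \<epsilon> using assms(2) by (simp add: adapted_form_def)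
 have "bilinear_form (a + b) (dirsum a K L) (dirsum a K' L') \<epsilon>" using K.J K.J' K.JJ' K.tpJ K.eps L.J L.J' L.JJ' L.tpJ
  by unfold_locales (simp_all add: dirsum_cor dirsum_mult dirsum_idm tp_dirsum scl_dirsum)
 then show ?thesis using assms K.J by (simp add: adapted_form_def tp_dirsum dirsum_mult rect_tp minus_dirsum)
qed

lemma adapted_form_block:
 assumes "\<epsilon> = (-1) ^ (k + 1)"
 shows "adapted_form \<epsilon> k (jblock k) (antidiagonal k) (scl \<epsilon> (antidiagonal k))"
 unfolding adapted_form_def bilinear_form_def
 using antidiagonal_cor[of k] tp_antidiagonal[of k] antidiagonal_square[of k] antidiagonal_jblock[of k]
 by (auto simp: assms rect_scl rect_minus minus_one_power_iff)

text \<open>For this parity the form \<open>S\<close> of one block has sign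
  \<open>- \<epsilon>\<close>. The block matrix with \<open>S\<close> in the upper right,
  \<open>- S\<close> in the lower left and zero diagonal blocks repairs the sign.\<close>

lemma adapted_form_pair:
 assumes "\<epsilon> = (-1) ^ k"
 obtains K K' where "adapted_form \<epsilon> (k + k) (dirsum k (jblock k) (jblock k)) K K'"
proof -
 define S B s where "S = antidiagonal k" and "B = jblock k" and "s = shift k"
 have tpS: "tp S = scl (- \<epsilon>) S" and SS: "S * S = scl (- \<epsilon>) (idm k)" and SB: "tp B * S = - (S * B)"
  using tp_antidiagonal[of k] antidiagonal_square[of k] antidiagonal_jblock[of k] by (simp_all add: S_def B_def assms)
 have c: "S \<in> cor k" "B \<in> cor k" "tp B \<in> cor k"
  using rect_tp[OF jblock_cor] by (simp_all add: S_def B_def antidiagonal_cor jblock_cor)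
 have s: "s * tp s = 1" "s * S = 0" "S * tp s = 0" "s * B = 0" "B * tp s = 0" "tp B * tp s = 0"
  using c by (simp_all add: s_def shift_cor)
 have \<epsilon>: "\<epsilon> = 1 \<or> \<epsilon> = -1" "\<epsilon> * \<epsilon> = 1" by (auto simp: assms minus_one_power_iff)
 define K where "K = S * s - tp s * S"
 have K_cor: "K \<in> cor (k + k)"
 proof -
  show ?thesis unfolding rect_iff
  proof (intro allI impI)
   fix i j assume "ent K i j ~= 0"
   then have "k \<le> j \<and> ent S i (j - k) ~= 0 \<or> k \<le> i \<and> ent S (i - k) j ~= 0"
    by (auto simp: K_def s_def ent_mult_shift ent_tp_shift_mult split: if_splits)
   then show "i < k + k \<and> j < k + k" by (auto simp: S_def ent_antidiagonal split: if_splits)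
  qed
 qed
 have tpK: "tp K = scl \<epsilon> K" by (simp add: K_def tp_mult tpS imat.scale_right_diff_distrib)
 have KK: "K * K = scl \<epsilon> (idm (k + k))"
 proof -
  have "K * K = - (S * S + tp s * (S * S) * s)"
   by (simp add: K_def left_diff_distrib right_diff_distrib assoc s s[THEN assoc_rule])
  also have "\<dots> = scl \<epsilon> (idm k + tp s * idm k * s)" by (simp add: SS imat.scale_right_distrib)
  also have "idm k + tp s * idm k * s = idm (k + k)" by (simp add: dirsum_def s_def flip: dirsum_idm)
  finally show ?thesis .
 qed
 have form: "bilinear_form (k + k) K (scl \<epsilon> K) \<epsilon>" using K_cor tpK KK \<epsilon> by unfold_locales (simp_all add: rect_scl)
 have "tp (dirsum k B B) * K = - (K * dirsum k B B)"
 proof -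
  have "tp (dirsum k B B) * K = tp B * S * s - tp s * (tp B * S)"
   by (simp add: dirsum_def K_def tp_mult s_def[symmetric] right_diff_distrib distrib_right assoc s s[THEN assoc_rule])
  moreover have "K * dirsum k B B = S * B * s - tp s * (S * B)"
   by (simp add: dirsum_def K_def s_def[symmetric] left_diff_distrib distrib_left assoc s s[THEN assoc_rule])
  ultimately show ?thesis by (simp add: SB assoc)
 qed
 then show thesis using that form unfolding adapted_form_def B_def by blast
qed

abbreviation jordan :: "nat list => imat" where "jordan p \<equiv> jmat (map (\<lambda>k. (k, 0)) p)"

lemma jordan_cor: "jordan p \<in> cor (sum_list p)" using jmat_cor[of "map (\<lambda>k. (k, 0)) p"] by (simp only: fst_map_pair)

text \<open>\<open>tp P * K = K * P\<close> is self-adjointness for \<open>K\<close>. For such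
  \<open>P\<close> the involution \<open>idm N - scl 2 P\<close> is an isometry of \<open>K\<close>
  of determinant \<open>-1\<close> that centralizes \<open>A\<close>.\<close>

definition odd_projection :: "nat => imat => imat => imat => bool" where
 "odd_projection N A K P \<longleftrightarrow>
   P \<in> cor N \<and> P * P = P \<and> P * A = A * P \<and> tp P * K = K * P \<and> odd (rk P)"

lemma adapted_form_exists:
 assumes "good_parts e p" "\<epsilon> = - ((-1) ^ e)"
 obtains K K' where "adapted_form \<epsilon> (sum_list p) (jordan p) K K'"
  "odd e ==> \<exists>k\<in>set p. odd k ==> \<exists>P. odd_projection (sum_list p) (jordan p) K P"
proof -
 have "\<exists>K K'. adapted_form \<epsilon> (sum_list p) (jordan p) K K' \<and>
  (odd e \<and> (\<exists>k\<in>set p. odd k) --> (\<exists>P. odd_projection (sum_list p) (jordan p) K P))"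
  using assms
 proof (induction rule: good_parts.induct)
  case Nil
  have "bilinear_form 0 0 0 (- ((-1) ^ e))" by unfold_locales (auto simp: minus_one_power_iff)
  then show ?case by (intro exI[of _ 0]) (auto simp: adapted_form_def Nil)
 next
  case (single x p)
  then obtain K K' where K: "adapted_form \<epsilon> (sum_list p) (jordan p) K K'" by blast
  define L L' where "L = antidiagonal x" and "L' = scl \<epsilon> (antidiagonal x)"
  have "\<epsilon> = (-1) ^ (x + 1)" using single by (auto simp: minus_one_power_iff)
  then have L: "adapted_form \<epsilon> x (jblock x) L L'" unfolding L_def L'_def by (rule adapted_form_block)
  have K_cor: "K \<in> cor (sum_list p)" using K by (simp add: adapted_form_def bilinear_form_def)
  have jx: "jordan (x # p) = dirsum x (jblock x) (jordan p)" by simp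
  show ?case
  proof (intro exI conjI impI)
   show "adapted_form \<epsilon> (sum_list (x # p)) (jordan (x # p)) (dirsum x L K) (dirsum x L' K')"
    unfolding jx sum_list.Cons by (rule adapted_form_dirsum[OF L K jblock_cor])
   assume "odd e \<and> (\<exists>k\<in>set (x # p). odd k)"
   \<comment> \<open>In the orthogonal case every part standing alone is odd, so the identity of its
     block is a projection of odd rank.\<close>
   then have "odd x" using single by simp
   then show "odd_projection (sum_list (x # p)) (jordan (x # p)) (dirsum x L K) (dirsum x (idm x) 0)"
    unfolding odd_projection_def jx sum_list.Cons using antidiagonal_cor[of x] jblock_cor[of x]
    by (simp add: dirsum_cor dirsum_mult tp_dirsum rk_dirsum[of _ x 0 0] rectD L_def)
  qed
 next
  case (pair x p)
  then obtain K K' where K: "adapted_form \<epsilon> (sum_list p) (jordan p) K K'"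
   "odd e \<and> (\<exists>k\<in>set p. odd k) --> (\<exists>P. odd_projection (sum_list p) (jordan p) K P)" by blast
  have "\<epsilon> = (-1) ^ x" using pair by (auto simp: minus_one_power_iff)
  then obtain L L' where L: "adapted_form \<epsilon> (x + x) (dirsum x (jblock x) (jblock x)) L L'"
   by (rule adapted_form_pair)
  have L_cor: "L \<in> cor (x + x)" using L by (simp add: adapted_form_def bilinear_form_def)
  define B where "B = dirsum x (jblock x) (jblock x)"
  have B: "B \<in> cor (x + x)" unfolding B_def by (intro dirsum_cor jblock_cor)
  have jx: "jordan (x # x # p) = dirsum (x + x) B (jordan p)" by (simp add: dirsum_assoc B_def)
  have sx: "sum_list (x # x # p) = (x + x) + sum_list p" by simp
  have "adapted_form \<epsilon> (sum_list (x # x # p)) (jordan (x # x # p)) (dirsum (x + x) L K) (dirsum (x + x) L' K')"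
   unfolding jx sx by (rule adapted_form_dirsum[OF L[folded B_def] K(1) B])
  moreover have "\<exists>P. odd_projection (sum_list (x # x # p)) (jordan (x # x # p)) (dirsum (x + x) L K) P"
   if "odd e \<and> (\<exists>k\<in>set (x # x # p). odd k)"
  proof -
   from that have "odd e \<and> (\<exists>k\<in>set p. odd k)" using pair by auto
   then obtain P where P: "odd_projection (sum_list p) (jordan p) K P" using K(2) by blast
   then have "odd_projection (sum_list (x # x # p)) (jordan (x # x # p)) (dirsum (x + x) L K) (dirsum (x + x) 0 P)"
    unfolding odd_projection_def jx sx using L_cor B
    by (simp add: dirsum_cor dirsum_mult tp_dirsum rk_dirsum[of 0 "x + x" P "sum_list p"])
   then show ?thesis by blast
  qed
  ultimately show ?case by blast
 qed
 then show thesis using that by blast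
qed


lemma (in bilinear_form) star_idm_power:
 assumes "A \<in> cor N" "star A = - A"
 shows "star (idm N * A ^ m) = scl ((-1) ^ m) (idm N * A ^ m)"
proof -
 have "(- A) ^ m = scl ((-1) ^ m) (A ^ m)" by (induction m) (simp_all)
 then show ?thesis using assms by (simp add: star_power)
qed

subsection \<open>Classical groups\<close>

definition form_sign :: "classical_type => complex" where
 "form_sign X = (if X = TypeC then -1 else 1)"

lemma form_sign: "form_sign X = - ((-1) ^ type_eps X)" by (simp add: form_sign_def type_eps_def)

definition form_inverse :: "classical_type => nat => imat" where
 "form_inverse X n = scl (form_sign X) (of_m (form_matrix X n))"

lemma form_matrix_bilinear:
 "bilinear_form (std_dim X n) (of_m (form_matrix X n)) (form_inverse X n) (form_sign X)"
proof -
 define N F where "N = std_dim X n" and "F = of_m (form_matrix X n)"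
 have ent: "ent F i j = (if i + j + 1 = N then if X = TypeC \<and> n \<le> i then -1 else 1 else 0)" for i j
  by (auto simp: F_def N_def ent_of_m form_matrix_def)
 have sgn: "ent F j i = form_sign X * ent F i j" for i j by (auto simp: ent N_def form_sign_def)
 have "ent (F * F) i j = ent (scl (form_sign X) (idm N)) i j" for i j
 proof -
  have "ent (F * F) i j = (\<Sum>l\<in>{N - 1 - i}. ent F i l * ent F l j)"
   by (rule ent_mult) (auto simp: ent split: if_splits)
  also have "\<dots> = ent (scl (form_sign X) (idm N)) i j"
  proof (cases "i < N")
   case True
   define l where "l = N - 1 - i"
   have l: "i + l + 1 = N" using True by (simp add: l_def)
   then have "ent F i l * ent F i l = 1" by (simp add: ent)
   moreover have "ent F l j = 0" if "i ~= j" using l that by (simp add: ent)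
   moreover have "ent F l i = form_sign X * ent F i l" by (rule sgn)
   ultimately have "ent F i l * ent F l j = ent (scl (form_sign X) (idm N)) i j"
    using True by (cases "i = j") (simp_all add: ent_idm)
   then show ?thesis by (simp add: l_def)
  qed (simp add: ent ent_idm)
  finally show ?thesis .
 qed
 then have "F * F = scl (form_sign X) (idm N)" by (rule imat_eqI)
 moreover have "tp F = scl (form_sign X) F" by (rule imat_eqI, unfold ent_tp ent_scl) (rule sgn)
 moreover have "F \<in> cor N" by (auto simp: rect_iff ent split: if_splits)
 ultimately show ?thesis unfolding form_inverse_def F_def[symmetric] N_def[symmetric]
  by unfold_locales (auto simp: rect_scl rect_minus form_sign_def)
qed

locale classical_form =
 fixes X :: classical_type and n :: nat

sublocale classical_form \<subseteq> bilinear_form "std_dim X n" "of_m (form_matrix X n)"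
  "form_inverse X n" "form_sign X" by (rule form_matrix_bilinear)

context classical_form
begin

abbreviation N :: nat where "N \<equiv> std_dim X n"

abbreviation mat_of :: "imat => complex mat" where "mat_of \<equiv> to_m N N"

definition special :: "imat => bool" where "special g \<longleftrightarrow> isometry g \<and> dt N g = 1"

lemma specialD: assumes "special g"
 shows "isometry g" "dt N g = 1" "g \<in> cor N" "star g * g = idm N" "g * star g = idm N"
 using assms isometryD by (auto simp: special_def)

lemma special_mult: "special g ==> special h ==> special (g * h)"
 by (simp add: special_def isometry_mult dt_mult isometryD(1))

lemma special_star: "special g ==> special (star g)" by (simp add: special_def isometryD dt_star)

lemma special_idm: "special (idm N)" by (simp add: special_def isometry_def dt_idm)

lemma isometry_iff: "g \<in> cor N ==> isometry g \<longleftrightarrow> tp g * of_m (form_matrix X n) * g = of_m (form_matrix X n)"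
proof
 assume g: "g \<in> cor N" and "isometry g"
 then have "of_m (form_matrix X n) * star g * g = of_m (form_matrix X n)"
  using isometryD(2)[of g] J by (simp add: assoc rectD)
 then show "tp g * of_m (form_matrix X n) * g = of_m (form_matrix X n)" using J_star[OF g] by simp
next
 assume g: "g \<in> cor N" and "tp g * of_m (form_matrix X n) * g = of_m (form_matrix X n)"
 then have "star g * g = idm N" using J'J by (simp add: star_def assoc)
 then show "isometry g" using g by (simp add: isometry_def)
qed

lemma group_mem: "g \<in> carrier (classical_group X n) \<longleftrightarrow> g \<in> carrier_mat N N \<and> special (of_m g)"
proof (cases "g \<in> carrier_mat N N")
 case True
 have f: "form_matrix X n \<in> carrier_mat N N" by (simp add: form_matrix_def)
 have "transpose_mat g * form_matrix X n * g = form_matrix X n \<longleftrightarrow> isometry (of_m g)"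
 proof -
  have "of_m (transpose_mat g * form_matrix X n * g) = tp (of_m g) * of_m (form_matrix X n) * of_m g"
   using True f by (simp add: of_m_mult[of _ N N _ N] of_m_tp assoc)
  then show ?thesis using of_m_inj[of "transpose_mat g * form_matrix X n * g" N N "form_matrix X n"] True f
   by (auto simp: isometry_iff[OF of_m_rect[OF True]])
 qed
 then show ?thesis using True by (simp add: classical_group_def matrix_group_def special_def dt_def to_m_of_m)
qed (simp add: classical_group_def matrix_group_def)

lemma group_simps: "x \<otimes>\<^bsub>classical_group X n\<^esub> y = x * y" "\<one>\<^bsub>classical_group X n\<^esub> = 1\<^sub>m N"
 by (simp_all add: classical_group_def matrix_group_def)

lemma mat_of_group: "special g ==> mat_of g \<in> carrier (classical_group X n)"
 using specialD(3)[of g] by (simp add: group_mem of_m_to_m)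

lemma group_inv:
 assumes "g \<in> carrier (classical_group X n)"
 shows "m_inv (classical_group X n) g = mat_of (star (of_m g))" "of_m (m_inv (classical_group X n) g) = star (of_m g)"
proof -
 have g: "g \<in> carrier_mat N N" "special (of_m g)" using assms by (auto simp: group_mem)
 note s = specialD[OF g(2)]
 define h where "h = mat_of (star (of_m g))"
 have h: "h \<in> carrier_mat N N" "of_m h = star (of_m g)" "h \<in> carrier (classical_group X n)"
  using special_star[OF g(2)] by (auto simp: h_def of_m_to_m star_cor intro: mat_of_group)
 have one: "of_m (1\<^sub>m N) = idm N" by (rule of_m_one)
 have gh: "g * h = 1\<^sub>m N" "h * g = 1\<^sub>m N"
  using g h s one by (auto intro!: of_m_inj[of _ N N] simp: of_m_mult[of _ N N _ N])
 have "m_inv (classical_group X n) g = h" unfolding m_inv_def group_simps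
 proof (rule the_equality)
  fix y assume y: "y \<in> carrier (classical_group X n) \<and> g * y = 1\<^sub>m N \<and> y * g = 1\<^sub>m N"
  then have "y \<in> carrier_mat N N" by (simp add: group_mem)
  then have "y = (h * g) * y" using gh by simp
  also have "\<dots> = h * (g * y)" using y g h by (simp add: group_mem assoc_mult_mat[of _ N N _ N _ N])
  finally show "y = h" using y h by simp
 qed (use gh h in auto)
 then show "m_inv (classical_group X n) g = mat_of (star (of_m g))" "of_m (m_inv (classical_group X n) g) = star (of_m g)"
  using h by (simp_all add: h_def)
qed

lemma lie_mem: "A \<in> classical_lie_algebra X n \<longleftrightarrow> A \<in> carrier_mat N N \<and> star (of_m A) = - of_m A"
proof (cases "A \<in> carrier_mat N N")
 case True
 have f: "form_matrix X n \<in> carrier_mat N N" by (simp add: form_matrix_def)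
 define F a where "F = of_m (form_matrix X n)" and "a = of_m A"
 have a: "a \<in> cor N" unfolding a_def using True by (rule of_m_rect)
 have "transpose_mat A * form_matrix X n + form_matrix X n * A = 0\<^sub>m N N \<longleftrightarrow> tp a * F + F * a = 0"
 proof -
  have "of_m (transpose_mat A * form_matrix X n + form_matrix X n * A) = tp a * F + F * a"
   using True f by (simp add: of_m_mult[of _ N N _ N] of_m_add[of _ N N] of_m_tp a_def F_def)
  then show ?thesis
   using of_m_inj[of "transpose_mat A * form_matrix X n + form_matrix X n * A" N N "0\<^sub>m N N"] True f
   by (auto simp: of_m_zero)
 qed
 also have "\<dots> \<longleftrightarrow> F * (star a + a) = 0" using J_star[OF a] by (simp add: F_def distrib_left)
 also have "\<dots> \<longleftrightarrow> star a + a = 0"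
 proof
  assume "F * (star a + a) = 0"
  then have "form_inverse X n * (F * (star a + a)) = 0" by simp
  then have "idm N * (star a + a) = 0" by (simp only: J'J[folded F_def] assoc[symmetric])
  then show "star a + a = 0" using star_cor[of a] a by (simp add: distrib_left rectD)
 qed simp
 finally show ?thesis using True by (simp add: classical_lie_algebra_def a_def eq_neg_iff_add_eq_0)
qed (simp add: classical_lie_algebra_def)

lemma orbit_mem:
 assumes "M \<in> carrier_mat N N"
 shows "B \<in> adjoint_orbit X n M \<longleftrightarrow> (\<exists>g. special g \<and> B = mat_of (g * of_m M * star g))"
proof
 assume "B \<in> adjoint_orbit X n M"
 then obtain g where g: "g \<in> carrier (classical_group X n)" "B = g * M * m_inv (classical_group X n) g"
  by (auto simp: adjoint_orbit_def)
 have gc: "g \<in> carrier_mat N N" "special (of_m g)" using g(1) by (auto simp: group_mem)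
 have "mat_of (of_m g * of_m M * star (of_m g)) = B" using gc assms group_inv(1)[OF g(1)]
  by (simp only: g(2) to_m_mult[OF cor_mult star_cor] to_m_mult[of _ N N _ N] of_m_rect to_m_of_m)
 then show "\<exists>g. special g \<and> B = mat_of (g * of_m M * star g)" using gc(2) by metis
next
 assume "\<exists>g. special g \<and> B = mat_of (g * of_m M * star g)"
 then obtain g where g: "special g" "B = mat_of (g * of_m M * star g)" by blast
 note gg = mat_of_group[OF g(1)] specialD(3)[OF g(1)]
 have "B = mat_of g * M * m_inv (classical_group X n) (mat_of g)" using gg assms group_inv(1)[OF gg(1)]
  by (simp only: g(2) to_m_mult[OF cor_mult star_cor] to_m_mult[of _ N N _ N] of_m_rect to_m_of_m of_m_to_m)
 then show "B \<in> adjoint_orbit X n M" using gg by (auto simp: adjoint_orbit_def)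
qed

lemma orbit_self: assumes "M \<in> carrier_mat N N" shows "M \<in> adjoint_orbit X n M"
proof -
 have "M = mat_of (idm N * of_m M * star (idm N))" using assms of_m_rect[OF assms] by (simp add: rectD to_m_of_m)
 then show ?thesis using special_idm orbit_mem[OF assms] by blast
qed

lemma special_sim: assumes "special g" "A \<in> cor N" shows "sim N (g * A * star g) A"
 unfolding sim_def using specialD[OF assms(1)] assms star_cor cor_mult by metis

lemma orbit_partition_eq:
 assumes M: "M \<in> carrier_mat N N" and p: "jordan_type N (of_m M) p"
 shows "orbit_partition (adjoint_orbit X n M) = p" unfolding orbit_partition_def
proof (rule the_equality)
 have m: "of_m M \<in> cor N" using M by (rule of_m_rect)
 show "is_partition p \<and> (\<exists>A\<in>adjoint_orbit X n M. jordan_nf A (map (\<lambda>k. (k, 0)) p))"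
  using p jordan_type_iff[OF M] orbit_self[OF M] by blast
 fix q assume "is_partition q \<and> (\<exists>A\<in>adjoint_orbit X n M. jordan_nf A (map (\<lambda>k. (k, 0)) q))"
 then obtain g where g: "special g" "is_partition q \<and> jordan_nf (mat_of (g * of_m M * star g)) (map (\<lambda>k. (k, 0)) q)"
  using orbit_mem[OF M] by auto
 have c: "g * of_m M * star g \<in> cor N" using specialD(3)[OF g(1)] star_cor m by (intro cor_mult)
 have "jordan_type N (g * of_m M * star g) q"
  using g(2) jordan_type_iff[of "mat_of (g * of_m M * star g)" N q] c by (simp add: of_m_to_m)
 moreover have "jordan_type N (g * of_m M * star g) p" by (rule jordan_type_sim[OF special_sim[OF g(1) m] p])
 ultimately show "q = p" by (rule jordan_type_unique)
qed

lemma orbit_eqI: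
 assumes "M \<in> carrier_mat N N" "special g" "M' = mat_of (g * of_m M * star g)"
 shows "adjoint_orbit X n M' = adjoint_orbit X n M"
proof -
 have m: "of_m M \<in> cor N" using assms(1) by (rule of_m_rect)
 note g = specialD[OF assms(2)]
 have M': "M' \<in> carrier_mat N N" "of_m M' = g * of_m M * star g"
  using assms(3) of_m_to_m[of "g * of_m M * star g" N N] cor_mult[OF cor_mult[OF g(3) m] star_cor] by auto
 have 1: "h * of_m M' * star h = (h * g) * of_m M * star (h * g)" if "special h" for h
  using specialD(3)[OF that] by (simp add: M' star_mult assoc)
 have 2: "h * of_m M * star h = (h * star g) * of_m M' * star (h * star g)" if "special h" for h
  using specialD(3)[OF that] g m
  by (simp add: M' star_mult star_star assoc g(4)[THEN assoc_rule] rectD rectD[OF star_cor]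
    rectD[OF m, THEN assoc_rule])
 show ?thesis
 proof (intro Set.set_eqI iffI)
  fix B assume "B \<in> adjoint_orbit X n M'"
  then obtain h where "special h" "B = mat_of (h * of_m M' * star h)" using orbit_mem[OF M'(1)] by blast
  then show "B \<in> adjoint_orbit X n M"
   using 1[of h] special_mult[of h g] assms(2) unfolding orbit_mem[OF assms(1)] by metis
 next
  fix B assume "B \<in> adjoint_orbit X n M"
  then obtain h where "special h" "B = mat_of (h * of_m M * star h)" using orbit_mem[OF assms(1)] by blast
  then show "B \<in> adjoint_orbit X n M'"
   using 2[of h] special_mult[of h "star g"] special_star[OF assms(2)] unfolding orbit_mem[OF M'(1)] by metis
 qed
qed

subsection \<open>Nilpotent orbits and partitions\<close>

text \<open>If \<open>m\<close> has the parity of \<open>type_eps X\<close>, the power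
  \<open>A ^ m\<close> is skew for the form, so its rank is even. A multiplicity that has to be even
  is, modulo 2, a sum of two such ranks.\<close>

lemma jordan_type_partition:
 assumes A: "A \<in> cor N" "star A = - A" and p: "jordan_type N A p"
 shows "partition_of_type X p"
proof -
 have ev: "even (excess p m)" if "even (m + type_eps X)" for m
 proof -
  have "(-1) ^ m = - form_sign X" using that by (auto simp: form_sign minus_one_power_iff)
  then have "even (rk (idm N * A ^ m))"
   using star_idm_power[OF A, of m] by (intro even_rk_skew_form idm_power_cor A) simp
  then show ?thesis using jordan_type_rk[OF p] by simp
 qed
 have "good_parts (type_eps X) p"
 proof (rule good_partsI)
  show "sorted_wrt (\<ge>) p" using p by (simp add: jordan_type_def is_partition_def)
  fix k assume k: "odd (k + type_eps X)"
  show "even (count_list p k)"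
  proof (cases "k = 0")
   case True
   then show ?thesis using p count_list_0 by (simp add: jordan_type_def)
  next
   case False
   then have "even (excess p (k - 1))" "even (excess p (k + 1))" using k by (auto intro!: ev)
   then show ?thesis using count_excess[of k p] False by (metis even_add even_mult_iff even_numeral not_gr0)
  qed
 qed
 moreover have "even N \<longleftrightarrow> X ~= TypeB" by (cases X) auto
 ultimately show ?thesis using p by (auto simp: partition_of_type_iff jordan_type_def)
qed

text \<open>A Jordan matrix is skew for the form built by \<open>adapted_form_exists\<close>. A
  congruence \<open>S\<close> relates that form to the standard one, and conjugation by
  \<open>S\<close> moves the matrix and the odd projection along. The element \<open>z\<close>
  serves to pass from all isometries to those of determinant \<open>1\<close>.\<close>

lemma skew_nilpotent_exists:
 assumes p: "partition_of_type X p" "sum_list p = N"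
 obtains A where "A \<in> cor N" "star A = - A" "jordan_type N A p"
  "X ~= TypeC ==> \<exists>k\<in>set p. odd k ==> \<exists>z. isometry z \<and> dt N z = -1 \<and> z * A * star z = A"
proof -
 have g: "good_parts (type_eps X) p" "is_partition p" using p(1) by (auto simp: partition_of_type_iff)
 obtain K K' where K: "adapted_form (form_sign X) (sum_list p) (jordan p) K K'"
  "odd (type_eps X) ==> \<exists>k\<in>set p. odd k ==> \<exists>P. odd_projection (sum_list p) (jordan p) K P"
  using adapted_form_exists[OF g(1) form_sign] by blast
 have form: "bilinear_form N K K' (form_sign X)" using K(1) p(2) by (simp add: adapted_form_def)
 obtain S S' where S: "S \<in> cor N" "S' \<in> cor N" "S * S' = idm N" "S' * S = idm N"
  "tp S * of_m (form_matrix X n) * S = K" using forms_congruent[OF form_matrix_bilinear form] by metis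
 define F where "F = of_m (form_matrix X n)"
 have tpS: "tp S' * tp S = idm N" using arg_cong[OF S(3), of tp] by (simp add: tp_mult)
 have FS: "tp S' * K * S' = F" and FS': "F * S = tp S' * K"
 proof -
  have "tp S' * K = (tp S' * tp S) * F * S" by (simp add: S(5)[symmetric] F_def assoc)
  also have "\<dots> = F * S" using J by (simp add: tpS F_def rectD assoc[symmetric])
  finally show FS': "F * S = tp S' * K" by simp
  have "tp S' * K * S' = F * (S * S')" by (simp add: FS'[symmetric] assoc)
  then show "tp S' * K * S' = F" using J by (simp add: S F_def rectD)
 qed
 \<comment> \<open>Conjugation by \<open>S\<close> turns adjoints for \<open>K\<close> into adjoints
   for the standard form.\<close>
 have star_conj: "star (S * Y * S') = scl c (S * Z * S')" if "tp Y * K = scl c (K * Z)" "Z \<in> cor N" for Y Z c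
 proof -
  have "tp (S * Y * S') * F = tp S' * tp Y * (tp S * F)" by (simp add: tp_mult assoc)
  also have "tp S * F = K * S'"
  proof -
   have "tp S * F * (S * S') = K * S'" by (simp add: S(5)[symmetric] F_def assoc)
   then show ?thesis using J by (simp add: S F_def rectD assoc)
  qed
  also have "tp S' * tp Y * (K * S') = scl c (tp S' * K * Z * S')"
   using that(1) by (simp add: assoc[of "tp S'"] assoc[symmetric, of "tp Y"] scl_mult)
  also have "tp S' * K * Z * S' = F * (S * Z * S')" by (simp add: FS'[symmetric] assoc)
  finally have "tp (S * Y * S') * F = scl c (F * (S * Z * S'))" .
  note tp_conj = this
  have "star (S * Y * S') = form_inverse X n * (tp (S * Y * S') * F)" by (simp only: star_def F_def assoc)
  then have "star (S * Y * S') = scl c (form_inverse X n * F * (S * Z * S'))"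
   unfolding tp_conj by (simp only: scl_mult_right assoc)
  then show ?thesis using S by (simp only: J'J[folded F_def]) (simp add: rectD flip: assoc)
 qed
 have jc: "jordan p \<in> cor N" using jordan_cor[of p] p(2) by simp
 define A where "A = S * jordan p * S'"
 have A: "A \<in> cor N" using S jc by (simp add: A_def cor_mult)
 have starA: "star A = - A"
 proof -
  have "tp (jordan p) * K = scl (-1) (K * jordan p)" using K(1) by (simp add: adapted_form_def)
  from star_conj[OF this jc] show ?thesis by (simp add: A_def)
 qed
 have "sim N A (jordan p)" unfolding sim_def A_def using S jc cor_mult by blast
 then have jt: "jordan_type N A p" using g p by (simp add: jordan_type_def)
 have "\<exists>z. isometry z \<and> dt N z = -1 \<and> z * A * star z = A" if X: "X ~= TypeC" and odd: "\<exists>k\<in>set p. odd k"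
 proof -
  obtain P where P: "P \<in> cor N" "P * P = P" "P * jordan p = jordan p * P" "tp P * K = K * P" "odd (rk P)"
   using K(2)[OF _ odd] X p(2) unfolding odd_projection_def type_eps_def by auto
  define Q z where "Q = S * P * S'" and "z = idm N - scl 2 Q"
  have SS: "S' * (S * Y) = Y" if "Y \<in> cor N" for Y using that S by (simp add: rectD flip: assoc)
  have Q: "Q \<in> cor N" "Q * Q = Q" "star Q = Q" "Q * A = A * Q"
  proof -
   show "Q \<in> cor N" using S P by (simp add: Q_def cor_mult)
   have "Q * Q = S * P * (S' * (S * (P * S')))" by (simp add: Q_def assoc)
   also have "\<dots> = S * (P * P) * S'" using P S by (simp add: SS cor_mult assoc P(2)[THEN assoc_rule])
   finally show "Q * Q = Q" by (simp only: P Q_def)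
   show "star Q = Q" using star_conj[of P 1 P] P by (simp add: Q_def)
   have "Q * A = S * P * (S' * (S * (jordan p * S')))" "A * Q = S * jordan p * (S' * (S * (P * S')))"
    by (simp_all add: Q_def A_def assoc)
   then show "Q * A = A * Q" using P S jc by (simp only: SS cor_mult) (simp add: P(3)[THEN assoc_rule] assoc)
  qed
  have "sim N Q P" unfolding sim_def Q_def using S P cor_mult by blast
  then have "odd (rk Q)" using P sim_rk by simp
  then have dtz: "dt N z = -1" using dt_involution[OF Q(1,2)] by (simp add: z_def)
  have z: "z \<in> cor N" "star z = z" using Q by (auto simp: z_def star_diff star_scl intro: rect_diff rect_scl)
  have "z * z = idm N - scl 2 Q - scl 2 (Q - scl 2 Q)"
   using Q by (simp add: z_def left_diff_distrib right_diff_distrib rectD)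
  also have "\<dots> = idm N" by (rule imat_eqI) simp
  finally have zz: "z * z = idm N" .
  have "z * A = A * z" using Q A by (simp add: z_def left_diff_distrib right_diff_distrib rectD)
  then have "z * A * star z = A" using z zz A by (simp add: assoc rectD)
  then show ?thesis using z zz dtz by (auto simp: isometry_def)
 qed
 then show thesis using that A starA jt by blast
qed

lemma orbit_of_type:
 assumes A: "A \<in> cor N" "star A = - A" and p: "jordan_type N A p"
 shows "adjoint_orbit X n (mat_of A) \<in> nilpotent_orbits X n" "orbit_partition (adjoint_orbit X n (mat_of A)) = p"
proof -
 have m: "mat_of A \<in> carrier_mat N N" "of_m (mat_of A) = A" using A by (simp_all add: of_m_to_m)
 have "excess p N = 0"
 proof -
  have "j \<le> N" if "j \<in> set p" for j using p member_le_sum_list[OF that] by (simp add: jordan_type_def)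
  then show ?thesis by (simp add: excess_def)
 qed
 then have "rk (idm N * A ^ N) = 0" using jordan_type_rk[OF p] by simp
 then have "idm N * A ^ N = 0" by (intro rk_eq_0 fin_mult_right) simp_all
 then have "mat_of A ^\<^sub>m N = 0\<^sub>m N N"
  using m of_m_pow[OF m(1), of N] by (intro of_m_inj[of _ N N]) (simp_all add: of_m_zero)
 then show "adjoint_orbit X n (mat_of A) \<in> nilpotent_orbits X n"
  using m A lie_mem by (auto simp: nilpotent_orbits_def)
 show "orbit_partition (adjoint_orbit X n (mat_of A)) = p" using orbit_partition_eq[OF m(1)] m p by simp
qed

lemma nilpotent_orbitE:
 assumes "Orb \<in> nilpotent_orbits X n"
 obtains A p where "A \<in> cor N" "star A = - A" "jordan_type N A p" "Orb = adjoint_orbit X n (mat_of A)"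
  "orbit_partition Orb = p"
proof -
 obtain M k where M: "M \<in> classical_lie_algebra X n" "M ^\<^sub>m k = 0\<^sub>m N N" "Orb = adjoint_orbit X n M"
  using assms by (auto simp: nilpotent_orbits_def)
 have m: "M \<in> carrier_mat N N" "star (of_m M) = - of_m M" "of_m M \<in> cor N" using M(1) lie_mem of_m_rect by auto
 have "idm N * of_m M ^ k = 0" using of_m_pow[OF m(1), of k] M(2) by (simp add: of_m_zero)
 then obtain p where p: "jordan_type N (of_m M) p" using jordan_type_exists[OF m(3)] by blast
 have "Orb = adjoint_orbit X n (mat_of (of_m M))" using M(3) m(1) by (simp add: to_m_of_m)
 then show thesis using that[OF m(3,2) p] orbit_of_type(2)[OF m(3,2) p] by blast
qed

text \<open>Obtained from \<open>skew_nilpotent_exists\<close> for the partition into ones, that is,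
  for the zero orbit.\<close>

lemma reflection_exists:
 assumes "X ~= TypeC" "N > 0" obtains z where "isometry z" "dt N z = -1"
proof -
 have "good_parts 1 (replicate k 1)" for k by (induction k) (auto intro: good_parts.intros)
 moreover have "even N \<longleftrightarrow> X ~= TypeB" by (cases X) auto
 moreover have "sorted_wrt (\<ge>) (replicate k (1::nat))" for k by (induction k) auto
 ultimately have "partition_of_type X (replicate N 1)"
  using assms by (simp add: partition_of_type_iff is_partition_def type_eps_def sum_list_replicate)
 moreover have "sum_list (replicate N 1) = N" by (simp add: sum_list_replicate)
 moreover have "\<exists>k\<in>set (replicate N 1). odd k" using assms by simp
 ultimately show thesis using skew_nilpotent_exists[of "replicate N 1"] assms(1) that by metis
qed

lemma orbit_eq_if_special:
 assumes "A \<in> cor N" "special g" "B = g * A * star g"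
 shows "adjoint_orbit X n (mat_of B) = adjoint_orbit X n (mat_of A)"
 using orbit_eqI[of "mat_of A" g "mat_of B"] assms by (simp add: of_m_to_m)

lemma star_conj_mult:
 assumes "isometry g" "isometry h" "A \<in> cor N"
 shows "(g * h) * A * star (g * h) = g * (h * A * star h) * star g"
 using isometryD(1)[OF assms(1)] by (simp add: star_mult assoc)

text \<open>Elements of equal Jordan type are conjugate by an isometry. If its determinant is
  \<open>-1\<close>, a centralizing isometry of determinant \<open>-1\<close> corrects it; outside
  type C an odd part provides one.\<close>

lemma orbit_unique:
 assumes p: "partition_of_type X p" "sum_list p = N" "X = TypeC \<or> (\<exists>k\<in>set p. odd k)"
  and A: "A \<in> cor N" "star A = - A" "jordan_type N A p"
  and B: "B \<in> cor N" "star B = - B" "jordan_type N B p"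
 shows "adjoint_orbit X n (mat_of B) = adjoint_orbit X n (mat_of A)"
proof -
 have base: "adjoint_orbit X n (mat_of B) = adjoint_orbit X n (mat_of C)"
  if C: "C \<in> cor N" "star C = - C" "jordan_type N C p" "X ~= TypeC ==> \<exists>k\<in>set p. odd k ==> \<exists>z. isometry z \<and> dt N z = -1 \<and> z * C * star z = C"
   and B: "B \<in> cor N" "star B = - B" "jordan_type N B p" for B C
 proof -
  obtain g where g: "isometry g" "B = g * C * star g"
   using conjugate_by_isometry[OF C(1,2) B(2) sim_of_jordan_type[OF B(3) C(3)]] .
  have "\<exists>g. special g \<and> B = g * C * star g"
  proof (cases "dt N g = 1")
   case True
   then show ?thesis using g by (auto simp: special_def)
  next
   case False
   then have d: "dt N g = -1" using dt_isometry[OF g(1)] by blast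
   have "X ~= TypeC" using dt_symplectic[OF g(1)] False by (auto simp: form_sign_def)
   then obtain z where z: "isometry z" "dt N z = -1" "z * C * star z = C" using C(4) p(3) by blast
   have "B = (g * z) * C * star (g * z)" using star_conj_mult[OF g(1) z(1) C(1)] z(3) g(2) by simp
   moreover have "special (g * z)" using g(1) z d by (simp add: special_def isometry_mult dt_mult isometryD(1))
   ultimately show ?thesis by blast
  qed
  then show ?thesis using orbit_eq_if_special[OF C(1)] by blast
 qed
 obtain C where C: "C \<in> cor N" "star C = - C" "jordan_type N C p"
  "X ~= TypeC ==> \<exists>k\<in>set p. odd k ==> \<exists>z. isometry z \<and> dt N z = -1 \<and> z * C * star z = C"
  using skew_nilpotent_exists[OF p(1,2)] by metis
 show ?thesis using base[OF C A] base[OF C B] by simp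
qed

lemma orbit_partition_of_partition:
 assumes p: "partition_of_type X p" "sum_list p = N" "X = TypeC \<or> (\<exists>k\<in>set p. odd k)"
 shows "orbit_partition (orbit_of_partition X n p) = p"
proof -
 obtain A where A: "A \<in> cor N" "star A = - A" "jordan_type N A p" using skew_nilpotent_exists[OF p(1,2)] by metis
 note o = orbit_of_type[OF A]
 have "orbit_of_partition X n p = adjoint_orbit X n (mat_of A)" unfolding orbit_of_partition_def
 proof (rule the_equality)
  fix Orb assume Orb: "Orb \<in> nilpotent_orbits X n \<and> orbit_partition Orb = p"
  then obtain B where "B \<in> cor N" "star B = - B" "jordan_type N B p" "Orb = adjoint_orbit X n (mat_of B)"
   using nilpotent_orbitE by metis
  then show "Orb = adjoint_orbit X n (mat_of A)" using orbit_unique[OF p A] by blast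
 qed (use o in auto)
 then show ?thesis using o by simp
qed

text \<open>By convexity of rank sequences, the sizes of the Jordan blocks of \<open>A\<close> on the image of \<open>P\<close> are among
 those of \<open>A\<close>, hence even, so \<open>rk P\<close> is even.\<close>

lemma centralizer_dt:
 assumes X: "X ~= TypeC" and A: "A \<in> cor N" "star A = - A" and p: "jordan_type N A p" "\<forall>k\<in>set p. even k"
  and g: "isometry g" "g * A = A * g"
 shows "dt N g = 1"
proof -
 obtain P where P: "P \<in> cor N" "P * P = P" "star P = P" "dt N g = (-1) ^ rk P"
  "\<And>B. B \<in> cor N ==> B * g = g * B ==> B * P = P * B" by (rule isometry_projection[OF g(1)], rule that) blast+
 have AP: "A * P = P * A" using P(5)[OF A(1)] g(2) by simp
 define P' where "P' = idm N - P"
 have P': "P' \<in> cor N" "P' * P' = P'" "P * P' = 0" "P' * P = 0" "A * P' = P' * A"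
  using P(1,2) A(1) AP by (simp_all add: P'_def left_diff_distrib right_diff_distrib rectD rect_diff)
 define a where "a m = idm N * A ^ m" for m
 have a_cor: "a m \<in> cor N" for m using A(1) by (simp add: a_def idm_power_cor)
 have a_Suc: "a (Suc m) = A * a m" "a (Suc m) = a m * A" for m
 proof -
  show "a (Suc m) = a m * A" by (simp add: a_def assoc power_commutes)
  show "a (Suc m) = A * a m" using A(1) by (simp add: a_def rectD flip: assoc)
 qed
 have comm: "a m * Q = Q * a m" if "A * Q = Q * A" "Q \<in> cor N" for m Q
 proof (induction m)
  case 0
  then show ?case using that by (simp add: a_def rectD)
 next
  case (Suc m)
  have "a (Suc m) * Q = A * (a m * Q)" by (simp add: a_Suc(1) assoc)
  also have "\<dots> = Q * (A * a m)" by (simp add: Suc.IH that(1)[symmetric] flip: assoc) 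
  finally show ?case by (simp add: a_Suc(1))
 qed
 define r where "r Q m = rk (a m * Q)" for Q m
 have convex: "2 * r Q (Suc m) \<le> r Q m + r Q (Suc (Suc m))" if "A * Q = Q * A" "Q \<in> cor N" for Q m
 proof -
  have fin: "fin (a m * Q)" using a_cor that cor_mult finI by blast
  have "A * (a m * Q) = a (Suc m) * Q" by (simp add: a_Suc(1) assoc)
  moreover have aQA: "(a m * Q) * A = a (Suc m) * Q" by (simp add: a_Suc(2) assoc that(1))
  moreover have "A * (a m * Q) * A = a (Suc (Suc m)) * Q" unfolding assoc[of A] aQA a_Suc(1)[of "Suc m"] ..
  ultimately show ?thesis using rk_frobenius[OF fin, of A A] by (simp add: r_def)
 qed
 have sum: "excess p m = r P m + r P' m" for m
 proof -
  have "a m * P + a m * P' = a m" by (simp add: P'_def right_diff_distrib rectD[OF a_cor])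
  moreover have "rk (a m * P + a m * P') = rk (a m * P) + rk (a m * P')"
  proof (rule rk_direct[of _ _ P P])
   show "fin (a m * P)" "fin (a m * P')" using a_cor P(1) P'(1) cor_mult finI by blast+
   show "P * (a m * P) = a m * P" "P * (a m * P') = 0"
    using comm[OF AP P(1)] comm[OF P'(5,1)] P P' by (simp_all add: assoc) (simp_all flip: assoc add: P P')
  qed (simp_all add: assoc P P')
  ultimately show ?thesis using jordan_type_rk[OF p(1), of m] by (simp add: r_def a_def)
 qed
 have odd_even: "even (r P m)" if "odd m" for m
 proof -
  have "star (a m * P) = star P * star (a m)" using a_cor by (simp add: star_mult)
  also have "\<dots> = scl (- 1) (a m * P)"
   using that star_idm_power[OF A, of m] by (simp add: P(3) a_def[symmetric] comm[OF AP P(1)])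
  finally show ?thesis
   using X a_cor P(1) unfolding r_def by (intro even_rk_skew_form cor_mult) (simp_all add: form_sign_def)
 qed
 \<comment> \<open>All block sizes are even, so the total rank sequence is affine at the odd index
   \<open>m + 1\<close>. The two convex sequences that add up to it are then affine there as
   well.\<close>
 have step: "even (r P m) \<longleftrightarrow> even (r P (Suc (Suc m)))" if "even m" for m
 proof -
  have "Suc m \<notin> set p" using that p(2) by fastforce
  then have "count_list p (Suc m) = 0" by (simp add: count_list_0_iff)
  then have "2 * excess p (Suc m) = excess p m + excess p (Suc (Suc m))" using count_excess[of "Suc m" p] by simp
  then have "2 * r P (Suc m) = r P m + r P (Suc (Suc m))"
   using convex[OF AP P(1), of m] convex[OF P'(5,1), of m] sum by simp
  then show ?thesis by (metis even_add even_mult_iff even_numeral)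
 qed
 have "even (r P 0) \<longleftrightarrow> even (r P (2 * m))" for m
 proof (induction m)
  case (Suc m)
  then show ?case using step[of "2 * m"] by simp
 qed simp
 moreover have "r P (2 * N) = 0"
 proof -
  have "j \<le> 2 * N" if "j \<in> set p" for j using p(1) member_le_sum_list[OF that] by (simp add: jordan_type_def)
  then have "excess p (2 * N) = 0" by (simp add: excess_def)
  then show ?thesis using sum[of "2 * N"] by simp
 qed
 ultimately have "even (r P 0)" by (metis dvd_0_right)
 moreover have "r P 0 = rk P" using P(1) by (simp add: r_def a_def rectD)
 ultimately show ?thesis by (simp add: P(4))
qed

end

text \<open>A reflection \<open>h\<close> produces a second orbit: if it were the first one, some
  isometry of determinant \<open>-1\<close> would centralize \<open>A\<close>, against
  \<open>centralizer_dt\<close>. There is no third orbit, since isometries have determinant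
  \<open>1\<close> or \<open>-1\<close>. So the definite description in \<open>orbit_II\<close> has
  exactly one solution.\<close>

lemma orbit_partition_orbit_II:
 assumes n: "n > 0" and p: "very_even p" "sum_list p = 2 * n"
  and OI: "OI p \<in> nilpotent_orbits TypeD n" "orbit_partition (OI p) = p"
 shows "orbit_partition (orbit_II n OI p) = p"
proof -
 interpret classical_form TypeD n .
 obtain A where A: "A \<in> cor N" "star A = - A" "jordan_type N A p" "OI p = adjoint_orbit TypeD n (mat_of A)"
  using nilpotent_orbitE[OF OI(1)] OI(2) by metis
 have even: "\<forall>k\<in>set p. even k" using p by (simp add: very_even_def)
 obtain h where h: "isometry h" "dt N h = -1" using reflection_exists n by auto
 note hh = isometryD[OF h(1)]
 define B where "B = h * A * star h"
 have B: "B \<in> cor N" "star B = - B" using A hh star_cor by (auto simp: B_def cor_mult star_mult star_star assoc)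
 have "sim N B A" unfolding sim_def B_def using A hh star_cor cor_mult by metis
 then have tB: "jordan_type N B p" by (rule jordan_type_sim[OF _ A(3)])
 have hB: "star h * B * h = A"
  using hh A by (simp add: B_def assoc hh(2)[THEN assoc_rule] rectD rectD[OF A(1), THEN assoc_rule])
 have ne: "adjoint_orbit TypeD n (mat_of B) ~= OI p"
 proof
  assume "adjoint_orbit TypeD n (mat_of B) = OI p"
  then have "mat_of B \<in> adjoint_orbit TypeD n (mat_of A)" using A(4) orbit_self[of "mat_of B"] by simp
  then obtain g where g: "special g" "mat_of B = mat_of (g * A * star g)"
   using orbit_mem[of "mat_of A"] A(1) by (auto simp: of_m_to_m)
  note gg = specialD[OF g(1)]
  have "g * A * star g \<in> cor N" using gg A star_cor by (intro cor_mult)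
  then have gB: "B = g * A * star g" using g(2) B(1) by (metis of_m_to_m)
  define u where "u = star h * g"
  have u: "isometry u" unfolding u_def by (intro isometry_mult hh gg)
  have "u * A = star h * (g * A * (star g * g))" using A(1) gg by (simp add: u_def assoc rectD)
  also have "\<dots> = star h * B * (h * star h) * g"
   using B(1) hh gg by (simp add: gB assoc rectD rectD[OF star_cor, THEN assoc_rule])
  also have "\<dots> = A * u" by (simp add: u_def hB[symmetric] assoc)
  finally have "dt N u = 1" using centralizer_dt[OF _ A(1-3) even u] by simp
  moreover have "dt N u = - 1" using h gg dt_star[OF hh(1)] dt_mult[OF star_cor gg(3), of h] by (simp add: u_def)
  ultimately show False by simp
 qed
 have "orbit_II n OI p = adjoint_orbit TypeD n (mat_of B)" unfolding orbit_II_def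
 proof (rule the_equality)
  fix Orb assume Orb: "Orb \<in> nilpotent_orbits TypeD n \<and> orbit_partition Orb = p \<and> Orb ~= OI p"
  then obtain C where C: "C \<in> cor N" "star C = - C" "jordan_type N C p" "Orb = adjoint_orbit TypeD n (mat_of C)"
   using nilpotent_orbitE by metis
  obtain g where g: "isometry g" "C = g * A * star g"
   using conjugate_by_isometry[OF A(1,2) C(2) sim_of_jordan_type[OF C(3) A(3)]] .
  have "dt N g ~= 1" using Orb C(4) A(4) g orbit_eq_if_special[OF A(1), of g C] by (auto simp: special_def)
  then have "dt N g = -1" using dt_isometry[OF g(1)] by blast
  then have s: "special (g * star h)"
   using isometry_mult[OF g(1) hh(4)] dt_mult[OF isometryD(1)[OF g(1)] star_cor, of h] dt_star[OF hh(1)] h(2)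
   by (simp add: special_def)
  have "C = g * (star h * B * h) * star g" by (simp add: g(2) hB)
  also have "\<dots> = (g * star h) * B * star (g * star h)"
   using isometryD(1)[OF g(1)] hh by (simp add: star_mult star_star assoc)
  finally show "Orb = adjoint_orbit TypeD n (mat_of B)" using C(4) orbit_eq_if_special[OF B(1) s] by simp
 qed (use orbit_of_type[OF B tB] ne in auto)
 then show ?thesis using orbit_of_type(2)[OF B tB] by simp
qed

text \<open>Shows that the definite descriptions in \<open>dBV\<close> denote orbits with the
  expected partition. In rank \<open>0\<close> of type D the empty partition is very even but has
  only one orbit, hence the condition on \<open>n\<close>.\<close>

lemma orbit_partition_dBV:
 assumes OI: "very_even_labelling n OI" and X: "X = TypeD ==> n > 0"
  and p: "partition_of_type X (orbit_partition Orb)" "sum_list (orbit_partition Orb) = std_dim X n"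
 shows "orbit_partition (dBV X n OI Orb) = dBV_partition X (orbit_partition Orb)"
proof -
 define p p' where "p = orbit_partition Orb" and "p' = dBV_partition X p"
 have p'_type: "partition_of_type (dual_type X) p'" "sum_list p' = std_dim (dual_type X) n"
  using p dBV_partition_type_B[of p] dBV_partition_type_C[of p] dBV_partition_type_D[of p]
  by (cases X; simp add: p_def[symmetric] p'_def)+
 have dBV: "dBV X n OI Orb = (if X = TypeD \<and> very_even p
   then if (Orb = OI p) = even n then OI p' else orbit_II n OI p' else orbit_of_partition (dual_type X) n p')"
  by (simp only: dBV_def Let_def p_def p'_def)
 show ?thesis unfolding p_def[symmetric] p'_def[symmetric] dBV
 proof (cases "X = TypeD \<and> very_even p")
  case True
  then have ve: "very_even p'" "sum_list p' = 2 * n" using very_even_dBV p'_type by (auto simp: p'_def)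
  then have "OI p' \<in> nilpotent_orbits TypeD n" "orbit_partition (OI p') = p'"
   using OI by (auto simp: very_even_labelling_def)
  then show "orbit_partition (if X = TypeD \<and> very_even p
   then if (Orb = OI p) = even n then OI p' else orbit_II n OI p' else orbit_of_partition (dual_type X) n p') = p'"
   using orbit_partition_orbit_II[OF _ ve] X True by presburger
 next
  case False
  have "dual_type X = TypeC \<or> (\<exists>k\<in>set p'. odd k)"
  proof (cases X)
   case TypeC
   then have "odd (sum_list p')" using p'_type by simp
   moreover have "even (sum_list q)" if "\<forall>k\<in>set q. even k" for q :: "nat list" using that by (induction q) auto
   ultimately show ?thesis by blast
  next
   case TypeD
   then have "\<not> very_even p'" using False p very_even_if_dBV by (auto simp: p_def[symmetric] p'_def)
   then show ?thesis using p'_type TypeD by (auto simp: very_even_def)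
  qed simp
  then have "orbit_partition (orbit_of_partition (dual_type X) n p') = p'"
   using classical_form.orbit_partition_of_partition[OF p'_type] by blast
  then show "orbit_partition (if X = TypeD \<and> very_even p
   then if (Orb = OI p) = even n then OI p' else orbit_II n OI p' else orbit_of_partition (dual_type X) n p') = p'"
   using False by presburger
 qed
qed

text \<open>Equal dual orbits have equal partitions whatever labels they carry, so the comparison of
  partitions applies and its excesses are read as ranks.\<close>

lemma dBV_fibre_ranks:
 fixes X :: classical_type and n :: nat
 defines "N \<equiv> std_dim X n"
 assumes OI: "very_even_labelling n OI" and X: "X = TypeD ==> n > 0"
  and A: "A \<in> classical_lie_algebra X n" "of_m A ^ k * idm N = 0"
  and B: "B \<in> classical_lie_algebra X n" "of_m B ^ l * idm N = 0"
  and eq: "dBV X n OI (adjoint_orbit X n A) = dBV X n OI (adjoint_orbit X n B)"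
 shows "rk (idm N * of_m B ^ m) \<le> rk (idm N * of_m A ^ m) + 1"
proof -
 interpret classical_form X n .
 have *: "\<exists>p. partition_of_type X p \<and> sum_list p = N \<and> orbit_partition (adjoint_orbit X n M) = p
   \<and> (\<forall>m. rk (idm N * of_m M ^ m) = excess p m)"
  if M: "M \<in> classical_lie_algebra X n" "of_m M ^ k * idm N = 0" for M k
 proof -
  have m: "M \<in> carrier_mat N N" "star (of_m M) = - of_m M" "of_m M \<in> cor N"
   using M(1) lie_mem of_m_rect by (auto simp: N_def)
  have "idm N * of_m M ^ k = of_m M ^ k * idm N"
   using rectD[OF rect_power[OF m(3), of k]] by (cases "k = 0") simp_all
  then obtain p where p: "jordan_type N (of_m M) p" using jordan_type_exists[OF m(3)] M(2) by metis
  then show ?thesis using jordan_type_partition[of "of_m M" p] orbit_partition_eq[of M p] jordan_type_rk[OF p] m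
   by (auto simp: N_def jordan_type_def)
 qed
 obtain p where p: "partition_of_type X p" "sum_list p = N" "orbit_partition (adjoint_orbit X n A) = p"
  "\<And>m. rk (idm N * of_m A ^ m) = excess p m" using *[OF A] by blast
 obtain q where q: "partition_of_type X q" "sum_list q = N" "orbit_partition (adjoint_orbit X n B) = q"
  "\<And>m. rk (idm N * of_m B ^ m) = excess q m" using *[OF B] by blast
 have "dBV_partition X p = dBV_partition X q"
  using orbit_partition_dBV[of n OI X, OF OI X, where Orb = "adjoint_orbit X n A"] orbit_partition_dBV[of n OI X, OF OI X, where Orb = "adjoint_orbit X n B"] p q eq
  by (simp add: N_def)
 then show ?thesis using dBV_partition_fibre[OF p(1) q(1)] p q by simp
qed


section \<open>Isometric representations\<close>

text \<open>Rank and nullity in terms of idempotents: with a generalized inverse \<open>G\<close> of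
  \<open>T\<close>, the idempotent \<open>E\<close> projects onto what \<open>T\<close> kills inside
  the image of \<open>P\<close>.\<close>

lemma kernel_projection:
 assumes P: "fin P" "P * P = P" and T: "T * P = T"
 obtains E G where "E = P - G * T" "P * G = G" "E * E = E" "P * E = E" "E * P = E" "T * E = 0"
  "rk E + rk T = rk P" "\<And>Y. P * Y = Y ==> T * Y = 0 ==> E * Y = Y" "T * G * T = T" "fin G"
proof -
 have fT: "fin T" using P(1) T by (metis fin_mult_left)
 obtain G0 where G0: "fin G0" "T * G0 * T = T" using regular[OF fT] .
 define G where "G = P * G0"
 define E where "E = P - G * T"
 have PG: "P * G = G" using P by (simp add: G_def flip: assoc)
 have fG: "fin G" using G0 by (simp add: G_def fin_mult_left)
 have TGT: "T * G * T = T" using T G0(2) by (simp add: G_def flip: assoc)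
 have GTGT: "G * T * (G * T) = G * T" using TGT by (simp add: assoc)
 have PGT: "P * (G * T) = G * T" "G * T * P = G * T" using PG T by (simp_all add: assoc[symmetric]) (simp add: assoc)
 have E: "E * E = E" "P * E = E" "E * P = E" "T * E = 0"
  using P PGT GTGT T TGT by (simp_all add: E_def left_diff_distrib right_diff_distrib assoc[symmetric])
 have fE: "fin E" using P(1) E by (metis fin_mult_left)
 have "rk (E + G * T) = rk E + rk (G * T)"
 proof (rule rk_direct[OF fE])
  show "fin (G * T)" using fT by (rule fin_mult_left)
  show "E * (G * T) = 0" using PGT GTGT by (simp add: E_def left_diff_distrib)
  show "G * T * E = 0" using E by (simp add: assoc)
 qed (use E in simp_all)
 moreover have "rk (G * T) = rk T"
 proof (rule antisym)
  show "rk (G * T) \<le> rk T" using fT by (rule rk_mult_left_le)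
  have "rk (T * (G * T)) \<le> rk (G * T)" using fT by (intro rk_mult_left_le fin_mult_left)
  then show "rk T \<le> rk (G * T)" using TGT by (simp add: assoc)
 qed
 ultimately have "rk E + rk T = rk P" by (simp add: E_def)
 moreover have "E * Y = Y" if "P * Y = Y" "T * Y = 0" for Y using that by (simp add: E_def left_diff_distrib assoc)
 ultimately show thesis using that[OF E_def PG E] TGT fG by blast
qed

lemma injective_if_rk:
 assumes "fin P" "P * P = P" "T * P = T" "rk P \<le> rk T" "T * Y = 0"
 shows "P * Y = 0"
proof -
 obtain E G where E: "E = P - G * T" "P * E = E" "rk E + rk T = rk P" using kernel_projection[OF assms(1-3)] by metis
 then have "rk E = 0" "fin E" using assms(4) fin_mult_right[OF assms(1), of E] by auto
 then have "E = 0" using rk_eq_0 by blast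
 then have "P * Y = G * (T * Y)" using E(1) by (simp flip: assoc)
 then show ?thesis using assms(5) by simp
qed

lemma rk_if_injective:
 assumes "fin P" "P * P = P" "T * P = T" "\<And>Y. T * Y = 0 ==> P * Y = 0"
 shows "rk T = rk P"
proof -
 have "fin T" using assms(1,3) by (metis fin_mult_left)
 then obtain G where "P = P * G * T" using left_factor[of T P] assms(4) by blast
 then have "rk P \<le> rk T" using rk_mult_left_le[OF \<open>fin T\<close>] by metis
 moreover have "rk T \<le> rk P" using rk_mult_left_le[OF assms(1), of T] assms(3) by simp
 ultimately show ?thesis by simp
qed

context sl2_rep
begin

lemma nil_idm: "k > 0 ==> idm N * nil ^ k = nil ^ k" "k > 0 ==> nil ^ k * idm N = nil ^ k"
 using rectD[OF rect_power[OF nil_cor]] by auto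

lemma eq_by_weights:
 assumes "A \<in> cor N" "B \<in> cor N"
 shows "(\<And>z. wt z * A = wt z * B) ==> A = B" "(\<And>z. A * wt z = B * wt z) ==> A = B"
proof -
 assume "\<And>z. wt z * A = wt z * B"
 then show "A = B" using cor_wt_decomp(1)[OF assms(1)] cor_wt_decomp(1)[OF assms(2)] by simp
next
 assume "\<And>z. A * wt z = B * wt z"
 then show "A = B" using cor_wt_decomp(2)[OF assms(1)] cor_wt_decomp(2)[OF assms(2)] by simp
qed

lemma nil_power_injective_le:
 assumes "z \<le> - int k" "nil ^ k * wt z * Y = 0" shows "wt z * Y = 0"
proof -
 define m where "m = nat (- z)"
 have m: "z = - int m" "k \<le> m" using assms(1) by (auto simp: m_def)
 have "nil ^ m = nil ^ (m - k) * nil ^ k" using m(2) by (simp flip: power_add)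
 then have "nil ^ m * wt (- int m) * Y = 0" using assms(2) by (simp add: m(1) assoc)
 then show ?thesis using nil_power_injective by (simp add: m(1))
qed

lemma weyl_injective: "idm N * Y = Y ==> weyl * Y = 0 ==> Y = 0" using weyl(4) by (metis assoc mult_zero_right)

lemma wt_idm: "idm N * (wt z * Y) = wt z * Y" using rectD(1)[OF wt_cor] by (simp flip: assoc)

text \<open>A subrepresentation, given as a set of matrices whose columns lie in it, vanishes if it
 contains no lowest weight vector.\<close>

lemma lowest_weight_vanish:
 assumes K: "\<And>Y. K Y ==> K (nil * Y)" "\<And>Y. K Y ==> K (weyl * Y)" "\<And>Y z. K Y ==> K (wt z * Y)"
  and lowest: "\<And>j Y. K Y ==> wt (- int j) * Y = Y ==> nil ^ Suc j * Y = 0 ==> Y = 0"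
  and Y: "K Y"
 shows "idm N * Y = 0"
proof -
 have Kpow: "K (nil ^ k * Y)" if "K Y" for k Y using that by (induction k) (simp_all add: assoc K)
 have neg: "wt (- int j) * Y = 0" if "K Y" for j Y using that
 proof (induction "Suc wbound - j" arbitrary: j Y rule: less_induct)
  case less
  show ?case
  proof (cases "j \<le> wbound")
   case False
   then have "wt (- int j) = 0" by (intro wt_outside) simp
   then show ?thesis by simp
  next
   case True
   \<comment> \<open>Induction downwards from the largest weight: \<open>nil ^ Suc j\<close> takes
     weight \<open>- j\<close> to \<open>j + 2\<close>, and the Weyl element reflects this to the
     more extreme weight \<open>- (j + 2)\<close>, where the claim is known. So the component of
     weight \<open>- j\<close> is killed by \<open>nil ^ Suc j\<close>.\<close>
   have "wt (- int (j + 2)) * (weyl * (nil ^ Suc j * Y)) = 0"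
    using True by (intro less.hyps K Kpow less.prems) simp
   moreover have "wt (- int (j + 2)) * weyl = weyl * wt (int (j + 2))" by (simp only: weyl_wt)
   ultimately have "weyl * (wt (int (j + 2)) * (nil ^ Suc j * Y)) = 0" by (simp only: assoc[symmetric])
   then have "wt (int (j + 2)) * (nil ^ Suc j * Y) = 0" by (rule weyl_injective[OF wt_idm])
   moreover have "nil ^ Suc j * wt (- int j) = wt (int (j + 2)) * nil ^ Suc j"
    unfolding nil_power_wt by (simp add: algebra_simps)
   ultimately have "nil ^ Suc j * (wt (- int j) * Y) = 0" by (simp only: assoc[symmetric])
   then show ?thesis using lowest[of "wt (- int j) * Y" j] K(3)[OF less.prems] by (simp add: wt_wt flip: assoc)
  qed
 qed
 have "wt z * Y = 0" for z
 proof (cases "z \<le> 0")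
  case True
  then have "z = - int (nat (- z))" by simp
  then show ?thesis using neg[OF Y] by metis
 next
  case False
  have "wt (- int (nat z)) * (weyl * Y) = 0" using neg[OF K(2)[OF Y]] .
  moreover have "wt (- int (nat z)) * weyl = weyl * wt z" using False by (simp add: weyl_wt)
  ultimately have "weyl * (wt z * Y) = 0" by (simp flip: assoc)
  then show ?thesis by (rule weyl_injective[OF wt_idm])
 qed
 then show ?thesis by (simp add: sum_distrib_right flip: sum_wt)
qed

text \<open>Followed by the Weyl element, \<open>nil ^ m\<close> is an injective endomorphism of the
  weight space \<open>- m\<close>, hence invertible.\<close>

lemma nil_power_surjective:
 obtains Z where "nil ^ m * Z = wt (int m)" "wt (- int m) * Z = Z"
proof -
 define p X where "p = wt (- int m)" and "X = weyl * (nil ^ m * p)"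
 have Xp: "X = weyl * (wt (int m) * nil ^ m)" by (simp add: X_def p_def nil_power_wt)
 have p: "fin p" "p * p = p" using finI[OF wt_cor] by (simp_all add: p_def wt_wt)
 have "p * X = weyl * wt (int m) * (nil ^ m * p)" unfolding X_def p_def weyl_wt by (simp flip: assoc)
 also have "\<dots> = X" using Xp by (simp add: X_def p_def nil_power_wt assoc wt_wt[THEN assoc_rule])
 finally have pX: "p * X = X" .
 have "X * p = X" using p by (simp add: X_def assoc)
 moreover have "p * Y = 0" if "X * Y = 0" for Y
 proof -
  have "weyl * (nil ^ m * p * Y) = 0" using that by (simp add: X_def assoc)
  moreover have "idm N * (nil ^ m * p * Y) = nil ^ m * p * Y" by (simp add: p_def nil_power_wt assoc wt_idm)
  ultimately have "nil ^ m * p * Y = 0" by (rule weyl_injective[rotated])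
  then show ?thesis unfolding p_def by (rule nil_power_injective)
 qed
 ultimately obtain Z where Z: "X * Z = p" "p * Z = Z" using idempotent_invertible[OF p pX] by metis
 have "weyl' * (X * Z) * weyl = weyl' * weyl * (nil ^ m * (p * Z)) * weyl" by (simp add: X_def assoc)
 then have "weyl' * p * weyl = idm N * (nil ^ m * p) * (Z * weyl)" unfolding weyl(4) Z(1) by (simp only: assoc)
 also have "idm N * (nil ^ m * p) = nil ^ m * p" by (simp add: p_def nil_power_wt wt_idm)
 finally have "weyl' * p * weyl = nil ^ m * (p * Z * weyl)" by (simp add: assoc)
 moreover have "weyl' * (p * weyl) = wt (int m)"
 proof -
  have "p * weyl = weyl * wt (int m)" by (simp only: p_def weyl_wt)
  then have "weyl' * (p * weyl) = weyl' * weyl * wt (int m)" by (simp only: assoc)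
  then show ?thesis by (simp only: weyl(4) rectD[OF wt_cor])
 qed
 ultimately have "nil ^ m * (Z * weyl) = wt (int m)" using Z(2) by (simp add: assoc)
 moreover have "wt (- int m) * (Z * weyl) = Z * weyl" using Z(2) by (simp add: p_def flip: assoc)
 ultimately show thesis using that by blast
qed

end

section \<open>Representations that preserve a bilinear form\<close>

locale isometric_rep = bilinear_form N J J' \<epsilon> + sl2_rep N \<tau>
 for N :: nat and J J' :: imat and \<epsilon> :: complex and \<tau> :: "complex mat => imat" +
 assumes isometric: "x \<in> carrier SL2 ==> star (\<tau> x) * \<tau> x = idm N"
begin

lemma star_rep:
 assumes "x \<in> carrier SL2" "y \<in> carrier SL2" "x * y = 1\<^sub>m 2" shows "star (\<tau> x) = \<tau> y"
proof -
 have "\<tau> x * \<tau> y = idm N" using \<tau>_mult[OF assms(1,2)] assms(3) \<tau>_one by simp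
 then have "star (\<tau> x) = star (\<tau> x) * \<tau> x * \<tau> y" using rectD(2)[OF star_cor] by (simp add: assoc)
 then show ?thesis using isometric[OF assms(1)] \<tau>_cor[OF assms(2)] by (simp add: rectD)
qed

lemma star_wt: "star (wt z) = wt (- z)"
proof (cases "z \<in> wts")
 case True
 have "(\<Sum>z\<in>wts. scl (s powi z) (star (wt z))) = (\<Sum>z\<in>wts. scl (s powi z) (wt (- z)))" if s: "s ~= 0" for s
 proof -
  have "(\<Sum>z\<in>wts. scl (s powi z) (star (wt z))) = star (\<tau> (dgm s))"
   using s by (simp add: dgm_expansion star_sum star_scl)
  also have "\<dots> = \<tau> (dgm (inverse s))" using s by (intro star_rep) (simp_all add: mat2_SL2 mat2_mult mat2_one)
  also have "\<dots> = (\<Sum>z\<in>wts. scl (inverse s powi z) (wt z))" using s by (intro dgm_expansion) simp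
  also have "\<dots> = (\<Sum>z\<in>wts. scl (s powi z) (wt (- z)))"
   using s by (intro sum.reindex_bij_witness[of _ uminus uminus]) (auto simp: power_int_minus power_int_inverse)
  finally show ?thesis .
 qed
 from laurent_unique[OF _ this True] show ?thesis by simp
qed (auto simp: wt_notin)

lemma star_nil: "star nil = - nil"
proof -
 obtain D where D: "\<And>t. \<tau> (upp t) = (\<Sum>k\<le>D. scl (t ^ k) (div_pow k))" "D \<ge> 1" using upp_coefficients by metis
 have "(\<Sum>k\<le>D. scl (t ^ k) (star (div_pow k))) = (\<Sum>k\<le>D. scl (t ^ k) (scl ((-1) ^ k) (div_pow k)))" for t
 proof -
  have "(\<Sum>k\<le>D. scl (t ^ k) (star (div_pow k))) = star (\<tau> (upp t))" unfolding D star_sum star_scl ..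
  also have "\<dots> = \<tau> (upp (- t))" by (rule star_rep) (simp_all add: mat2_SL2 mat2_mult mat2_one)
  also have "\<dots> = (\<Sum>k\<le>D. scl (t ^ k) (scl ((-1) ^ k) (div_pow k)))"
   unfolding D by (intro sum.cong refl) (simp add: power_minus[of t] mult.commute)
  finally show ?thesis .
 qed
 from polynomial_unique[OF this D(2)] show ?thesis by (simp only: div_pow_1) (simp)
qed

lemma star_nil_power: "k > 0 ==> star (nil ^ k) = scl ((-1) ^ k) (nil ^ k)"
 using star_idm_power[OF nil_cor star_nil, of k] nil_idm by simp

lemma even_rk_nil: "k > 0 ==> (-1) ^ k = - \<epsilon> ==> even (rk (nil ^ k))"
 using rect_power[OF nil_cor] star_nil_power by (intro even_rk_skew_form) auto

definition lower :: "int => imat" where "lower m = (\<Sum>i | i \<in> wts \<and> i < m. wt i)"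

lemma lower_cor: "lower m \<in> cor N" unfolding lower_def by (intro rect_sum wt_cor)

lemma lower_wt: "lower m * wt i = (if i < m then wt i else 0)" and wt_lower: "wt i * lower m = (if i < m then wt i else 0)"
proof -
 have 1: "lower m * wt i = (\<Sum>j | j \<in> wts \<and> j < m. if j = i then wt i else 0)"
  unfolding lower_def sum_distrib_right by (intro sum.cong refl) (simp add: wt_wt)
 have 2: "wt i * lower m = (\<Sum>j | j \<in> wts \<and> j < m. if j = i then wt i else 0)"
  unfolding lower_def sum_distrib_left by (intro sum.cong refl) (simp add: wt_wt)
 have "(\<Sum>j | j \<in> wts \<and> j < m. if j = i then wt i else 0) = (if i < m then wt i else 0)"
 proof -
  have fin: "finite {j. j \<in> wts \<and> j < m}" by (rule finite_subset[of _ wts]) auto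
  show ?thesis using sum.delta[OF fin, of i "\<lambda>_. wt i"] wt_notin[of i] by auto
 qed
 then show "lower m * wt i = (if i < m then wt i else 0)" "wt i * lower m = (if i < m then wt i else 0)"
  using 1 2 by simp_all
qed

lemma lower_lower: "lower m * lower m = lower m" using cor_mult[OF lower_cor lower_cor] lower_cor
 by (rule eq_by_weights(2)) (simp add: assoc lower_wt)

lemma star_lower: "star (idm N - lower m - wt m) = lower (- m)"
proof (rule eq_by_weights(2)[OF star_cor lower_cor])
 fix z
 have "wt (- z) * (idm N - lower m - wt m) = (if z < - m then wt (- z) else 0)"
  by (auto simp: right_diff_distrib rectD[OF wt_cor] wt_lower wt_wt)
 then have "star (wt (- z) * (idm N - lower m - wt m)) = (if z < - m then wt z else 0)" by (simp add: star_wt)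
 then show "star (idm N - lower m - wt m) * wt z = lower (- m) * wt z"
  using wt_cor by (simp add: star_mult star_wt lower_wt)
qed

text \<open>\<open>X\<close> raises weights by \<open>2 * k\<close>, so its rank splits over the
  source weights below, at and above \<open>- k\<close>. Adjunction exchanges the outer two, which
  therefore have equal rank. The lemma is applied to \<open>nil\<close> with its own weights and
  with those of a second representation.\<close>

lemma rank_formula:
 assumes X: "X \<in> cor N" and shift: "\<And>i. X * wt i = wt (i + 2 * int k) * X"
  and star: "star X = scl c X" "c ~= 0"
 shows "rk X = 2 * rk (X * lower (- int k)) + rk (X * wt (- int k))"
proof -
 define L p U where "L = lower (- int k)" and "p = wt (- int k)" and "U = idm N - L - p"
 have cor: "L \<in> cor N" "p \<in> cor N" "U \<in> cor N"
  unfolding U_def L_def p_def by (intro rect_diff idm_cor lower_cor wt_cor)+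
 have LX: "X * L = lower (int k) * X" by (rule eq_by_weights(2)[OF cor_mult[OF X cor(1)] cor_mult[OF lower_cor X]])
   (auto simp: L_def assoc lower_wt shift lower_wt[THEN assoc_rule])
 have pX: "X * p = wt (int k) * X" using shift[of "- int k"] by (simp add: p_def)
 have z: "L * L = L" "p * p = p" "L * p = 0" "p * L = 0"
  by (simp_all add: L_def p_def lower_lower wt_wt lower_wt wt_lower)
 have fin: "fin (X * B)" for B using X finI fin_mult_right by blast
 have s: "star U = lower (int k)" using star_lower[of "- int k"] by (simp add: U_def L_def p_def)
 have XL: "X = X * L + (X * p + X * U)" using X by (simp add: U_def right_diff_distrib rectD)
 have LU: "L * U = 0" "U * L = 0" "p * U = 0" "U * p = 0"
  using z cor by (simp_all add: U_def left_diff_distrib right_diff_distrib rectD)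
 have "rk (X * L + (X * p + X * U)) = rk (X * L) + rk (X * p + X * U)"
 proof (rule rk_direct[of _ _ "lower (int k)" L])
  show "lower (int k) * (X * L) = X * L" "lower (int k) * (X * p + X * U) = 0"
   using LX z LU by (simp_all add: distrib_left assoc[symmetric] LX[symmetric]) (simp_all add: assoc z LU)
  show "X * L * L = X * L" "(X * p + X * U) * L = 0" using z LU by (simp_all add: distrib_right assoc)
 qed (auto intro: fin fin_add)
 moreover have "rk (X * p + X * U) = rk (X * p) + rk (X * U)"
 proof (rule rk_direct[of _ _ "wt (int k)" p])
  show "wt (int k) * (X * p) = X * p" "wt (int k) * (X * U) = 0"
   using z LU by (simp_all add: assoc[symmetric] pX[symmetric]) (simp_all add: assoc z LU)
  show "X * p * p = X * p" "X * U * p = 0" using z LU by (simp_all add: assoc)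
 qed (auto intro: fin)
 moreover have "rk (X * U) = rk (X * L)"
 proof -
  have "star (X * U) = scl c (X * L)" using X star s LX by (simp add: star_mult)
  then have "rk (X * U) = rk (scl c (X * L))" using rk_star[OF cor_mult[OF X cor(3)]] by simp
  then show ?thesis using rk_scl[OF fin star(2)] by simp
 qed
 ultimately show ?thesis using XL by (simp add: L_def p_def)
qed

lemma rank_nil_power:
 assumes "k > 0" shows "rk (nil ^ k) = 2 * rk (lower (- int k)) + rk (wt (- int k))"
proof -
 have c: "nil ^ k \<in> cor N" using nil_cor assms by (rule rect_power)
 have inj: "nil ^ k * P * Y = 0 ==> P * Y = 0" if P: "P \<in> cor N" "\<And>z. wt z * P = P * wt z" "\<And>z. z > - int k ==> wt z * P = 0" for P Y
 proof -
  assume 0: "nil ^ k * P * Y = 0"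
  have "wt z * (P * Y) = 0" for z
  proof (cases "z \<le> - int k")
   case True
   have "nil ^ k * wt z * (P * Y) = wt (z + 2 * int k) * (nil ^ k * P * Y)" by (simp add: nil_power_wt assoc)
   then show ?thesis using nil_power_injective_le[OF True, of "P * Y"] 0 by simp
  qed (use P(3)[of z] in \<open>simp flip: assoc\<close>)
  then have "idm N * (P * Y) = 0" by (simp add: sum_distrib_right flip: sum_wt)
  then show ?thesis using P by (simp add: rectD flip: assoc)
 qed
 have "rk (nil ^ k * lower (- int k)) = rk (lower (- int k))"
 proof (rule rk_if_injective[OF finI[OF lower_cor] lower_lower])
  show "\<And>Y. nil ^ k * lower (- int k) * Y = 0 ==> lower (- int k) * Y = 0"
   by (rule inj[OF lower_cor]) (auto simp: wt_lower lower_wt)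
 qed (simp add: assoc lower_lower)
 moreover have "rk (nil ^ k * wt (- int k)) = rk (wt (- int k))"
 proof (rule rk_if_injective[OF finI[OF wt_cor]])
  show "\<And>Y. nil ^ k * wt (- int k) * Y = 0 ==> wt (- int k) * Y = 0" by (rule inj[OF wt_cor]) (auto simp: wt_wt)
 qed (simp_all add: assoc wt_wt)
 ultimately show ?thesis using rank_formula[OF c nil_power_wt star_nil_power[OF assms]] by simp
qed

end


section \<open>Two representations with the same infinitesimal character\<close>

lemma cor_scalar: assumes "X \<in> cor r" "r \<le> 1" obtains c where "X = scl c (idm r)"
proof -
 have "ent X i j = ent (scl (ent X 0 0) (idm r)) i j" for i j
 proof (cases "i = 0 \<and> j = 0 \<and> r = 1")
  case False
  then have ij: "\<not> (i < r \<and> j < r)" using assms(2) by (cases "r = 0") auto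
  have "ent X i j = 0" if "\<not> (i < r \<and> j < r)" for i j using that assms(1) unfolding rect_iff by blast
  moreover have "ent X 0 0 = 0 \<or> r ~= 0" using calculation[of 0 0] by auto
  ultimately show ?thesis using ij by (auto simp: ent_idm)
 qed (simp add: ent_idm)
 then show thesis using that imat_eqI by blast
qed

text \<open>In the application \<open>\<tau>0\<close> comes from the tempered parameter. The
  relations of \<open>nil\<close> and \<open>wt\<close> with the weights of \<open>\<tau>0\<close>
  are what the equality of infinitesimal parameters provides.\<close>

locale rep_pair = isometric_rep N J J' \<epsilon> \<tau> + zero: isometric_rep N J J' \<epsilon> \<tau>0
 for N :: nat and J J' :: imat and \<epsilon> :: complex and \<tau> \<tau>0 :: "complex mat => imat" +
 assumes nil_zero_wt: "nil * zero.wt i = zero.wt (i + 2) * nil"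
  and wt_zero_wt: "wt j * zero.wt i = zero.wt i * wt j"
  and rank_le: "k > 0 ==> rk (zero.nil ^ k) \<le> rk (nil ^ k) + 1"
begin

lemmas nil_power_zero_wt = zero.power_shift_wt[OF nil_zero_wt]

text \<open>By \<open>rank_formula\<close> both ranks are twice a contribution from below
  \<open>- k\<close> plus one from \<open>- k\<close>, and for \<open>zero.nil\<close> these
  contributions are full. A total loss of at most \<open>1\<close> cannot come from the doubled
  term. If \<open>(-1) ^ k = - \<epsilon>\<close>, both ranks are even and nothing is lost.\<close>

lemma nullity:
 assumes "k > 0"
 shows "rk (zero.lower (- int k)) \<le> rk (nil ^ k * zero.lower (- int k))"
  "rk (zero.wt (- int k)) \<le> rk (nil ^ k * zero.wt (- int k)) + (if (-1) ^ k = - \<epsilon> then 0 else 1)"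
proof -
 have c: "nil ^ k \<in> cor N" using nil_cor assms by (rule rect_power)
 have N: "rk (nil ^ k) = 2 * rk (nil ^ k * zero.lower (- int k)) + rk (nil ^ k * zero.wt (- int k))"
  by (rule zero.rank_formula[OF c nil_power_zero_wt star_nil_power[OF assms]]) simp
 have le: "rk (nil ^ k * zero.lower (- int k)) \<le> rk (zero.lower (- int k))"
  "rk (nil ^ k * zero.wt (- int k)) \<le> rk (zero.wt (- int k))"
  using finI[OF zero.lower_cor] finI[OF zero.wt_cor] rk_mult_left_le by blast+
 have "rk (zero.nil ^ k) \<le> rk (nil ^ k) + (if (-1) ^ k = - \<epsilon> then 0 else 1)"
  using rank_le[OF assms] even_rk_nil[OF assms] zero.even_rk_nil[OF assms]
  by (cases "rk (zero.nil ^ k) = rk (nil ^ k) + 1") auto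
 then show "rk (zero.lower (- int k)) \<le> rk (nil ^ k * zero.lower (- int k))"
  "rk (zero.wt (- int k)) \<le> rk (nil ^ k * zero.wt (- int k)) + (if (-1) ^ k = - \<epsilon> then 0 else 1)"
  using zero.rank_nil_power[OF assms] N le by (auto split: if_splits)
qed

lemma injective_below:
 assumes "k > 0" "i < - int k" "nil ^ k * zero.wt i * Y = 0" shows "zero.wt i * Y = 0"
proof -
 have L: "zero.lower (- int k) * zero.wt i = zero.wt i" using assms(2) by (simp add: zero.lower_wt)
 have "zero.lower (- int k) * (zero.wt i * Y) = 0"
 proof (rule injective_if_rk[OF finI[OF zero.lower_cor] zero.lower_lower _ nullity(1)[OF assms(1)]])
  have "nil ^ k * zero.lower (- int k) * (zero.wt i * Y) = nil ^ k * (zero.lower (- int k) * zero.wt i) * Y"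
   by (simp add: assoc)
  then show "nil ^ k * zero.lower (- int k) * (zero.wt i * Y) = 0" using assms(3) L by simp
 qed (simp add: assoc zero.lower_lower)
 then show ?thesis using L by (simp flip: assoc)
qed

subsection \<open>Relative weights\<close>

text \<open>Projects onto the vectors whose weight for \<open>\<tau>0\<close> exceeds that for
  \<open>\<tau>\<close> by \<open>z\<close>; the two families of weight projections commute.\<close>

definition Q :: "int => imat" where "Q z = (\<Sum>i\<in>zero.wts. zero.wt i * wt (i - z))"

lemma Q_cor: "Q z \<in> cor N" unfolding Q_def by (intro rect_sum cor_mult wt_cor zero.wt_cor)

lemma zero_wt_Q: "zero.wt i * Q z = zero.wt i * wt (i - z)" and Q_zero_wt: "Q z * zero.wt i = zero.wt i * wt (i - z)"
proof -
 have "zero.wt i * Q z = (\<Sum>j\<in>zero.wts. if j = i then zero.wt i * wt (i - z) else 0)"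
  unfolding Q_def sum_distrib_left by (intro sum.cong refl) (simp add: zero.wt_wt flip: assoc)
 then show "zero.wt i * Q z = zero.wt i * wt (i - z)" by (simp add: zero.wt_notin)
 have "Q z * zero.wt i = (\<Sum>j\<in>zero.wts. if j = i then zero.wt i * wt (i - z) else 0)"
  unfolding Q_def sum_distrib_right
  by (intro sum.cong refl) (simp add: zero.wt_wt assoc wt_zero_wt, simp add: zero.wt_wt flip: assoc)
 then show "Q z * zero.wt i = zero.wt i * wt (i - z)" by (simp add: zero.wt_notin)
qed

lemma Q_wt: "Q z * wt j = zero.wt (j + z) * wt j" and wt_Q: "wt j * Q z = zero.wt (j + z) * wt j"
proof -
 have "Q z * wt j = (\<Sum>i\<in>zero.wts. if i = j + z then zero.wt (j + z) * wt j else 0)"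
  unfolding Q_def sum_distrib_right by (intro sum.cong refl) (auto simp: wt_wt assoc)
 then show 1: "Q z * wt j = zero.wt (j + z) * wt j" by (simp add: zero.wt_notin)
 have "wt j * Q z = Q z * wt j" unfolding Q_def sum_distrib
  by (intro sum.cong refl) (auto simp: wt_wt assoc wt_zero_wt[THEN assoc_rule])
 then show "wt j * Q z = zero.wt (j + z) * wt j" using 1 by simp
qed

lemma nil_Q: "nil * Q z = Q z * nil"
proof (rule zero.eq_by_weights(1)[OF cor_mult[OF nil_cor Q_cor] cor_mult[OF Q_cor nil_cor]])
 fix i
 have "zero.wt i * (nil * Q z) = nil * (zero.wt (i - 2) * Q z)" using nil_zero_wt[of "i - 2"] by (simp flip: assoc)
 also have "\<dots> = zero.wt i * wt (i - z) * nil"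
  using nil_zero_wt[of "i - 2"] nil_wt[of "i - 2 - z"] by (simp add: zero_wt_Q assoc[symmetric]) (simp add: assoc)
 finally show "zero.wt i * (nil * Q z) = zero.wt i * (Q z * nil)" by (simp add: zero_wt_Q assoc[symmetric])
qed

lemma Q_rep: "x \<in> carrier SL2 ==> \<tau> x * Q z = Q z * \<tau> x"
 using commutes_with_rep[OF Q_cor nil_Q] by (simp add: Q_wt wt_Q)

lemma star_Q: "star (Q z) = Q (- z)"
proof -
 have "star (Q z) = (\<Sum>i\<in>zero.wts. wt (z - i) * zero.wt (- i))"
  by (simp add: Q_def star_sum star_mult[OF zero.wt_cor] star_wt zero.star_wt)
 also have "\<dots> = Q (- z)"
  unfolding Q_def by (intro sum.reindex_bij_witness[of _ uminus uminus]) (auto simp: wt_zero_wt add.commute)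
 finally show ?thesis .
qed

text \<open>For \<open>z \<le> - 2\<close>, a lowest weight vector of weight \<open>- j\<close> in
  \<open>Q z\<close> has weight \<open>z - j < - (j + 1)\<close> for \<open>\<tau>0\<close> and is
  killed by \<open>nil ^ Suc j\<close>, against \<open>injective_below\<close>. Adjoints give the
  case \<open>z \<ge> 2\<close>.\<close>

lemma Q_eq_0: assumes "\<bar>z\<bar> \<ge> 2" shows "Q z = 0"
proof -
 have neg: "Q z = 0" if z: "z \<le> - 2" for z
 proof -
  have "idm N * Q z = 0"
  proof (rule lowest_weight_vanish[of "\<lambda>Y. \<exists>X. Y = Q z * X"])
   fix Y y assume "\<exists>X. Y = Q z * X"
   then obtain X where Y: "Y = Q z * X" by blast
   show "\<exists>X. nil * Y = Q z * X" using nil_Q by (intro exI[of _ "nil * X"]) (simp add: Y flip: assoc)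
   show "\<exists>X. weyl * Y = Q z * X" using Q_rep[of wey]
    by (intro exI[of _ "weyl * X"]) (simp add: Y mat2_SL2 weyl_def flip: assoc)
   show "\<exists>X. wt y * Y = Q z * X" by (intro exI[of _ "wt y * X"]) (simp add: Y Q_wt wt_Q flip: assoc)
   fix j assume j: "wt (- int j) * Y = Y" "nil ^ Suc j * Y = 0"
   have "zero.wt (- int j + z) * Y = Y"
   proof -
    have "zero.wt (- int j + z) * Y = zero.wt (- int j + z) * zero.wt (- int j + z) * (wt (- int j) * X)"
     using j(1) by (metis Y wt_Q assoc)
    then show ?thesis using j(1) Y by (simp add: zero.wt_wt wt_Q flip: assoc) 
   qed
   then show "Y = 0" using injective_below[of "Suc j" "- int j + z" Y] z j(2) by (simp add: assoc)
  next
   show "\<exists>X. Q z = Q z * X" using rectD(2)[OF Q_cor] by metis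
  qed
  then show ?thesis by (simp only: rectD[OF Q_cor])
 qed
 show ?thesis
 proof (cases "z \<le> - 2")
  case False
  then have "star (Q z) = 0" using assms by (simp add: star_Q neg)
  then show ?thesis using star_star[OF Q_cor, of z] by simp
 qed (rule neg)
qed

lemma zero_wt_wt_eq_0: "\<bar>i - j\<bar> \<ge> 2 ==> zero.wt i * wt j = 0" using Q_wt[of "i - j" j] Q_eq_0[of "i - j"] by simp

lemma sum_Q: "Q (-1) + Q 0 + Q 1 = idm N"
proof (rule eq_by_weights(2))
 fix j
 have "wt j = (\<Sum>i\<in>zero.wts. zero.wt i * wt j)" using wt_cor by (rule zero.cor_wt_decomp)
 also have "\<dots> = (\<Sum>i\<in>zero.wts. (if i = j - 1 then zero.wt (j - 1) * wt j else 0) +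
   (if i = j then zero.wt j * wt j else 0) + (if i = j + 1 then zero.wt (j + 1) * wt j else 0))"
  by (intro sum.cong refl) (auto intro!: zero_wt_wt_eq_0)
 also have "\<dots> = zero.wt (j - 1) * wt j + zero.wt j * wt j + zero.wt (j + 1) * wt j"
  unfolding sum.distrib by (simp add: zero.wt_notin)
 finally show "(Q (-1) + Q 0 + Q 1) * wt j = idm N * wt j" by (simp add: distrib_right Q_wt rectD[OF wt_cor])
qed (auto intro!: rect_add Q_cor)

lemma Q_Q: "Q z * Q w = (if z = w then Q z else 0)"
proof (rule eq_by_weights(2))
 fix j
 have "Q z * Q w * wt j = Q z * zero.wt (j + w) * wt j" by (simp add: Q_wt assoc)
 also have "\<dots> = zero.wt (j + w) * (wt (j + w - z) * wt j)" by (simp add: Q_zero_wt assoc)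
 finally show "Q z * Q w * wt j = (if z = w then Q z else 0) * wt j" by (auto simp: wt_wt Q_wt)
qed (auto intro: cor_mult Q_cor)

subsection \<open>Primitive vectors\<close>

text \<open>The properties of the Weil group action of the tempered parameter on which the
  invariance of \<open>f\<close> depends.\<close>

definition admissible :: "imat => bool" where
 "admissible g \<longleftrightarrow> isometry g \<and> g * nil = nil * g \<and> (\<forall>i. g * wt i = wt i * g) \<and>
   (\<forall>i. g * zero.wt i = zero.wt i * g) \<and> g * zero.weyl = zero.weyl * g"

lemma J_cor_star: assumes "A \<in> cor N" "star A = scl c A" shows "J * A = scl c (tp A * J)"
proof (cases "A = 0")
 case False
 have "A = scl (c * c) A" using star_star[OF assms(1)] assms(2) by (simp add: star_scl)
 then have "scl (1 - c * c) A = 0" by (simp add: imat.scale_left_diff_distrib)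
 then have "c * c = 1" using False by simp
 then have "A = scl c (star A)" using assms(2) by simp
 then show ?thesis using J_star[OF assms(1)] by (metis scl_mult_right)
qed simp

text \<open>The columns of \<open>u\<close> span the kernel of \<open>nil ^ k\<close> on the weight
  space \<open>- k\<close> of \<open>\<tau>0\<close>. The cancellation law says that
  \<open>u\<close> is injective on what \<open>tp u\<close> produces, and the last clause is
  invariance of the operator \<open>v \<mapsto> <u, v> u\<close>.\<close>

definition primitive :: "nat => imat => bool" where
 "primitive k u \<longleftrightarrow> zero.wt (- int k) * u = u \<and> nil ^ k * u = 0 \<and> ((-1) ^ k = - \<epsilon> --> u = 0) \<and>
  (\<forall>Y. zero.wt (- int k) * Y = Y --> nil ^ k * Y = 0 --> (\<exists>C. Y = u * C)) \<and>
  (\<forall>Z. u * (tp u * Z) = 0 --> tp u * Z = 0) \<and>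
  (\<forall>g. admissible g --> g * (u * tp u * J) = u * tp u * J * g)"

text \<open>The vector \<open>u\<close> spans the kernel of \<open>T\<close>, which is an endomorphism of a weight space of \<open>\<tau>0\<close> and is
 self-adjoint for an invariant form. Hence \<open>g\<close> acts on the kernel and the cokernel of \<open>T\<close> by inverse
 scalars; since \<open>T\<close> commutes with \<open>g\<close>, comparing traces shows that these scalars agree.\<close>

lemma primitive_exists: assumes k: "k > 0" shows "\<exists>u. primitive k u"
proof -
 define p T where "p = zero.wt (- int k)" and "T = zero.weyl * (nil ^ k * p)"
 have p: "p \<in> cor N" "p * p = p" "fin p" using zero.wt_cor finI by (auto simp: p_def zero.wt_wt)
 have nk: "nil ^ k \<in> cor N" using nil_cor k by (rule rect_power)
 have np: "nil ^ k * p = zero.wt (int k) * nil ^ k" using nil_power_zero_wt[of k "- int k"] by (simp add: p_def)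
 have Tp: "T * p = T" by (simp add: T_def assoc p)
 have T: "T \<in> cor N" unfolding T_def by (intro cor_mult zero.weyl nk p)
 have pT: "p * T = T"
 proof -
  have "p * zero.weyl = zero.weyl * zero.wt (int k)" by (simp add: p_def zero.weyl_wt)
  then have "p * T = zero.weyl * (zero.wt (int k) * (nil ^ k * p))" by (simp add: T_def flip: assoc)
  then show ?thesis by (simp add: T_def np zero.wt_wt flip: assoc)
 qed
 have weyl'_T: "zero.weyl' * T = nil ^ k * p" using zero.weyl(4) nk by (simp add: T_def rectD flip: assoc)
 obtain E G where E: "E = p - G * T" "p * G = G" "E * E = E" "p * E = E" "E * p = E" "T * E = 0"
  "rk E + rk T = rk p" "\<And>Y. p * Y = Y ==> T * Y = 0 ==> E * Y = Y" "T * G * T = T" "fin G"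
  using kernel_projection[OF p(3,2) Tp] by blast
 have fE: "fin E" using p(3) E(4) by (metis fin_mult_right)
 have "rk (nil ^ k * p) \<le> rk T" using rk_mult_left_le[OF finI[OF T], of "zero.weyl'"] weyl'_T by simp
 then have rkE: "rk E \<le> (if (-1) ^ k = - \<epsilon> then 0 else 1)" using E(7) nullity(2)[OF k] by (simp add: p_def)
 define r where "r = rk E"
 have r: "r \<le> 1" using rkE by (auto simp: r_def split: if_splits)
 obtain u C B' C' where uC: "E = u * C" "u * idm r = u" "idm r * C = C" "B' * u = idm r" "C * C' = idm r"
  using rk_factor[OF fE] unfolding r_def by metis
 have Cu: "C * u = idm r"
 proof -
  have "B' * (u * C * (u * C)) * C' = B' * (u * C) * C'" using E(3) uC(1) by simp
  then have "(B' * u) * (C * u) * (C * C') = (B' * u) * (C * C')" by (simp add: assoc)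
  then have "idm r * C * (u * idm r) = idm r" by (simp add: uC(4,5) assoc)
  then show ?thesis by (simp add: uC)
 qed
 have Eu: "E * u = u" using uC Cu by (simp add: assoc)
 have pu: "p * u = u" using Eu E(4) by (metis assoc)
 have Tu: "T * u = 0" using Eu E(6) by (metis assoc mult_zero_left)
 have nu: "nil ^ k * u = 0" using weyl'_T Tu pu by (metis assoc mult_zero_right)
 have span: "\<exists>C. Y = u * C" if "p * Y = Y" "nil ^ k * Y = 0" for Y
 proof -
  have "T * Y = 0" using that by (simp add: T_def assoc)
  then have "Y = E * Y" using E(8)[OF that(1)] by simp
  then show ?thesis using uC(1) by (metis assoc)
 qed
 have tu: "idm r * tp u = tp u" using arg_cong[OF uC(2), of tp] by (simp add: tp_mult)
 have inj: "tp u * Z = 0" if "u * (tp u * Z) = 0" for Z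
 proof -
  have "B' * u * (tp u * Z) = 0" using that by (simp add: assoc)
  then show ?thesis using tu by (simp add: uC(4) flip: assoc)
 qed
 have eigen: "\<exists>c. h * u = scl c u" if "h * p = p * h" "h * T = T * h" for h
 proof -
  have "p * (h * u) = h * u" using that(1) pu by (metis assoc)
  moreover have "T * (h * u) = 0" using that(2) Tu by (metis assoc mult_zero_right)
  ultimately have "h * u = u * (C * (h * u))" using E(8) uC(1) by (metis assoc)
  moreover have "C * (h * u) \<in> cor r" using uC(2,3) by (simp add: rect_def assoc[symmetric]) (simp add: assoc)
  then obtain c where "C * (h * u) = scl c (idm r)" using cor_scalar r by blast
  ultimately show ?thesis using uC(2) by (metis scl_mult_right)
 qed
 have "g * (u * tp u * J) = u * tp u * J * g" if g: "admissible g" for g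
 proof (cases "r = 0")
  case True
  then have "u = 0" using uC(2) by simp
  then show ?thesis by simp
 next
  case False
  then have r1: "r = 1" using r by simp
  have iso: "isometry g" and gc: "g * nil = nil * g" "g * p = p * g" "g * zero.weyl = zero.weyl * g"
   using g by (auto simp: admissible_def p_def)
  note gi = isometryD[OF iso]
  have gn: "g * nil ^ m = nil ^ m * g" for m using power_commuting_commutes[OF gc(1)[symmetric], of m] by simp
  have gT: "g * T = T * g"
  proof -
   have "g * T = (g * zero.weyl) * nil ^ k * p" by (simp add: T_def assoc)
   also have "\<dots> = zero.weyl * (g * nil ^ k) * p" by (simp add: gc(3) assoc)
   also have "\<dots> = zero.weyl * nil ^ k * (g * p)" by (simp add: gn assoc)
   finally show ?thesis by (simp add: gc(2) T_def assoc)
  qed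
  have inverse: "star g * M = M * star g" if "g * M = M * g" "M \<in> cor N" for M
  proof -
   have "star g * (g * M) * star g = star g * (M * g) * star g" by (simp add: that(1))
   then have "(star g * g) * M * star g = star g * M * (g * star g)" by (simp add: assoc)
   then show ?thesis using gi that(2) star_cor by (simp add: rectD cor_mult assoc)
  qed
  obtain c where c: "g * u = scl c u" using eigen[OF gc(2) gT] by blast
  obtain c' where c': "star g * u = scl c' u" using eigen inverse gc(2) gT p(1) T by metis
  have trE: "tr E = 1" using rk_idempotent[OF fE E(3)] r1 by (simp add: r_def)
  have fg: "fin g" using gi(1) finI by blast
  have fT: "fin T" using T finI by blast
  \<comment> \<open>\<open>E\<close> projects onto the kernel of \<open>T\<close>, and
    \<open>E'\<close> is its counterpart for the cokernel, killing the image of \<open>T\<close>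
    within \<open>p\<close>; both have rank \<open>1\<close> here.\<close>
  define E' where "E' = p - T * G * p"
  have E'E': "E' * E' = E'"
  proof -
   have "T * G * p * (T * G * p) = (T * G * T) * G * p" by (simp add: assoc pT[THEN assoc_rule])
   then have "T * G * p * (T * G * p) = T * G * p" by (simp add: E(9))
   then show ?thesis
    using p pT by (simp add: E'_def left_diff_distrib right_diff_distrib assoc pT[THEN assoc_rule])
  qed
  have fE': "fin E'" unfolding E'_def using p(3) by (intro fin_diff fin_mult_left)
  have trE': "tr E' = 1"
  proof -
   have "tr (T * (G * p)) = tr (G * p * T)" using fT E(10) by (intro tr_commute fin_mult_right)
   then have "tr E' = tr p - tr (G * T)"
    unfolding E'_def using p(3) fT E(10) pT by (subst tr_diff) (auto intro: fin_mult_left simp: assoc)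
   also have "\<dots> = tr E" unfolding E(1) using p(3) fT by (subst tr_diff) (auto intro: fin_mult_left)
   finally show ?thesis by (simp add: trE)
  qed
  then have "rk E' = 1" using rk_idempotent[OF fE' E'E'] by simp
  then obtain a d a' d' where ad: "E' = a * d" "a * idm 1 = a" "idm 1 * d = d" "a' * a = idm 1" "d * d' = idm 1"
   using rk_factor[OF fE'] by metis
  \<comment> \<open>The functional \<open>v \<mapsto> <u, zero.weyl v>\<close>. It vanishes on the
    image of \<open>T\<close>, because \<open>nil ^ k\<close> is self-adjoint up to sign and kills
    \<open>u\<close>; thus it spans the dual of the cokernel.\<close>
  define l where "l = tp u * (J * zero.weyl)"
  have Jp: "J * zero.wt (int k) = tp p * J" using J_star[OF p(1)] by (simp add: p_def zero.star_wt)
  have lp: "l * p = l"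
  proof -
   have "l * p = tp u * (J * zero.wt (int k)) * zero.weyl"
    using zero.weyl_wt[of "- int k"] by (simp add: l_def p_def assoc)
   also have "\<dots> = tp (p * u) * J * zero.weyl" by (simp add: Jp tp_mult assoc)
   finally show ?thesis by (simp add: pu l_def assoc)
  qed
  have lT: "l * T = 0"
  proof -
   have w2: "zero.weyl * zero.weyl = \<tau>0 (dgm (-1))"
    using zero.\<tau>_mult[of wey wey] by (simp add: zero.weyl_def mat2_SL2 mat2_mult)
   have "l * T = tp u * J * (zero.weyl * zero.weyl * zero.wt (int k)) * nil ^ k"
    by (simp add: l_def T_def np assoc)
   also have "zero.weyl * zero.weyl * zero.wt (int k) = scl ((-1) powi int k) (zero.wt (int k))"
    unfolding w2 by (rule zero.dgm_wt) simp
   also have "tp u * J * scl ((-1) powi int k) (zero.wt (int k)) * nil ^ k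
     = scl ((-1) powi int k) (tp u * (J * nil ^ k) * p)"
    by (simp add: assoc np)
   also have "J * nil ^ k = scl ((-1) ^ k) (tp (nil ^ k) * J)" by (rule J_cor_star[OF nk star_nil_power[OF k]])
   also have "tp u * scl ((-1) ^ k) (tp (nil ^ k) * J) = scl ((-1) ^ k) (tp (nil ^ k * u) * J)"
    by (simp add: tp_mult assoc)
   finally show ?thesis by (simp add: nu)
  qed
  have "l * E' = l" using lp lT by (simp add: E'_def right_diff_distrib flip: assoc)
  then have lad: "l = (l * a) * d" by (simp add: ad(1) assoc)
  have "l * a \<in> cor 1" using tu ad(2) r1 by (simp add: rect_def l_def assoc[symmetric]) (simp add: assoc)
  then obtain b where "l * a = scl b (idm 1)" using cor_scalar by blast
  then have lb: "l = scl b d" using lad ad(3) by simp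
  have "l * (zero.weyl' * (J' * tp B')) = idm 1"
  proof -
   have "l * (zero.weyl' * (J' * tp B')) = tp u * (J * (zero.weyl * zero.weyl') * J') * tp B'"
    by (simp add: l_def assoc)
   also have "J * (zero.weyl * zero.weyl') * J' = idm N" using zero.weyl(3) J JJ' by (simp add: rectD)
   also have "tp u * idm N * tp B' = tp (B' * (idm N * u))" by (simp add: tp_mult assoc)
   also have "idm N * u = u" using pu p(1) by (metis rectD(1) assoc)
   finally show ?thesis by (simp add: uC(4) r1)
  qed
  moreover have "idm 1 ~= 0" using rk_idm[of 1] by (metis rk_0 zero_neq_one)
  ultimately have b: "b ~= 0" using lb by auto
  have ug: "tp u * (J * g) = scl c' (tp u * J)"
  proof -
   have "J * g = tp (star g) * J" using J_star[OF star_cor, of g] star_star[OF gi(1)] by simp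
   then have "tp u * (J * g) = tp (star g * u) * J" by (simp add: tp_mult assoc)
   then show ?thesis by (simp add: c')
  qed
  have "l * g = tp u * (J * g) * zero.weyl" by (simp add: l_def gc(3) assoc)
  then have "l * g = scl c' l" by (simp add: ug l_def assoc)
  then have "scl b (d * g) = scl b (scl c' d)" by (simp add: lb mult.commute)
  then have dg: "d * g = scl c' d" using b by (simp only: imat.scale_cancel_left) simp
  have "tr (g * E) = c * tr E" using c fE by (simp add: uC(1) tr_scl flip: assoc)
  moreover have "tr (E' * g) = c' * tr E'" using dg fE' by (simp add: ad(1) assoc tr_scl)
  \<comment> \<open>The traces of \<open>g\<close> on the kernel and on the cokernel agree, since
    both differ from its trace on \<open>p\<close> by its trace on the image of
    \<open>T\<close>.\<close>
  moreover have "tr (g * E) = tr (E' * g)"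
  proof -
   have "tr (g * E) = tr (g * p) - tr (g * (G * T))"
    unfolding E(1) right_diff_distrib using fg by (intro tr_diff fin_mult_right)
   moreover have "tr (E' * g) = tr (p * g) - tr (T * (G * p * g))"
    unfolding E'_def left_diff_distrib using fg by (subst tr_diff) (auto intro: fin_mult_left simp: assoc)
   moreover have "tr (T * (G * p * g)) = tr (G * p * g * T)" using fT fg by (intro tr_commute fin_mult_left)
   moreover have "G * p * g * T = G * T * g"
   proof -
    have "G * p * g * T = G * (p * g) * T" by (simp add: assoc)
    also have "\<dots> = G * (g * (p * T))" by (simp add: gc(2)[symmetric] assoc)
    finally show ?thesis by (simp add: pT gT assoc)
   qed
   moreover have "tr (G * T * g) = tr (g * (G * T))" using fT fg by (intro tr_commute fin_mult_left)
   ultimately show ?thesis by (simp add: gc(2))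
  qed
  ultimately have "c = c'" by (simp add: trE trE')
  then show ?thesis using c ug by (simp add: assoc) (simp flip: assoc)
 qed
 moreover have "u = 0" if "(-1) ^ k = - \<epsilon>" using that rkE uC(2) by (simp add: r_def)
 ultimately show ?thesis using pu nu inj span unfolding p_def primitive_def by blast
qed

definition prim :: "nat => imat" where "prim k = (SOME u. primitive k u)"

lemma prim:
 assumes "k > 0"
 shows "zero.wt (- int k) * prim k = prim k" "nil ^ k * prim k = 0" "(-1) ^ k = - \<epsilon> ==> prim k = 0"
  "zero.wt (- int k) * Y = Y ==> nil ^ k * Y = 0 ==> \<exists>C. Y = prim k * C"
  "prim k * (tp (prim k) * Z) = 0 ==> tp (prim k) * Z = 0"
  "admissible g ==> g * (prim k * tp (prim k) * J) = prim k * tp (prim k) * J * g"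
proof -
 have "primitive k (prim k)" unfolding prim_def by (rule someI_ex[OF primitive_exists[OF assms]])
 note * = this[unfolded primitive_def]
 from * show "zero.wt (- int k) * prim k = prim k" "nil ^ k * prim k = 0" "(-1) ^ k = - \<epsilon> ==> prim k = 0" by blast+
 from * show "zero.wt (- int k) * Y = Y ==> nil ^ k * Y = 0 ==> \<exists>C. Y = prim k * C"
  "prim k * (tp (prim k) * Z) = 0 ==> tp (prim k) * Z = 0"
  "admissible g ==> g * (prim k * tp (prim k) * J) = prim k * tp (prim k) * J * g" by blast+
qed

subsection \<open>The second action of \<open>SL\<^sub>2\<close>\<close>

text \<open>The weight for \<open>\<tau>\<close> is within \<open>1\<close> of \<open>- k\<close>,
  and \<open>nil ^ k\<close> is injective on weights at most \<open>- k\<close>, which leaves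
  \<open>1 - k\<close>. So \<open>prim k\<close> lies in \<open>Q (-1)\<close>, as a lowest weight
  vector of a block of size \<open>k\<close>.\<close>

lemma prim_wt: assumes "k > 0" shows "wt (1 - int k) * prim k = prim k"
proof -
 note u = prim(1,2)[OF assms]
 have z: "wt z * prim k = 0" if "z ~= 1 - int k" for z
 proof (cases "\<bar>- int k - z\<bar> \<ge> 2")
  case True
  have "wt z * prim k = zero.wt (- int k) * wt z * prim k" using u(1) by (simp add: wt_zero_wt[symmetric] assoc)
  then show ?thesis by (simp add: zero_wt_wt_eq_0[OF True])
 next
  case False
  then have "z \<le> - int k" using that by linarith
  then show ?thesis using nil_power_injective_le[of z k "prim k"] u(2) by (simp add: nil_power_wt assoc)
 qed
 have "prim k = idm N * prim k" using u(1) rectD(1)[OF zero.wt_cor] by (metis assoc)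
 also have "\<dots> = (\<Sum>z\<in>wts. wt z * prim k)" by (simp add: sum_distrib_right flip: sum_wt)
 also have "\<dots> = (\<Sum>z\<in>wts. if z = 1 - int k then wt (1 - int k) * prim k else 0)"
  by (intro sum.cong refl) (auto simp: z)
 also have "\<dots> = wt (1 - int k) * prim k" by (simp add: wt_notin)
 finally show ?thesis by simp
qed

definition R :: "nat => imat" where "R k = prim k * tp (prim k) * J"

lemma R:
 assumes k: "k > 0"
 shows "R k \<in> cor N" "star (R k) = scl \<epsilon> (R k)" "(-1) ^ k = - \<epsilon> ==> R k = 0"
  "nil ^ k * R k = 0" "R k * nil ^ k = 0"
  "zero.wt (- int k) * R k = R k" "R k * zero.wt (int k) = R k"
  "wt (1 - int k) * R k = R k" "R k * wt (int k - 1) = R k"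
proof -
 define u where "u = prim k"
 have Ru: "R k = u * (tp u * J)" by (simp add: R_def u_def assoc)
 note u = prim(1-3)[OF k, folded u_def] prim_wt[OF k, folded u_def]
 have J_move: "tp u * (J * A) = tp (star A * u) * J" if "A \<in> cor N" for A
  using J_star[OF star_cor, of A] star_star[OF that] by (simp add: tp_mult assoc)
 have uN: "idm N * u = u" using u(1) rectD(1)[OF zero.wt_cor] by (metis assoc)
 have JN: "J * idm N = J" using J by (simp add: rectD)
 show cor: "R k \<in> cor N" by (simp add: rect_def Ru assoc JN) (simp add: uN flip: assoc)
 have "star (R k) = scl \<epsilon> (J' * J * u * tp u * J)" by (simp add: star_def Ru tp_mult tpJ assoc)
 then show "star (R k) = scl \<epsilon> (R k)" by (simp only: J'J uN Ru assoc)
 show "(-1) ^ k = - \<epsilon> ==> R k = 0" using u(3) by (simp add: Ru)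
 show "nil ^ k * R k = 0" "zero.wt (- int k) * R k = R k" "wt (1 - int k) * R k = R k"
  using u by (simp_all add: Ru flip: assoc)
 show "R k * nil ^ k = 0" using J_move[OF rect_power[OF nil_cor k]] u(2) by (simp add: Ru assoc star_nil_power[OF k])
 show "R k * zero.wt (int k) = R k" "R k * wt (int k - 1) = R k"
  using J_move[OF zero.wt_cor, of "int k"] J_move[OF wt_cor, of "int k - 1"] u(1,4)
  by (simp_all add: Ru assoc star_wt zero.star_wt)
qed

text \<open>\<open>R k\<close> is the operator \<open>v \<mapsto> <u, v> u\<close>; it takes the top
  weight \<open>k - 1\<close> in \<open>Q 1\<close> to the bottom weight \<open>1 - k\<close> in
  \<open>Q (-1)\<close>. Distributing \<open>k - 1\<close> factors \<open>nil\<close> over both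
  sides in all ways gives an operator that commutes with \<open>nil\<close>. Blocks have size at
  most \<open>wbound + 1\<close>.\<close>

definition f :: imat where
 "f = (\<Sum>k\<in>{1..Suc wbound}. \<Sum>a<k. nil ^ (k - 1 - a) * R k * nil ^ a)"

lemma nil_R_nil:
 assumes k: "k > 0"
 shows "nil ^ b * R k * nil ^ a = (idm N * nil ^ b) * R k * (idm N * nil ^ a)"
proof -
 have "nil ^ b * idm N = idm N * nil ^ b" using nil_idm[of b] by (cases "b = 0") simp_all
 then have "(idm N * nil ^ b) * R k * (idm N * nil ^ a) = nil ^ b * (idm N * R k * idm N) * nil ^ a" by (metis assoc)
 then show ?thesis by (simp only: rectD[OF R(1)[OF k]])
qed

lemma f_cor: "f \<in> cor N" unfolding f_def
proof (intro rect_sum)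
 fix k a assume "k \<in> {1..Suc wbound}"
 then have k: "k > 0" by simp
 show "nil ^ (k - 1 - a) * R k * nil ^ a \<in> cor N"
  unfolding nil_R_nil[OF k] by (intro cor_mult idm_power_cor nil_cor R(1)[OF k])
qed

lemma nil_f: "nil * f = f * nil" unfolding f_def sum_distrib
proof (rule sum.cong[OF refl])
 fix k assume "k \<in> {1..Suc wbound}"
 then have k: "k > 0" by simp
 \<comment> \<open>Multiplication by \<open>nil\<close> from the two sides gives sums that differ by
   telescoping; the boundary terms vanish since \<open>nil ^ k\<close> annihilates
   \<open>R k\<close> on both sides.\<close>
 define G where "G b = nil ^ (k - b) * R k * nil ^ b" for b
 have 1: "nil * (nil ^ (k - 1 - a) * R k * nil ^ a) = G a" if "a < k" for a
 proof -
  have "nil * nil ^ (k - 1 - a) = nil ^ (k - a)" using that by (simp flip: power_Suc add: Suc_diff_Suc)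
  then show ?thesis by (simp add: G_def flip: assoc)
 qed
 have 2: "nil ^ (k - 1 - a) * R k * nil ^ a * nil = G (Suc a)" if "a < k" for a
  by (simp add: G_def assoc power_commutes)
 have "(\<Sum>a<k. G a) - (\<Sum>a<k. G (Suc a)) = G 0 - G k"
  using sum_lessThan_telescope'[of G k] by (simp add: sum_subtractf)
 also have "\<dots> = 0" by (simp add: G_def R(4,5)[OF k])
 finally show "(\<Sum>a<k. nil * (nil ^ (k - 1 - a) * R k * nil ^ a)) = (\<Sum>a<k. nil ^ (k - 1 - a) * R k * nil ^ a * nil)"
  using 1 2 by simp
qed

lemma f_term_wt:
 assumes "k > 0" "a < k"
 defines "F \<equiv> nil ^ (k - 1 - a) * R k * nil ^ a"
 shows "wt (int k - 1 - 2 * int a) * F = F" "F * wt (int k - 1 - 2 * int a) = F"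
  "zero.wt (int k - 2 - 2 * int a) * F = F" "F * zero.wt (int k - 2 * int a) = F"
proof -
 have b: "int (k - 1 - a) = int k - 1 - int a" using assms(2) by simp
 have "F = nil ^ (k - 1 - a) * (wt (1 - int k) * R k) * nil ^ a" by (simp add: F_def R(8)[OF assms(1)])
 also have "\<dots> = nil ^ (k - 1 - a) * wt (1 - int k) * R k * nil ^ a" by (simp add: assoc)
 also have "\<dots> = wt (int k - 1 - 2 * int a) * F" unfolding nil_power_wt b by (simp add: F_def assoc algebra_simps)
 finally show "wt (int k - 1 - 2 * int a) * F = F" by simp
 have "F = nil ^ (k - 1 - a) * (zero.wt (- int k) * R k) * nil ^ a" by (simp add: F_def R(6)[OF assms(1)])
 also have "\<dots> = nil ^ (k - 1 - a) * zero.wt (- int k) * R k * nil ^ a" by (simp add: assoc)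
 also have "\<dots> = zero.wt (int k - 2 - 2 * int a) * F" unfolding nil_power_zero_wt b by (simp add: F_def assoc algebra_simps)
 finally show "zero.wt (int k - 2 - 2 * int a) * F = F" by simp
 have "nil ^ a * wt (int k - 1 - 2 * int a) = wt (int k - 1) * nil ^ a" unfolding nil_power_wt by simp
 then have "F * wt (int k - 1 - 2 * int a) = nil ^ (k - 1 - a) * (R k * wt (int k - 1)) * nil ^ a"
  by (simp add: F_def assoc)
 then show "F * wt (int k - 1 - 2 * int a) = F" by (simp add: F_def R(9)[OF assms(1)])
 have "nil ^ a * zero.wt (int k - 2 * int a) = zero.wt (int k) * nil ^ a" unfolding nil_power_zero_wt by simp
 then have "F * zero.wt (int k - 2 * int a) = nil ^ (k - 1 - a) * (R k * zero.wt (int k)) * nil ^ a"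
  by (simp add: F_def assoc)
 then show "F * zero.wt (int k - 2 * int a) = F" by (simp add: F_def R(7)[OF assms(1)])
qed

lemma wt_f: "wt z * f = f * wt z" and zero_wt_f: "zero.wt z * f = f * zero.wt (z + 2)"
proof -
 have "wt z * F = F * wt z" if "wt y * F = F" "F * wt y = F" for F y
  using that wt_wt[of z y] wt_wt[of y z] by (metis assoc mult_zero_left mult_zero_right)
 note 1 = this
 have 2: "zero.wt z * F = F * zero.wt (z + 2)" if "zero.wt (y - 2) * F = F" "F * zero.wt y = F" for F y
 proof (cases "z = y - 2")
  case False
  have "zero.wt z * F = zero.wt z * zero.wt (y - 2) * F" using that(1) by (simp add: assoc)
  moreover have "F * zero.wt (z + 2) = F * (zero.wt y * zero.wt (z + 2))" using that(2) by (simp flip: assoc)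
  ultimately show ?thesis using False by (simp add: zero.wt_wt)
 qed (use that in simp)
 show "wt z * f = f * wt z" unfolding f_def sum_distrib by (intro sum.cong refl 1[OF f_term_wt(1,2)]) auto
 show "zero.wt z * f = f * zero.wt (z + 2)" unfolding f_def sum_distrib
 proof (intro sum.cong refl)
  fix k a assume "k \<in> {1..Suc wbound}" "a \<in> {..<k}"
  then show "zero.wt z * (nil ^ (k - 1 - a) * R k * nil ^ a) = nil ^ (k - 1 - a) * R k * nil ^ a * zero.wt (z + 2)"
   using f_term_wt(3,4)[of k a] by (intro 2[of "int k - 2 * int a"]) (auto simp: algebra_simps)
 qed
qed

text \<open>Adjunction reverses the sum over \<open>a\<close> and multiplies each term by
  \<open>\<epsilon> * (-1) ^ (k - 1)\<close>. This is \<open>-1\<close> for the parity of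
  \<open>k\<close> in which \<open>R k\<close> may be nonzero.\<close>

lemma star_f: "star f = - f"
proof -
 have "star (\<Sum>a<k. nil ^ (k - 1 - a) * R k * nil ^ a) = - (\<Sum>a<k. nil ^ (k - 1 - a) * R k * nil ^ a)"
  if k: "k > 0" for k
 proof (cases "(-1) ^ k = - \<epsilon>")
  case True
  then show ?thesis using R(3)[OF k] by simp
 next
  case False
  then have sgn: "\<epsilon> * (-1) ^ (k - 1) = -1" using eps k by (cases k) (auto simp: minus_one_power_iff split: if_splits)
  have summand: "star (nil ^ (k - 1 - a) * R k * nil ^ a) = - (nil ^ (k - 1 - (k - Suc a)) * R k * nil ^ (k - Suc a))"
   if a: "a < k" for a
  proof -
   define A B where "A = idm N * nil ^ a" and "B = idm N * nil ^ (k - 1 - a)"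
   have cor: "A \<in> cor N" "B \<in> cor N" unfolding A_def B_def by (intro idm_power_cor nil_cor)+
   have stars: "star A = scl ((-1) ^ a) A" "star B = scl ((-1) ^ (k - 1 - a)) B"
    unfolding A_def B_def using star_idm_power[OF nil_cor star_nil] by blast+
   have "star (nil ^ (k - 1 - a) * R k * nil ^ a) = star (B * R k * A)" unfolding A_def B_def nil_R_nil[OF k] ..
   also have "\<dots> = star A * (star (R k) * star B)" using cor R(1)[OF k] by (simp add: star_mult cor_mult)
   also have "\<dots> = scl (\<epsilon> * ((-1) ^ a * (-1) ^ (k - 1 - a))) (A * R k * B)"
    by (simp add: stars R(2)[OF k] assoc mult.commute mult.left_commute)
   also have "(-1) ^ a * (-1 :: complex) ^ (k - 1 - a) = (-1) ^ (k - 1)" using a by (simp flip: power_add)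
   also have "scl (\<epsilon> * (-1) ^ (k - 1)) (A * R k * B) = - (A * R k * B)" unfolding sgn by simp
   also have "A * R k * B = nil ^ a * R k * nil ^ (k - 1 - a)" unfolding A_def B_def nil_R_nil[OF k, symmetric] ..
   finally show ?thesis using a by simp
  qed
  have "star (\<Sum>a<k. nil ^ (k - 1 - a) * R k * nil ^ a)
    = - (\<Sum>a<k. nil ^ (k - 1 - (k - Suc a)) * R k * nil ^ (k - Suc a))"
   unfolding star_sum using summand by (simp add: sum_negf)
  then show ?thesis using sum.nat_diff_reindex[of "\<lambda>a. nil ^ (k - 1 - a) * R k * nil ^ a" k] by simp
 qed
 note inner = this
 have "star f = (\<Sum>k\<in>{1..Suc wbound}. star (\<Sum>a<k. nil ^ (k - 1 - a) * R k * nil ^ a))"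
  unfolding f_def by (rule star_sum)
 also have "\<dots> = (\<Sum>k\<in>{1..Suc wbound}. - (\<Sum>a<k. nil ^ (k - 1 - a) * R k * nil ^ a))"
  by (intro sum.cong refl inner) auto
 finally show ?thesis by (simp only: sum_negf f_def)
qed

lemma Q_f: "Q z * f = f * Q (z + 2)"
proof (rule eq_by_weights(2)[OF cor_mult[OF Q_cor f_cor] cor_mult[OF f_cor Q_cor]])
 fix j
 have "Q z * f * wt j = Q z * wt j * f" by (simp only: assoc wt_f)
 also have "\<dots> = zero.wt (j + z) * (wt j * f)" by (simp only: Q_wt assoc)
 also have "\<dots> = f * zero.wt (j + z + 2) * wt j" by (simp add: wt_f zero_wt_f flip: assoc)
 also have "\<dots> = f * Q (z + 2) * wt j" by (simp add: Q_wt assoc add.assoc)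
 finally show "Q z * f * wt j = f * Q (z + 2) * wt j" .
qed

lemma f_Q: "f * Q 1 = f" "Q (-1) * f = f" "Q 1 * f = 0" "Q 0 * f = 0" "f * Q (-1) = 0" "f * Q 0 = 0"
proof -
 show 1: "Q 1 * f = 0" "Q 0 * f = 0" using Q_f[of 1] Q_f[of 0] Q_eq_0[of 3] Q_eq_0[of 2] by simp_all
 show 2: "f * Q (-1) = 0" "f * Q 0 = 0" using Q_f[of "-3"] Q_f[of "-2"] Q_eq_0[of "-3"] Q_eq_0[of "-2"] by simp_all
 have "f = (Q (-1) + Q 0 + Q 1) * f" "f = f * (Q (-1) + Q 0 + Q 1)" using f_cor by (simp_all add: sum_Q rectD)
 then show "Q (-1) * f = f" "f * Q 1 = f" using 1 2 by (simp_all add: distrib_left distrib_right)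
qed

lemma f_rep: "x \<in> carrier SL2 ==> \<tau> x * f = f * \<tau> x" using commutes_with_rep[OF f_cor nil_f wt_f] .

text \<open>\<open>R k\<close> sees only the weight \<open>k - 1\<close>, while
  \<open>nil ^ a * Y\<close> has weight \<open>2 * a - j\<close> and vanishes for
  \<open>a > j\<close>; with \<open>a < k\<close> this leaves \<open>a = j\<close> and
  \<open>k = j + 1\<close>.\<close>

lemma f_lowest:
 assumes Y: "wt (- int j) * Y = Y" "nil ^ Suc j * Y = 0" and j: "j \<le> wbound"
 shows "f * Y = R (Suc j) * nil ^ j * Y"
proof -
 have summand: "nil ^ (k - 1 - a) * R k * nil ^ a * Y = (if k = Suc j then if a = j then R (Suc j) * nil ^ j * Y else 0 else 0)"
  if k: "k > 0" "a < k" for k a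
 proof (cases "k = Suc j \<and> a = j")
  case False
  have "R k * (nil ^ a * Y) = 0"
  proof (cases "int k - 1 = - int j + 2 * int a")
   case True
   then have "a > j" using k False by auto
   then have "nil ^ a = nil ^ (a - Suc j) * nil ^ Suc j" by (metis Suc_leI le_add_diff_inverse2 power_add)
   then have "nil ^ a * Y = 0" using Y(2) by (simp only: assoc) simp
   then show ?thesis by simp
  next
   case False
   have "nil ^ a * Y = wt (- int j + 2 * int a) * (nil ^ a * Y)"
    using Y(1) nil_power_wt[of a "- int j"] by (metis assoc)
   then have "R k * (nil ^ a * Y) = R k * wt (int k - 1) * (wt (- int j + 2 * int a) * (nil ^ a * Y))"
    using R(9)[OF k(1)] by simp
   also have "\<dots> = 0" using False by (simp add: assoc wt_wt[THEN assoc_rule])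
   finally show ?thesis .
  qed
  then show ?thesis using False by (auto simp: assoc)
 qed simp
 have "f * Y = (\<Sum>k\<in>{1..Suc wbound}. \<Sum>a<k. if k = Suc j then if a = j then R (Suc j) * nil ^ j * Y else 0 else 0)"
  unfolding f_def sum_distrib_right using summand by (intro sum.cong refl) auto
 also have "\<dots> = (\<Sum>k\<in>{1..Suc wbound}. if k = Suc j then R (Suc j) * nil ^ j * Y else 0)" by (intro sum.cong refl) simp
 also have "\<dots> = R (Suc j) * nil ^ j * Y" using j by simp
 finally show ?thesis .
qed

text \<open>If \<open>f\<close> kills a lowest weight vector \<open>Y\<close> of weight
  \<open>- j\<close>, then \<open>nil ^ j * Y\<close> is orthogonal to
  \<open>u = prim (Suc j)\<close>. The weight space \<open>- j\<close> of \<open>Q (-1)\<close> is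
  spanned by \<open>u\<close> and by images under \<open>nil\<close>, which are orthogonal too
  because \<open>nil ^ Suc j * Y = 0\<close>. Nondegeneracy of the form kills
  \<open>nil ^ j * Y\<close>, hence \<open>Y\<close>.\<close>

lemma f_injective: assumes "f * Y = 0" shows "Q 1 * Y = 0"
proof -
 have "idm N * (Q 1 * Y) = 0"
 proof (rule lowest_weight_vanish[of "\<lambda>Y. Q 1 * Y = Y \<and> f * Y = 0"])
  show "Q 1 * (Q 1 * Y) = Q 1 * Y \<and> f * (Q 1 * Y) = 0" using assms by (simp add: Q_Q f_Q flip: assoc)
  fix Y z assume Y: "Q 1 * Y = Y \<and> f * Y = 0"
  show "Q 1 * (nil * Y) = nil * Y \<and> f * (nil * Y) = 0" using Y by (metis nil_Q nil_f assoc mult_zero_right)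
  show "Q 1 * (weyl * Y) = weyl * Y \<and> f * (weyl * Y) = 0"
  proof -
   have "weyl * Q 1 = Q 1 * weyl" "weyl * f = f * weyl"
    using Q_rep[of wey 1] f_rep[of wey] by (simp_all add: weyl_def mat2_SL2)
   then show ?thesis using Y by (metis assoc mult_zero_right)
  qed
  show "Q 1 * (wt z * Y) = wt z * Y \<and> f * (wt z * Y) = 0" using Y by (metis wt_f wt_Q Q_wt assoc mult_zero_right)
  fix j assume low: "wt (- int j) * Y = Y" "nil ^ Suc j * Y = 0"
  show "Y = 0"
  proof (cases "j \<le> wbound")
   case False
   then have "wt (- int j) = 0" by (intro wt_outside) simp
   then show ?thesis using low(1) by simp
  next
   case True
   define u where "u = prim (Suc j)"
   have "u * (tp u * (J * (nil ^ j * Y))) = 0" using f_lowest[OF low True] Y by (simp add: R_def u_def assoc)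
   then have u0: "tp u * (J * (nil ^ j * Y)) = 0" unfolding u_def by (intro prim(5)) simp_all
   define X where "X = Q (-1) * wt (- int j)"
   have X: "X = wt (- int j) * Q (-1)" "Q (-1) * X = X" "X \<in> cor N"
   proof -
    show "X = wt (- int j) * Q (-1)" by (simp add: X_def Q_wt wt_Q)
    show "Q (-1) * X = X" by (simp add: X_def Q_Q flip: assoc)
    show "X \<in> cor N" unfolding X_def by (intro cor_mult Q_cor wt_cor)
   qed
   obtain Z where Z: "nil ^ (j + 2) * Z = wt (int (j + 2))" "wt (- int (j + 2)) * Z = Z"
    using nil_power_surjective .
   define V where "V = Q (-1) * (Z * (nil ^ Suc j * X))"
   have nil_Q_power: "nil ^ m * Q z = Q z * nil ^ m" for m z using power_commuting_commutes[OF nil_Q] by simp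
   \<comment> \<open>Subtracting \<open>nil * V\<close> removes from \<open>X\<close> what
     \<open>nil ^ Suc j\<close> does not kill, so \<open>D\<close> falls under the spanning property
     of \<open>u\<close>.\<close>
   define D where "D = X - nil * V"
   have nX: "nil ^ Suc j * X = wt (int (j + 2)) * (nil ^ Suc j * Q (-1))"
   proof -
    have "nil ^ Suc j * X = nil ^ Suc j * wt (- int j) * Q (-1)" by (simp only: X(1) assoc)
    also have "nil ^ Suc j * wt (- int j) = wt (int (j + 2)) * nil ^ Suc j"
     unfolding nil_power_wt by (simp add: algebra_simps)
    finally show ?thesis by (simp only: assoc)
   qed
   have "nil ^ Suc j * (nil * V) = nil ^ (j + 2) * V" by (simp only: assoc[symmetric] power_Suc2[symmetric] add_2_eq_Suc')
   also have "\<dots> = Q (-1) * (nil ^ (j + 2) * Z * (nil ^ Suc j * X))"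
    unfolding V_def by (simp only: nil_Q_power[THEN assoc_rule] assoc)
   also have "\<dots> = Q (-1) * (nil ^ Suc j * X)" unfolding Z(1) nX by (simp add: wt_wt flip: assoc)
   also have "\<dots> = nil ^ Suc j * X"
    using X(2) by (simp only: nil_Q_power[symmetric] assoc[symmetric]) (simp only: assoc)
   finally have D0: "nil ^ Suc j * D = 0" by (simp add: D_def right_diff_distrib)
   have wtV: "wt (- int j) * (nil * V) = nil * V"
   proof -
    have "wt (- int j) * (nil * V) = nil * (wt (- int (j + 2)) * V)"
     using nil_wt[of "- int (j + 2)"] by (simp flip: assoc)
    also have "wt (- int (j + 2)) * V = Q (-1) * (wt (- int (j + 2)) * Z * (nil ^ Suc j * X))"
     unfolding V_def by (simp only: Q_wt[symmetric] wt_Q assoc[symmetric])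
    finally show ?thesis by (simp only: Z(2) V_def)
   qed
   have QV: "Q (-1) * (nil * V) = nil * V"
   proof -
    have "Q (-1) * (nil * V) = nil * (Q (-1) * V)" by (simp only: nil_Q assoc[symmetric])
    also have "Q (-1) * V = V" by (simp add: V_def Q_Q flip: assoc)
    finally show ?thesis .
   qed
   have "zero.wt (- int (Suc j)) * D = D"
   proof -
    have "zero.wt (- int (Suc j)) * D = zero.wt (- int j + -1) * (wt (- int j) * D)"
     using wtV X(1) by (simp add: D_def right_diff_distrib wt_wt[THEN assoc_rule] add.commute)
    also have "\<dots> = wt (- int j) * (Q (-1) * D)" by (simp add: wt_Q flip: assoc)
    also have "\<dots> = D" using wtV QV X by (simp add: D_def right_diff_distrib wt_wt[THEN assoc_rule])
    finally show ?thesis .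
   qed
   then obtain C where C: "D = u * C" unfolding u_def using prim(4) D0 by blast
   have "tp X * (J * (nil ^ j * Y)) = tp C * (tp u * (J * (nil ^ j * Y))) + tp V * (tp nil * J * (nil ^ j * Y))"
   proof -
    have "X = u * C + nil * V" using C D_def by (metis diff_add_cancel)
    then show ?thesis by (simp add: tp_mult distrib_right assoc)
   qed
   also have "tp nil * J = - (J * nil)" using J_star[OF nil_cor] star_nil by simp
   also have "tp V * (- (J * nil) * (nil ^ j * Y)) = - (tp V * (J * (nil ^ Suc j * Y)))" by (simp add: assoc)
   finally have "tp X * J * (nil ^ j * Y) = 0" using u0 low(2) by (simp add: assoc)
   moreover have "tp X * J = J * (wt (int j) * Q 1)"
    using J_star[OF X(3)] by (simp add: X_def star_mult Q_cor star_Q star_wt)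
   ultimately have "J' * J * (wt (int j) * Q 1 * (nil ^ j * Y)) = 0" by (simp add: assoc)
   then have "wt (int j) * (Q 1 * (nil ^ j * Y)) = 0" by (simp add: J'J wt_idm assoc)
   moreover have "Q 1 * (nil ^ j * Y) = nil ^ j * Y" using Y nil_Q_power[of j 1] by (metis assoc)
   moreover have "wt (int j) * (nil ^ j * Y) = nil ^ j * (wt (- int j) * Y)"
    using nil_power_wt[of j "- int j"] by (simp flip: assoc)
   ultimately have "nil ^ j * wt (- int j) * Y = 0" by (simp add: assoc)
   then show ?thesis using nil_power_injective low(1) by metis
  qed
 qed
 then show ?thesis using rectD(1)[OF Q_cor] by (simp flip: assoc)
qed

definition e :: imat where
 "e = (SOME e. e * f = Q 1 \<and> f * e = Q (-1) \<and> star e = - e \<and> Q 1 * e = e \<and> e * Q (-1) = e)"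

text \<open>Injectivity gives a left inverse \<open>E\<close> of \<open>f\<close>. As
  \<open>f\<close> is skew, \<open>- star E\<close> is a right inverse, so the two coincide: the
  inverse is two-sided and skew.\<close>

lemma e: "e * f = Q 1" "f * e = Q (-1)" "star e = - e" "Q 1 * e = e" "e * Q (-1) = e"
proof -
 obtain G where G: "Q 1 = Q 1 * G * f" using left_factor[of f "Q 1"] finI[OF f_cor] f_injective by blast
 define E where "E = Q 1 * G * Q (-1)"
 have cor: "E \<in> cor N"
  unfolding E_def rect_def using rectD(1)[OF Q_cor] rectD(2)[OF Q_cor] by (simp add: assoc) (simp flip: assoc)
 have ef: "E * f = Q 1" using G by (simp add: E_def assoc f_Q)
 have Qe: "Q 1 * E = E" "E * Q (-1) = E" by (simp_all add: E_def assoc Q_Q Q_Q[THEN assoc_rule])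
 define E' where "E' = - star E"
 have fe': "f * E' = Q (-1)" using arg_cong[OF ef, of star] cor by (simp add: star_mult star_f star_Q E'_def)
 have Qe': "Q 1 * E' = E'" using arg_cong[OF Qe(2), of star] cor by (simp add: star_mult star_Q E'_def)
 have "E = E * (f * E')" using Qe fe' by simp
 also have "\<dots> = E'" using ef Qe' by (simp flip: assoc)
 finally have "E = E'" .
 then have "\<exists>e. e * f = Q 1 \<and> f * e = Q (-1) \<and> star e = - e \<and> Q 1 * e = e \<and> e * Q (-1) = e"
  using ef Qe fe' E'_def by (metis minus_minus)
 from someI_ex[OF this, folded e_def]
 show "e * f = Q 1" "f * e = Q (-1)" "star e = - e" "Q 1 * e = e" "e * Q (-1) = e" by blast+
qed

lemma e_cor: "e \<in> cor N"
 unfolding rect_def using e(4,5) rectD(1)[OF Q_cor] rectD(2)[OF Q_cor] by (metis (mono_tags, lifting) mem_Collect_eq assoc)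

lemma e_commute:
 assumes "X * f = f * X" "X * Q 1 = Q 1 * X" "X * Q (-1) = Q (-1) * X"
 shows "X * e = e * X"
proof -
 have "e * X = e * (Q (-1) * X)" using e(5) by (simp flip: assoc)
 also have "\<dots> = e * X * (f * e)" by (simp add: e(2) assms(3) assoc)
 also have "\<dots> = e * f * X * e" by (simp add: assms(1)[symmetric, THEN assoc_rule] assoc)
 also have "\<dots> = X * (Q 1 * e)" by (simp add: e(1) assms(2)[symmetric] assoc)
 finally show ?thesis by (simp add: e(4))
qed

lemma ef_products: "e * e = 0" "f * f = 0" "Q 1 * f = 0" "Q (-1) * e = 0" "e * Q 1 = 0" "f * Q (-1) = 0"
proof -
 have "e * Q 1 = e * (Q (-1) * Q 1)" "Q (-1) * e = Q (-1) * Q 1 * e" by (metis e(4,5) assoc)+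
 then show 1: "e * Q 1 = 0" "Q (-1) * e = 0" by (simp_all add: Q_Q)
 have "e * e = e * Q 1 * e" "f * f = f * Q (-1) * f" by (simp_all only: e(4) f_Q(2) assoc)
 then show "e * e = 0" "f * f = 0" using 1 f_Q(5) by simp_all
qed (rule f_Q)+

text \<open>The standard representation tensored with \<open>Q 1\<close>, which \<open>f\<close>
  identifies with \<open>Q (-1)\<close>, plus the trivial representation on
  \<open>Q 0\<close>.\<close>

definition \<theta> :: "complex mat => imat" where
 "\<theta> y = Q 0 + scl (y $$ (0, 0)) (Q 1) + scl (y $$ (0, 1)) e + scl (y $$ (1, 0)) f + scl (y $$ (1, 1)) (Q (-1))"

lemma \<theta>_mat2: "\<theta> (mat2 a b c d) = Q 0 + scl a (Q 1) + scl b e + scl c f + scl d (Q (-1))" by (simp add: \<theta>_def)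

lemma \<theta>_cor: "\<theta> y \<in> cor N" unfolding \<theta>_def by (intro rect_add rect_scl Q_cor e_cor f_cor)

lemma \<theta>_one: "\<theta> (1\<^sub>m 2) = idm N" unfolding mat2_one[symmetric] \<theta>_mat2 by (simp add: add_ac flip: sum_Q)

lemma Q0_e: "Q 0 * e = 0" "e * Q 0 = 0"
proof -
 have "Q 0 * e = Q 0 * Q 1 * e" "e * Q 0 = e * (Q (-1) * Q 0)" by (metis e(4,5) assoc)+
 then show "Q 0 * e = 0" "e * Q 0 = 0" by (simp_all add: Q_Q)
qed

lemma \<theta>_mult: assumes "x \<in> carrier SL2" "y \<in> carrier SL2" shows "\<theta> (x * y) = \<theta> x * \<theta> y"
proof -
 obtain a b c d a' b' c' d' where "x = mat2 a b c d" "y = mat2 a' b' c' d'" using assms SL2_cases by metis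
 then show ?thesis by (simp add: mat2_mult \<theta>_mat2 distrib_left distrib_right e ef_products f_Q Q_Q Q0_e
    imat.scale_left_distrib imat.scale_right_distrib ac_simps)
qed

lemma \<theta>_isometry: assumes "x \<in> carrier SL2" shows "isometry (\<theta> x)"
proof -
 obtain a b c d where x: "x = mat2 a b c d" "a * d - b * c = 1" using assms SL2_cases by metis
 have y: "mat2 d (-b) (-c) a \<in> carrier SL2" using x(2) by (simp add: mat2_SL2 mult.commute)
 have "star (\<theta> x) = \<theta> (mat2 d (-b) (-c) a)" by (simp add: x(1) \<theta>_mat2 star_add star_scl star_Q e(3) star_f ac_simps)
 moreover have "mat2 d (-b) (-c) a * x = 1\<^sub>m 2"
  unfolding x(1) mat2_mult mat2_one[symmetric] using x(2) by (simp add: mult.commute)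
 ultimately show ?thesis unfolding isometry_def using \<theta>_mult[OF y assms] by (simp add: \<theta>_cor \<theta>_one)
qed

lemma \<theta>_rep: "x \<in> carrier SL2 ==> \<tau> x * \<theta> y = \<theta> y * \<tau> x" using Q_rep f_rep e_commute[OF f_rep Q_rep Q_rep]
 by (simp add: \<theta>_def distrib_left distrib_right)

lemma \<theta>_admissible: assumes "admissible g" shows "g * \<theta> y = \<theta> y * g"
proof -
 have g: "g * nil = nil * g" "\<And>i. g * wt i = wt i * g" "\<And>i. g * zero.wt i = zero.wt i * g"
  using assms by (auto simp: admissible_def)
 have gQ: "g * Q z = Q z * g" for z unfolding Q_def sum_distrib by (intro sum.cong refl) (metis g(2,3) assoc)
 have gn: "g * nil ^ m = nil ^ m * g" for m using power_commuting_commutes[OF g(1)[symmetric], of m] by simp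
 have gf: "g * f = f * g" unfolding f_def sum_distrib
 proof (intro sum.cong refl)
  fix k a assume "k \<in> {1..Suc wbound}"
  then have "g * R k = R k * g" using prim(6)[OF _ assms, of k] by (simp add: R_def)
  then show "g * (nil ^ (k - 1 - a) * R k * nil ^ a) = nil ^ (k - 1 - a) * R k * nil ^ a * g" by (metis gn assoc)
 qed
 show ?thesis using gQ gf e_commute[OF gf gQ gQ] by (simp add: \<theta>_def distrib_left distrib_right)
qed

text \<open>On \<open>Q z\<close> the element \<open>\<theta> (dgm s)\<close> is the scalar
  \<open>s powi z\<close>, exactly the discrepancy between the weights of \<open>\<tau>0\<close> and
  \<open>\<tau>\<close>.\<close>

lemma \<theta>_dgm: assumes "s ~= 0" shows "\<tau>0 (dgm s) = \<tau> (dgm s) * \<theta> (dgm s)"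
proof (rule eq_by_weights(2))
 fix j
 have 1: "\<tau>0 (dgm s) * (Q z * wt j) = scl (s powi (j + z)) (Q z * wt j)" for z
  using zero.dgm_wt[OF assms, of "j + z"] by (simp add: Q_wt flip: assoc)
 have 2: "\<tau> (dgm s) * (Q z * wt j) = scl (s powi j) (Q z * wt j)" for z
  using Q_rep[of "dgm s" z] dgm_wt[OF assms, of j] assms by (simp add: mat2_SL2 assoc flip: assoc[of "\<tau> (dgm s)"])
 have "\<tau>0 (dgm s) * wt j = \<tau>0 (dgm s) * ((Q (-1) + Q 0 + Q 1) * wt j)"
  unfolding sum_Q by (simp add: rectD[OF wt_cor])
 also have "\<dots> = \<tau> (dgm s) * ((Q 0 + scl s (Q 1) + scl (inverse s) (Q (-1))) * wt j)"
  using assms by (simp add: distrib_left distrib_right 1 2 power_int_add power_int_diff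
    divide_inverse ac_simps)
 finally show "\<tau>0 (dgm s) * wt j = \<tau> (dgm s) * \<theta> (dgm s) * wt j" by (simp add: \<theta>_mat2 assoc)
qed (auto intro!: cor_mult zero.\<tau>_cor \<tau>_cor \<theta>_cor simp: mat2_SL2 assms)

text \<open>Isometries have determinant \<open>1\<close> or \<open>-1\<close>, so their squares have
  determinant \<open>1\<close>. Unipotent and diagonal generators are squares, and the Weyl element
  is a product of unipotents.\<close>

lemma \<theta>_dt: assumes "x \<in> carrier SL2" shows "dt N (\<theta> x) = 1"
proof -
 have sq: "dt N (\<theta> (y * y)) = 1" if "y \<in> carrier SL2" for y
  using dt_isometry[OF \<theta>_isometry[OF that]] by (auto simp: \<theta>_mult[OF that that] dt_mult[OF \<theta>_cor \<theta>_cor])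
 have mult: "dt N (\<theta> (y * z)) = 1" if "y \<in> carrier SL2" "z \<in> carrier SL2" "dt N (\<theta> y) = 1" "dt N (\<theta> z) = 1" for y z
  using that by (simp add: \<theta>_mult dt_mult[OF \<theta>_cor \<theta>_cor])
 have upp: "dt N (\<theta> (upp t)) = 1" and low: "dt N (\<theta> (low t)) = 1" for t
  using sq[of "upp (t / 2)"] sq[of "low (t / 2)"] by (simp_all add: mat2_SL2 mat2_mult)
 have "wey = upp 1 * (low (- 1) * upp 1)" by (simp add: mat2_mult)
 moreover have "dt N (\<theta> (upp 1 * (low (- 1) * upp 1))) = 1" by (intro mult upp low SL2_mult) (simp_all add: mat2_SL2)
 ultimately have wey: "dt N (\<theta> wey) = 1" by simp
 from assms show ?thesis
 proof (induction rule: SL2_induct)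
  case (dgm s)
  define r where "r = csqrt s"
  have "dgm s = dgm r * dgm r" "dgm r \<in> carrier SL2"
   using dgm power2_csqrt[of s] by (auto simp: r_def mat2_mult mat2_SL2 power2_eq_square simp flip: inverse_mult_distrib)
  then show ?case using sq by metis
 qed (use upp wey mult in auto)
qed

lemma \<theta>_regular: "regular_on_SL2 (\<lambda>y. ent (\<theta> y) i j)"
proof -
 define c :: "nat => nat => nat => nat => complex" where
  "c p q r s = (if (p, q, r, s) = (0, 0, 0, 0) then ent (Q 0) i j
    else if (p, q, r, s) = (1, 0, 0, 0) then ent (Q 1) i j else if (p, q, r, s) = (0, 1, 0, 0) then ent e i j
    else if (p, q, r, s) = (0, 0, 1, 0) then ent f i j else if (p, q, r, s) = (0, 0, 0, 1) then ent (Q (-1)) i j else 0)"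
  for p q r s
 have "ent (\<theta> y) i j = (\<Sum>p\<le>1. \<Sum>q\<le>1. \<Sum>r\<le>1. \<Sum>s\<le>1.
   c p q r s * y $$ (0,0) ^ p * y $$ (0,1) ^ q * y $$ (1,0) ^ r * y $$ (1,1) ^ s)" for y
  by (simp add: \<theta>_def c_def atMost_Suc)
 then show ?thesis unfolding regular_on_SL2_def by blast
qed

end


section \<open>Parameters\<close>

subsection \<open>Regular and continuous matrix functions\<close>

lemma regular_on_SL2_iff:
 "regular_on_SL2 F \<longleftrightarrow> (\<exists>S c. finite S \<and> (\<forall>x\<in>carrier SL2. F x = (\<Sum>m\<in>S. SL2_monomial x m * c m)))"
proof
 assume "regular_on_SL2 F"
 then obtain c d where "\<forall>x\<in>carrier SL2. F x = (\<Sum>i\<le>d. \<Sum>j\<le>d. \<Sum>k\<le>d. \<Sum>l\<le>(d::nat).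
    c i j k l * x $$ (0,0) ^ i * x $$ (0,1) ^ j * x $$ (1,0) ^ k * x $$ (1,1) ^ l)"
  unfolding regular_on_SL2_def by blast
 then show "\<exists>S c. finite S \<and> (\<forall>x\<in>carrier SL2. F x = (\<Sum>m\<in>S. SL2_monomial x m * c m))"
  by (intro exI[of _ "{..d} \<times> {..d} \<times> {..d} \<times> {..d}"] exI[of _ "\<lambda>(i, j, k, l). c i j k l"])
   (simp add: SL2_monomial_def sum.cartesian_product' mult_ac)
next
 assume "\<exists>S c. finite S \<and> (\<forall>x\<in>carrier SL2. F x = (\<Sum>m\<in>S. SL2_monomial x m * c m))"
 then obtain S c where S: "finite S" "\<And>x. x \<in> carrier SL2 ==> F x = (\<Sum>m\<in>S. SL2_monomial x m * c m)" by blast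
 define d where "d = Max (insert 0 ((\<lambda>(i, j, k, l). i + j + k + l) ` S))"
 have d: "i \<le> d \<and> j \<le> d \<and> k \<le> d \<and> l \<le> d" if "(i, j, k, l) \<in> S" for i j k l
 proof -
  have "i + j + k + l \<le> d" unfolding d_def using S(1) that by (intro Max_ge) force+
  then show ?thesis by linarith
 qed
 have "F x = (\<Sum>i\<le>d. \<Sum>j\<le>d. \<Sum>k\<le>d. \<Sum>l\<le>d. (if (i, j, k, l) \<in> S then c (i, j, k, l) else 0)
   * x $$ (0,0) ^ i * x $$ (0,1) ^ j * x $$ (1,0) ^ k * x $$ (1,1) ^ l)" if x: "x \<in> carrier SL2" for x
 proof -
  have "F x = (\<Sum>(i, j, k, l)\<in>{..d} \<times> {..d} \<times> {..d} \<times> {..d}. (if (i, j, k, l) \<in> S then c (i, j, k, l) else 0)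
   * x $$ (0,0) ^ i * x $$ (0,1) ^ j * x $$ (1,0) ^ k * x $$ (1,1) ^ l)"
   unfolding S(2)[OF x] using d by (intro sum.mono_neutral_cong_left) (auto simp: SL2_monomial_def)
  then show ?thesis by (simp add: sum.cartesian_product[symmetric])
 qed
 then show "regular_on_SL2 F" unfolding regular_on_SL2_def
  by (intro exI[of _ "\<lambda>i j k l. if (i, j, k, l) \<in> S then c (i, j, k, l) else 0"] exI[of _ d]) blast
qed

lemma (in sl2_rep) regular_entries: "regular_on_SL2 (\<lambda>x. ent (\<tau> x) i j)"
proof -
 obtain S C where S: "finite S" "\<forall>x\<in>carrier SL2. \<tau> x = (\<Sum>m\<in>S. scl (SL2_monomial x m) (C m))"
  using \<tau>_regular by (elim exE conjE)
 then have "\<forall>x\<in>carrier SL2. ent (\<tau> x) i j = (\<Sum>m\<in>S. SL2_monomial x m * ent (C m) i j)" by simp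
 with S(1) show ?thesis unfolding regular_on_SL2_iff by (intro exI[of _ S] exI[of _ "\<lambda>m. ent (C m) i j"] conjI)
qed

text \<open>The expansions of the entries are extended by zero to a common finite set of
  monomials.\<close>

lemma regular_matrixI:
 assumes F: "\<And>x. x \<in> carrier SL2 ==> F x \<in> cor N"
  "\<And>i j. i < N ==> j < N ==> regular_on_SL2 (\<lambda>x. ent (F x) i j)"
 shows "\<exists>S C. finite S \<and> (\<forall>x\<in>carrier SL2. F x = (\<Sum>m\<in>S. scl (SL2_monomial x m) (C m)))"
proof -
 obtain S c where S: "\<And>i j. i < N ==> j < N ==> finite (S i j)"
  "\<And>i j x. i < N ==> j < N ==> x \<in> carrier SL2 ==> ent (F x) i j = (\<Sum>m\<in>S i j. SL2_monomial x m * c i j m)"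
  using F(2) unfolding regular_on_SL2_iff by metis
 define U where "U = (\<Union>i<N. \<Union>j<N. S i j)"
 define C where "C m = of_m (mat N N (\<lambda>(i, j). if m \<in> S i j then c i j m else 0))" for m
 have U: "finite U" using S(1) by (simp add: U_def)
 have "F x = (\<Sum>m\<in>U. scl (SL2_monomial x m) (C m))" if x: "x \<in> carrier SL2" for x
 proof (rule imat_eqI)
  fix i j
  show "ent (F x) i j = ent (\<Sum>m\<in>U. scl (SL2_monomial x m) (C m)) i j"
  proof (cases "i < N \<and> j < N")
   case True
   then show ?thesis unfolding S(2)[OF conjunct1[OF True] conjunct2[OF True] x] using U
    by (auto simp: C_def ent_of_m U_def intro!: sum.mono_neutral_cong_left)
  next
   case False
   have "C m \<in> cor N" for m unfolding C_def by (rule of_m_rect) simp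
   then show ?thesis using rect_ent_0[OF F(1)[OF x] False] rect_ent_0[OF _ False] by simp
  qed
 qed
 then show ?thesis using U by blast
qed

lemma regular_cong: "(\<And>x. x \<in> carrier SL2 ==> F x = G x) ==> regular_on_SL2 F \<longleftrightarrow> regular_on_SL2 G"
 unfolding regular_on_SL2_def by simp

lemma ent_mult_rect: "A \<in> rect m n ==> ent (A * B) i j = (\<Sum>k<n. ent A i k * ent B k j)"
 by (rule ent_mult) (auto simp: rect_iff)

lemma continuous_map_mult_complex:
 fixes F G :: "'a => complex"
 shows "continuous_map T euclidean F ==> continuous_map T euclidean G ==> continuous_map T euclidean (\<lambda>x. F x * G x)"
 by (simp add: continuous_map_atin tendsto_mult)

lemma continuous_matrix_iff:
 "continuous_map T (matrix_topology N) F \<longleftrightarrow>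
   F ` topspace T \<subseteq> carrier_mat N N \<and> (\<forall>i<N. \<forall>j<N. continuous_map T euclidean (\<lambda>t. F t $$ (i, j)))"
proof (intro iffI conjI allI impI)
 assume F: "continuous_map T (matrix_topology N) F"
 have "topspace (matrix_topology N) \<subseteq> carrier_mat N N" by (auto simp: matrix_topology_def topspace_pullback_topology)
 then show "F ` topspace T \<subseteq> carrier_mat N N" using continuous_map_image_subset_topspace[OF F] by blast
 fix i j assume ij: "i < N" "j < N"
 have "continuous_map (product_topology (\<lambda>_. euclidean :: complex topology) ({..<N} \<times> {..<N})) euclidean (\<lambda>x. x (i, j))"
  using ij by (intro continuous_map_product_projection) auto
 from continuous_map_pullback[OF this, of "carrier_mat N N" "\<lambda>A. restrict (\<lambda>ij. A $$ ij) ({..<N} \<times> {..<N})"]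
 have "continuous_map (matrix_topology N) euclidean (\<lambda>A :: complex mat. A $$ (i, j))"
  using ij by (simp add: matrix_topology_def comp_def)
 from continuous_map_compose[OF F this] show "continuous_map T euclidean (\<lambda>t. F t $$ (i, j))" by (simp add: comp_def)
next
 assume F: "F ` topspace T \<subseteq> carrier_mat N N \<and> (\<forall>i<N. \<forall>j<N. continuous_map T euclidean (\<lambda>t. F t $$ (i, j)))"
 show "continuous_map T (matrix_topology N) F" unfolding matrix_topology_def
 proof (rule continuous_map_pullback')
  show "continuous_map T (product_topology (\<lambda>_. euclidean) ({..<N} \<times> {..<N})) ((\<lambda>A. restrict (\<lambda>ij. A $$ ij) ({..<N} \<times> {..<N})) \<circ> F)"
   using F by (auto simp: continuous_map_componentwise)
 qed (use F in auto)
qed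

definition continuous_entries :: "'a topology => nat => ('a => imat) => bool" where
 "continuous_entries T N F \<longleftrightarrow> (\<forall>t\<in>topspace T. F t \<in> cor N) \<and> (\<forall>i j. continuous_map T euclidean (\<lambda>t. ent (F t) i j))"

lemma continuous_entries_const: "A \<in> cor N ==> continuous_entries T N (\<lambda>t. A)" by (simp add: continuous_entries_def)

lemma continuous_entries_mult:
 assumes F: "continuous_entries T N F" and G: "continuous_entries T N G"
 shows "continuous_entries T N (\<lambda>t. F t * G t)"
proof -
 have "continuous_map T euclidean (\<lambda>t. ent (F t * G t) i j)" for i j
 proof -
  have "continuous_map T euclidean (\<lambda>t. \<Sum>k<N. ent (F t) i k * ent (G t) k j)"
   using F G by (intro continuous_map_sum continuous_map_mult_complex) (auto simp: continuous_entries_def)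
  then show ?thesis by (rule continuous_map_eq) (use F ent_mult_rect in \<open>auto simp: continuous_entries_def\<close>)
 qed
 then show ?thesis using F G by (auto simp: continuous_entries_def intro: cor_mult)
qed

lemma continuous_entries_of_m:
 assumes "continuous_map T (matrix_topology N) F" shows "continuous_entries T N (\<lambda>t. of_m (F t))"
proof -
 have F: "F t \<in> carrier_mat N N" if "t \<in> topspace T" for t using assms that by (auto simp: continuous_matrix_iff)
 have "continuous_map T euclidean (\<lambda>t. ent (of_m (F t)) i j)" for i j
 proof (cases "i < N \<and> j < N")
  case True
  then have "continuous_map T euclidean (\<lambda>t. F t $$ (i, j))" using assms by (auto simp: continuous_matrix_iff)
  then show ?thesis by (rule continuous_map_eq) (use F True in \<open>auto simp: ent_of_m\<close>)
 next
  case False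
  have "continuous_map T euclidean (\<lambda>t. 0 :: complex)" by simp
  then show ?thesis by (rule continuous_map_eq) (use rect_ent_0[OF of_m_rect[OF F] False] in auto)
 qed
 then show ?thesis using F of_m_rect by (auto simp: continuous_entries_def)
qed

lemma continuous_to_m:
 assumes "continuous_entries T N F" shows "continuous_map T (matrix_topology N) (\<lambda>t. to_m N N (F t))"
 unfolding continuous_matrix_iff using assms by (auto simp: continuous_entries_def to_m_def)

definition bounded_entries :: "('a => imat) => 'a set => bool" where
 "bounded_entries F S \<longleftrightarrow> (\<exists>b. \<forall>s\<in>S. \<forall>i j. cmod (ent (F s) i j) \<le> b)"

lemma bounded_entries_mult:
 assumes F: "bounded_entries F S" "\<And>s. s \<in> S ==> F s \<in> cor N" and G: "bounded_entries G S"
 shows "bounded_entries (\<lambda>s. F s * G s) S"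
proof -
 obtain a where a: "\<forall>s\<in>S. \<forall>i j. cmod (ent (F s) i j) \<le> a" using F by (auto simp: bounded_entries_def)
 obtain b where b: "\<forall>s\<in>S. \<forall>i j. cmod (ent (G s) i j) \<le> b" using G by (auto simp: bounded_entries_def)
 have "cmod (ent (F s * G s) i j) \<le> of_nat N * (a * b)" if s: "s \<in> S" for s i j
 proof -
  have "cmod (ent (F s * G s) i j) \<le> (\<Sum>k<N. a * b)" unfolding ent_mult_rect[OF F(2)[OF s]]
  proof (intro sum_norm_le)
   fix k
   have "0 \<le> a" using a s norm_ge_zero order_trans by blast
   then show "cmod (ent (F s) i k * ent (G s) k j) \<le> a * b" using a b s by (auto simp: norm_mult intro!: mult_mono)
  qed
  then show ?thesis by simp
 qed
 then show ?thesis unfolding bounded_entries_def by blast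
qed

lemma bounded_entries_const: "A \<in> cor N ==> bounded_entries (\<lambda>s. A) S"
proof -
 assume A: "A \<in> cor N"
 have "cmod (ent A i j) \<le> (\<Sum>i<N. \<Sum>j<N. cmod (ent A i j))" for i j
 proof (cases "i < N \<and> j < N")
  case True
  have "cmod (ent A i j) \<le> (\<Sum>j<N. cmod (ent A i j))" using True by (intro member_le_sum) auto
  also have "\<dots> \<le> (\<Sum>i<N. \<Sum>j<N. cmod (ent A i j))"
   using True by (intro member_le_sum[of i _ "\<lambda>i. \<Sum>j<N. cmod (ent A i j)"]) (auto intro: sum_nonneg)
  finally show ?thesis .
 qed (use A in \<open>auto simp: rect_ent_0 intro!: sum_nonneg\<close>)
 then show ?thesis unfolding bounded_entries_def by blast
qed

lemma bounded_entries_tp: "bounded_entries F S ==> bounded_entries (\<lambda>s. tp (F s)) S" by (auto simp: bounded_entries_def)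

subsection \<open>Conjugate representations and intertwiners\<close>

context sl2_rep
begin

lemma nil_nilpotent: obtains k where "nil ^ k * idm N = 0"
proof -
 obtain D where D: "\<And>k. k > D ==> div_pow k = 0" using upp_coefficients by metis
 have "div_pow (Suc D) = 0" using D by simp
 then have "idm N * nil ^ Suc D = 0" by (simp add: div_pow_def del: power_Suc fact_Suc)
 then have "nil ^ Suc D * idm N = 0" using nil_idm[of "Suc D"] by simp
 then show thesis using that by blast
qed

lemma commutes_with_nil_wt:
 assumes "\<And>x. x \<in> carrier SL2 ==> Y * \<tau> x = \<tau> x * Y"
 shows "Y * nil = nil * Y" "Y * wt z = wt z * Y"
proof -
 obtain D where D: "\<And>t. \<tau> (upp t) = (\<Sum>k\<le>D. scl (t ^ k) (div_pow k))" "D \<ge> 1" using upp_coefficients by metis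
 have "(\<Sum>k\<le>D. scl (t ^ k) (Y * div_pow k)) = (\<Sum>k\<le>D. scl (t ^ k) (div_pow k * Y))" for t
 proof -
  have "Y * \<tau> (upp t) = \<tau> (upp t) * Y" by (rule assms) (simp add: mat2_SL2)
  then show ?thesis unfolding D(1) by (simp only: sum_distrib scl_mult)
 qed
 from polynomial_unique[OF this D(2)] show "Y * nil = nil * Y" by (simp only: div_pow_1)
 show "Y * wt z = wt z * Y"
 proof (cases "z \<in> wts")
  case True
  have "(\<Sum>z\<in>wts. scl (s powi z) (Y * wt z)) = (\<Sum>z\<in>wts. scl (s powi z) (wt z * Y))" if "s ~= 0" for s
  proof -
   have "Y * \<tau> (dgm s) = \<tau> (dgm s) * Y" using that by (intro assms) (simp add: mat2_SL2)
   then show ?thesis unfolding dgm_expansion[OF that] by (simp only: sum_distrib scl_mult)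
  qed
  from laurent_unique[OF _ this True] show ?thesis by simp
 qed (simp add: wt_notin)
qed

lemma dgm_nil: assumes "s ~= 0" shows "\<tau> (dgm s) * nil = scl (s powi 2) (nil * \<tau> (dgm s))"
proof (rule eq_by_weights(2))
 fix z
 have "\<tau> (dgm s) * nil * wt z = \<tau> (dgm s) * wt (z + 2) * nil" by (simp add: nil_wt assoc)
 also have "\<dots> = scl (s powi (z + 2)) (nil * wt z)" by (simp add: dgm_wt[OF assms] nil_wt)
 finally show "\<tau> (dgm s) * nil * wt z = scl (s powi 2) (nil * \<tau> (dgm s)) * wt z"
  using assms by (simp add: dgm_wt[OF assms] assoc power_int_add)
qed (use assms in \<open>auto intro!: cor_mult rect_scl nil_cor \<tau>_cor simp: mat2_SL2\<close>)

end

lemma (in isometric_rep) conjugate_rep: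
 assumes h: "isometry h"
 shows "isometric_rep N J J' \<epsilon> (\<lambda>x. h * \<tau> x * star h)"
  "sl2_rep.nil N (\<lambda>x. h * \<tau> x * star h) = h * nil * star h"
proof -
 note hh = isometryD[OF h]
 have cancel: "star h * (h * A) = A" if "A \<in> cor N" for A using hh(2) that by (simp add: rectD flip: assoc)
 show rep: "isometric_rep N J J' \<epsilon> (\<lambda>x. h * \<tau> x * star h)"
 proof unfold_locales
  fix x y assume x: "x \<in> carrier SL2" and y: "y \<in> carrier SL2"
  show "h * \<tau> x * star h \<in> cor N" by (intro cor_mult hh \<tau>_cor x star_cor)
  have "h * \<tau> x * star h * (h * \<tau> y * star h) = h * \<tau> x * (star h * (h * (\<tau> y * star h)))" by (simp only: assoc)
  also have "\<dots> = h * \<tau> (x * y) * star h"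
   using x y by (subst cancel) (simp_all add: cor_mult \<tau>_cor star_cor \<tau>_mult assoc)
  finally show "h * \<tau> (x * y) * star h = h * \<tau> x * star h * (h * \<tau> y * star h)" by simp
  have "star (h * \<tau> x * star h) = h * star (\<tau> x) * star h"
   using hh \<tau>_cor[OF x] by (simp add: star_mult star_star cor_mult assoc)
  then have "star (h * \<tau> x * star h) * (h * \<tau> x * star h) = h * star (\<tau> x) * (star h * (h * (\<tau> x * star h)))"
   by (simp only: assoc)
  also have "\<dots> = h * (star (\<tau> x) * \<tau> x) * star h"
   using x by (subst cancel) (simp_all add: cor_mult \<tau>_cor star_cor assoc)
  finally show "star (h * \<tau> x * star h) * (h * \<tau> x * star h) = idm N" using isometric[OF x] hh by (simp add: rectD)
 next
  show "h * \<tau> (1\<^sub>m 2) * star h = idm N" using hh by (simp add: \<tau>_one rectD)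
  obtain S C where S: "finite S" "\<forall>x\<in>carrier SL2. \<tau> x = (\<Sum>m\<in>S. scl (SL2_monomial x m) (C m))"
   using \<tau>_regular by (elim exE conjE)
  then have "h * \<tau> x * star h = (\<Sum>m\<in>S. scl (SL2_monomial x m) (h * C m * star h))" if "x \<in> carrier SL2" for x
   using that by (simp add: sum_distrib)
  then show "\<exists>S C. finite S \<and> (\<forall>x\<in>carrier SL2. h * \<tau> x * star h = (\<Sum>m\<in>S. scl (SL2_monomial x m) (C m)))"
   using S(1) by (intro exI[of _ S] exI[of _ "\<lambda>m. h * C m * star h"] conjI ballI)
 qed
 interpret c: isometric_rep N J J' \<epsilon> "\<lambda>x. h * \<tau> x * star h" by (rule rep)
 obtain D where D: "\<And>t. \<tau> (upp t) = (\<Sum>k\<le>D. scl (t ^ k) (div_pow k))" "D \<ge> 1" using upp_coefficients by metis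
 have "c.nil = h * div_pow 1 * star h" using hh(1) star_cor nil_cor D(2) unfolding div_pow_1
  by (intro c.nil_eqI[where A = "\<lambda>k. h * div_pow k * star h" and D = D, unfolded div_pow_1])
   (auto simp: D(1) sum_distrib intro!: cor_mult)
 then show "sl2_rep.nil N (\<lambda>x. h * \<tau> x * star h) = h * nil * star h" by (simp only: div_pow_1)
qed

subsection \<open>Bounded conjugation\<close>

text \<open>If \<open>A Y = q Y A\<close> with \<open>q\<close> of absolute value different from \<open>1\<close>, where all powers of \<open>A\<close> and their
 inverses are bounded, then \<open>A^m Y A^-m = q^m Y\<close> is bounded for \<open>m\<close> of both signs, so \<open>Y = 0\<close>.\<close>

lemma bounded_scaling_zero:
 assumes Y: "\<And>m. A m * Y = scl (q ^ m) (Y * A m)" and inv: "\<And>m. A m * B m = idm N" "\<And>m. B m * A m = idm N"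
  and A: "bounded_entries A UNIV" "\<And>m. A m \<in> cor N" and B: "bounded_entries B UNIV" "\<And>m. B m \<in> cor N"
  and Yc: "Y \<in> cor N" and q: "cmod q ~= 1" "q ~= 0"
 shows "Y = 0"
proof -
 have 1: "scl (q ^ m) Y = A m * Y * B m" for m using Yc by (simp only: Y inv scl_mult_left assoc rectD)
 have 2: "scl (inverse q ^ m) Y = B m * Y * A m" for m
 proof -
  have "Y = B m * (A m * Y)" using Yc by (simp add: inv rectD flip: assoc)
  also have "\<dots> = scl (q ^ m) (B m * Y * A m)" by (simp only: Y scl_mult_right assoc)
  finally have "scl (inverse q ^ m) Y = scl (inverse q ^ m) (scl (q ^ m) (B m * Y * A m))" by (rule arg_cong)
  then show ?thesis using q(2) by (simp flip: power_mult_distrib)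
 qed
 have grow: "Y = 0" if r: "cmod r > 1" and bd: "bounded_entries (\<lambda>m :: nat. scl (r ^ m) Y) UNIV" for r
 proof (rule imat_eqI)
  fix i j
  obtain b where b: "\<And>m. cmod (r ^ m * ent Y i j) \<le> b" using bd by (auto simp: bounded_entries_def)
  show "ent Y i j = ent 0 i j"
  proof (rule ccontr)
   assume "ent Y i j ~= ent 0 i j"
   then have pos: "cmod (ent Y i j) > 0" by simp
   obtain m where "b / cmod (ent Y i j) < cmod r ^ m" using real_arch_pow[OF r] by blast
   then show False using b[of m] pos by (simp add: norm_mult norm_power divide_less_eq)
  qed
 qed
 have bd: "bounded_entries (\<lambda>m. A m * Y * B m) UNIV" "bounded_entries (\<lambda>m. B m * Y * A m) UNIV"
  using A B Yc by (auto intro!: bounded_entries_mult[where N = N] bounded_entries_const cor_mult)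
 show ?thesis
 proof (cases "cmod q > 1")
  case True
  then show ?thesis using grow[of q] bd(1) 1 by simp
 next
  case False
  then have "cmod (inverse q) > 1" using q by (simp add: norm_inverse one_less_inverse_iff)
  then show ?thesis using grow[of "inverse q"] bd(2) 2 by simp
 qed
qed


lemma continuous_entries_compose:
 assumes F: "continuous_entries T N F" and g: "continuous_map S T g"
 shows "continuous_entries S N (\<lambda>s. F (g s))"
proof -
 have "continuous_map S euclidean (\<lambda>s. ent (F (g s)) i j)" for i j
  using continuous_map_compose[OF g, of euclidean "\<lambda>t. ent (F t) i j"] F
  by (simp add: continuous_entries_def comp_def)
 then show ?thesis using F continuous_map_image_subset_topspace[OF g] by (auto simp: continuous_entries_def)
qed

subsection \<open>The two components of a parameter\<close>

definition weil_part :: "('f::field_char_0 weil \<times> complex mat => complex mat) => 'f weil => imat" where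
 "weil_part \<phi> w = of_m (\<phi> (w, 1\<^sub>m 2))"

definition sl2_part :: "('f::field_char_0 weil \<times> complex mat => complex mat) => complex mat => imat" where
 "sl2_part \<phi> x = of_m (\<phi> (id, x))"

locale l_param = nonarch_local_field v + classical_form "dual_type T" n
 for v :: "'f::field_char_0 => real" and T n +
 fixes \<phi> :: "'f weil \<times> complex mat => complex mat"
 assumes L: "L_parameter v T n \<phi>"
begin

lemma param_mem:
 assumes "w \<in> carrier (weil_group v)" "x \<in> carrier SL2"
 shows "\<phi> (w, x) \<in> carrier_mat N N" "special (of_m (\<phi> (w, x)))"
proof -
 have "\<phi> (w, x) \<in> carrier (dual_group T n)" using L assms unfolding L_parameter_def hom_def by auto
 then show "\<phi> (w, x) \<in> carrier_mat N N" "special (of_m (\<phi> (w, x)))" by (auto simp: group_mem)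
qed

lemma param_mult:
 assumes "w \<in> carrier (weil_group v)" "x \<in> carrier SL2" "w' \<in> carrier (weil_group v)" "x' \<in> carrier SL2"
 shows "of_m (\<phi> (w \<circ> w', x * x')) = of_m (\<phi> (w, x)) * of_m (\<phi> (w', x'))"
proof -
 have "\<phi> ((w, x) \<otimes>\<^bsub>weil_group v \<times>\<times> SL2\<^esub> (w', x')) = \<phi> (w, x) \<otimes>\<^bsub>dual_group T n\<^esub> \<phi> (w', x')"
  using L assms unfolding L_parameter_def hom_def by auto
 then have "\<phi> (w \<circ> w', x * x') = \<phi> (w, x) * \<phi> (w', x')" by (simp add: group_simps SL2_simps weil_group_def)
 then show ?thesis using param_mem assms by (simp add: of_m_mult[of _ N N _ N])
qed

lemma param_one: "of_m (\<phi> (id, 1\<^sub>m 2)) = idm N"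
proof -
 define g where "g = of_m (\<phi> (id, 1\<^sub>m 2))"
 have s: "special g" unfolding g_def by (rule param_mem[OF id_weil_group SL2_one])
 have gg: "g * g = g" using param_mult[OF id_weil_group SL2_one id_weil_group SL2_one] by (simp add: g_def)
 have "star g * g * g = g" using specialD[OF s] by (simp add: rectD)
 moreover have "star g * g * g = star g * g" by (simp only: assoc gg)
 ultimately show ?thesis using specialD(4)[OF s] by (simp add: g_def)
qed

lemma parts:
 assumes "w \<in> carrier (weil_group v)" "x \<in> carrier SL2"
 shows "of_m (\<phi> (w, x)) = weil_part \<phi> w * sl2_part \<phi> x" "of_m (\<phi> (w, x)) = sl2_part \<phi> x * weil_part \<phi> w"
proof -
 have c: "x \<in> carrier_mat 2 2" using assms(2) by (simp add: SL2_def matrix_group_def)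
 show "of_m (\<phi> (w, x)) = weil_part \<phi> w * sl2_part \<phi> x" "of_m (\<phi> (w, x)) = sl2_part \<phi> x * weil_part \<phi> w"
  using param_mult[OF assms(1) SL2_one id_weil_group assms(2)] param_mult[OF id_weil_group assms(2) assms(1) SL2_one] c
  by (simp_all add: weil_part_def sl2_part_def)
qed

lemma weil_part_special: "w \<in> carrier (weil_group v) ==> special (weil_part \<phi> w)"
 unfolding weil_part_def by (rule param_mem(2)[OF _ SL2_one])

lemma weil_part_mult:
 "w \<in> carrier (weil_group v) ==> w' \<in> carrier (weil_group v) ==> weil_part \<phi> (w \<circ> w') = weil_part \<phi> w * weil_part \<phi> w'"
 using param_mult[OF _ SL2_one _ SL2_one] by (simp add: weil_part_def)

lemma weil_part_id: "weil_part \<phi> id = idm N" by (simp add: weil_part_def param_one)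

lemma sl2_part_special: "x \<in> carrier SL2 ==> special (sl2_part \<phi> x)"
 unfolding sl2_part_def by (rule param_mem(2)[OF id_weil_group])

sublocale rep: isometric_rep "std_dim (dual_type T) n" "of_m (form_matrix (dual_type T) n)" "form_inverse (dual_type T) n"
  "form_sign (dual_type T)" "sl2_part \<phi>"
proof unfold_locales
 fix x y assume x: "x \<in> carrier SL2" and y: "y \<in> carrier SL2"
 show "sl2_part \<phi> x \<in> cor N" using specialD(3)[OF sl2_part_special[OF x]] .
 show "sl2_part \<phi> (x * y) = sl2_part \<phi> x * sl2_part \<phi> y"
  using param_mult[OF id_weil_group x id_weil_group y] by (simp add: sl2_part_def)
 show "star (sl2_part \<phi> x) * sl2_part \<phi> x = idm N" using specialD(4)[OF sl2_part_special[OF x]] .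
next
 show "sl2_part \<phi> (1\<^sub>m 2) = idm N" by (simp add: sl2_part_def param_one)
next
 show "\<exists>S C. finite S \<and> (\<forall>x\<in>carrier SL2. sl2_part \<phi> x = (\<Sum>m\<in>S. scl (SL2_monomial x m) (C m)))"
 proof (rule regular_matrixI)
  fix i j assume ij: "i < N" "j < N"
  have "regular_on_SL2 (\<lambda>x. \<phi> (id, x) $$ (i, j))" using L ij by (auto simp: L_parameter_def algebraic_on_SL2_def)
  moreover have "\<phi> (id, x) $$ (i, j) = ent (sl2_part \<phi> x) i j" if "x \<in> carrier SL2" for x
   using param_mem(1)[OF id_weil_group that] ij by (auto simp: sl2_part_def ent_of_m)
  ultimately show "regular_on_SL2 (\<lambda>x. ent (sl2_part \<phi> x) i j)"
   by (subst regular_cong[of _ "\<lambda>x. \<phi> (id, x) $$ (i, j)"]) simp_all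
 qed (rule specialD(3)[OF sl2_part_special])
qed

lemma nilpotent_of_phi: "of_m (nilpotent_of_phi N \<phi>) = rep.nil"
proof -
 have "(\<lambda>t. \<phi> (id, mat_of_rows_list 2 [[1, t], [0, 1]]) $$ (i, j)) = (\<lambda>t. ent (sl2_part \<phi> (upp t)) i j)"
  if "i < N" "j < N" for i j
 proof
  fix t
  have "\<phi> (id, upp t) \<in> carrier_mat N N" by (rule param_mem(1)[OF id_weil_group]) (simp add: mat2_SL2)
  then show "\<phi> (id, mat_of_rows_list 2 [[1, t], [0, 1]]) $$ (i, j) = ent (sl2_part \<phi> (upp t)) i j"
   using that by (auto simp: sl2_part_def ent_of_m mat2_def)
 qed
 then show ?thesis unfolding rep.nil_def nilpotent_of_phi_def by (intro arg_cong[of _ _ of_m] eq_matI) auto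
qed

lemma nilpotent_of_phi_lie: "nilpotent_of_phi N \<phi> \<in> classical_lie_algebra (dual_type T) n"
 unfolding lie_mem nilpotent_of_phi using rep.star_nil by (simp add: nilpotent_of_phi_def)

lemma continuous_parts:
 "continuous_entries (weil_topology v) N (weil_part \<phi>)"
 "continuous_entries (subtopology (matrix_topology 2) (carrier SL2)) N (sl2_part \<phi>)"
proof -
 define S where "S = subtopology (matrix_topology 2) (carrier SL2)"
 have c: "continuous_map (prod_topology (weil_topology v) S) (matrix_topology N) \<phi>"
  using L by (simp add: L_parameter_def S_def)
 have "topspace (matrix_topology 2) = carrier_mat 2 2" by (auto simp: matrix_topology_def topspace_pullback_topology)
 then have one: "1\<^sub>m 2 \<in> topspace S" using SL2_one by (simp add: S_def)
 have id: "id \<in> topspace (weil_topology v)"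
 proof -
  have "id \<in> inertia_group v"
   using ac_integers_0 by (simp add: inertia_group_def galois_automorphisms_def frobenius_degree_def ac_maximal_ideal_iff)
  then have "id \<in> (\<lambda>\<tau>. id \<circ> \<tau>) ` {\<tau> \<in> inertia_group v. \<forall>x\<in>{}. \<tau> x = x}" by force
  then show ?thesis unfolding weil_topology_def topology_generated_by_topspace using id_weil_group by blast
 qed
 have "continuous_map (weil_topology v) (prod_topology (weil_topology v) S) (\<lambda>w. (w, 1\<^sub>m 2))"
  "continuous_map S (prod_topology (weil_topology v) S) (\<lambda>x. (id, x))"
  using one id by (auto intro!: continuous_map_pairedI)
 from this[THEN continuous_map_compose, OF c]
 have "continuous_map (weil_topology v) (matrix_topology N) (\<lambda>w. \<phi> (w, 1\<^sub>m 2))"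
  "continuous_map S (matrix_topology N) (\<lambda>x. \<phi> (id, x))" by (simp_all add: comp_def)
 then show "continuous_entries (weil_topology v) N (weil_part \<phi>)" "continuous_entries (subtopology (matrix_topology 2) (carrier SL2)) N (sl2_part \<phi>)"
  unfolding weil_part_def sl2_part_def S_def by (auto intro: continuous_entries_of_m)
qed

lemma tempered_iff: "tempered v T n \<phi> \<longleftrightarrow> bounded_entries (weil_part \<phi>) (carrier (weil_group v))"
proof
 assume "tempered v T n \<phi>"
 then obtain b where b: "\<And>w i j. w \<in> carrier (weil_group v) ==> i < N ==> j < N ==> cmod (\<phi> (w, 1\<^sub>m 2) $$ (i, j)) \<le> b"
  by (auto simp: tempered_def entries_bounded_def)
 \<comment> \<open>Entries outside the corner are \<open>0\<close>, and \<open>b\<close> may be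
   negative if the corner is empty.\<close>
 have "cmod (ent (weil_part \<phi> w) i j) \<le> max b 0" if w: "w \<in> carrier (weil_group v)" for w i j
  using b[OF w, of i j] param_mem(1)[OF w SL2_one] by (auto simp: weil_part_def ent_of_m le_max_iff_disj)
 then show "bounded_entries (weil_part \<phi>) (carrier (weil_group v))" by (auto simp: bounded_entries_def)
next
 assume "bounded_entries (weil_part \<phi>) (carrier (weil_group v))"
 then obtain b where b: "\<And>w i j. w \<in> carrier (weil_group v) ==> cmod (ent (weil_part \<phi> w) i j) \<le> b"
  by (auto simp: bounded_entries_def)
 have "cmod (\<phi> (w, 1\<^sub>m 2) $$ (i, j)) \<le> b" if w: "w \<in> carrier (weil_group v)" and "i < N" "j < N" for w i j
  using b[OF w, of i j] param_mem(1)[OF w SL2_one] that by (auto simp: weil_part_def ent_of_m)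
 then show "tempered v T n \<phi>" by (auto simp: tempered_def entries_bounded_def)
qed

end

definition norm_root :: "('f::field_char_0 => real) => 'f weil => complex" where
 "norm_root v w = complex_of_real (weil_norm v w powr (1/2))"

lemma (in nonarch_local_field) d_mat:
 "d_mat v w = dgm (norm_root v w)" "norm_root v w ~= 0" "d_mat v w \<in> carrier SL2"
proof -
 have "complex_of_real (weil_norm v w powr (- 1/2)) = inverse (norm_root v w)"
  by (simp add: norm_root_def powr_minus)
 then show d: "d_mat v w = dgm (norm_root v w)" by (simp add: d_mat_def mat2_def norm_root_def)
 show nz: "norm_root v w ~= 0" using weil_norm_pos[of w] by (simp add: norm_root_def)
 show "d_mat v w \<in> carrier SL2" using nz by (simp add: d mat2_SL2)
qed

lemma (in classical_form) conjugate_on_refl: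
 assumes X: "X = dual_type T" and "\<And>s. s \<in> S ==> F s \<in> carrier_mat N N" "\<And>s. s \<in> S ==> F' s = F s"
 shows "conjugate_on T n S F F'"
proof -
 have one: "1\<^sub>m N \<in> carrier (classical_group X n)" using special_idm by (simp add: group_mem of_m_one)
 have "m_inv (classical_group X n) (1\<^sub>m N) = 1\<^sub>m N" using group_inv(1)[OF one] by (simp add: of_m_one to_m_idm)
 then show ?thesis unfolding conjugate_on_def X[symmetric]
  using one by (intro bexI[of _ "1\<^sub>m N"]) (auto simp: assms(3) left_mult_one_mat[OF assms(2)] right_mult_one_mat[OF assms(2)])
qed

lemma hom_mult_SL2_SL2:
 assumes "\<psi> \<in> hom (weil_group v \<times>\<times> SL2 \<times>\<times> SL2) G"
 shows "(\<lambda>(w, x). \<psi> (w, x, 1\<^sub>m 2)) \<in> hom (weil_group v \<times>\<times> SL2) G"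
proof (rule homI)
 fix p q assume "p \<in> carrier (weil_group v \<times>\<times> SL2)" "q \<in> carrier (weil_group v \<times>\<times> SL2)"
 then obtain w x w' x' where "p = (w, x)" "q = (w', x')" and mem: "(w, x, 1\<^sub>m 2) \<in> carrier (weil_group v \<times>\<times> SL2 \<times>\<times> SL2)"
  "(w', x', 1\<^sub>m 2) \<in> carrier (weil_group v \<times>\<times> SL2 \<times>\<times> SL2)" using SL2_one by auto
 then show "(case p of (w, x) => \<psi> (w, x, 1\<^sub>m 2)) \<in> carrier G"
  "(case p \<otimes>\<^bsub>weil_group v \<times>\<times> SL2\<^esub> q of (w, x) => \<psi> (w, x, 1\<^sub>m 2)) =
   (case p of (w, x) => \<psi> (w, x, 1\<^sub>m 2)) \<otimes>\<^bsub>G\<^esub> (case q of (w, x) => \<psi> (w, x, 1\<^sub>m 2))"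
  using hom_mult[OF assms mem] hom_in_carrier[OF assms mem(1)] by (simp_all add: SL2_simps)
qed

text \<open>Let the second copy of \<open>SL2\<close> act trivially.\<close>

lemma tempered_arthur_type:
 assumes "nonarch_local_field v" "L_parameter v T n \<phi>" "tempered v T n \<phi>"
 shows "arthur_type v T n \<phi>"
proof -
 interpret l_param v T n \<phi> using assms(1,2) by (simp add: l_param_def l_param_axioms_def)
 define \<psi> where "\<psi> = (\<lambda>(w, x, y :: complex mat). \<phi> (w, x))"
 have h: "\<phi> \<in> hom (weil_group v \<times>\<times> SL2) (dual_group T n)" using L by (simp add: L_parameter_def)
 have "arthur_parameter v T n \<psi>" unfolding arthur_parameter_def
 proof (intro conjI)
  show "\<psi> \<in> hom (weil_group v \<times>\<times> SL2 \<times>\<times> SL2) (dual_group T n)" using h by (fastforce simp: hom_def \<psi>_def)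
  show "L_parameter v T n (\<lambda>(w, x). \<psi> (w, x, 1\<^sub>m 2))" using L by (simp add: \<psi>_def)
  have "regular_on_SL2 (\<lambda>_. c)" for c
   unfolding regular_on_SL2_def by (intro exI[of _ "\<lambda>_ _ _ _. c"] exI[of _ 0]) simp
  then show "algebraic_on_SL2 N (\<lambda>y. \<psi> (id, 1\<^sub>m 2, y))" by (simp add: \<psi>_def algebraic_on_SL2_def)
  show "entries_bounded N ((\<lambda>w. \<psi> (w, 1\<^sub>m 2, 1\<^sub>m 2)) ` carrier (weil_group v))"
   using assms(3) by (simp add: tempered_def \<psi>_def)
 qed
 moreover have "conjugate_on T n (carrier (weil_group v \<times>\<times> SL2)) (phi_of_psi v \<psi>) \<phi>"
  using param_mem by (intro conjugate_on_refl) (auto simp: phi_of_psi_def \<psi>_def)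
 ultimately show ?thesis by (auto simp: arthur_type_def)
qed

subsection \<open>Comparison of two parameters\<close>

text \<open>Conjugation by \<open>h\<close> makes the two infinitesimal parameters literally equal.
  The element \<open>w1\<close> of nontrivial norm allows weights to be read off from absolute
  values.\<close>

lemma arthur_type_of_pair:
 fixes v :: "'f::field_char_0 => real" and T n \<phi>0 \<phi>
 assumes v: "nonarch_local_field v" and L0: "L_parameter v T n \<phi>0" and L: "L_parameter v T n \<phi>"
  and h: "classical_form.special (dual_type T) n h"
  and lambda: "\<And>w. w \<in> carrier (weil_group v) ==> of_m (\<phi> (w, d_mat v w)) =
    h * of_m (\<phi>0 (w, d_mat v w)) * bilinear_form.star (of_m (form_matrix (dual_type T) n)) (form_inverse (dual_type T) n) h"
  and tempered: "tempered v T n \<phi>0"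
  and rank: "\<And>k. rk (idm (dual_dim T n) * of_m (nilpotent_of_phi (dual_dim T n) \<phi>0) ^ k)
    \<le> rk (idm (dual_dim T n) * of_m (nilpotent_of_phi (dual_dim T n) \<phi>) ^ k) + 1"
  and w1: "w1 \<in> carrier (weil_group v)" "weil_norm v w1 ~= 1"
 shows "arthur_type v T n \<phi>"
proof -
 interpret nonarch_local_field v by fact
 interpret classical_form "dual_type T" n .
 interpret P0: l_param v T n \<phi>0 using v L0 by (simp add: l_param_def l_param_axioms_def)
 interpret P: l_param v T n \<phi> using v L by (simp add: l_param_def l_param_axioms_def)
 let ?W = "carrier (weil_group v)"
 let ?s = "norm_root v"
 note hh = specialD[OF h]
 define r r0 \<tau> \<tau>0 where "r = weil_part \<phi>" and "r0 w = h * weil_part \<phi>0 w * star h"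
  and "\<tau> = sl2_part \<phi>" and "\<tau>0 x = h * sl2_part \<phi>0 x * star h" for w x
 have \<tau>0_eq: "\<tau>0 = (\<lambda>x. h * sl2_part \<phi>0 x * star h)" by (simp add: \<tau>0_def fun_eq_iff)
 interpret rep: isometric_rep N "of_m (form_matrix (dual_type T) n)" "form_inverse (dual_type T) n" "form_sign (dual_type T)" \<tau>
  unfolding \<tau>_def by unfold_locales
 interpret zero: isometric_rep N "of_m (form_matrix (dual_type T) n)" "form_inverse (dual_type T) n" "form_sign (dual_type T)" \<tau>0
  unfolding \<tau>0_eq by (rule P0.rep.conjugate_rep(1)[OF hh(1)])
 have conj_mult: "h * A * star h * (h * B * star h) = h * (A * B) * star h" if "B \<in> cor N" for A B
 proof -
  have "h * A * star h * (h * B * star h) = h * A * (star h * h * B) * star h" by (simp only: assoc)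
  also have "star h * h * B = B" using hh that by (simp add: rectD)
  finally show ?thesis by (simp only: assoc)
 qed
 have r_cor: "r w \<in> cor N" and r0_special: "special (r0 w)" if "w \<in> ?W" for w
  using specialD(3)[OF P.weil_part_special[OF that]] P0.weil_part_special[OF that] h
  by (simp_all add: r_def r0_def special_mult special_star)
 have r0_cor: "r0 w \<in> cor N" if "w \<in> ?W" for w using specialD(3)[OF r0_special[OF that]] by simp
 have r_\<tau>: "r w * \<tau> x = \<tau> x * r w" and r0_\<tau>0: "r0 w * \<tau>0 x = \<tau>0 x * r0 w" if "w \<in> ?W" "x \<in> carrier SL2" for w x
 proof -
  show "r w * \<tau> x = \<tau> x * r w" using P.parts[OF that] by (simp add: r_def \<tau>_def)
  have c: "sl2_part \<phi>0 x \<in> cor N" "weil_part \<phi>0 w \<in> cor N"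
   using specialD(3)[OF P0.sl2_part_special[OF that(2)]] specialD(3)[OF P0.weil_part_special[OF that(1)]] by simp_all
  show "r0 w * \<tau>0 x = \<tau>0 x * r0 w"
   using P0.parts[OF that] by (simp add: r0_def \<tau>0_def conj_mult[OF c(1)] conj_mult[OF c(2)])
 qed
 have match: "r0 w * \<tau>0 (dgm (?s w)) = r w * \<tau> (dgm (?s w))" if "w \<in> ?W" for w
 proof -
  have d: "dgm (?s w) \<in> carrier SL2" using d_mat[of w] by simp
  have c: "sl2_part \<phi>0 (dgm (?s w)) \<in> cor N" using specialD(3)[OF P0.sl2_part_special[OF d]] by simp
  show ?thesis using lambda[OF that] P.parts(1)[OF that d] P0.parts(1)[OF that d]
   by (simp add: d_mat(1) r0_def \<tau>0_def r_def \<tau>_def conj_mult[OF c])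
 qed
 have r0_mult: "r0 (w \<circ> w') = r0 w * r0 w'" if "w \<in> ?W" "w' \<in> ?W" for w w'
  using P0.weil_part_mult[OF that] specialD(3)[OF P0.weil_part_special[OF that(2)]] by (simp add: r0_def conj_mult)
 have r0_id: "r0 id = idm N" using hh by (simp add: r0_def P0.weil_part_id rectD)
 have bounded: "bounded_entries r0 ?W"
 proof -
  have "bounded_entries (\<lambda>w. h * weil_part \<phi>0 w * star h) ?W"
   using tempered P0.tempered_iff specialD(3)[OF P0.weil_part_special] hh star_cor
   by (intro bounded_entries_mult[where N = N] bounded_entries_const[where N = N]) (auto simp: cor_mult)
  then show ?thesis by (simp add: r0_def[abs_def])
 qed

 \<comment> \<open>\<open>lam\<close> is the common infinitesimal parameter at \<open>w1\<close>.
   Its factor \<open>\<rho>\<close> has bounded powers, and the other factor acts on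
   \<open>zero.wt i\<close> by \<open>s powi i\<close>.\<close>
 define s \<rho> lam where "s = ?s w1" and "\<rho> = r0 w1" and "lam = \<rho> * \<tau>0 (dgm s)"
 have s0: "s ~= 0" using d_mat(2) by (simp add: s_def)
 have s_powi: "cmod (s powi c) ~= 1" if "c ~= 0" for c
 proof -
  define x where "x = weil_norm v w1 powr (1/2)"
  have x: "x > 0" "x ~= 1" using w1(2) weil_norm_pos[of w1] by (auto simp: x_def powr_half_sqrt)
  have "cmod (s powi c) = x powi c" using x by (simp add: s_def norm_root_def x_def[symmetric] norm_power_int)
  moreover have "x powi c ~= 1"
  proof
   assume "x powi c = 1"
   then have "x ^ nat \<bar>c\<bar> = 1" by (cases "c \<ge> 0") (simp_all add: power_int_def power_inverse)
   then have "ln (x ^ nat \<bar>c\<bar>) = 0" by simp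
   then show False using x that by (simp add: ln_realpow)
  qed
  ultimately show ?thesis by simp
 qed
 have \<rho>: "special \<rho>" "\<rho> \<in> cor N" unfolding \<rho>_def by (rule r0_special[OF w1(1)], rule r0_cor[OF w1(1)])
 note \<rho>i = specialD[OF \<rho>(1)]
 have \<rho>_wt: "\<rho> * zero.wt i = zero.wt i * \<rho>" for i
  using zero.commutes_with_nil_wt(2)[of \<rho> i] r0_\<tau>0[OF w1(1)] by (simp add: \<rho>_def)
 \<comment> \<open>A block \<open>Y\<close> of \<open>X\<close> between other weights than expected
   satisfies \<open>\<rho> * Y = scl q (Y * \<rho>)\<close> with \<open>q\<close> of absolute value
   different from \<open>1\<close>, so boundedness of the powers of \<open>\<rho>\<close> kills
   it.\<close>
 have off_diagonal: "zero.wt i * X * zero.wt j = 0"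
  if X: "X \<in> cor N" "lam * X = scl (s powi a) (X * lam)" and ij: "i ~= j + a" for X a i j
 proof -
  define Y q where "Y = zero.wt i * X * zero.wt j" and "q = s powi (a + j - i)"
  have Yc: "Y \<in> cor N" unfolding Y_def by (intro cor_mult X zero.wt_cor)
  have "zero.wt i * (lam * X) * zero.wt j = scl (s powi i) (\<rho> * Y)"
  proof -
   have "zero.wt i * (lam * X) * zero.wt j = (zero.wt i * \<rho>) * \<tau>0 (dgm s) * X * zero.wt j"
    by (simp add: lam_def assoc)
   also have "\<dots> = \<rho> * (zero.wt i * \<tau>0 (dgm s)) * X * zero.wt j" by (simp add: \<rho>_wt[symmetric] assoc)
   finally show ?thesis by (simp add: zero.wt_dgm[OF s0] Y_def assoc)
  qed
  moreover have "zero.wt i * (X * lam) * zero.wt j = scl (s powi j) (Y * \<rho>)"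
  proof -
   have "zero.wt i * (X * lam) * zero.wt j = zero.wt i * X * (\<rho> * (\<tau>0 (dgm s) * zero.wt j))"
    by (simp add: lam_def assoc)
   also have "\<dots> = scl (s powi j) (zero.wt i * X * (\<rho> * zero.wt j))" by (simp add: zero.dgm_wt[OF s0])
   finally show ?thesis by (simp add: \<rho>_wt Y_def assoc)
  qed
  ultimately have "scl (s powi i) (\<rho> * Y) = scl (s powi a) (scl (s powi j) (Y * \<rho>))" using X(2) by simp
  then have "scl (inverse (s powi i)) (scl (s powi i) (\<rho> * Y)) = scl (inverse (s powi i)) (scl (s powi a * s powi j) (Y * \<rho>))"
   by simp
  moreover have "inverse (s powi i) * (s powi a * s powi j) = q"
   using s0 by (simp add: q_def power_int_add power_int_diff divide_inverse mult_ac)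
  ultimately have \<rho>Y: "\<rho> * Y = scl q (Y * \<rho>)" using s0 by simp
  have q0: "q ~= 0" using s0 by (simp add: q_def)
  define A B where "A m = r0 (w1 ^^ m)" and "B m = star (A m)" for m
  have W: "w1 ^^ m \<in> ?W" for m by (rule weil_group_power[OF w1(1)])
  have A_cor: "A m \<in> cor N" "B m \<in> cor N" for m using r0_cor[OF W] star_cor by (simp_all add: A_def B_def)
  have inv: "A m * B m = idm N" "B m * A m = idm N" for m
   using specialD(4,5)[OF r0_special[OF W]] by (simp_all add: A_def B_def)
  have AY: "A m * Y = scl (q ^ m) (Y * A m)" for m
  proof (induction m)
   case 0
   then show ?case using Yc by (simp add: A_def r0_id rectD flip: id_def)
  next
   case (Suc m)
   have A: "A (Suc m) = \<rho> * A m" using r0_mult[OF w1(1) W] by (simp add: A_def \<rho>_def)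
   have "A (Suc m) * Y = scl (q ^ m) (\<rho> * Y * A m)" by (simp only: A Suc.IH assoc scl_mult_right)
   then show ?case by (simp add: \<rho>Y A assoc mult.commute)
  qed
  have bA: "bounded_entries A UNIV" using bounded W unfolding bounded_entries_def A_def by blast
  then have bB: "bounded_entries B UNIV" unfolding B_def star_def using A_cor J J'
   by (intro bounded_entries_mult[where N = N] bounded_entries_const[where N = N] bounded_entries_tp)
    (auto simp: cor_mult rect_tp)
  have "Y = 0" by (rule bounded_scaling_zero[OF AY inv bA A_cor(1) bB A_cor(2) Yc _ q0])
    (use s_powi[of "a + j - i"] ij in \<open>simp add: q_def\<close>)
  then show ?thesis by (simp add: Y_def)
 qed
 have graded: "X * zero.wt j = zero.wt (j + a) * X" if X: "X \<in> cor N" "lam * X = scl (s powi a) (X * lam)" for X a j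
  by (rule zero.gradedI[OF X(1) off_diagonal[OF X]])
 have lam: "lam = r w1 * \<tau> (dgm s)" unfolding lam_def \<rho>_def s_def by (rule match[OF w1(1)])
 have r_comm: "r w * rep.nil = rep.nil * r w" "r w * rep.wt j = rep.wt j * r w" if "w \<in> ?W" for w j
  using rep.commutes_with_nil_wt[of "r w"] r_\<tau>[OF that] by simp_all
 have r_dgm_nil: "r w * \<tau> (dgm c) * rep.nil = scl (c powi 2) (rep.nil * (r w * \<tau> (dgm c)))"
  and r_dgm_wt: "r w * \<tau> (dgm c) * rep.wt j = rep.wt j * (r w * \<tau> (dgm c))"
  if w: "w \<in> ?W" and c: "c ~= 0" for w c j
 proof -
  have "r w * \<tau> (dgm c) * rep.nil = r w * (\<tau> (dgm c) * rep.nil)" by (rule assoc)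
  also have "\<dots> = scl (c powi 2) (r w * rep.nil * \<tau> (dgm c))" by (simp only: rep.dgm_nil[OF c] scl_mult_right assoc)
  finally show "r w * \<tau> (dgm c) * rep.nil = scl (c powi 2) (rep.nil * (r w * \<tau> (dgm c)))"
   by (simp only: r_comm[OF w] assoc)
  have "r w * \<tau> (dgm c) * rep.wt j = r w * (\<tau> (dgm c) * rep.wt j)" by (rule assoc)
  also have "\<tau> (dgm c) * rep.wt j = rep.wt j * \<tau> (dgm c)" by (simp only: rep.dgm_wt[OF c] rep.wt_dgm[OF c])
  finally show "r w * \<tau> (dgm c) * rep.wt j = rep.wt j * (r w * \<tau> (dgm c))"
   by (simp only: r_comm[OF w] assoc[symmetric])
 qed
 interpret pair: rep_pair N "of_m (form_matrix (dual_type T) n)" "form_inverse (dual_type T) n" "form_sign (dual_type T)" \<tau> \<tau>0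
 proof unfold_locales
  show "rep.nil * zero.wt i = zero.wt (i + 2) * rep.nil" for i
   using graded[OF rep.nil_cor, of 2 i] r_dgm_nil[OF w1(1) s0] by (simp add: lam)
  show "rep.wt j * zero.wt i = zero.wt i * rep.wt j" for i j
   using graded[OF rep.wt_cor, of j 0 i] r_dgm_wt[OF w1(1) s0] by (simp add: lam)
  fix k :: nat assume k: "k > 0"
  have nil: "P.rep.nil = rep.nil" by (simp add: \<tau>_def)
  have "zero.nil = h * P0.rep.nil * star h" using P0.rep.conjugate_rep(2)[OF hh(1)] by (simp add: \<tau>0_eq)
  then have "sim N zero.nil P0.rep.nil" using special_sim[OF h P0.rep.nil_cor] by simp
  then have "rk (idm N * zero.nil ^ k) = rk (idm N * P0.rep.nil ^ k)" by (rule sim_rk[OF sim_power])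
  then show "rk (zero.nil ^ k) \<le> rk (rep.nil ^ k) + 1"
   using rank[of k] P0.nilpotent_of_phi P.nilpotent_of_phi zero.nil_idm(1)[OF k] rep.nil_idm(1)[OF k] nil by simp
 qed
 \<comment> \<open>The infinitesimal parameter \<open>r0 w * d\<close> and its factor
   \<open>d\<close> scale \<open>rep.nil\<close> by the same number and both commute with
   \<open>rep.wt j\<close>; cancelling \<open>d\<close> leaves the commutation of
   \<open>r0 w\<close>.\<close>
 have admissible: "pair.admissible (r0 w)" if w: "w \<in> ?W" for w
 proof -
  define c d where "c = ?s w" and "d = \<tau>0 (dgm c)"
  have c0: "c ~= 0" using d_mat(2) by (simp add: c_def)
  have dc: "dgm c \<in> carrier SL2" "dgm (inverse c) \<in> carrier SL2" using c0 by (simp_all add: mat2_SL2)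
  have d_inv: "d * \<tau>0 (dgm (inverse c)) = idm N"
   using zero.\<tau>_mult[OF dc] c0 by (simp add: d_def mat2_mult mat2_one zero.\<tau>_one)
  have cancel: "r0 w * X = X * r0 w"
   if X: "X \<in> cor N" and b: "b ~= 0" and "d * X = scl b (X * d)" "r0 w * d * X = scl b (X * (r0 w * d))" for X b
  proof -
   have "scl b (r0 w * X * d) = scl b (X * r0 w * d)" using that(3,4) by (simp add: assoc)
   then have "r0 w * X * d = X * r0 w * d" using b by simp
   then have "r0 w * X * (d * \<tau>0 (dgm (inverse c))) = X * r0 w * (d * \<tau>0 (dgm (inverse c)))"
    by (simp only: assoc[symmetric])
   then have "r0 w * X * idm N = X * r0 w * idm N" unfolding d_inv .
   moreover have "r0 w * X \<in> cor N" "X * r0 w \<in> cor N" by (intro cor_mult r0_cor[OF w] X)+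
   ultimately show ?thesis by (simp only: rectD)
  qed
  have m: "r0 w * d = r w * \<tau> (dgm c)" unfolding d_def c_def by (rule match[OF w])
  have d_nil: "d * rep.nil = scl (c powi 2) (rep.nil * d)"
  proof (rule zero.eq_by_weights(2))
   fix z
   have "d * rep.nil * zero.wt z = d * zero.wt (z + 2) * rep.nil" by (simp add: pair.nil_zero_wt assoc)
   also have "\<dots> = scl (c powi (z + 2)) (rep.nil * zero.wt z)"
    by (simp add: d_def zero.dgm_wt[OF c0] pair.nil_zero_wt)
   finally show "d * rep.nil * zero.wt z = scl (c powi 2) (rep.nil * d) * zero.wt z"
    using c0 by (simp add: d_def zero.dgm_wt[OF c0] assoc power_int_add)
  qed (use dc in \<open>auto intro!: cor_mult rect_scl rep.nil_cor zero.\<tau>_cor simp: d_def\<close>)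
  have d_wt: "d * rep.wt j = rep.wt j * d" for j
  proof (rule zero.eq_by_weights(2))
   fix z
   have "d * rep.wt j * zero.wt z = d * zero.wt z * rep.wt j" by (simp add: pair.wt_zero_wt assoc)
   also have "\<dots> = scl (c powi z) (rep.wt j * zero.wt z)" by (simp add: d_def zero.dgm_wt[OF c0] pair.wt_zero_wt)
   finally show "d * rep.wt j * zero.wt z = rep.wt j * d * zero.wt z" by (simp add: d_def zero.dgm_wt[OF c0] assoc)
  qed (use dc in \<open>auto intro!: cor_mult rep.wt_cor zero.\<tau>_cor simp: d_def\<close>)
  have "r0 w * rep.nil = rep.nil * r0 w" using cancel[OF rep.nil_cor _ d_nil] c0 r_dgm_nil[OF w c0] by (simp add: m)
  moreover have "r0 w * rep.wt j = rep.wt j * r0 w" for j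
   using cancel[OF rep.wt_cor, of 1 j] d_wt[of j] r_dgm_wt[OF w c0, of j] by (simp add: m)
  moreover have "r0 w * zero.wt i = zero.wt i * r0 w" for i
   using zero.commutes_with_nil_wt(2)[of "r0 w" i] r0_\<tau>0[OF w] by simp
  moreover have "r0 w * zero.weyl = zero.weyl * r0 w"
   unfolding zero.weyl_def by (rule r0_\<tau>0[OF w]) (simp add: mat2_SL2)
  moreover have "isometry (r0 w)" using specialD(1)[OF r0_special[OF w]] .
  ultimately show ?thesis unfolding pair.admissible_def by simp
 qed
 have r0_comm: "r0 w * rep.nil = rep.nil * r0 w" "r0 w * rep.wt j = rep.wt j * r0 w" if "w \<in> ?W" for w j
  using admissible[OF that] by (auto simp: pair.admissible_def)
 have r0_\<tau>: "r0 w * \<tau> x = \<tau> x * r0 w" if "w \<in> ?W" "x \<in> carrier SL2" for w x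
  using rep.commutes_with_rep[OF r0_cor[OF that(1)] _ _ that(2)] r0_comm[OF that(1)] by simp
 have r0_\<theta>: "r0 w * pair.\<theta> y = pair.\<theta> y * r0 w" if "w \<in> ?W" for w y
  by (rule pair.\<theta>_admissible[OF admissible[OF that]])
 \<comment> \<open>Recovers \<open>\<phi>\<close> on the Weil group: in the two factorizations of
   the infinitesimal parameter, \<open>\<theta>_dgm\<close> exposes a common factor
   \<open>\<tau> (dgm c)\<close> that can be cancelled.\<close>
 have r0_\<theta>_dgm: "r0 w * pair.\<theta> (dgm (?s w)) = r w" if w: "w \<in> ?W" for w
 proof -
  define c where "c = ?s w"
  have c0: "c ~= 0" using d_mat(2) by (simp add: c_def)
  have dc: "dgm c \<in> carrier SL2" "dgm (inverse c) \<in> carrier SL2" using c0 by (simp_all add: mat2_SL2)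
  have inv: "\<tau> (dgm c) * \<tau> (dgm (inverse c)) = idm N"
   using rep.\<tau>_mult[OF dc] c0 by (simp add: mat2_mult mat2_one rep.\<tau>_one)
  have "r0 w * pair.\<theta> (dgm c) * \<tau> (dgm c) = r w * \<tau> (dgm c)"
   using match[OF w] pair.\<theta>_rep[OF dc(1), of "dgm c"] pair.\<theta>_dgm[OF c0] by (simp add: c_def assoc)
  then have "r0 w * pair.\<theta> (dgm c) * (\<tau> (dgm c) * \<tau> (dgm (inverse c))) = r w * (\<tau> (dgm c) * \<tau> (dgm (inverse c)))"
   by (simp only: assoc[symmetric])
  then have "r0 w * pair.\<theta> (dgm c) * idm N = r w * idm N" unfolding inv .
  moreover have "r0 w * pair.\<theta> (dgm c) \<in> cor N" by (intro cor_mult r0_cor[OF w] pair.\<theta>_cor)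
  ultimately show ?thesis using r_cor[OF w] unfolding c_def by (simp only: rectD)
 qed

 define \<Psi> where "\<Psi> w x y = r0 w * \<tau> x * pair.\<theta> y" for w x y
 define \<psi> where "\<psi> = (\<lambda>(w, x, y). mat_of (\<Psi> w x y))"
 have \<tau>_special: "special (\<tau> x)" if "x \<in> carrier SL2" for x unfolding \<tau>_def by (rule P.sl2_part_special[OF that])
 have \<theta>_special: "special (pair.\<theta> y)" if "y \<in> carrier SL2" for y
  unfolding special_def using pair.\<theta>_isometry[OF that] pair.\<theta>_dt[OF that] by simp
 have \<Psi>_special: "special (\<Psi> w x y)" if "w \<in> ?W" "x \<in> carrier SL2" "y \<in> carrier SL2" for w x y
  unfolding \<Psi>_def by (intro special_mult r0_special \<tau>_special \<theta>_special that)
 have \<Psi>_cor: "\<Psi> w x y \<in> cor N" if "w \<in> ?W" "x \<in> carrier SL2" "y \<in> carrier SL2" for w x y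
  using specialD(3)[OF \<Psi>_special[OF that]] by simp
 have \<Psi>_mult: "\<Psi> (w \<circ> w') (x * x') (y * y') = \<Psi> w x y * \<Psi> w' x' y'"
  if w: "w \<in> ?W" "w' \<in> ?W" and x: "x \<in> carrier SL2" "x' \<in> carrier SL2" and y: "y \<in> carrier SL2" "y' \<in> carrier SL2"
  for w w' x x' y y'
 proof -
  have "\<Psi> (w \<circ> w') (x * x') (y * y') = r0 w * (r0 w' * \<tau> x) * \<tau> x' * pair.\<theta> y * pair.\<theta> y'"
   by (simp add: \<Psi>_def r0_mult[OF w] rep.\<tau>_mult[OF x] pair.\<theta>_mult[OF y] assoc)
  also have "\<dots> = r0 w * \<tau> x * r0 w' * (\<tau> x' * pair.\<theta> y) * pair.\<theta> y'" by (simp add: r0_\<tau>[OF w(2) x(1)] assoc)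
  also have "\<dots> = r0 w * \<tau> x * (r0 w' * pair.\<theta> y) * \<tau> x' * pair.\<theta> y'" by (simp add: pair.\<theta>_rep[OF x(2)] assoc)
  also have "\<dots> = r0 w * \<tau> x * pair.\<theta> y * r0 w' * \<tau> x' * pair.\<theta> y'" by (simp add: r0_\<theta>[OF w(2)] assoc)
  finally show ?thesis by (simp add: \<Psi>_def assoc)
 qed
 have \<Psi>_1: "\<Psi> w x (1\<^sub>m 2) = r0 w * \<tau> x" if "w \<in> ?W" "x \<in> carrier SL2" for w x
  using rep.\<tau>_cor[OF that(2)] by (simp add: \<Psi>_def pair.\<theta>_one rectD assoc)
 have \<Psi>_11: "\<Psi> w (1\<^sub>m 2) (1\<^sub>m 2) = r0 w" if "w \<in> ?W" for w
  using r0_cor[OF that] by (simp add: \<Psi>_1[OF that SL2_one] rep.\<tau>_one rectD)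
 have hom: "\<psi> \<in> hom (weil_group v \<times>\<times> SL2 \<times>\<times> SL2) (dual_group T n)"
 proof (rule homI)
  fix p q assume "p \<in> carrier (weil_group v \<times>\<times> SL2 \<times>\<times> SL2)" "q \<in> carrier (weil_group v \<times>\<times> SL2 \<times>\<times> SL2)"
  then obtain w x y w' x' y' where p: "p = (w, x, y)" "w \<in> ?W" "x \<in> carrier SL2" "y \<in> carrier SL2"
   and q: "q = (w', x', y')" "w' \<in> ?W" "x' \<in> carrier SL2" "y' \<in> carrier SL2" by auto
  show "\<psi> p \<in> carrier (dual_group T n)" using mat_of_group[OF \<Psi>_special[OF p(2-4)]] by (simp add: \<psi>_def p(1))
  have "p \<otimes>\<^bsub>weil_group v \<times>\<times> SL2 \<times>\<times> SL2\<^esub> q = (w \<circ> w', x * x', y * y')"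
   by (simp add: p(1) q(1) SL2_simps weil_group_def)
  then show "\<psi> (p \<otimes>\<^bsub>weil_group v \<times>\<times> SL2 \<times>\<times> SL2\<^esub> q) = \<psi> p \<otimes>\<^bsub>dual_group T n\<^esub> \<psi> q"
   using \<Psi>_mult[OF p(2) q(2) p(3) q(3) p(4) q(4)] \<Psi>_cor[OF p(2-4)] \<Psi>_cor[OF q(2-4)]
   by (simp add: \<psi>_def p(1) q(1) group_simps to_m_mult)
 qed
 have "arthur_parameter v T n \<psi>" unfolding arthur_parameter_def
 proof (intro conjI)
  show "\<psi> \<in> hom (weil_group v \<times>\<times> SL2 \<times>\<times> SL2) (dual_group T n)" by (rule hom)
  show "L_parameter v T n (\<lambda>(w, x). \<psi> (w, x, 1\<^sub>m 2))" unfolding L_parameter_def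
  proof (intro conjI ballI)
   show "(\<lambda>(w, x). \<psi> (w, x, 1\<^sub>m 2)) \<in> hom (weil_group v \<times>\<times> SL2) (dual_group T n)"
    by (rule hom_mult_SL2_SL2[OF hom])
   let ?S = "subtopology (matrix_topology 2) (carrier SL2)"
   have c0: "continuous_entries (prod_topology (weil_topology v) ?S) N (\<lambda>p. weil_part \<phi>0 (fst p))"
    and c1: "continuous_entries (prod_topology (weil_topology v) ?S) N (\<lambda>p. \<tau> (snd p))" unfolding \<tau>_def
    by (rule continuous_entries_compose[OF P0.continuous_parts(1) continuous_map_fst],
      rule continuous_entries_compose[OF P.continuous_parts(2) continuous_map_snd])
   have "continuous_entries (prod_topology (weil_topology v) ?S) N
     (\<lambda>p. h * weil_part \<phi>0 (fst p) * star h * \<tau> (snd p) * pair.\<theta> (1\<^sub>m 2))"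
    using hh star_cor by (intro continuous_entries_mult c0 c1 continuous_entries_const pair.\<theta>_cor) simp_all
   from continuous_to_m[OF this]
   show "continuous_map (prod_topology (weil_topology v) ?S) (matrix_topology (dual_dim T n)) (\<lambda>(w, x). \<psi> (w, x, 1\<^sub>m 2))"
    by (simp add: \<psi>_def \<Psi>_def r0_def case_prod_unfold)
  next
   fix w assume w: "w \<in> ?W"
   have "sim N (r0 w) (weil_part \<phi>0 w)"
    unfolding r0_def by (rule special_sim[OF h specialD(3)[OF P0.weil_part_special[OF w]]])
   from sim_to_m[OF this] have "similar_mat (mat_of (r0 w)) (\<phi>0 (w, 1\<^sub>m 2))"
    using P0.param_mem(1)[OF w SL2_one] by (simp add: weil_part_def to_m_of_m)
   moreover obtain D where "diagonal_mat D" "similar_mat (\<phi>0 (w, 1\<^sub>m 2)) D"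
    using L0 w by (auto simp: L_parameter_def semisimple_mat_def)
   ultimately have "semisimple_mat (mat_of (r0 w))" unfolding semisimple_mat_def using similar_mat_trans by blast
   then show "semisimple_mat ((\<lambda>(w, x). \<psi> (w, x, 1\<^sub>m 2)) (w, 1\<^sub>m 2))" by (simp add: \<psi>_def \<Psi>_11[OF w])
  next
   have "regular_on_SL2 (\<lambda>x. mat_of (\<Psi> id x (1\<^sub>m 2)) $$ (i, j))" if "i < N" "j < N" for i j
   proof -
    have "mat_of (\<Psi> id x (1\<^sub>m 2)) $$ (i, j) = ent (\<tau> x) i j" if x: "x \<in> carrier SL2" for x
     using \<open>i < N\<close> \<open>j < N\<close> rep.\<tau>_cor[OF x] by (simp add: \<Psi>_1[OF id_weil_group x] r0_id rectD to_m_def)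
    then show ?thesis using rep.regular_entries by (subst regular_cong[of _ "\<lambda>x. ent (\<tau> x) i j"]) simp_all
   qed
   then show "algebraic_on_SL2 (dual_dim T n) (\<lambda>x. (\<lambda>(w, x). \<psi> (w, x, 1\<^sub>m 2)) (id, x))"
    by (simp add: algebraic_on_SL2_def \<psi>_def)
  qed
  have "mat_of (\<Psi> id (1\<^sub>m 2) y) $$ (i, j) = ent (pair.\<theta> y) i j" if "i < N" "j < N" for i j y
   using that pair.\<theta>_cor[of y] by (simp add: \<Psi>_def r0_id rep.\<tau>_one rectD to_m_def)
  then show "algebraic_on_SL2 (dual_dim T n) (\<lambda>y. \<psi> (id, 1\<^sub>m 2, y))"
   using pair.\<theta>_regular by (simp add: algebraic_on_SL2_def \<psi>_def)
  show "entries_bounded (dual_dim T n) ((\<lambda>w. \<psi> (w, 1\<^sub>m 2, 1\<^sub>m 2)) ` ?W)"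
   using bounded by (auto simp: entries_bounded_def bounded_entries_def \<psi>_def \<Psi>_11 to_m_def)
 qed
 moreover have "conjugate_on T n (carrier (weil_group v \<times>\<times> SL2)) (phi_of_psi v \<psi>) \<phi>"
 proof (rule conjugate_on_refl[OF refl])
  fix p assume "p \<in> carrier (weil_group v \<times>\<times> SL2)"
  then obtain w x where p: "p = (w, x)" "w \<in> ?W" "x \<in> carrier SL2" by auto
  have d: "dgm (?s w) \<in> carrier SL2" using d_mat[of w] by simp
  have "\<Psi> w x (dgm (?s w)) = r0 w * pair.\<theta> (dgm (?s w)) * \<tau> x" by (simp add: \<Psi>_def pair.\<theta>_rep[OF p(3)] assoc)
  also have "\<dots> = of_m (\<phi> (w, x))" unfolding r0_\<theta>_dgm[OF p(2)] using P.parts(1)[OF p(2,3)] by (simp add: r_def \<tau>_def)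
  finally have "phi_of_psi v \<psi> p = \<phi> p"
   using P.param_mem(1)[OF p(2,3)] by (simp add: phi_of_psi_def \<psi>_def p(1) d_mat(1) to_m_of_m)
  then show "phi_of_psi v \<psi> p \<in> carrier_mat (std_dim (dual_type T) n) (std_dim (dual_type T) n)" "\<phi> p = phi_of_psi v \<psi> p"
   using P.param_mem(1)[OF p(2,3)] by (simp_all add: p(1))
 qed
 ultimately show ?thesis by (auto simp: arthur_type_def)
qed

theorem proposition1p6:
 fixes v :: "'f::field_char_0 => real"
  and T :: classical_type
  and n :: nat
  and OI :: "nat list => complex mat set"
  and lam :: "'f weil => complex mat"
  and \<phi>0 :: "'f weil \<times> complex mat => complex mat"
  and Orb' :: "complex mat set"
 assumes "nonarch_local_field v"
  and "very_even_labelling n OI"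
  and "infinitesimal_parameter v T n lam"
  and "open_parameter v T n lam \<phi>0"
  and "tempered v T n \<phi>0"
  and "Orb' = dBV (dual_type T) n OI (orbit_of_phi T n \<phi>0)"
 shows "\<forall>\<phi> \<in> dBV_fibre v T n OI lam Orb'. arthur_type v T n \<phi>"
proof
 fix \<phi> assume "\<phi> \<in> dBV_fibre v T n OI lam Orb'"
 then have L: "L_parameter v T n \<phi>" and c: "conjugate_on T n (carrier (weil_group v)) (lambda_of_phi v \<phi>) lam"
  and orb: "dBV (dual_type T) n OI (orbit_of_phi T n \<phi>) = dBV (dual_type T) n OI (orbit_of_phi T n \<phi>0)"
  using assms(6) by (auto simp: dBV_fibre_def L_parameters_over_def)
 have L0: "L_parameter v T n \<phi>0" and c0: "conjugate_on T n (carrier (weil_group v)) (lambda_of_phi v \<phi>0) lam"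
  using assms(4) by (auto simp: open_parameter_def L_parameters_over_def)
 interpret nonarch_local_field v by fact
 interpret classical_form "dual_type T" n .
 interpret P0: l_param v T n \<phi>0 using assms(1) L0 by (simp add: l_param_def l_param_axioms_def)
 interpret P: l_param v T n \<phi> using assms(1) L by (simp add: l_param_def l_param_axioms_def)
 let ?W = "carrier (weil_group v)"
 obtain g0 where g0: "g0 \<in> carrier (dual_group T n)"
  "\<And>w. w \<in> ?W ==> lam w = g0 * \<phi>0 (w, d_mat v w) * m_inv (dual_group T n) g0"
  using c0 by (auto simp: conjugate_on_def lambda_of_phi_def)
 obtain g where g: "g \<in> carrier (dual_group T n)"
  "\<And>w. w \<in> ?W ==> lam w = g * \<phi> (w, d_mat v w) * m_inv (dual_group T n) g"
  using c by (auto simp: conjugate_on_def lambda_of_phi_def)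
 \<comment> \<open>\<open>g0\<close> and \<open>g\<close> carry the infinitesimal parameters of
   \<open>\<phi>0\<close> and \<open>\<phi>\<close> to \<open>lam\<close>, so the inverse of
   \<open>g\<close> times \<open>g0\<close> carries the first to the second.\<close>
 define a b h where "a = of_m g0" and "b = of_m g" and "h = star b * a"
 have sp: "special a" "special b" using g0(1) g(1) by (simp_all add: a_def b_def group_mem)
 have h: "special h" unfolding h_def by (intro special_mult special_star sp)
 note aa = specialD[OF sp(1)] and bb = specialD[OF sp(2)]
 have lambda: "of_m (\<phi> (w, d_mat v w)) = h * of_m (\<phi>0 (w, d_mat v w)) * star h" if w: "w \<in> ?W" for w
 proof -
  define M M0 where "M = of_m (\<phi> (w, d_mat v w))" and "M0 = of_m (\<phi>0 (w, d_mat v w))"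
  have M: "M \<in> cor N" "M0 \<in> cor N" unfolding M_def M0_def
   using P.param_mem(2)[OF w d_mat(3)] P0.param_mem(2)[OF w d_mat(3)] specialD(3) by blast+
  have "of_m (lam w) = a * M0 * star a" "of_m (lam w) = b * M * star b"
  proof -
   have i0: "m_inv (dual_group T n) g0 \<in> carrier_mat N N" and i: "m_inv (dual_group T n) g \<in> carrier_mat N N"
    using group_inv(1)[OF g0(1)] group_inv(1)[OF g(1)] by simp_all
   have gc: "g0 \<in> carrier_mat N N" "g \<in> carrier_mat N N" using g0(1) g(1) by (simp_all add: group_mem)
   show "of_m (lam w) = a * M0 * star a" unfolding g0(2)[OF w] a_def M0_def group_inv(2)[OF g0(1), symmetric]
    using i0 gc P0.param_mem(1)[OF w d_mat(3)] by (simp add: of_m_mult[of _ N N _ N] assoc)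
   show "of_m (lam w) = b * M * star b" unfolding g(2)[OF w] b_def M_def group_inv(2)[OF g(1), symmetric]
    using i gc P.param_mem(1)[OF w d_mat(3)] by (simp add: of_m_mult[of _ N N _ N] assoc)
  qed
  then have "star b * (b * M * star b) * b = star b * (a * M0 * star a) * b" by simp
  moreover have "star b * (b * M * star b) * b = (star b * b) * M * (star b * b)" by (simp only: assoc)
  ultimately have "M = star b * (a * M0 * star a) * b" using bb M by (simp add: rectD)
  then show ?thesis using bb star_cor by (simp add: h_def M_def M0_def star_mult star_star assoc)
 qed
 \<comment> \<open>If the norm is trivial, the infinitesimal parameters are the restrictions to the
   Weil group, and \<open>\<phi>\<close> inherits temperedness from \<open>\<phi>0\<close>. The case
   \<open>N = 0\<close> is settled along with it, which gives \<open>n > 0\<close> in type D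
   afterwards.\<close>
 show "arthur_type v T n \<phi>"
 proof (cases "N = 0 \<or> (\<forall>w\<in>?W. weil_norm v w = 1)")
  case True
  have "tempered v T n \<phi>"
  proof (cases "N = 0")
   case True
   then show ?thesis by (simp add: tempered_def entries_bounded_def)
  next
   case False
   then have "norm_root v w = 1" if "w \<in> ?W" for w using True that by (simp add: norm_root_def)
   then have "d_mat v w = 1\<^sub>m 2" if "w \<in> ?W" for w using that by (simp add: d_mat(1) mat2_one)
   then have e: "weil_part \<phi> w = h * weil_part \<phi>0 w * star h" if "w \<in> ?W" for w
    using lambda[OF that] that by (simp add: weil_part_def)
   have "bounded_entries (\<lambda>w. h * weil_part \<phi>0 w * star h) ?W"
    using assms(5) P0.tempered_iff specialD(3)[OF P0.weil_part_special] specialD(3)[OF h] star_cor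
    by (intro bounded_entries_mult[where N = N] bounded_entries_const[where N = N]) (auto simp: cor_mult)
   then show ?thesis unfolding P.tempered_iff using e by (simp add: bounded_entries_def)
  qed
  then show ?thesis by (rule tempered_arthur_type[OF assms(1) L])
 next
  case False
  then obtain w1 where w1: "w1 \<in> ?W" "weil_norm v w1 ~= 1" by blast
  have n: "dual_type T = TypeD ==> n > 0" using False by (cases "n = 0") auto
  obtain k where k: "P.rep.nil ^ k * idm N = 0" by (rule P.rep.nil_nilpotent)
  obtain k0 where k0: "P0.rep.nil ^ k0 * idm N = 0" by (rule P0.rep.nil_nilpotent)
  have "rk (idm N * of_m (nilpotent_of_phi N \<phi>0) ^ m) \<le> rk (idm N * of_m (nilpotent_of_phi N \<phi>) ^ m) + 1" for m
  proof (rule dBV_fibre_ranks[OF assms(2) n])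
   show "nilpotent_of_phi N \<phi> \<in> classical_lie_algebra (dual_type T) n"
    "nilpotent_of_phi N \<phi>0 \<in> classical_lie_algebra (dual_type T) n"
    by (rule P.nilpotent_of_phi_lie, rule P0.nilpotent_of_phi_lie)
   show "of_m (nilpotent_of_phi N \<phi>) ^ k * idm N = 0" "of_m (nilpotent_of_phi N \<phi>0) ^ k0 * idm N = 0"
    using k k0 by (simp_all add: P.nilpotent_of_phi P0.nilpotent_of_phi)
   show "dBV (dual_type T) n OI (adjoint_orbit (dual_type T) n (nilpotent_of_phi N \<phi>)) =
     dBV (dual_type T) n OI (adjoint_orbit (dual_type T) n (nilpotent_of_phi N \<phi>0))"
    using orb by (simp add: orbit_of_phi_def)
  qed
  then show ?thesis by (intro arthur_type_of_pair[OF assms(1) L0 L h lambda assms(5) _ w1])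
 qed
qed

end
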